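(* Let $m$ be an integer with $2\le m\le 5$ and $n$ a positive integer with $\gcd(m,n)=1$. Then the solutions $h$ of $$\{h,\tau\}=2\pi^2\left(\frac{n}{m}\right)^2E_4(\tau)$$ are modular functions for $\Gamma(m)$. Moreover, each solution is a rational function of degree $d$ of a Hauptmodul for $\Gamma(m)$, where $d$ satisfies $(6n-m)\nu_\infty=12d$, $\nu_\infty$ being the number of $\Gamma(m)$-inequivalent cusps.
   Context: $\mathfrak{H}$ is the upper half-plane; $\{h,\tau\}=\frac{h'''}{h'}-\frac32(\frac{h''}{h'})^2$ is the Schwarz derivative; $E_4(\tau)=1+240\sum_{k\ge1}\sigma_3(k)e^{2\pi ik\tau}$ is the weight 4 Eisenstein series. $\Gamma(m)$ is the principal congruence subgroup of level $m$ of $\mathrm{SL}_2(\mathbb{Z})$, which for $2\le m\le5$ has genus zero. A modular function for $\Gamma(m)$ is a meromorphic function on $\mathfrak{H}$ invariant under $\Gamma(m)$ acting by linear fractional transformations and meromorphic at the cusps. A Hauptmodul for $\Gamma(m)$ is a modular function for $\Gamma(m)$ inducing an isomorphism of the compactified modular curve $X(\Gamma(m))=\Gamma(m)\backslash(\mathfrak{H}\cup\mathbb{Q}\cup\{\infty\})$ onto $\mathbb{P}^1(\mathbb{C})$. *)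

theory Defs
  imports "HOL-Complex_Analysis.Complex_Analysis"
    "HOL-Number_Theory.Cong"
    "HOL-Computational_Algebra.Polynomial_Factorial"
begin

text \<open>
  A meromorphic function is a total function \<open>f\<close> with \<open>f nicely_meromorphic_on A\<close>: it is
  continuous where it has a limit and has the dummy value \<open>0\<close> at its poles.  The projective line
  over \<open>\<complex>\<close> is \<^typ>\<open>complex option\<close> with \<^term>\<open>None\<close> as the point at infinity.
\<close>

definition upper_half_plane :: "complex set" where
  "upper_half_plane = {\<tau>. 0 < Im \<tau>}"

definition schwarz_derivative :: "(complex \<Rightarrow> complex) \<Rightarrow> complex \<Rightarrow> complex" where
  "schwarz_derivative h \<tau> =
     (deriv ^^ 3) h \<tau> / deriv h \<tau> - 3 / 2 * ((deriv ^^ 2) h \<tau> / deriv h \<tau>)\<^sup>2"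

definition sigma3 :: "nat \<Rightarrow> nat" where
  "sigma3 k = (\<Sum>d | d dvd k. d ^ 3)"

definition E4 :: "complex \<Rightarrow> complex" where
  "E4 \<tau> = 1 + 240 * (\<Sum>k. of_nat (sigma3 (Suc k)) * exp (2 * of_real pi * \<i> * of_nat (Suc k) * \<tau>))"

text \<open>
  The equation is one between meromorphic functions, so it is required off a discrete set (which
  contains the poles of \<open>h\<close> and the zeros of \<open>h'\<close>).
\<close>

definition schwarz_solution :: "complex \<Rightarrow> (complex \<Rightarrow> complex) \<Rightarrow> bool" where
  "schwarz_solution c h \<longleftrightarrow>
     h nicely_meromorphic_on upper_half_plane \<and> \<not> h constant_on upper_half_plane \<and>
     (\<forall>\<^sub>\<approx>\<tau>\<in>upper_half_plane. schwarz_derivative h \<tau> = c * E4 \<tau>)"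

definition SL2Z :: "(int ^ 2 ^ 2) set" where
  "SL2Z = {A. det A = 1}"

definition principal_congruence_subgroup :: "nat \<Rightarrow> (int ^ 2 ^ 2) set" where
  "principal_congruence_subgroup m =
     {A \<in> SL2Z. \<forall>i j. [A $ i $ j = (mat 1 :: int ^ 2 ^ 2) $ i $ j] (mod int m)}"

definition lin_frac :: "int ^ 2 ^ 2 \<Rightarrow> complex \<Rightarrow> complex" where
  "lin_frac A z = (of_int (A $ 1 $ 1) * z + of_int (A $ 1 $ 2)) /
                  (of_int (A $ 2 $ 1) * z + of_int (A $ 2 $ 2))"

definition lin_frac_P1 :: "int ^ 2 ^ 2 \<Rightarrow> complex option \<Rightarrow> complex option" where
  "lin_frac_P1 A x = (case x of
       None \<Rightarrow> if A $ 2 $ 1 = 0 then None else Some (of_int (A $ 1 $ 1) / of_int (A $ 2 $ 1))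
     | Some z \<Rightarrow> if of_int (A $ 2 $ 1) * z + of_int (A $ 2 $ 2) = 0 then None
                 else Some (lin_frac A z))"

definition cusps :: "complex option set" where
  "cusps = insert None (Some ` \<rat>)"

definition extended_upper_half_plane :: "complex option set" where
  "extended_upper_half_plane = Some ` upper_half_plane \<union> cusps"

definition orbit_rel :: "nat \<Rightarrow> (complex option \<times> complex option) set" where
  "orbit_rel m = {(x, y). x \<in> extended_upper_half_plane \<and>
     (\<exists>A \<in> principal_congruence_subgroup m. y = lin_frac_P1 A x)}"

definition modular_curve :: "nat \<Rightarrow> complex option set set" where
  "modular_curve m = extended_upper_half_plane // orbit_rel m"

definition num_inequivalent_cusps :: "nat \<Rightarrow> nat" where
  "num_inequivalent_cusps m = card (cusps // orbit_rel m)"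

text \<open>
  For \<open>f\<close> invariant under \<open>\<Gamma>(m)\<close> and \<open>A\<close> in \<open>SL\<^sub>2(\<int>)\<close>, the function \<open>f(A\<tau>)\<close> has period \<open>m\<close>, hence
  is a function of \<open>q = exp(2\<pi>i\<tau>/m)\<close> in the punctured unit disc; this is that function, with
  \<open>\<tau> = m Ln q / (2\<pi>i)\<close>.  By periodicity the branch cut of \<open>Ln\<close> is invisible. The value at \<open>q = 0\<close>
  is meaningless; only the behaviour around it is used.
\<close>

definition cusp_fun :: "nat \<Rightarrow> (complex \<Rightarrow> complex) \<Rightarrow> int ^ 2 ^ 2 \<Rightarrow> complex \<Rightarrow> complex" where
  "cusp_fun m f A q = f (lin_frac A (of_nat m * Ln q / (2 * of_real pi * \<i>)))"

text \<open>Every cusp is of the form \<open>A\<infinity>\<close> with \<open>A\<close> in \<open>SL\<^sub>2(\<int>)\<close>.\<close>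

definition modular_function :: "nat \<Rightarrow> (complex \<Rightarrow> complex) \<Rightarrow> bool" where
  "modular_function m f \<longleftrightarrow>
     f nicely_meromorphic_on upper_half_plane \<and>
     (\<forall>A \<in> principal_congruence_subgroup m. \<forall>\<tau> \<in> upper_half_plane. f (lin_frac A \<tau>) = f \<tau>) \<and>
     (\<forall>A \<in> SL2Z. cusp_fun m f A meromorphic_on {0})"

definition value_P1 :: "(complex \<Rightarrow> complex) \<Rightarrow> complex \<Rightarrow> complex option" where
  "value_P1 f z = (if is_pole f z then None else Some (remove_sings f z))"

text \<open>
  The map from the extended upper half-plane to the projective line given by a modular function.
  Its value at a cusp \<open>A\<infinity>\<close> does not depend on \<open>A\<close>: two choices differ by a sign and a translation
  of \<open>\<tau>\<close>, i.e. by a rotation of \<open>q\<close>.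
\<close>

definition map_P1 :: "nat \<Rightarrow> (complex \<Rightarrow> complex) \<Rightarrow> complex option \<Rightarrow> complex option" where
  "map_P1 m f x =
     (if x \<in> cusps then value_P1 (cusp_fun m f (SOME A. A \<in> SL2Z \<and> lin_frac_P1 A None = x)) 0
      else value_P1 f (the x))"

text \<open>
  Local biholomorphy as a map to the projective line, using the charts \<open>w\<close> and \<open>1/w\<close> on the latter.
\<close>

definition locally_biholomorphic_at :: "(complex \<Rightarrow> complex) \<Rightarrow> complex \<Rightarrow> bool" where
  "locally_biholomorphic_at f z \<longleftrightarrow>
     (if is_pole f z then deriv (remove_sings (\<lambda>w. inverse (f w))) z \<noteq> 0
      else deriv (remove_sings f) z \<noteq> 0)"

text \<open>
  An isomorphism of Riemann surfaces is a bijection that is biholomorphic in local charts. For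
  \<open>m \<ge> 2\<close> the image of \<open>\<Gamma>(m)\<close> in \<open>PSL\<^sub>2(\<int>)\<close> acts freely on the upper half-plane and all cusps have
  width \<open>m\<close>, so the charts of the modular curve are \<open>\<tau>\<close> itself on the upper half-plane, and
  \<open>q = exp(2\<pi>i\<tau>/m)\<close> at the cusps. (The definition is not meant for \<open>m < 2\<close>.)
\<close>

definition hauptmodul :: "nat \<Rightarrow> (complex \<Rightarrow> complex) \<Rightarrow> bool" where
  "hauptmodul m t \<longleftrightarrow>
     modular_function m t \<and>
     bij_betw (\<lambda>X. the_elem (map_P1 m t ` X)) (modular_curve m) UNIV \<and>
     (\<forall>\<tau> \<in> upper_half_plane. locally_biholomorphic_at t \<tau>) \<and>
     (\<forall>A \<in> SL2Z. locally_biholomorphic_at (cusp_fun m t A) 0)"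

definition rational_function_of_degree :: "nat \<Rightarrow> (complex \<Rightarrow> complex) \<Rightarrow> bool" where
  "rational_function_of_degree d R \<longleftrightarrow>
     (\<exists>P Q :: complex poly. Q \<noteq> 0 \<and> coprime P Q \<and> d = max (degree P) (degree Q) \<and>
        R = (\<lambda>z. poly P z / poly Q z))"

end

theory Submission
  imports Defs "HOL-Computational_Algebra.Fundamental_Theorem_Algebra"
begin

text \<open>
  The substitution \<open>h = y\<^sub>1 / y\<^sub>2\<close> linearizes the equation to \<open>y'' = -\<pi>\<^sup>2 (n/m)\<^sup>2 E\<^sub>4 y\<close>, whose exponents
  at the cusp are \<open>\<plusminus>n/(2m)\<close>; there are no logarithms because \<open>m\<close> does not divide \<open>n\<close>. Solutions have
  weight -1, so multiplying them by \<open>\<eta>\<^sup>2\<close> gives a two-dimensional space of functions of weight 0 on which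
  \<open>SL\<^sub>2(\<int>)\<close> acts. The translation by \<open>m\<close> acts by a scalar, and for \<open>m \<le> 5\<close> its conjugates generate \<open>\<Gamma>(m)\<close>
  up to sign; hence \<open>\<Gamma>(m)\<close> acts by scalars and \<open>h\<close> is invariant.
  
  Let \<open>n = 1\<close>, with basis \<open>U\<^sub>1\<close>, \<open>U\<^sub>2\<close>. The product of the translates of \<open>U\<^sub>1\<close> over all cusps has order 0
  at every cusp, so it is constant by the maximum principle and \<open>U\<^sub>1\<close> has no zeros. It follows that
  \<open>t = U\<^sub>1/U\<^sub>2\<close> separates the points of the modular curve: it is a local coordinate everywhere, and the
  set of points where it fails to be injective is open and closed but does not approach the cusp
  \<open>\<infinity>\<close>. So \<open>t\<close> is a Hauptmodul, and each zero of a linear form in \<open>U\<^sub>1\<close>, \<open>U\<^sub>2\<close> is a single simple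
  point. Dividing out zeros, a function of weight 0 with order at least \<open>d\<kappa>\<close> at the cusps, where
  \<open>\<kappa> = 1/12 - 1/(2m)\<close>, is a product of \<open>d\<close> linear forms. Since \<open>1/12 - n/(2m) = d\<kappa>\<close>, this applies to
  the numerator and the denominator of \<open>h\<close> for general \<open>n\<close>, which have no common zero.
\<close>

section \<open>Congruence subgroups\<close>

no_notation fps_nth (infixl "$" 75)

text \<open>The bound m < 6 enters twice, as the same inequality 1/m > 1/6. It makes the triangle
  group (2,3,m), the quotient of PSL_2(Z) by the normal closure of T^m, finite, so that generation
  of \<plusminus>\<Gamma>(m) can be checked on a finite table of columns. It also makes \<kappa> =
  1/12 - 1/(2m) negative. Under \<Gamma>(m) the functions of weight 0 acquire constants of absolute
  value 1. Hence invariance is demanded of |f| only, a condition stable under products and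
  quotients, and zeros are never counted: the maximum principle does the work of a valence formula.
  For negative order it is applied to 1/f, which forces f to vanish at some point or cusp. The
  factor \<eta>^2 has weight 1, cancelling the weight -1 of the solutions, and it shifts the
  exponents by 1/12. Its law under z -> -1/z and that of E_4 are derived from the reflection formula
  of the digamma function. The delicate case is E_2, whose lattice sum is only conditionally
  convergent. The equation 1/12 - n/(2m) = d \<kappa> is 6n - m = d (6 - m); since there are 12/(6 -
  m) cusps, this is the formula for the degree.\<close>

definition mat2 :: "int \<Rightarrow> int \<Rightarrow> int \<Rightarrow> int \<Rightarrow> int ^ 2 ^ 2" where
  "mat2 a b c d = (\<chi> i j. if i = 1 then (if j = 1 then a else b) else (if j = 1 then c else d))"

lemma mat2_nth [simp]:
  "mat2 a b c d $ 1 $ 1 = a" "mat2 a b c d $ 1 $ 2 = b"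
  "mat2 a b c d $ 2 $ 1 = c" "mat2 a b c d $ 2 $ 2 = d"
  by (simp_all add: mat2_def)

lemma mat2_eq_iff:
  "A = B \<longleftrightarrow> A $ 1 $ 1 = B $ 1 $ 1 \<and> A $ 1 $ 2 = B $ 1 $ 2 \<and> A $ 2 $ 1 = B $ 2 $ 1 \<and> A $ 2 $ 2 = B $ 2 $ 2"
  for A B :: "int ^ 2 ^ 2"
  by (auto simp: vec_eq_iff forall_2)

lemma mat1_nth [simp]:
  "(mat 1 :: int ^ 2 ^ 2) $ 1 $ 1 = 1" "(mat 1 :: int ^ 2 ^ 2) $ 1 $ 2 = 0"
  "(mat 1 :: int ^ 2 ^ 2) $ 2 $ 1 = 0" "(mat 1 :: int ^ 2 ^ 2) $ 2 $ 2 = 1"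
  by (simp_all add: mat_def)

lemma mult2_nth [simp]: "(A ** B) $ i $ j = A $ i $ 1 * B $ 1 $ j + A $ i $ 2 * B $ 2 $ j"
  for A B :: "int ^ 2 ^ 2"
  by (simp add: matrix_matrix_mult_def sum_2)

definition adj2 :: "int ^ 2 ^ 2 \<Rightarrow> int ^ 2 ^ 2" where
  "adj2 A = mat2 (A $ 2 $ 2) (- A $ 1 $ 2) (- A $ 2 $ 1) (A $ 1 $ 1)"

lemma adj2_nth [simp]:
  "adj2 A $ 1 $ 1 = A $ 2 $ 2" "adj2 A $ 1 $ 2 = - A $ 1 $ 2"
  "adj2 A $ 2 $ 1 = - A $ 2 $ 1" "adj2 A $ 2 $ 2 = A $ 1 $ 1"
  by (simp_all add: adj2_def)

lemma SL2Z_iff: "A \<in> SL2Z \<longleftrightarrow> A $ 1 $ 1 * A $ 2 $ 2 - A $ 1 $ 2 * A $ 2 $ 1 = 1"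
  by (simp add: SL2Z_def det_2)

lemma mat2_in_SL2Z: "mat2 a b c d \<in> SL2Z \<longleftrightarrow> a * d - b * c = 1"
  by (simp add: SL2Z_iff)

lemma SL2Z_one [simp]: "mat 1 \<in> SL2Z"
  by (simp add: SL2Z_iff)

lemma SL2Z_mult [simp]: "A \<in> SL2Z \<Longrightarrow> B \<in> SL2Z \<Longrightarrow> A ** B \<in> SL2Z"
  by (simp add: SL2Z_def det_mul)

lemma SL2Z_adj [simp]: "A \<in> SL2Z \<Longrightarrow> adj2 A \<in> SL2Z"
  by (simp add: SL2Z_iff algebra_simps)

lemma SL2Z_uminus [simp]: "- A \<in> SL2Z \<longleftrightarrow> A \<in> SL2Z"
  by (simp add: SL2Z_iff algebra_simps)

lemma adj2_adj2 [simp]: "adj2 (adj2 A) = A"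
  by (simp add: mat2_eq_iff)

lemma adj2_mult: "adj2 (A ** B) = adj2 B ** adj2 A"
  by (simp add: mat2_eq_iff algebra_simps)

lemma adj2_left [simp]: "A \<in> SL2Z \<Longrightarrow> adj2 A ** A = mat 1"
  and adj2_right [simp]: "A \<in> SL2Z \<Longrightarrow> A ** adj2 A = mat 1"
  by (simp_all add: SL2Z_iff mat2_eq_iff algebra_simps)

lemma adj2_cancel [simp]:
  assumes "A \<in> SL2Z"
  shows "adj2 A ** (A ** B) = B" "A ** (adj2 A ** B) = B"
  using assms by (metis adj2_left adj2_right matrix_mul_assoc matrix_mul_lid)+

lemma uminus_mult2: "(- A) ** B = - (A ** B)" "A ** (- B) = - (A ** B)" for A B :: "int ^ 2 ^ 2"
  by (simp_all add: mat2_eq_iff)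

definition transl :: "int \<Rightarrow> int ^ 2 ^ 2" where
  "transl k = mat2 1 k 0 1"

lemma transl_nth [simp]:
  "transl k $ 1 $ 1 = 1" "transl k $ 1 $ 2 = k" "transl k $ 2 $ 1 = 0" "transl k $ 2 $ 2 = 1"
  by (simp_all add: transl_def)

lemma transl_in_SL2Z [simp]: "transl k \<in> SL2Z"
  by (simp add: SL2Z_iff)

lemma transl_mult: "transl k ** transl l = transl (k + l)"
  and transl_0: "transl 0 = mat 1"
  and adj2_transl: "adj2 (transl k) = transl (- k)"
  by (simp_all add: mat2_eq_iff)

definition inversion :: "int ^ 2 ^ 2" where
  "inversion = mat2 0 (-1) 1 0"

lemma inversion_nth [simp]:
  "inversion $ 1 $ 1 = 0" "inversion $ 1 $ 2 = -1" "inversion $ 2 $ 1 = 1" "inversion $ 2 $ 2 = 0"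
  by (simp_all add: inversion_def)

lemma inversion_in_SL2Z [simp]: "inversion \<in> SL2Z"
  by (simp add: SL2Z_iff)

text \<open>The Euclidean algorithm on the first column: a translation reduces a modulo c and the
  inversion swaps the entries, so |c| drops. The inversion has order 4, so its inverse is a
  threefold left multiplication by it.\<close>

lemma SL2Z_induct [consumes 1, case_names transl mult_transl mult_inversion]:
  assumes "A \<in> SL2Z"
    and t: "\<And>k. P (transl k)"
    and mt: "\<And>A k. A \<in> SL2Z \<Longrightarrow> P A \<Longrightarrow> P (transl k ** A)"
    and mi: "\<And>A. A \<in> SL2Z \<Longrightarrow> P A \<Longrightarrow> P (inversion ** A)"
  shows "P A"
  using assms(1)
proof (induction "nat \<bar>A $ 2 $ 1\<bar>" arbitrary: A rule: less_induct)
  case less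
  define a b c d where "a = A $ 1 $ 1" and "b = A $ 1 $ 2" and "c = A $ 2 $ 1" and "d = A $ 2 $ 2"
  note abcd = a_def b_def c_def d_def
  have det: "a * d - b * c = 1"
    using less.prems by (simp add: SL2Z_iff abcd)
  have SS: "inversion ** (inversion ** (inversion ** (inversion ** B))) = B" for B :: "int ^ 2 ^ 2"
    by (simp add: mat2_eq_iff)
  show ?case
  proof (cases "c = 0")
    case True
    then have ad: "a * d = 1"
      using det by simp
    then have "(a = 1 \<and> d = 1) \<or> (a = -1 \<and> d = -1)"
      by (auto simp: zmult_eq_1_iff)
    then show ?thesis
    proof
      assume *: "a = 1 \<and> d = 1"
      then have "A = transl b"
        using True by (simp add: mat2_eq_iff abcd)
      then show ?thesis
        using t by simp
    next
      assume *: "a = -1 \<and> d = -1"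
      then have "A = inversion ** (inversion ** transl (-b))"
        using True by (simp add: mat2_eq_iff abcd)
      then show ?thesis
        using t mi by simp
    qed
  next
    case False
    define B where "B = inversion ** (transl (- (a div c)) ** A)"
    have B: "B \<in> SL2Z"
      using less.prems by (simp add: B_def)
    have "B $ 2 $ 1 = a mod c"
      by (simp add: B_def abcd minus_div_mult_eq_mod [symmetric] algebra_simps)
    then have "nat \<bar>B $ 2 $ 1\<bar> < nat \<bar>A $ 2 $ 1\<bar>"
      using False abs_mod_less[of c a] by (simp add: c_def)
    then have "P B"
      using less.hyps B by blast
    moreover have "A = transl (a div c) ** (inversion ** (inversion ** (inversion ** B)))"
      unfolding B_def SS by (simp add: matrix_mul_assoc transl_mult transl_0)
    ultimately show ?thesis
      using mt mi B by simp
  qed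
qed

definition sl2_normal :: "(int ^ 2 ^ 2) set \<Rightarrow> bool" where
  "sl2_normal K \<longleftrightarrow> K \<subseteq> SL2Z \<and> mat 1 \<in> K \<and> (\<forall>A\<in>K. \<forall>B\<in>K. A ** B \<in> K) \<and> (\<forall>A\<in>K. adj2 A \<in> K) \<and>
     (\<forall>A\<in>K. \<forall>B\<in>SL2Z. B ** A ** adj2 B \<in> K)"

text \<open>This is \<plusminus>\<Gamma>(m). A matrix and its negative give the same linear
  fractional map, and a cusp determines the column of a matrix only up to sign.\<close>

definition Gpm :: "nat \<Rightarrow> (int ^ 2 ^ 2) set" where
  "Gpm m = {A. A \<in> principal_congruence_subgroup m \<or> - A \<in> principal_congruence_subgroup m}"

lemma pcs_iff:
  "A \<in> principal_congruence_subgroup m \<longleftrightarrow> A \<in> SL2Z \<and> [A $ 1 $ 1 = 1] (mod int m) \<and>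
    [A $ 1 $ 2 = 0] (mod int m) \<and> [A $ 2 $ 1 = 0] (mod int m) \<and> [A $ 2 $ 2 = 1] (mod int m)"
  by (auto simp: principal_congruence_subgroup_def forall_2)

lemma pcs_dvd_iff:
  "A \<in> principal_congruence_subgroup m \<longleftrightarrow> A \<in> SL2Z \<and> int m dvd A $ 1 $ 1 - 1 \<and>
    int m dvd A $ 1 $ 2 \<and> int m dvd A $ 2 $ 1 \<and> int m dvd A $ 2 $ 2 - 1"
  by (simp add: pcs_iff cong_iff_dvd_diff)

lemma sl2_normal_pcs: "sl2_normal (principal_congruence_subgroup m)"
proof -
  have "A ** B \<in> principal_congruence_subgroup m"
    if "A \<in> principal_congruence_subgroup m" "B \<in> principal_congruence_subgroup m" for A B
  proof -
    have "[(A ** B) $ 1 $ 1 = 1 * 1 + 0 * 0] (mod int m)" "[(A ** B) $ 1 $ 2 = 1 * 0 + 0 * 1] (mod int m)"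
      "[(A ** B) $ 2 $ 1 = 0 * 1 + 1 * 0] (mod int m)" "[(A ** B) $ 2 $ 2 = 0 * 0 + 1 * 1] (mod int m)"
      unfolding mult2_nth using that unfolding pcs_iff by (intro cong_add cong_mult; blast)+
    then show ?thesis
      using that by (simp add: pcs_iff)
  qed
  moreover have "B ** A ** adj2 B \<in> principal_congruence_subgroup m"
    if "A \<in> principal_congruence_subgroup m" "B \<in> SL2Z" for A B
  proof -
    obtain x y z w :: int where xyzw: "A $ 1 $ 1 = 1 + int m * x" "A $ 1 $ 2 = int m * y"
      "A $ 2 $ 1 = int m * z" "A $ 2 $ 2 = 1 + int m * w"
    proof -
      from \<open>A \<in> _\<close> obtain x y z w where *: "A $ 1 $ 1 - 1 = int m * x" "A $ 1 $ 2 = int m * y"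
        "A $ 2 $ 1 = int m * z" "A $ 2 $ 2 - 1 = int m * w"
        unfolding pcs_dvd_iff by (elim conjE dvdE) blast
      show thesis
        by (rule that[of x y z w]) (use * in linarith)+
    qed
    have det: "B $ 1 $ 1 * B $ 2 $ 2 - B $ 1 $ 2 * B $ 2 $ 1 = 1"
      using that by (simp add: SL2Z_iff)
    define a b c d where "a = B $ 1 $ 1" and "b = B $ 1 $ 2" and "c = B $ 2 $ 1" and "d = B $ 2 $ 2"
    have ad: "a * d - b * c - 1 = 0"
      using det by (simp add: a_def b_def c_def d_def)
    have "(B ** A ** adj2 B) $ 1 $ 1 - 1 = int m * (a * x * d + b * z * d - a * y * c - b * w * c) + (a * d - b * c - 1)"
      "(B ** A ** adj2 B) $ 1 $ 2 = int m * (- a * x * b - b * z * b + a * y * a + b * w * a)"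
      "(B ** A ** adj2 B) $ 2 $ 1 = int m * (c * x * d + d * z * d - c * y * c - d * w * c)"
      "(B ** A ** adj2 B) $ 2 $ 2 - 1 = int m * (- c * x * b - d * z * b + c * y * a + d * w * a) + (a * d - b * c - 1)"
      unfolding mult2_nth adj2_nth xyzw a_def [symmetric] b_def [symmetric] c_def [symmetric] d_def [symmetric]
      by (simp_all add: algebra_simps)
    from this [unfolded ad] show ?thesis
      using that by (simp add: pcs_dvd_iff)
  qed
  ultimately show ?thesis
    unfolding sl2_normal_def by (auto simp: pcs_dvd_iff)
qed

lemma sl2_normal_Gpm: "sl2_normal (Gpm m)"
proof -
  note N = sl2_normal_pcs[of m, unfolded sl2_normal_def]
  have adj: "adj2 (- A) = - adj2 A" for A
    by (simp add: mat2_eq_iff)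
  show ?thesis
    unfolding sl2_normal_def
  proof (intro conjI ballI subsetI)
    show "A \<in> SL2Z" if "A \<in> Gpm m" for A
      using that N unfolding Gpm_def by (metis (no_types, lifting) SL2Z_uminus mem_Collect_eq subsetD)
    show "mat 1 \<in> Gpm m"
      using N by (simp add: Gpm_def)
    show "A ** B \<in> Gpm m" if "A \<in> Gpm m" "B \<in> Gpm m" for A B
      using that N unfolding Gpm_def mem_Collect_eq by (metis uminus_mult2 minus_minus)
    show "adj2 A \<in> Gpm m" if "A \<in> Gpm m" for A
      using that N unfolding Gpm_def mem_Collect_eq by (metis adj)
    show "B ** A ** adj2 B \<in> Gpm m" if "A \<in> Gpm m" "B \<in> SL2Z" for A B
      using that N unfolding Gpm_def mem_Collect_eq by (metis uminus_mult2)
  qed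
qed

lemma sl2_normal_Int: "sl2_normal K \<Longrightarrow> sl2_normal L \<Longrightarrow> sl2_normal (K \<inter> L)"
  unfolding sl2_normal_def by blast

lemma Gpm_transl: "transl k \<in> Gpm m \<longleftrightarrow> int m dvd k"
  by (auto simp: Gpm_def pcs_dvd_iff)

lemma sl2_normal_transl:
  assumes "sl2_normal K" "transl k \<in> K"
  shows "transl (k * l) \<in> K"
proof -
  have *: "transl (k * int i) \<in> K" for i
  proof (induction i)
    case 0
    then show ?case
      using assms by (simp add: transl_0 sl2_normal_def)
  next
    case (Suc i)
    then have "transl k ** transl (k * int i) \<in> K"
      using assms by (simp add: sl2_normal_def)
    then show ?case
      by (simp add: transl_mult algebra_simps)
  qed
  show ?thesis
  proof (cases "l \<ge> 0")
    case True
    then show ?thesis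
      using *[of "nat l"] by simp
  next
    case False
    have "adj2 (transl (k * int (nat (- l)))) \<in> K"
      using assms *[of "nat (- l)"] unfolding sl2_normal_def by blast
    then show ?thesis
      using False by (simp add: adj2_transl)
  qed
qed

lemma ex_first_column:
  assumes "coprime p q"
  shows "\<exists>A\<in>SL2Z. A $ 1 $ 1 = p \<and> A $ 2 $ 1 = q"
proof -
  obtain x y where "x * p + y * q = 1"
    using assms bezout_int[of p q] by auto
  then have "mat2 p (- y) q x \<in> SL2Z"
    by (simp add: mat2_in_SL2Z algebra_simps)
  then show ?thesis
    by (intro bexI[of _ "mat2 p (- y) q x"]) auto
qed

text \<open>Orbits of column vectors: these are the cusps, up to sign.\<close>

definition vrel :: "(int ^ 2 ^ 2) set \<Rightarrow> int \<times> int \<Rightarrow> int \<times> int \<Rightarrow> bool" where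
  "vrel K v w \<longleftrightarrow> (\<exists>A\<in>K. w = (A $ 1 $ 1 * fst v + A $ 1 $ 2 * snd v, A $ 2 $ 1 * fst v + A $ 2 $ 2 * snd v))"

lemma vrel_trans: "sl2_normal K \<Longrightarrow> vrel K u v \<Longrightarrow> vrel K v w \<Longrightarrow> vrel K u w"
proof -
  assume K: "sl2_normal K" and "vrel K u v" "vrel K v w"
  then obtain A B where AB: "A \<in> K" "B \<in> K"
    and v: "v = (A $ 1 $ 1 * fst u + A $ 1 $ 2 * snd u, A $ 2 $ 1 * fst u + A $ 2 $ 2 * snd u)"
    and w: "w = (B $ 1 $ 1 * fst v + B $ 1 $ 2 * snd v, B $ 2 $ 1 * fst v + B $ 2 $ 2 * snd v)"
    by (auto simp: vrel_def)
  have "B ** A \<in> K"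
    using K AB by (simp add: sl2_normal_def)
  then show "vrel K u w"
    unfolding vrel_def by (rule rev_bexI) (simp add: v w algebra_simps)
qed

lemma vrel_refl: "sl2_normal K \<Longrightarrow> vrel K v v"
  unfolding vrel_def sl2_normal_def by (rule bexI[of _ "mat 1"]) auto

text \<open>Normality at work: B A B^{-1} stays in K, so B permutes the K-orbits of columns. Each
  generator of SL_2(Z) can therefore be tested on one vector per orbit.\<close>

lemma vrel_conj:
  assumes "sl2_normal K" "B \<in> SL2Z" "vrel K v w"
  shows "vrel K (B $ 1 $ 1 * fst v + B $ 1 $ 2 * snd v, B $ 2 $ 1 * fst v + B $ 2 $ 2 * snd v)
    (B $ 1 $ 1 * fst w + B $ 1 $ 2 * snd w, B $ 2 $ 1 * fst w + B $ 2 $ 2 * snd w)"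
proof -
  obtain A where A: "A \<in> K"
    "w = (A $ 1 $ 1 * fst v + A $ 1 $ 2 * snd v, A $ 2 $ 1 * fst v + A $ 2 $ 2 * snd v)"
    using assms(3) by (auto simp: vrel_def)
  have C: "B ** A ** adj2 B \<in> K"
    using assms A(1) by (simp add: sl2_normal_def)
  have eq: "(B ** A ** adj2 B) ** B = B ** A"
    using assms(2) by (simp flip: matrix_mul_assoc)
  define C where "C = B ** A ** adj2 B"
  have eqs: "C $ i $ 1 * B $ 1 $ j + C $ i $ 2 * B $ 2 $ j = B $ i $ 1 * A $ 1 $ j + B $ i $ 2 * A $ 2 $ j" for i j
    using arg_cong[OF eq, of "\<lambda>M. M $ i $ j"] by (simp only: C_def [symmetric] mult2_nth)
  have lin: "C $ i $ 1 * (B $ 1 $ 1 * x + B $ 1 $ 2 * y) + C $ i $ 2 * (B $ 2 $ 1 * x + B $ 2 $ 2 * y)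
    = B $ i $ 1 * (A $ 1 $ 1 * x + A $ 1 $ 2 * y) + B $ i $ 2 * (A $ 2 $ 1 * x + A $ 2 $ 2 * y)" for i x y
  proof -
    have "C $ i $ 1 * (B $ 1 $ 1 * x + B $ 1 $ 2 * y) + C $ i $ 2 * (B $ 2 $ 1 * x + B $ 2 $ 2 * y)
      = (C $ i $ 1 * B $ 1 $ 1 + C $ i $ 2 * B $ 2 $ 1) * x + (C $ i $ 1 * B $ 1 $ 2 + C $ i $ 2 * B $ 2 $ 2) * y"
      by (simp add: algebra_simps)
    also have "\<dots> = (B $ i $ 1 * A $ 1 $ 1 + B $ i $ 2 * A $ 2 $ 1) * x + (B $ i $ 1 * A $ 1 $ 2 + B $ i $ 2 * A $ 2 $ 2) * y"
      by (simp only: eqs)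
    finally show ?thesis
      by (simp add: algebra_simps)
  qed
  show ?thesis
    unfolding vrel_def by (rule bexI[of _ C]) (use C lin A(2) in \<open>simp_all add: C_def\<close>)
qed

text \<open>The conjugates of \<open>transl m\<close> are the transvections \<open>v \<mapsto> v + m det(u,v) u\<close>.\<close>

lemma vrel_transvection:
  assumes K: "sl2_normal K" and m: "transl (int m) \<in> K" and "coprime p q"
    and w: "w = (fst v + int m * k * (p * snd v - q * fst v) * p, snd v + int m * k * (p * snd v - q * fst v) * q)"
  shows "vrel K v w"
proof -
  obtain B where B: "B \<in> SL2Z" "B $ 1 $ 1 = p" "B $ 2 $ 1 = q"
    using ex_first_column[OF assms(3)] by blast
  have det: "p * B $ 2 $ 2 = 1 + B $ 1 $ 2 * q"
    using B by (auto simp: SL2Z_iff)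
  have C: "B ** transl (int m * k) ** adj2 B \<in> K"
    using sl2_normal_transl[OF K m, of k] K B(1) by (simp add: sl2_normal_def)
  have ent: "(B ** transl (int m * k) ** adj2 B) $ 1 $ 1 = 1 - int m * k * p * q"
      "(B ** transl (int m * k) ** adj2 B) $ 1 $ 2 = int m * k * p * p"
      "(B ** transl (int m * k) ** adj2 B) $ 2 $ 1 = - int m * k * q * q"
      "(B ** transl (int m * k) ** adj2 B) $ 2 $ 2 = 1 + int m * k * p * q"
    using det by (simp_all add: B algebra_simps)
  show ?thesis
    unfolding vrel_def by (rule bexI[OF _ C]) (simp only: ent w, simp add: algebra_simps)
qed

lemma vrel_uminus:
  assumes "sl2_normal K" "- mat 1 \<in> K" "w = (- fst v, - snd v)"
  shows "vrel K v w"
  unfolding vrel_def by (rule bexI[of _ "- mat 1"]) (use assms in auto)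

section \<open>A table of representatives of the cusps\<close>

text \<open>One representative for each class of primitive columns modulo m up to sign: 3, 4, 6 and
  12 of them. Entries beyond m keep the integers coprime; for m = 5, (2,5) stands for (2,0) and
  (9,2) for (4,2).\<close>

definition cusp_vectors :: "nat \<Rightarrow> (int \<times> int) set" where
  "cusp_vectors m =
    (if m = 2 then {(1,0),(0,1),(1,1)}
     else if m = 3 then {(1,0),(0,1),(1,1),(2,1)}
     else if m = 4 then {(1,0),(0,1),(1,1),(2,1),(3,1),(1,2)}
     else {(1,0),(0,1),(1,1),(2,1),(3,1),(4,1),(2,5),(1,2),(3,2),(5,2),(7,2),(9,2)})"

text \<open>The finite verification behind generation: after a translation by 1 or an inversion,
  each listed column is carried back to the list by explicit transvections and a sign, hence inside
  every normal K that contains \<open>transl m\<close> and -1.\<close>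

lemma cusp_vectors_closed:
  assumes "2 \<le> m" "m \<le> 5" and K: "sl2_normal K" and T: "transl (int m) \<in> K" and I: "- mat 1 \<in> K"
    and "v \<in> cusp_vectors m"
  shows "\<exists>w\<in>cusp_vectors m. vrel K (fst v + snd v, snd v) w" (is ?thesis1)
    and "\<exists>w\<in>cusp_vectors m. vrel K (- snd v, fst v) w" (is ?thesis2)
proof -
  note tr = vrel_trans[OF K] and rf = vrel_refl[OF K] and um = vrel_uminus[OF K I]
  note tv = vrel_transvection[OF K T]
  have m: "m = 2 \<or> m = 3 \<or> m = 4 \<or> m = 5"
    using assms(1,2) by linarith
  have ok: "\<exists>w\<in>W. vrel K v w" if "vrel K v u" "u \<in> W" for u v W
    using that by blast
  have ok': "\<exists>w\<in>W. vrel K v w" if "vrel K v u" "(- fst u, - snd u) \<in> W" for u v W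
    using that tr um by blast
  have mv: "vrel K v (fst v + int m * k * (p * snd v - q * fst v) * p, snd v + int m * k * (p * snd v - q * fst v) * q)"
    if "coprime p q" for v k p q
    using tv[OF that] by blast
  have nm: "vrel K v (a, b) \<Longrightarrow> vrel K v (- a, - b)" for v a b
    using tr um[of "(- a, - b)" "(a, b)"] by simp
  have nrf: "vrel K (- a, - b) (a, b)" "vrel K (- a, b) (a, - b)" "vrel K (a, - b) (- a, b)" for a b
    by (rule um; simp)+
  have T: "m = 2 \<Longrightarrow> vrel K (2,1) (0,1)" "m = 3 \<Longrightarrow> vrel K (3,1) (0,1)"
     "m = 4 \<Longrightarrow> vrel K (4,1) (0,1)" "m = 4 \<Longrightarrow> vrel K (3,2) (1,2)"
     "m = 5 \<Longrightarrow> vrel K (5,1) (0,1)" "m = 5 \<Longrightarrow> vrel K (7,5) (2,5)" "m = 5 \<Longrightarrow> vrel K (11,2) (1,2)"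
    \<comment> \<open>Each \<open>mv\<close> names the direction (p, q), the starting column and the
      multiplier k. \<open>nm\<close> changes the sign of the result, and \<open>tr\<close> chains
      two moves, as in (7,5) -> (-3,-5) -> (2,5).\<close>
    using mv[of 1 0 "(2,1)" "-1"] mv[of 1 0 "(3,1)" "-1"] mv[of 1 0 "(4,1)" "-1"] mv[of 1 0 "(5,1)" "-1"]
      nm[OF mv[of 1 1 "(3,2)" 1]] mv[of 1 0 "(11,2)" "-1"] tr[OF mv[of 1 1 "(7,5)" 1] mv[of 1 2 _ 1]]
    by simp_all
  have S: "m = 2 \<Longrightarrow> vrel K (-1,1) (1,1)" "m = 3 \<Longrightarrow> vrel K (-1,1) (2,1)"
     "m = 3 \<Longrightarrow> vrel K (-1,2) (1,1)" "m = 4 \<Longrightarrow> vrel K (-1,1) (3,1)" "m = 4 \<Longrightarrow> vrel K (-1,2) (1,2)"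
     "m = 4 \<Longrightarrow> vrel K (-1,3) (1,1)" "m = 4 \<Longrightarrow> vrel K (-2,1) (2,1)"
     "m = 5 \<Longrightarrow> vrel K (-1,1) (4,1)" "m = 5 \<Longrightarrow> vrel K (-1,2) (9,2)" "m = 5 \<Longrightarrow> vrel K (-1,3) (1,2)"
     "m = 5 \<Longrightarrow> vrel K (-1,4) (1,1)" "m = 5 \<Longrightarrow> vrel K (-5,2) (5,2)" "m = 5 \<Longrightarrow> vrel K (-2,1) (3,1)"
     "m = 5 \<Longrightarrow> vrel K (-2,3) (7,2)" "m = 5 \<Longrightarrow> vrel K (-2,5) (2,5)" "m = 5 \<Longrightarrow> vrel K (-2,7) (3,2)"
     "m = 5 \<Longrightarrow> vrel K (-2,9) (2,1)"
    using mv[of 1 0 "(-1,1)" 1] nm[OF mv[of 0 1 "(-1,1)" "-1"]] nm[OF mv[of 0 1 "(-1,2)" "-1"]] nm[OF mv[of 0 1 "(-1,3)" "-1"]]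
      mv[of 1 0 "(-2,1)" 1]
      mv[of 1 0 "(-1,2)" 1] nm[OF mv[of 0 1 "(-1,4)" "-1"]] mv[of 1 0 "(-5,2)" 1]
      nm[OF tr[OF mv[of 1 "-1" "(-2,3)" 1] mv[of 1 0 _ 1]]] nm[OF mv[of 0 1 "(-2,5)" "-1"]]
      tr[OF mv[of 0 1 "(-2,7)" "-1"] mv[of 1 1 _ "-1"]] nm[OF mv[of 0 1 "(-2,9)" "-1"]]
    by simp_all
  have "m = 2 \<Longrightarrow> ?thesis1" "m = 3 \<Longrightarrow> ?thesis1" "m = 4 \<Longrightarrow> ?thesis1" "m = 5 \<Longrightarrow> ?thesis1"
    using assms(6) by (auto simp: cusp_vectors_def rf T)
  then show ?thesis1
    using m by blast
  have "m = 2 \<Longrightarrow> ?thesis2" "m = 3 \<Longrightarrow> ?thesis2" "m = 4 \<Longrightarrow> ?thesis2" "m = 5 \<Longrightarrow> ?thesis2"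
    using assms(6) by (auto simp: cusp_vectors_def rf S nrf(2)[of 1 0, simplified])
  then show ?thesis2
    using m by blast
qed

text \<open>Completes the column to determinant 1. The columns left for the last branch have second
  entry 2 and odd first entry, so the division is exact.\<close>

definition cusp_mat :: "int \<times> int \<Rightarrow> int ^ 2 ^ 2" where
  "cusp_mat v =
    (if v = (1, 0) then mat 1
     else if v = (2, 5) then mat2 2 1 5 3
     else if snd v = 1 then mat2 (fst v) (fst v - 1) 1 1
     else mat2 (fst v) ((fst v - 1) div 2) 2 1)"

lemma cusp_mat:
  assumes "v \<in> cusp_vectors m"
  shows "cusp_mat v \<in> SL2Z" "cusp_mat v $ 1 $ 1 = fst v" "cusp_mat v $ 2 $ 1 = snd v"
  using assms by (auto simp: cusp_vectors_def cusp_mat_def mat2_in_SL2Z split: if_splits)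

lemma cusp_mat_10 [simp]: "cusp_mat (1, 0) = mat 1"
  by (simp add: cusp_mat_def)

lemma finite_cusp_vectors [simp]: "finite (cusp_vectors m)"
  and cusp_vectors_10 [simp]: "(1, 0) \<in> cusp_vectors m"
  by (simp_all add: cusp_vectors_def)

text \<open>The products are 3 times 4, 4 times 3, 6 times 2 and 12 times 1. This is the origin of
  the 12 in the degree formula.\<close>

lemma card_cusp_vectors:
  assumes "2 \<le> m" "m \<le> 5"
  shows "card (cusp_vectors m) * (6 - m) = 12"
proof -
  have "m = 2 \<or> m = 3 \<or> m = 4 \<or> m = 5"
    using assms by linarith
  then show ?thesis
    by (auto simp: cusp_vectors_def)
qed

lemma cusp_vectors_incongruent:
  assumes "2 \<le> m" "m \<le> 5" "v \<in> cusp_vectors m" "w \<in> cusp_vectors m" "s = 1 \<or> s = -1"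
    "[fst v = s * fst w] (mod int m)" "[snd v = s * snd w] (mod int m)"
  shows "v = w"
proof -
  have "m = 2 \<or> m = 3 \<or> m = 4 \<or> m = 5"
    using assms by linarith
  moreover have "v = w" if "m = 2" using assms that by (auto simp: cusp_vectors_def cong_def)
  moreover have "v = w" if "m = 3" using assms that by (auto simp: cusp_vectors_def cong_def)
  moreover have "v = w" if "m = 4" using assms that by (auto simp: cusp_vectors_def cong_def)
  moreover have "v = w" if "m = 5" using assms that by (auto simp: cusp_vectors_def cong_def)
  ultimately show ?thesis
    by blast
qed

lemma vrel_cusp_vectors:
  assumes m: "2 \<le> m" "m \<le> 5" and K: "sl2_normal K" and T: "transl (int m) \<in> K" and I: "- mat 1 \<in> K"
    and "A \<in> SL2Z"
  shows "\<exists>v\<in>cusp_vectors m. vrel K (A $ 1 $ 1, A $ 2 $ 1) v"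
proof -
  define X where "X w \<longleftrightarrow> (\<exists>v\<in>cusp_vectors m. vrel K w v)" for w
  have step: "X (a + b, b)" "X (- b, a)" if ab: "X (a, b)" for a b
  proof -
    obtain v where v: "v \<in> cusp_vectors m" "vrel K (a, b) v"
      using ab unfolding X_def by blast
    have "vrel K (a + b, b) (fst v + snd v, snd v)" "vrel K (- b, a) (- snd v, fst v)"
      using vrel_conj[OF K _ v(2), of "transl 1"] vrel_conj[OF K _ v(2), of inversion] by simp_all
    then show "X (a + b, b)" "X (- b, a)"
      using cusp_vectors_closed[OF m K T I v(1)] vrel_trans[OF K] unfolding X_def by blast+
  qed
  have nat_step: "X (a + int k * b, b)" if "X (a, b)" for a b k
  proof (induction k)
    case (Suc k)
    then show ?case
      using step(1)[of "a + int k * b" b] by (simp add: algebra_simps)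
  qed (use that in simp)
  have int_step: "X (a + k * b, b)" if "X (a, b)" for a b k
  proof -
    define l where "l = \<bar>k\<bar>"
    \<comment> \<open>Only translations by nonnegative integers have been treated so far. Adding
      m|k| makes k nonnegative without changing the K-orbit.\<close>
    have "0 \<le> k + int m * l"
      using m mult_right_mono[of 1 "int m" l] unfolding l_def by linarith
    then have X': "X (a + (k + int m * l) * b, b)"
      using nat_step[OF that, of "nat (k + int m * l)"] by simp
    have "vrel K (a + k * b, b) (a + (k + int m * l) * b, b)"
      unfolding vrel_def by (rule bexI[of _ "transl (int m * l)"])
        (use sl2_normal_transl[OF K T] in \<open>auto simp: algebra_simps\<close>)
    then show ?thesis
      using X' vrel_trans[OF K] unfolding X_def by blast
  qed
  have "X (A $ 1 $ 1, A $ 2 $ 1)"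
    using \<open>A \<in> SL2Z\<close>
  proof (induction A rule: SL2Z_induct)
    case (transl k)
    then show ?case
      using vrel_refl[OF K] unfolding X_def by (intro bexI[of _ "(1, 0)"]) simp_all
  next
    case (mult_transl A k)
    then show ?case
      using int_step by simp
  next
    case (mult_inversion A)
    then show ?case
      using step by simp
  qed
  then show ?thesis
    by (simp add: X_def)
qed

lemma eq_transl:
  assumes "B \<in> SL2Z" "B $ 1 $ 1 = 1" "B $ 2 $ 1 = 0"
  shows "B = transl (B $ 1 $ 2)"
  using assms by (simp add: mat2_eq_iff SL2Z_iff)

lemma same_column:
  assumes "A \<in> SL2Z" "B \<in> SL2Z" "A $ 1 $ 1 = B $ 1 $ 1" "A $ 2 $ 1 = B $ 2 $ 1"
  obtains k where "A = B ** transl k"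
proof -
  have "(adj2 B ** A) $ 1 $ 1 = 1" "(adj2 B ** A) $ 2 $ 1 = 0"
    using assms by (simp_all add: SL2Z_iff algebra_simps)
  then have "adj2 B ** A = transl ((adj2 B ** A) $ 1 $ 2)"
    using assms by (intro eq_transl) simp_all
  then have "A = B ** transl ((adj2 B ** A) $ 1 $ 2)"
    using assms(2) by (metis adj2_cancel(2))
  then show ?thesis
    by (rule that)
qed

text \<open>Double cosets of K and the translations: an element of K brings the first column of A
  into the table, and two matrices of determinant 1 with the same first column differ by a
  translation on the right.\<close>

lemma cusp_decomposition:
  assumes "2 \<le> m" "m \<le> 5" and K: "sl2_normal K" and "transl (int m) \<in> K" "- mat 1 \<in> K"
    and A: "A \<in> SL2Z"
  obtains v g k where "v \<in> cusp_vectors m" "g \<in> K" "A = g ** cusp_mat v ** transl k"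
proof -
  obtain v g where v: "v \<in> cusp_vectors m" and g: "g \<in> K"
    and eq: "v = (g $ 1 $ 1 * A $ 1 $ 1 + g $ 1 $ 2 * A $ 2 $ 1, g $ 2 $ 1 * A $ 1 $ 1 + g $ 2 $ 2 * A $ 2 $ 1)"
    using vrel_cusp_vectors[OF assms] by (auto simp: vrel_def)
  have g': "g \<in> SL2Z" "adj2 g \<in> K"
    using g K by (auto simp: sl2_normal_def)
  obtain k where "g ** A = cusp_mat v ** transl k"
    using same_column[of "g ** A" "cusp_mat v"] cusp_mat[OF v] eq A g' by auto
  then have "A = adj2 g ** cusp_mat v ** transl k"
    using g' by (metis adj2_cancel(1) matrix_mul_assoc)
  then show ?thesis
    using that v g' by blast
qed

lemma sl2_normal_subset: "sl2_normal K \<Longrightarrow> A \<in> K \<Longrightarrow> A \<in> SL2Z"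
  by (auto simp: sl2_normal_def)

lemma Gpm_SL2Z: "A \<in> Gpm m \<Longrightarrow> A \<in> SL2Z"
  using sl2_normal_subset[OF sl2_normal_Gpm] .

section \<open>Congruence of columns and generation of \<plusminus>\<Gamma>(m)\<close>

text \<open>The arithmetic criterion for the cusps A\<infinity> and B\<infinity> to be equivalent
  under \<Gamma>(m).\<close>

definition col_cong :: "nat \<Rightarrow> int ^ 2 ^ 2 \<Rightarrow> int ^ 2 ^ 2 \<Rightarrow> bool" where
  "col_cong m A B \<longleftrightarrow> (\<exists>s. (s = 1 \<or> s = -1) \<and> [A $ 1 $ 1 = s * B $ 1 $ 1] (mod int m) \<and>
     [A $ 2 $ 1 = s * B $ 2 $ 1] (mod int m))"

lemma Gpm_obtain:
  assumes "g \<in> Gpm m"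
  obtains s where "s = 1 \<or> s = -1" "[g $ 1 $ 1 = s] (mod int m)" "[g $ 1 $ 2 = 0] (mod int m)"
    "[g $ 2 $ 1 = 0] (mod int m)" "[g $ 2 $ 2 = s] (mod int m)"
proof -
  consider "g \<in> principal_congruence_subgroup m" | "- g \<in> principal_congruence_subgroup m"
    using assms by (auto simp: Gpm_def)
  then show ?thesis
  proof cases
    case 1
    then show ?thesis
      using that[of 1] by (simp add: pcs_iff)
  next
    case 2
    have "[x = - y] (mod int m)" if "[- x = y] (mod int m)" for x y
      using that by (metis cong_minus_minus_iff minus_minus)
    from this[of _ 0] this[of _ 1] show ?thesis
      using 2 that[of "-1"] by (simp add: pcs_iff)
  qed
qed

lemma col_cong_mult:
  assumes "g \<in> Gpm m" 
  shows "col_cong m (g ** B ** transl k) B"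
proof -
  obtain s where s: "s = 1 \<or> s = -1" "[g $ 1 $ 1 = s] (mod int m)" "[g $ 1 $ 2 = 0] (mod int m)"
    "[g $ 2 $ 1 = 0] (mod int m)" "[g $ 2 $ 2 = s] (mod int m)"
    using Gpm_obtain[OF assms] .
  have "[g $ 1 $ 1 * B $ 1 $ 1 + g $ 1 $ 2 * B $ 2 $ 1 = s * B $ 1 $ 1 + 0 * B $ 2 $ 1] (mod int m)"
    "[g $ 2 $ 1 * B $ 1 $ 1 + g $ 2 $ 2 * B $ 2 $ 1 = 0 * B $ 1 $ 1 + s * B $ 2 $ 1] (mod int m)"
    using s by (intro cong_add cong_mult; simp)+
  then show ?thesis
    using s(1) by (auto simp: col_cong_def)
qed

lemma col_cong_sym: "col_cong m A B \<Longrightarrow> col_cong m B A"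
  unfolding col_cong_def
proof (elim exE conjE)
  fix s :: int
  assume s: "s = 1 \<or> s = -1" "[A $ 1 $ 1 = s * B $ 1 $ 1] (mod int m)" "[A $ 2 $ 1 = s * B $ 2 $ 1] (mod int m)"
  have "[y = s * x] (mod int m)" if "[x = s * y] (mod int m)" for x y
    using cong_mult[OF cong_refl that, of s] s(1) by (auto simp: cong_sym)
  then show "\<exists>s. (s = 1 \<or> s = -1) \<and> [B $ 1 $ 1 = s * A $ 1 $ 1] (mod int m) \<and> [B $ 2 $ 1 = s * A $ 2 $ 1] (mod int m)"
    using s by blast
qed

lemma col_cong_trans: "col_cong m A B \<Longrightarrow> col_cong m B C \<Longrightarrow> col_cong m A C"
  unfolding col_cong_def
proof (elim exE conjE)
  fix s t :: int
  assume st: "s = 1 \<or> s = -1" "[A $ 1 $ 1 = s * B $ 1 $ 1] (mod int m)" "[A $ 2 $ 1 = s * B $ 2 $ 1] (mod int m)"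
    "t = 1 \<or> t = -1" "[B $ 1 $ 1 = t * C $ 1 $ 1] (mod int m)" "[B $ 2 $ 1 = t * C $ 2 $ 1] (mod int m)"
  have "[x = s * t * z] (mod int m)" if "[x = s * y] (mod int m)" "[y = t * z] (mod int m)" for x y z
    using cong_trans[OF that(1) cong_mult[OF cong_refl that(2), of s]] by (simp add: mult.assoc)
  then show "\<exists>s. (s = 1 \<or> s = -1) \<and> [A $ 1 $ 1 = s * C $ 1 $ 1] (mod int m) \<and> [A $ 2 $ 1 = s * C $ 2 $ 1] (mod int m)"
    using st by (intro exI[of _ "s * t"]) auto
qed

lemma Gpm_contains: "transl (int m) \<in> Gpm m" "- mat 1 \<in> Gpm m" 
  using sl2_normal_pcs[of m] by (simp add: Gpm_transl) (simp add: Gpm_def sl2_normal_def pcs_iff)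

lemma col_cong_cusp_mat:
  assumes "2 \<le> m" "m \<le> 5" "v \<in> cusp_vectors m" "w \<in> cusp_vectors m" "col_cong m (cusp_mat v) (cusp_mat w)"
  shows "v = w"
  using assms cusp_mat[OF assms(3)] cusp_mat[OF assms(4)] unfolding col_cong_def
  by (metis cusp_vectors_incongruent)

text \<open>Converse of \<open>col_cong_mult\<close>. Both matrices are decomposed over the table;
  their representatives are congruent up to sign, hence equal, and the common middle factor
  cancels.\<close>

lemma col_congD:
  assumes m: "2 \<le> m" "m \<le> 5" and AB: "A \<in> SL2Z" "B \<in> SL2Z" "col_cong m A B"
  obtains g k where "g \<in> Gpm m" "A = g ** B ** transl k"
proof -
  note dec = cusp_decomposition[OF m sl2_normal_Gpm Gpm_contains]
  obtain v g k where A: "v \<in> cusp_vectors m" "g \<in> Gpm m" "A = g ** cusp_mat v ** transl k"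
    using dec[OF AB(1)] .
  obtain w h l where B: "w \<in> cusp_vectors m" "h \<in> Gpm m" "B = h ** cusp_mat w ** transl l"
    using dec[OF AB(2)] .
  have "col_cong m (cusp_mat v) (cusp_mat w)"
    using col_cong_mult[OF A(2), of "cusp_mat v" k] col_cong_mult[OF B(2), of "cusp_mat w" l] AB(3)
      col_cong_sym col_cong_trans unfolding A(3) B(3) by blast
  then have "v = w"
    using col_cong_cusp_mat m A(1) B(1) by blast
  have h: "h \<in> SL2Z" "adj2 h \<in> Gpm m"
    using B(2) sl2_normal_Gpm[of m] by (auto simp: sl2_normal_def)
  have "g ** adj2 h ** B ** transl (k - l) = A"
  proof -
    have "g ** adj2 h ** B ** transl (k - l) = g ** (adj2 h ** (h ** (cusp_mat w ** (transl l ** transl (k - l)))))"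
      by (simp add: B(3) matrix_mul_assoc)
    also have "\<dots> = g ** (cusp_mat w ** transl k)"
      using h by (simp add: transl_mult)
    also have "\<dots> = A"
      using A(3) \<open>v = w\<close> by (simp add: matrix_mul_assoc)
    finally show ?thesis .
  qed
  moreover have "g ** adj2 h \<in> Gpm m"
    using A(2) h(2) sl2_normal_Gpm[of m] by (simp add: sl2_normal_def)
  ultimately show ?thesis
    using that by metis
qed

text \<open>Decomposing A over K \<inter> \<open>Gpm m\<close> instead of K keeps control of
  congruences: the first column of A is trivial modulo m up to sign, so the representative must be
  (1,0). What remains is a translation in \<plusminus>\<Gamma>(m), a power of
  \<open>transl m\<close>, which lies in K.\<close>

theorem Gpm_subset_normal:
  assumes m: "2 \<le> m" "m \<le> 5" and K: "sl2_normal K" "transl (int m) \<in> K" "- mat 1 \<in> K"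
  shows "Gpm m \<subseteq> K"
proof
  fix A assume A: "A \<in> Gpm m"
  have L: "sl2_normal (K \<inter> Gpm m)" "transl (int m) \<in> K \<inter> Gpm m" "- mat 1 \<in> K \<inter> Gpm m"
    using K Gpm_contains sl2_normal_Int sl2_normal_Gpm by auto
  obtain v g k where *: "v \<in> cusp_vectors m" "g \<in> K \<inter> Gpm m" "A = g ** cusp_mat v ** transl k"
    using cusp_decomposition[OF m L Gpm_SL2Z[OF A]] .
  have "col_cong m A (cusp_mat v)"
    unfolding *(3) using * by (intro col_cong_mult) auto
  moreover have "col_cong m A (mat 1)"
    using col_cong_mult[OF A, of "mat 1" 0] by (simp add: transl_0)
  ultimately have "col_cong m (cusp_mat v) (cusp_mat (1, 0))"
    using col_cong_sym col_cong_trans by (metis cusp_mat_10)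
  then have "v = (1, 0)"
    using col_cong_cusp_mat[OF m *(1)] by simp
  then have A_eq: "A = g ** transl k"
    using *(3) by simp
  have g: "adj2 g \<in> Gpm m" "g \<in> SL2Z"
    using * L by (auto simp: sl2_normal_def)
  have "adj2 g ** A \<in> Gpm m"
    using A g sl2_normal_Gpm[of m] by (simp add: sl2_normal_def)
  then have "transl k \<in> Gpm m"
    using A_eq g by simp
  then have "transl k \<in> K"
    using sl2_normal_transl[OF K(1,2)] by (auto simp: Gpm_transl)
  then show "A \<in> K"
    using A_eq * K by (simp add: sl2_normal_def)
qed

section \<open>The upper half-plane and its cusps\<close>

definition denom :: "int ^ 2 ^ 2 \<Rightarrow> complex \<Rightarrow> complex" where
  "denom A z = of_int (A $ 2 $ 1) * z + of_int (A $ 2 $ 2)"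

definition numer :: "int ^ 2 ^ 2 \<Rightarrow> complex \<Rightarrow> complex" where
  "numer A z = of_int (A $ 1 $ 1) * z + of_int (A $ 1 $ 2)"

lemma lin_frac_eq: "lin_frac A z = numer A z / denom A z"
  by (simp add: lin_frac_def numer_def denom_def)

lemma mem_uhp: "z \<in> upper_half_plane \<longleftrightarrow> 0 < Im z"
  by (simp add: upper_half_plane_def)

lemma open_uhp [simp]: "open upper_half_plane"
  unfolding upper_half_plane_def by (rule open_halfspace_Im_gt)

lemma convex_uhp: "convex upper_half_plane"
  unfolding upper_half_plane_def by (rule convex_halfspace_Im_gt)

lemma connected_uhp [simp]: "connected upper_half_plane"
  by (rule convex_connected[OF convex_uhp])

lemma ii_in_uhp [simp]: "\<i> \<in> upper_half_plane"
  by (simp add: mem_uhp)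

lemma denom_nonzero [simp]:
  assumes "A \<in> SL2Z" "z \<in> upper_half_plane"
  shows "denom A z \<noteq> 0"
proof
  assume eq: "denom A z = 0"
  then have "Im (denom A z) = 0" "Re (denom A z) = 0"
    by simp_all
  then show False
    using assms by (simp add: denom_def mem_uhp SL2Z_iff)
qed

lemma denom_mult:
  assumes "B \<in> SL2Z" "z \<in> upper_half_plane"
  shows "denom (A ** B) z = denom A (lin_frac B z) * denom B z"
    and "numer (A ** B) z = numer A (lin_frac B z) * denom B z"
proof -
  have n: "numer B z = lin_frac B z * denom B z"
    using denom_nonzero[OF assms] by (simp add: lin_frac_eq)
  have "denom (A ** B) z = of_int (A $ 2 $ 1) * numer B z + of_int (A $ 2 $ 2) * denom B z"
    "numer (A ** B) z = of_int (A $ 1 $ 1) * numer B z + of_int (A $ 1 $ 2) * denom B z"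
    by (simp_all add: denom_def numer_def algebra_simps)
  then show "denom (A ** B) z = denom A (lin_frac B z) * denom B z"
    "numer (A ** B) z = numer A (lin_frac B z) * denom B z"
    unfolding n by (simp_all add: denom_def[of A] numer_def[of A] algebra_simps)
qed

lemma lin_frac_mult:
  assumes "B \<in> SL2Z" "z \<in> upper_half_plane"
  shows "lin_frac (A ** B) z = lin_frac A (lin_frac B z)"
  unfolding lin_frac_eq[of "A ** B"] denom_mult[OF assms] lin_frac_eq[of A]
  using denom_nonzero[OF assms] by simp

lemma Im_lin_frac:
  assumes "A \<in> SL2Z" "z \<in> upper_half_plane"
  shows "Im (lin_frac A z) = Im z / (cmod (denom A z))\<^sup>2"
proof -
  have "real_of_int (A $ 1 $ 1) * real_of_int (A $ 2 $ 2) - real_of_int (A $ 1 $ 2) * real_of_int (A $ 2 $ 1) = 1"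
    using arg_cong[OF assms(1)[unfolded SL2Z_iff], of real_of_int] by simp
  moreover have "Im (numer A z * cnj (denom A z)) = (real_of_int (A $ 1 $ 1) * real_of_int (A $ 2 $ 2) -
      real_of_int (A $ 1 $ 2) * real_of_int (A $ 2 $ 1)) * Im z"
    by (simp add: numer_def denom_def algebra_simps)
  ultimately have "Im (numer A z * cnj (denom A z)) = Im z"
    by simp
  moreover have "Im (lin_frac A z) = Im (numer A z * cnj (denom A z)) / (cmod (denom A z))\<^sup>2"
    by (simp add: lin_frac_eq complex_div_cnj[of "numer A z"] Im_divide_of_real flip: of_real_power)
  ultimately show ?thesis
    by simp
qed

lemma lin_frac_in_uhp [simp]: "A \<in> SL2Z \<Longrightarrow> z \<in> upper_half_plane \<Longrightarrow> lin_frac A z \<in> upper_half_plane"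
  by (simp add: Im_lin_frac mem_uhp[of "lin_frac A z"]) (simp add: mem_uhp)

lemma lin_frac_transl [simp]: "lin_frac (transl k) z = z + of_int k"
  and lin_frac_one [simp]: "lin_frac (mat 1) z = z"
  and lin_frac_inversion [simp]: "lin_frac inversion z = - 1 / z"
  by (simp_all add: lin_frac_eq numer_def denom_def)

lemma lin_frac_uminus [simp]: "lin_frac (- A) z = lin_frac A z"
proof -
  have "numer (- A) z = - numer A z" "denom (- A) z = - denom A z"
    by (simp_all add: numer_def denom_def)
  then show ?thesis
    by (simp add: lin_frac_eq)
qed

lemma lin_frac_adj2 [simp]:
  assumes "A \<in> SL2Z" "z \<in> upper_half_plane"
  shows "lin_frac (adj2 A) (lin_frac A z) = z" "lin_frac A (lin_frac (adj2 A) z) = z"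
  using assms lin_frac_mult[of A z "adj2 A"] lin_frac_mult[of "adj2 A" z A] by simp_all

lemma lin_frac_has_field_derivative:
  assumes "A \<in> SL2Z" "z \<in> upper_half_plane"
  shows "(lin_frac A has_field_derivative 1 / (denom A z)\<^sup>2) (at z)"
proof -
  have det: "of_int (A $ 1 $ 1) * of_int (A $ 2 $ 2) - of_int (A $ 1 $ 2) * of_int (A $ 2 $ 1) = (1 :: complex)"
    using arg_cong[OF assms(1)[unfolded SL2Z_iff], of of_int] by simp
  have "((\<lambda>z. numer A z / denom A z) has_field_derivative
     (of_int (A $ 1 $ 1) * denom A z - numer A z * of_int (A $ 2 $ 1)) / (denom A z * denom A z)) (at z)"
    using denom_nonzero[OF assms] unfolding numer_def denom_def
    by (auto intro!: derivative_eq_intros)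
  moreover have "of_int (A $ 1 $ 1) * denom A z - numer A z * of_int (A $ 2 $ 1) = 1"
    using det by (simp add: numer_def denom_def algebra_simps)
  ultimately show ?thesis
    by (simp add: lin_frac_eq[abs_def] power2_eq_square)
qed

lemma holomorphic_lin_frac [holomorphic_intros]: "A \<in> SL2Z \<Longrightarrow> lin_frac A holomorphic_on upper_half_plane"
  unfolding holomorphic_on_def field_differentiable_def
  using lin_frac_has_field_derivative has_field_derivative_at_within by blast

text \<open>The imaginary part bounds c, and then the triangle inequality bounds d. This
  discreteness underlies both the fundamental domain and the separation of orbits.\<close>

lemma finite_small_denom:
  assumes "0 < Im z"
  shows "finite {(c :: int, d :: int). cmod (of_int c * z + of_int d) \<le> r}"
proof -
  define N where "N = \<lceil>r / Im z\<rceil>"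
  define M where "M = \<lceil>r + r / Im z * cmod z\<rceil>"
  have "{(c :: int, d :: int). cmod (of_int c * z + of_int d) \<le> r} \<subseteq> {-N..N} \<times> {-M..M}"
  proof (rule subrelI)
    fix c d :: int
    assume "(c, d) \<in> {(c, d). cmod (of_int c * z + of_int d) \<le> r}"
    then have le: "cmod (of_int c * z + of_int d) \<le> r"
      by simp
    have "\<bar>real_of_int c * Im z\<bar> \<le> r"
      using abs_Im_le_cmod[of "of_int c * z + of_int d"] le by simp
    then have c: "\<bar>real_of_int c\<bar> \<le> r / Im z"
      using assms by (simp add: abs_mult field_simps)
    have "\<bar>real_of_int d\<bar> = cmod ((of_int c * z + of_int d) - of_int c * z)"
      by simp
    also have "\<dots> \<le> r + \<bar>real_of_int c\<bar> * cmod z"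
      using norm_triangle_ineq4[of "of_int c * z + of_int d" "of_int c * z"] le by (simp add: norm_mult)
    also have "\<dots> \<le> r + r / Im z * cmod z"
      using mult_right_mono[OF c, of "cmod z"] by simp
    finally have "\<bar>real_of_int d\<bar> \<le> r + r / Im z * cmod z" .
    with c have "- N \<le> c" "c \<le> N" "- M \<le> d" "d \<le> M"
      unfolding N_def M_def by linarith+
    then show "(c, d) \<in> {-N..N} \<times> {-M..M}"
      by simp
  qed
  then show ?thesis
    by (rule finite_subset) simp
qed

text \<open>Since Im(Az) = Im z / |cz+d|^2, the highest point of the orbit minimizes |cz+d|. Only
  finitely many rows satisfy |cz+d| \<le> 1, and that of the identity is among them. A translation
  then adjusts the real part. The bound 1/2 suffices for the compactness arguments below.\<close>

lemma fundamental_domain: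
  assumes z: "z \<in> upper_half_plane"
  obtains A where "A \<in> SL2Z" "\<bar>Re (lin_frac A z)\<bar> \<le> 1 / 2" "1 / 2 < Im (lin_frac A z)"
proof -
  define S where "S = (\<lambda>A. (A $ 2 $ 1, A $ 2 $ 2)) ` {A \<in> SL2Z. cmod (denom A z) \<le> 1}"
  define f where "f = (\<lambda>(c, d). cmod (of_int c * z + of_int d))"
  have "S \<subseteq> {(c, d). cmod (of_int c * z + of_int d) \<le> 1}"
    by (auto simp: S_def denom_def)
  then have "finite S"
    using finite_small_denom[of z 1] z finite_subset by (auto simp: mem_uhp)
  moreover have "mat 1 \<in> {A \<in> SL2Z. cmod (denom A z) \<le> 1}"
    by (simp add: denom_def)
  then have "S \<noteq> {}"
    unfolding S_def by blast
  ultimately obtain s where s: "s \<in> S" "\<And>t. t \<in> S \<Longrightarrow> f s \<le> f t"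
    using ex_min_if_finite[of "f ` S"] by (metis (no_types, lifting) arg_min_if_finite(1) arg_min_least)
  obtain A where A: "A \<in> SL2Z" "cmod (denom A z) \<le> 1" "s = (A $ 2 $ 1, A $ 2 $ 2)"
    using s(1) by (auto simp: S_def)
  have min: "cmod (denom A z) \<le> cmod (denom B z)" if "B \<in> SL2Z" for B
  proof (cases "cmod (denom B z) \<le> 1")
    case True
    then have "(B $ 2 $ 1, B $ 2 $ 2) \<in> S"
      using that by (auto simp: S_def)
    then show ?thesis
      using s(2) A(3) by (force simp: f_def denom_def)
  qed (use A in linarith)
  define B where "B = transl (- round (Re (lin_frac A z))) ** A"
  have B: "B \<in> SL2Z"
    using A by (simp add: B_def)
  define w where "w = lin_frac B z"
  have w: "w \<in> upper_half_plane"
    using B z by (simp add: w_def)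
  have "w = lin_frac A z - of_int (round (Re (lin_frac A z)))"
    using A z by (simp add: w_def B_def lin_frac_mult)
  then have Re: "\<bar>Re w\<bar> \<le> 1 / 2"
    using of_int_round_abs_le[of "Re (lin_frac A z)"] by (simp add: abs_minus_commute)
  have "denom B z = denom A z"
    using A z by (simp add: B_def denom_mult) (simp add: denom_def)
  then have "cmod (denom B z) \<le> cmod (denom (inversion ** B) z)"
    using min[of "inversion ** B"] B by simp
  also have "denom (inversion ** B) z = w * denom B z"
    using B z by (simp add: denom_mult w_def) (simp add: denom_def)
  \<comment> \<open>Passing from w to -1/w multiplies the denominator by w, so minimality forbids
    |w| < 1.\<close>
  finally have "1 \<le> cmod w"
    using denom_nonzero[OF B z] by (simp add: norm_mult)
  then have "1 \<le> (Re w)\<^sup>2 + (Im w)\<^sup>2"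
    by (simp add: cmod_def)
  moreover have "(Re w)\<^sup>2 \<le> (1 / 2)\<^sup>2"
    using Re by (metis abs_ge_zero power2_abs power_mono)
  ultimately have "(1 / 2)\<^sup>2 < (Im w)\<^sup>2"
    by (simp add: power2_eq_square)
  then have "1 / 2 < Im w"
    using w power2_less_imp_less[of "1 / 2" "Im w"] by (simp add: mem_uhp)
  with Re B show ?thesis
    using that by (simp add: w_def)
qed

section \<open>The action on cusps and the orbit relation\<close>

definition cusp_of :: "int ^ 2 ^ 2 \<Rightarrow> complex option" where
  "cusp_of A = lin_frac_P1 A None"

lemma cusp_of_eq: "cusp_of A = (if A $ 2 $ 1 = 0 then None else Some (of_int (A $ 1 $ 1) / of_int (A $ 2 $ 1)))"
  by (simp add: cusp_of_def lin_frac_P1_def)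

lemma cusp_of_uminus [simp]: "cusp_of (- A) = cusp_of A"
  by (simp add: cusp_of_eq)

lemma cusp_of_mult_transl [simp]: "cusp_of (A ** transl k) = cusp_of A"
  by (simp add: cusp_of_eq)

lemma cusp_of_in_cusps [simp]: "cusp_of A \<in> cusps"
  by (auto simp: cusp_of_eq cusps_def)

lemma cusp_obtain:
  assumes "x \<in> cusps"
  obtains A where "A \<in> SL2Z" "x = cusp_of A"
proof (cases x)
  case None
  then show ?thesis
    using that[of "mat 1"] by (simp add: cusp_of_eq)
next
  case (Some z)
  then have "z \<in> \<rat>"
    using assms by (auto simp: cusps_def)
  then obtain a b where ab: "b > 0" "coprime a b" "z = of_int a / of_int b"
    by (elim Rats_cases') 
  obtain A where "A \<in> SL2Z" "A $ 1 $ 1 = a" "A $ 2 $ 1 = b"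
    using ex_first_column[OF ab(2)] by blast
  then show ?thesis
    using that[of A] ab Some by (simp add: cusp_of_eq)
qed

lemma lin_frac_P1_cusp_of:
  assumes "A \<in> SL2Z" "B \<in> SL2Z"
  shows "lin_frac_P1 A (cusp_of B) = cusp_of (A ** B)"
proof (cases "B $ 2 $ 1 = 0")
  case True
  then have "B $ 1 $ 1 * B $ 2 $ 2 = 1"
    using assms(2) by (simp add: SL2Z_iff)
  then have "B $ 1 $ 1 \<noteq> 0"
    by auto
  then show ?thesis
    using True by (simp add: cusp_of_eq lin_frac_P1_def)
next
  case False
  have "(of_int (A $ i $ 1) * (of_int (B $ 1 $ 1) / of_int (B $ 2 $ 1)) + of_int (A $ i $ 2) :: complex)
    = of_int (A $ i $ 1 * B $ 1 $ 1 + A $ i $ 2 * B $ 2 $ 1) / of_int (B $ 2 $ 1)" for i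
    using False by (simp add: field_simps)
  then show ?thesis
    using False by (simp add: cusp_of_eq lin_frac_P1_def lin_frac_def)
      (metis (no_types, lifting) of_int_0_eq_iff of_int_add of_int_mult)
qed

text \<open>B^{-1} A fixes \<infinity>, so it is upper triangular with both diagonal entries 1 or
  both -1.\<close>

lemma cusp_of_eqD:
  assumes "A \<in> SL2Z" "B \<in> SL2Z" "cusp_of A = cusp_of B"
  obtains k where "A = B ** transl k \<or> A = - B ** transl k"
proof -
  have "A $ 1 $ 1 * B $ 2 $ 1 = A $ 2 $ 1 * B $ 1 $ 1"
  proof (cases "A $ 2 $ 1 = 0")
    case False
    then have "B $ 2 $ 1 \<noteq> 0" "of_int (A $ 1 $ 1) / of_int (A $ 2 $ 1) = (of_int (B $ 1 $ 1) / of_int (B $ 2 $ 1) :: complex)"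
      using assms(3) by (auto simp: cusp_of_eq split: if_splits)
    then have "of_int (A $ 1 $ 1 * B $ 2 $ 1) = (of_int (A $ 2 $ 1 * B $ 1 $ 1) :: complex)"
      using False by (simp add: field_simps)
    then show ?thesis
      unfolding of_int_eq_iff .
  qed (use assms(3) in \<open>simp add: cusp_of_eq split: if_splits\<close>)
  then have 0: "(adj2 B ** A) $ 2 $ 1 = 0"
    by (simp add: algebra_simps)
  moreover have C: "adj2 B ** A \<in> SL2Z"
    using assms by simp
  ultimately have "(adj2 B ** A) $ 1 $ 1 * (adj2 B ** A) $ 2 $ 2 = 1"
    unfolding SL2Z_iff by simp
  then consider "(adj2 B ** A) $ 1 $ 1 = 1" | "(- (adj2 B ** A)) $ 1 $ 1 = 1"
    by (auto simp: zmult_eq_1_iff simp del: mult2_nth)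
  then show ?thesis
  proof cases
    case 1
    then have "adj2 B ** A = transl ((adj2 B ** A) $ 1 $ 2)"
      using eq_transl C 0 by blast
    then show ?thesis
      using that assms(2) by (metis adj2_cancel(2))
  next
    case 2
    then have "- (adj2 B ** A) = transl ((- (adj2 B ** A)) $ 1 $ 2)"
      using eq_transl[of "- (adj2 B ** A)"] C 0 by simp
    then have "A = - (B ** transl ((- (adj2 B ** A)) $ 1 $ 2))"
      using assms(2) by (metis adj2_cancel(2) minus_minus uminus_mult2(2))
    then show ?thesis
      using that by (metis uminus_mult2(1))
  qed
qed

lemma cusp_not_Some_uhp: "z \<in> upper_half_plane \<Longrightarrow> Some z \<notin> cusps"
  by (auto simp: cusps_def mem_uhp elim!: Rats_cases')

lemma lin_frac_P1_Some:
  "A \<in> SL2Z \<Longrightarrow> z \<in> upper_half_plane \<Longrightarrow> lin_frac_P1 A (Some z) = Some (lin_frac A z)"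
  using denom_nonzero[of A z] by (simp add: lin_frac_P1_def denom_def)

lemma extended_cases:
  assumes "x \<in> extended_upper_half_plane"
  obtains z where "z \<in> upper_half_plane" "x = Some z" | A where "A \<in> SL2Z" "x = cusp_of A"
  using assms cusp_obtain unfolding extended_upper_half_plane_def by blast

lemma lin_frac_P1_mult:
  assumes "A \<in> SL2Z" "B \<in> SL2Z" "x \<in> extended_upper_half_plane"
  shows "lin_frac_P1 (A ** B) x = lin_frac_P1 A (lin_frac_P1 B x)"
  using assms(3)
proof (cases rule: extended_cases)
  case (1 z)
  then show ?thesis
    using assms by (simp add: lin_frac_P1_Some lin_frac_mult)
next
  case (2 C)
  then show ?thesis
    using assms by (simp add: lin_frac_P1_cusp_of matrix_mul_assoc)
qed

lemma lin_frac_P1_extended: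
  assumes "A \<in> SL2Z" "x \<in> extended_upper_half_plane"
  shows "lin_frac_P1 A x \<in> extended_upper_half_plane"
  using assms(2)
proof (cases rule: extended_cases)
  case (1 z)
  then show ?thesis
    using assms by (simp add: lin_frac_P1_Some extended_upper_half_plane_def)
next
  case (2 C)
  then show ?thesis
    using assms by (simp add: lin_frac_P1_cusp_of) (simp add: extended_upper_half_plane_def)
qed

lemma lin_frac_P1_one: "x \<in> extended_upper_half_plane \<Longrightarrow> lin_frac_P1 (mat 1) x = x"
  by (auto simp: lin_frac_P1_def split: option.splits)

lemma pcs_SL2Z: "A \<in> principal_congruence_subgroup m \<Longrightarrow> A \<in> SL2Z"
  by (simp add: pcs_iff)

lemma equiv_orbit_rel: "equiv extended_upper_half_plane (orbit_rel m)"
proof (rule equivI)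
  note N = sl2_normal_pcs[of m, unfolded sl2_normal_def]
  show "orbit_rel m \<subseteq> extended_upper_half_plane \<times> extended_upper_half_plane"
    by (auto simp: orbit_rel_def lin_frac_P1_extended pcs_SL2Z)
  show "refl_on extended_upper_half_plane (orbit_rel m)"
    using N by (auto simp: refl_on_def orbit_rel_def lin_frac_P1_extended pcs_SL2Z
        intro!: bexI[of _ "mat 1"] lin_frac_P1_one[symmetric])
  show "sym (orbit_rel m)"
  proof (rule symI, unfold orbit_rel_def, clarify)
    fix x A assume x: "x \<in> extended_upper_half_plane" and A: "A \<in> principal_congruence_subgroup m"
    have "x = lin_frac_P1 (adj2 A) (lin_frac_P1 A x)"
      using x A lin_frac_P1_mult[of "adj2 A" A x] by (simp add: pcs_SL2Z lin_frac_P1_one)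
    then show "lin_frac_P1 A x \<in> extended_upper_half_plane \<and>
        (\<exists>Aa\<in>principal_congruence_subgroup m. x = lin_frac_P1 Aa (lin_frac_P1 A x))"
      using A N x lin_frac_P1_extended pcs_SL2Z by blast
  qed
  show "trans (orbit_rel m)"
  proof (rule transI, unfold orbit_rel_def, clarify)
    fix x A B assume x: "x \<in> extended_upper_half_plane" and A: "A \<in> principal_congruence_subgroup m"
      and B: "B \<in> principal_congruence_subgroup m"
    have "lin_frac_P1 B (lin_frac_P1 A x) = lin_frac_P1 (B ** A) x"
      using x A B lin_frac_P1_mult[of B A x] by (simp add: pcs_SL2Z)
    then show "\<exists>Aa\<in>principal_congruence_subgroup m. lin_frac_P1 B (lin_frac_P1 A x) = lin_frac_P1 Aa x"
      using A B N by blast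
  qed
qed

text \<open>A cusp does not see the sign of a matrix, so elements of \<open>Gpm m\<close> can be
  exchanged for elements of \<Gamma>(m) in either direction.\<close>

lemma orbit_rel_cusp_iff:
  assumes m: "2 \<le> m" "m \<le> 5" and AB: "A \<in> SL2Z" "B \<in> SL2Z"
  shows "(cusp_of A, cusp_of B) \<in> orbit_rel m \<longleftrightarrow> col_cong m A B"
proof
  assume "(cusp_of A, cusp_of B) \<in> orbit_rel m"
  then obtain g where g: "g \<in> principal_congruence_subgroup m" "cusp_of B = cusp_of (g ** A)"
    using AB by (auto simp: orbit_rel_def lin_frac_P1_cusp_of pcs_SL2Z)
  obtain k where "B = g ** A ** transl k \<or> B = - (g ** A) ** transl k"
    using cusp_of_eqD[OF AB(2) _ g(2)] AB g by (metis SL2Z_mult pcs_SL2Z)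
  moreover have "g \<in> Gpm m" "- g \<in> Gpm m"
    using g by (simp_all add: Gpm_def)
  ultimately show "col_cong m A B"
    using col_cong_mult[of _ m A k] col_cong_sym by (metis uminus_mult2(1))
next
  assume "col_cong m A B"
  then obtain g k where g: "g \<in> Gpm m" "B = g ** A ** transl k"
    using col_congD[OF m AB(2,1)] col_cong_sym by blast
  obtain h where h: "h \<in> principal_congruence_subgroup m" "h = g \<or> h = - g"
    using g by (auto simp: Gpm_def)
  have "cusp_of B = cusp_of (h ** A)"
    using g h by (auto simp: uminus_mult2)
  then show "(cusp_of A, cusp_of B) \<in> orbit_rel m"
    using h AB by (auto simp: orbit_rel_def lin_frac_P1_cusp_of pcs_SL2Z extended_upper_half_plane_def)
qed

lemma num_inequivalent_cusps_eq:
  assumes m: "2 \<le> m" "m \<le> 5"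
  shows "num_inequivalent_cusps m = card (cusp_vectors m)"
proof -
  define F where "F v = orbit_rel m `` {cusp_of (cusp_mat v)}" for v
  have ext: "cusp_of A \<in> extended_upper_half_plane" for A
    by (simp add: extended_upper_half_plane_def)
  have eq_iff: "orbit_rel m `` {cusp_of A} = orbit_rel m `` {cusp_of B} \<longleftrightarrow> col_cong m A B"
    if "A \<in> SL2Z" "B \<in> SL2Z" for A B
    using eq_equiv_class_iff[OF equiv_orbit_rel ext ext] orbit_rel_cusp_iff[OF m that] by blast
  have "inj_on F (cusp_vectors m)"
    unfolding F_def using col_cong_cusp_mat[OF m] eq_iff cusp_mat(1) by (intro inj_onI) blast
  moreover have "F ` cusp_vectors m = cusps // orbit_rel m"
  proof (intro equalityI subsetI)
    fix X assume "X \<in> cusps // orbit_rel m"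
    then obtain x where x: "x \<in> cusps" "X = orbit_rel m `` {x}"
      by (auto simp: quotient_def)
    obtain A where A: "A \<in> SL2Z" "x = cusp_of A"
      using cusp_obtain[OF x(1)] .
    obtain v g k where v: "v \<in> cusp_vectors m" "g \<in> Gpm m" "A = g ** cusp_mat v ** transl k"
      using cusp_decomposition[OF m sl2_normal_Gpm Gpm_contains A(1)] .
    have "col_cong m A (cusp_mat v)"
      unfolding v(3) using v(2) by (rule col_cong_mult)
    then have "X = F v"
      using eq_iff[OF A(1) cusp_mat(1)[OF v(1)]] A x by (simp only: F_def)
    then show "X \<in> F ` cusp_vectors m"
      using v by blast
  qed (auto simp: F_def quotient_def)
  ultimately show ?thesis
    unfolding num_inequivalent_cusps_def by (metis card_image)
qed

section \<open>Eisenstein series\<close>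

definition qexp :: "complex \<Rightarrow> complex" where
  "qexp z = exp (2 * of_real pi * \<i> * z)"

lemma qexp_nonzero [simp]: "qexp z \<noteq> 0"
  by (simp add: qexp_def)

lemma qexp_0 [simp]: "qexp 0 = 1"
  by (simp add: qexp_def)

lemma qexp_add: "qexp (a + b) = qexp a * qexp b"
  by (simp add: qexp_def ring_distribs exp_add)

lemma qexp_uminus: "qexp (- a) = inverse (qexp a)"
  by (simp add: qexp_def exp_minus)

lemma qexp_of_nat_mult: "qexp (of_nat n * a) = qexp a ^ n"
  by (simp add: qexp_def mult_ac flip: exp_of_nat_mult)

lemma norm_qexp: "norm (qexp z) = exp (- 2 * pi * Im z)"
  by (simp add: qexp_def)

lemma norm_qexp_less_1: "z \<in> upper_half_plane \<Longrightarrow> norm (qexp z) < 1"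
  by (simp add: norm_qexp mem_uhp)

lemma qexp_of_int [simp]: "qexp (of_int n) = 1"
  unfolding qexp_def exp_eq_1 by (auto intro: exI[of _ n])

lemma qexp_eq_1_iff: "qexp z = 1 \<longleftrightarrow> z \<in> \<int>"
proof
  assume "qexp z = 1"
  then obtain n :: int where "Re (2 * of_real pi * \<i> * z) = 0" "Im (2 * of_real pi * \<i> * z) = of_int (2 * n) * pi"
    unfolding qexp_def exp_eq_1 by blast
  then have "z = of_int n"
    by (simp add: complex_eq_iff)
  then show "z \<in> \<int>"
    by simp
qed (auto elim: Ints_cases)

lemma DERIV_qexp [derivative_intros]:
  "(f has_field_derivative f') (at z within A) \<Longrightarrow>
    ((\<lambda>z. qexp (f z)) has_field_derivative 2 * of_real pi * \<i> * f' * qexp (f z)) (at z within A)"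
  unfolding qexp_def by (auto intro!: derivative_eq_intros)

lemma holomorphic_qexp [holomorphic_intros]: "f holomorphic_on A \<Longrightarrow> (\<lambda>z. qexp (f z)) holomorphic_on A"
  unfolding qexp_def by (intro holomorphic_intros)

lemma continuous_on_qexp [continuous_intros]: "continuous_on A f \<Longrightarrow> continuous_on A (\<lambda>z. qexp (f z))"
  unfolding qexp_def by (intro continuous_intros)

text \<open>Differentiates an identity between two functions on an open set. The reflection formulas
  of higher order are obtained with it.\<close>

lemma has_field_derivative_eq_on_open:
  assumes "open S" "z \<in> S" "\<And>w. w \<in> S \<Longrightarrow> f w = g w"
    and "(f has_field_derivative f') (at z)" "(g has_field_derivative g') (at z)"
  shows "f' = g'"
  using has_field_derivative_transform_within_open[OF assms(4,1,2,3)] assms(5) DERIV_unique by blast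

lemma open_minus_Ints: "open (- \<int> :: complex set)"
  using closed_Ints open_Compl by blast

lemma Ints_1_minus_iff [simp]: "1 - z \<in> \<int> \<longleftrightarrow> z \<in> \<int>" for z :: complex
  using Ints_diff[of 1 z] Ints_diff[of 1 "1 - z"] by auto

lemma notin_nonpos_Ints: "z \<notin> \<int> \<Longrightarrow> z \<notin> \<int>\<^sub>\<le>\<^sub>0" for z :: complex
  using nonpos_Ints_subset_Ints by blast

section \<open>Reflection formulas and the sum of inverse fourth powers\<close>

text \<open>Logarithmic derivative of Euler's reflection formula for the Gamma function; the
  right-hand side is \<pi> cot(\<pi>z) in terms of q.\<close>

lemma Digamma_reflection:
  assumes z: "z \<notin> \<int>"
  shows "Digamma (1 - z) - Digamma z = of_real pi * \<i> * (qexp z + 1) / (qexp z - 1)"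
proof -
  have nz: "1 - z \<notin> \<int>\<^sub>\<le>\<^sub>0" "z \<notin> \<int>\<^sub>\<le>\<^sub>0"
    using z by (auto intro!: notin_nonpos_Ints)
  have sin: "sin (of_real pi * w) \<noteq> 0" if "w \<notin> \<int>" for w :: complex
    using that by (auto simp: sin_eq_0 mult.commute)
  have 1: "((\<lambda>z. Gamma z * Gamma (1 - z)) has_field_derivative
      Gamma z * Gamma (1 - z) * (Digamma z - Digamma (1 - z))) (at z)"
    using nz by (auto intro!: derivative_eq_intros simp: algebra_simps)
  have 2: "((\<lambda>z. of_real pi / sin (of_real pi * z)) has_field_derivative
      - (of_real pi / sin (of_real pi * z)) * (of_real pi * cos (of_real pi * z) / sin (of_real pi * z))) (at z)"
    using sin[OF z] by (auto intro!: derivative_eq_intros simp: field_simps power2_eq_square)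
  have "Gamma z * Gamma (1 - z) * (Digamma z - Digamma (1 - z)) =
     - (of_real pi / sin (of_real pi * z)) * (of_real pi * cos (of_real pi * z) / sin (of_real pi * z))"
    by (rule has_field_derivative_eq_on_open[OF open_minus_Ints _ _ 1 2])
      (use z Gamma_reflection_complex in auto)
  then have "(of_real pi / sin (of_real pi * z)) * (Digamma (1 - z) - Digamma z) =
      (of_real pi / sin (of_real pi * z)) * (of_real pi * cos (of_real pi * z) / sin (of_real pi * z))"
    by (simp add: Gamma_reflection_complex algebra_simps)
  then have "Digamma (1 - z) - Digamma z = of_real pi * cos (of_real pi * z) / sin (of_real pi * z)"
    using sin[OF z] by (subst (asm) mult_cancel_left) auto
  also have "\<dots> = of_real pi * \<i> * (qexp z + 1) / (qexp z - 1)"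
  proof -
    define E where "E = exp (\<i> * (of_real pi * z))"
    have E: "E \<noteq> 0" "qexp z = E\<^sup>2"
      by (simp_all add: E_def qexp_def mult_ac flip: exp_double)
    have "E\<^sup>2 \<noteq> 1"
      using z E by (simp flip: qexp_eq_1_iff)
    have cs: "cos (of_real pi * z) = (E\<^sup>2 + 1) / (2 * E)" "sin (of_real pi * z) = (E\<^sup>2 - 1) / (2 * \<i> * E)"
      by (simp_all add: E_def cos_exp_eq sin_exp_eq exp_minus field_simps power2_eq_square)
    show ?thesis
      unfolding cs E(2) using E \<open>E\<^sup>2 \<noteq> 1\<close> by (simp add: field_simps)
  qed
  finally show ?thesis .
qed

text \<open>In terms of \<open>u = 1/(q - 1)\<close> the derivatives of \<open>\<pi> cot \<pi>z\<close> are polynomials.\<close>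

definition invq :: "complex \<Rightarrow> complex" where
  "invq z = 1 / (qexp z - 1)"

text \<open>A Riccati equation, which is why differentiation does not leave the polynomials in
  u.\<close>

lemma DERIV_invq [derivative_intros]:
  assumes "z \<notin> \<int>"
  shows "(invq has_field_derivative - 2 * of_real pi * \<i> * (invq z + invq z ^ 2)) (at z)"
proof -
  have q: "qexp z \<noteq> 1"
    using assms by (simp add: qexp_eq_1_iff)
  have "(invq has_field_derivative - (2 * of_real pi * \<i> * 1 * qexp z) / ((qexp z - 1) * (qexp z - 1))) (at z)"
    unfolding invq_def using q by (auto intro!: derivative_eq_intros)
  moreover have "- (2 * of_real pi * \<i> * 1 * qexp z) / ((qexp z - 1) * (qexp z - 1)) =
      - 2 * of_real pi * \<i> * (invq z + invq z ^ 2)"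
    unfolding invq_def using q by (simp add: divide_simps power2_eq_square)
  ultimately show ?thesis
    by simp
qed

lemma Polygamma_reflection_1:
  assumes z: "z \<notin> \<int>"
  shows "Polygamma 1 z + Polygamma 1 (1 - z) = - 4 * of_real pi ^ 2 * (invq z + invq z ^ 2)"
proof -
  have nz: "1 - z \<notin> \<int>\<^sub>\<le>\<^sub>0" "z \<notin> \<int>\<^sub>\<le>\<^sub>0"
    using z by (auto intro!: notin_nonpos_Ints)
  have 1: "((\<lambda>z. Digamma (1 - z) - Digamma z) has_field_derivative - Polygamma 1 (1 - z) - Polygamma 1 z) (at z)"
    using nz by (auto intro!: derivative_eq_intros DERIV_chain2[OF has_field_derivative_Polygamma])
  have 2: "((\<lambda>z. of_real pi * \<i> * (1 + 2 * invq z)) has_field_derivative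
     4 * of_real pi ^ 2 * (invq z + invq z ^ 2)) (at z)"
    using z by (auto intro!: derivative_eq_intros simp: power2_eq_square algebra_simps)
  have "of_real pi * \<i> * (qexp w + 1) / (qexp w - 1) = of_real pi * \<i> * (1 + 2 * invq w)" if "w \<notin> \<int>" for w
    using that unfolding qexp_eq_1_iff [symmetric] invq_def by (simp add: field_simps)
  then have "- Polygamma 1 (1 - z) - Polygamma 1 z = 4 * of_real pi ^ 2 * (invq z + invq z ^ 2)"
    by (intro has_field_derivative_eq_on_open[OF open_minus_Ints _ _ 1 2]) (use z Digamma_reflection in auto)
  then have "- (- Polygamma 1 (1 - z) - Polygamma 1 z) = - (4 * of_real pi ^ 2 * (invq z + invq z ^ 2))"
    by (rule arg_cong)
  then show ?thesis
    by (simp only: minus_diff_eq diff_minus_eq_add mult_minus_left minus_mult_left [symmetric] minus_minus)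
qed

lemma Polygamma_reflection_2:
  assumes z: "z \<notin> \<int>"
  shows "Polygamma 2 z - Polygamma 2 (1 - z) = 8 * of_real pi ^ 3 * \<i> * (invq z + 3 * invq z ^ 2 + 2 * invq z ^ 3)"
proof -
  have nz: "1 - z \<notin> \<int>\<^sub>\<le>\<^sub>0" "z \<notin> \<int>\<^sub>\<le>\<^sub>0"
    using z by (auto intro!: notin_nonpos_Ints)
  have 1: "((\<lambda>z. Polygamma 1 z + Polygamma 1 (1 - z)) has_field_derivative Polygamma 2 z - Polygamma 2 (1 - z)) (at z)"
    using nz by (auto intro!: derivative_eq_intros DERIV_chain2[OF has_field_derivative_Polygamma] simp: numeral_2_eq_2)
  have 2: "((\<lambda>z. - 4 * of_real pi ^ 2 * (invq z + invq z ^ 2)) has_field_derivative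
     8 * of_real pi ^ 3 * \<i> * (invq z + 3 * invq z ^ 2 + 2 * invq z ^ 3)) (at z)"
    using z by (auto intro!: derivative_eq_intros simp: power2_eq_square power3_eq_cube algebra_simps)
  show ?thesis
    by (rule has_field_derivative_eq_on_open[OF open_minus_Ints _ _ 1 2]) (use z Polygamma_reflection_1 in auto)
qed

lemma Polygamma_reflection_3:
  assumes z: "z \<notin> \<int>"
  shows "Polygamma 3 z + Polygamma 3 (1 - z) =
    16 * of_real pi ^ 4 * (invq z + invq z ^ 2) * (1 + 6 * invq z + 6 * invq z ^ 2)"
proof -
  have nz: "1 - z \<notin> \<int>\<^sub>\<le>\<^sub>0" "z \<notin> \<int>\<^sub>\<le>\<^sub>0"
    using z by (auto intro!: notin_nonpos_Ints)
  have 1: "((\<lambda>z. Polygamma 2 z - Polygamma 2 (1 - z)) has_field_derivative Polygamma 3 z + Polygamma 3 (1 - z)) (at z)"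
    using nz by (auto intro!: derivative_eq_intros DERIV_chain2[OF has_field_derivative_Polygamma]
        simp: numeral_2_eq_2 numeral_3_eq_3)
  have 2: "((\<lambda>z. 8 * of_real pi ^ 3 * \<i> * (invq z + 3 * invq z ^ 2 + 2 * invq z ^ 3)) has_field_derivative
     16 * of_real pi ^ 4 * (invq z + invq z ^ 2) * (1 + 6 * invq z + 6 * invq z ^ 2)) (at z)"
    using z by (auto intro!: derivative_eq_intros simp: power2_eq_square power3_eq_cube power4_eq_xxxx algebra_simps)
  show ?thesis
    by (rule has_field_derivative_eq_on_open[OF open_minus_Ints _ _ 1 2]) (use z Polygamma_reflection_2 in auto)
qed

lemma half_notin_Ints: "(1 / 2 :: complex) \<notin> \<int>"
proof
  assume "(1 / 2 :: complex) \<in> \<int>"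
  then obtain n where "(1 / 2 :: complex) = of_int n"
    by (elim Ints_cases)
  then have "(1 :: complex) = of_int (2 * n)"
    by (simp add: field_simps)
  then have "1 = 2 * n"
    by (metis of_int_1 of_int_eq_iff)
  then show False
    by presburger
qed

lemma qexp_half: "qexp (1 / 2) = -1"
  by (simp add: qexp_def)

text \<open>At z = 1/2 one has q = -1 and u = -1/2, and the reflection formula of order 3 yields the
  sum over odd numbers, \<pi>^4/96. The even terms contribute 1/16 of the whole, whence Z =
  \<pi>^4/96 + Z/16.\<close>

lemma inverse_fourth_powers_sums:
  "(\<lambda>k. 1 / of_nat (Suc k) ^ 4) sums (of_real pi ^ 4 / 90 :: complex)"
proof -
  have "Polygamma 3 (1 / 2) = (of_real pi ^ 4 :: complex)"
    using Polygamma_reflection_3[OF half_notin_Ints] by (simp add: qexp_half invq_def power2_eq_square)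
  then have "(\<lambda>k. inverse ((1 / 2 + of_nat k) ^ 4)) sums (of_real pi ^ 4 / 6 :: complex)"
    using Polygamma_LIMSEQ[of "1 / 2 :: complex" 3] by (simp add: fact_numeral)
  then have "(\<lambda>k. inverse ((1 / 2 + of_nat k) ^ 4) / 16) sums (of_real pi ^ 4 / 6 / 16 :: complex)"
    by (rule sums_divide)
  also have "(\<lambda>k. inverse ((1 / 2 + of_nat k) ^ 4) / 16) = (\<lambda>k. 1 / of_nat (Suc (2 * k)) ^ 4 :: complex)"
  proof
    fix k
    have "(1 / 2 + of_nat k :: complex) = of_nat (Suc (2 * k)) / 2"
      by (simp add: field_simps)
    then show "inverse ((1 / 2 + of_nat k) ^ 4) / 16 = (1 / of_nat (Suc (2 * k)) ^ 4 :: complex)"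
      by (simp only: power_divide inverse_eq_divide) simp
  qed
  finally have odd: "(\<lambda>k. 1 / of_nat (Suc (2 * k)) ^ 4 :: complex) sums (of_real pi ^ 4 / 96)"
    by simp
  have "summable (\<lambda>k. inverse ((1 + of_nat k) ^ 4 :: complex))"
    using Polygamma_converges'[of "1 :: complex" 4] by simp
  then obtain Z where Z: "(\<lambda>k. 1 / of_nat (Suc k) ^ 4 :: complex) sums Z"
    by (auto simp: summable_def inverse_eq_divide)
  have "(\<lambda>k. \<Sum>n = k * 2..<k * 2 + 2. 1 / of_nat (Suc n) ^ 4 :: complex) sums Z"
    using sums_group[OF Z, of 2] by simp
  also have "(\<lambda>k. \<Sum>n = k * 2..<k * 2 + 2. 1 / of_nat (Suc n) ^ 4 :: complex) =
    (\<lambda>k. 1 / of_nat (Suc (2 * k)) ^ 4 + 1 / of_nat (Suc k) ^ 4 / 16)"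
  proof
    fix k
    have "{k * 2..<k * 2 + 2} = {2 * k, Suc (2 * k)}"
      by auto
    moreover have "(of_nat (Suc (Suc (2 * k))) :: complex) = 2 * of_nat (Suc k)"
      by simp
    then have "(1 / of_nat (Suc (Suc (2 * k))) ^ 4 :: complex) = 1 / of_nat (Suc k) ^ 4 / 16"
      by (simp only: power_mult_distrib) simp
    ultimately show "(\<Sum>n = k * 2..<k * 2 + 2. 1 / of_nat (Suc n) ^ 4 :: complex) =
        1 / of_nat (Suc (2 * k)) ^ 4 + 1 / of_nat (Suc k) ^ 4 / 16"
      by simp
  qed
  finally have "(\<lambda>k. 1 / of_nat (Suc (2 * k)) ^ 4 + 1 / of_nat (Suc k) ^ 4 / 16) sums Z" .
  moreover have "(\<lambda>k. 1 / of_nat (Suc (2 * k)) ^ 4 + 1 / of_nat (Suc k) ^ 4 / 16) sums (of_real pi ^ 4 / 96 + Z / 16)"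
    by (intro sums_add odd sums_divide Z)
  ultimately have "Z = of_real pi ^ 4 / 96 + Z / 16"
    by (rule sums_unique2)
  then have "Z = of_real pi ^ 4 / 90"
    by (simp add: field_simps)
  with Z show ?thesis
    by simp
qed

section \<open>Lipschitz's formula and Lambert series\<close>

definition powerfps :: "nat \<Rightarrow> complex fps" where
  "powerfps r = Abs_fps (\<lambda>k. of_nat k ^ r)"

lemma powerfps_Suc: "powerfps (Suc r) = fps_X * fps_deriv (powerfps r)"
  by (rule fps_ext) (auto simp: powerfps_def fps_X_mult_nth gr0_conv_Suc split: nat.splits)

lemma conv_radius_powerfps: "fps_conv_radius (powerfps r) \<ge> 1"
proof (induction r)
  case 0
  show ?case
    unfolding fps_conv_radius_def powerfps_def by (rule conv_radius_geI_ex') (simp add: summable_geometric)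
next
  case (Suc r)
  have "1 \<le> fps_conv_radius (fps_deriv (powerfps r))"
    using Suc fps_conv_radius_deriv[of "powerfps r"] by (rule order_trans)
  then show ?case
    using fps_conv_radius_mult[of fps_X "fps_deriv (powerfps r)"] by (simp add: powerfps_Suc min_def split: if_splits)
qed

lemma powerfps_radius [simp]: "norm (q :: complex) < 1 \<Longrightarrow> ereal (norm q) < fps_conv_radius (powerfps r)"
  using conv_radius_powerfps[of r] by (metis ereal_less(3) less_le_trans)

lemma summable_norm_powerfps:
  fixes q :: complex
  assumes "norm q < 1"
  shows "summable (\<lambda>k. real k ^ r * norm q ^ k)"
  using abs_summable_in_conv_radius[of q "fps_nth (powerfps r)"] powerfps_radius[OF assms, of r]
  by (simp add: fps_conv_radius_def powerfps_def norm_mult norm_power)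

lemma eval_powerfps_0: "norm q < 1 \<Longrightarrow> eval_fps (powerfps 0) q = 1 / (1 - q)"
  by (simp add: eval_fps_def powerfps_def suminf_geometric)

lemma eval_powerfps_Suc:
  assumes "norm q < 1" and "\<And>w. norm w < 1 \<Longrightarrow> eval_fps (powerfps r) w = f w"
    and "(f has_field_derivative D) (at q)"
  shows "eval_fps (powerfps (Suc r)) q = q * D"
proof -
  have r: "ereal (norm q) < fps_conv_radius (fps_deriv (powerfps r))"
    using powerfps_radius[OF assms(1), of r] fps_conv_radius_deriv[of "powerfps r"] by (rule less_le_trans)
  have "(eval_fps (powerfps r) has_field_derivative eval_fps (fps_deriv (powerfps r)) q) (at q)"
    by (rule has_field_derivative_eval_fps) (use assms in simp)
  then have "eval_fps (fps_deriv (powerfps r)) q = D"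
    by (rule has_field_derivative_eq_on_open[OF open_ball[of 0 1], rotated -2]) (use assms in auto)
  then show ?thesis
    using r by (simp add: powerfps_Suc eval_fps_mult)
qed

lemma eval_powerfps_1:
  assumes "norm q < 1"
  shows "eval_fps (powerfps 1) q = q / (1 - q) ^ 2"
proof -
  have "q \<noteq> 1"
    using assms by auto
  then have "((\<lambda>q. 1 / (1 - q)) has_field_derivative 1 / (1 - q) ^ 2) (at q)"
    by (auto intro!: derivative_eq_intros simp: power2_eq_square)
  from eval_powerfps_Suc[OF assms eval_powerfps_0 this] show ?thesis
    by simp
qed

text \<open>With v = 1/(1-q) one has v' = v^2 and q v = v - 1, so repeated application of q d/dq
  stays within the polynomials in v.\<close>

lemma eval_powerfps_3:
  assumes "norm q < 1"
  shows "eval_fps (powerfps 3) q = q * (1 + 4 * q + q ^ 2) / (1 - q) ^ 4"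
proof -
  define v where "v = (\<lambda>q :: complex. 1 / (1 - q))"
  have ne: "w \<noteq> 1" if "norm w < 1" for w :: complex
    using that by auto
  have v [derivative_intros]: "(v has_field_derivative v w ^ 2) (at w)" if "norm w < 1" for w
    unfolding v_def using ne[OF that] by (auto intro!: derivative_eq_intros simp: power2_eq_square)
  have qv: "w * v w = v w - 1" if "norm w < 1" for w
    unfolding v_def using ne[OF that] by (simp add: field_simps)
  have 1: "eval_fps (powerfps 1) w = v w ^ 2 - v w" if "norm w < 1" for w
  proof -
    have "v w ^ 2 - v w = v w * (w * v w)"
      unfolding qv[OF that] by (simp add: power2_eq_square algebra_simps)
    then show ?thesis
      unfolding eval_powerfps_1[OF that] by (simp add: v_def power2_eq_square)
  qed
  have 2: "eval_fps (powerfps 2) w = 2 * v w ^ 3 - 3 * v w ^ 2 + v w" if w: "norm w < 1" for w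
  proof -
    have "((\<lambda>w. v w ^ 2 - v w) has_field_derivative 2 * v w ^ 3 - v w ^ 2) (at w)"
      using w by (auto intro!: derivative_eq_intros simp: power2_eq_square power3_eq_cube)
    from eval_powerfps_Suc[OF w 1 this] have "eval_fps (powerfps 2) w = (w * v w) * (2 * v w ^ 2 - v w)"
      by (simp add: numeral_2_eq_2 power2_eq_square power3_eq_cube algebra_simps)
    then show ?thesis
      by (simp add: qv[OF w] power2_eq_square power3_eq_cube algebra_simps)
  qed
  have "((\<lambda>w. 2 * v w ^ 3 - 3 * v w ^ 2 + v w) has_field_derivative 6 * v q ^ 4 - 6 * v q ^ 3 + v q ^ 2) (at q)"
    using assms by (auto intro!: derivative_eq_intros simp: power2_eq_square power3_eq_cube power4_eq_xxxx)
  from eval_powerfps_Suc[OF assms 2 this]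
  have "eval_fps (powerfps 3) q = q * (6 * v q ^ 4 - 6 * v q ^ 3 + v q ^ 2)"
    by (simp add: numeral_3_eq_3)
  also have "6 * v q ^ 4 - 6 * v q ^ 3 + v q ^ 2 = v q ^ 4 * (6 - 6 * (1 - q) + (1 - q) ^ 2)"
  proof -
    define x where "x = 1 - q"
    have vx: "v q * x = 1"
      using ne[OF assms] by (simp add: v_def x_def)
    have "v q ^ 4 * (6 - 6 * x + x ^ 2) = 6 * v q ^ 4 - 6 * v q ^ 3 * (v q * x) + v q ^ 2 * (v q * x) ^ 2"
      by (simp add: power2_eq_square power3_eq_cube power4_eq_xxxx algebra_simps)
    then show ?thesis
      unfolding vx unfolding x_def by simp
  qed
  also have "6 - 6 * (1 - q) + (1 - q) ^ 2 = 1 + 4 * q + q ^ 2"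
    by (simp add: power2_eq_square algebra_simps)
  finally show ?thesis
    by (simp add: v_def power_one_over)
qed

lemma uhp_notin_Ints: "z \<in> upper_half_plane \<Longrightarrow> z \<notin> \<int>"
  by (auto simp: mem_uhp elim!: Ints_cases)

text \<open>Both sides are rational functions of q: the left one by the reflection formulas, the
  right one by the closed forms of the power series, which are available because |q| < 1.\<close>

lemma Polygamma_uhp:
  assumes "z \<in> upper_half_plane"
  shows "Polygamma 1 z + Polygamma 1 (1 - z) = - 4 * of_real pi ^ 2 * eval_fps (powerfps 1) (qexp z)"
    and "Polygamma 3 z + Polygamma 3 (1 - z) = 16 * of_real pi ^ 4 * eval_fps (powerfps 3) (qexp z)"
proof -
  have q: "norm (qexp z) < 1" "qexp z \<noteq> 1"
    using assms by (simp_all add: norm_qexp_less_1 qexp_eq_1_iff uhp_notin_Ints)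
  have u: "qexp z = (1 + invq z) / invq z" "invq z \<noteq> 0"
    using q by (simp_all add: invq_def field_simps)
  have q1: "1 - qexp z = - 1 / invq z"
    using q by (simp add: invq_def)
  have "invq z + invq z ^ 2 = qexp z / (1 - qexp z) ^ 2"
    unfolding q1 u(1) using u(2) by (simp add: power2_eq_square field_simps)
  moreover have "(invq z + invq z ^ 2) * (1 + 6 * invq z + 6 * invq z ^ 2) =
      qexp z * (1 + 4 * qexp z + qexp z ^ 2) / (1 - qexp z) ^ 4"
    unfolding q1 u(1) using u(2) by (simp add: power2_eq_square power4_eq_xxxx field_simps)
  ultimately show "Polygamma 1 z + Polygamma 1 (1 - z) = - 4 * of_real pi ^ 2 * eval_fps (powerfps 1) (qexp z)"
    "Polygamma 3 z + Polygamma 3 (1 - z) = 16 * of_real pi ^ 4 * eval_fps (powerfps 3) (qexp z)"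
    unfolding Polygamma_reflection_1[OF uhp_notin_Ints[OF assms]] Polygamma_reflection_3[OF uhp_notin_Ints[OF assms]]
      eval_powerfps_1[OF q(1)] eval_powerfps_3[OF q(1)]
    by (simp_all only: mult.assoc)
qed

no_notation Infinite_Set_Sum.abs_summable_on (infix "abs'_summable'_on" 50)

lemma has_sum_int_split:
  fixes f :: "int \<Rightarrow> 'a :: {real_normed_vector}"
  assumes "((\<lambda>k. f (int k + 1)) has_sum A) UNIV" "((\<lambda>k. f (- int k - 1)) has_sum B) UNIV"
  shows "(f has_sum (f 0 + A + B)) UNIV"
proof -
  have 1: "(f has_sum A) {1..}"
    using assms(1) by (subst has_sum_reindex_bij_witness[where S = "{1..}" and T = UNIV
        and j = "\<lambda>d. nat (d - 1)" and i = "\<lambda>k. int k + 1" and h = "\<lambda>k. f (int k + 1)"]) auto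
  have 2: "(f has_sum B) {..-1}"
    using assms(2) by (subst has_sum_reindex_bij_witness[where S = "{..-1}" and T = UNIV
        and j = "\<lambda>d. nat (- d - 1)" and i = "\<lambda>k. - int k - 1" and h = "\<lambda>k. f (- int k - 1)"]) auto
  have 0: "(f has_sum f 0) {0}"
    using has_sum_finite[of "{0}" f] by simp
  have "(f has_sum (f 0 + A)) ({0} \<union> {1..})"
    by (rule has_sum_Un_disjoint[OF 0 1]) auto
  then have "(f has_sum (f 0 + A + B)) (({0} \<union> {1..}) \<union> {..-1})"
    by (rule has_sum_Un_disjoint[OF _ 2]) auto
  moreover have "({0} \<union> {1..}) \<union> {..-1} = (UNIV :: int set)"
    by auto
  ultimately show ?thesis
    by simp
qed

lemma abs_summable_on_prod:
  fixes f :: "'a \<Rightarrow> 'c :: {real_normed_field, banach}"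
  assumes "f abs_summable_on A" "g abs_summable_on B"
  shows "(\<lambda>(x, y). f x * g y) abs_summable_on A \<times> B"
proof (rule Infinite_Sum.abs_summable_on_Sigma_iff[THEN iffD2], intro conjI ballI)
  show "(\<lambda>y. (case (x, y) of (x, y) \<Rightarrow> f x * g y)) abs_summable_on B" if "x \<in> A" for x
    using assms(2) by (simp add: norm_mult summable_on_cmult_right)
  have "(\<Sum>\<^sub>\<infinity>y\<in>B. norm (case (x, y) of (x, y) \<Rightarrow> f x * g y)) = norm (f x) * (\<Sum>\<^sub>\<infinity>y\<in>B. norm (g y))" for x
    by (simp add: norm_mult infsum_cmult_right')
  moreover have "0 \<le> (\<Sum>\<^sub>\<infinity>y\<in>B. norm (g y))"
    by (rule infsum_nonneg) simp
  ultimately show "(\<lambda>x. \<Sum>\<^sub>\<infinity>y\<in>B. norm (case (x, y) of (x, y) \<Rightarrow> f x * g y)) abs_summable_on A"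
    using assms(1) by (simp add: abs_mult summable_on_cmult_left)
qed

lemma summable_norm_Polygamma_terms:
  fixes z :: complex
  assumes "n \<ge> 1"
  shows "summable (\<lambda>k. norm (1 / (z + of_nat k) ^ Suc n))"
proof (rule summable_comparison_test_ev)
  show "summable (\<lambda>k. 2 ^ Suc n * inverse (real k ^ Suc n))"
    using assms by (intro summable_mult inverse_power_summable) simp
  show "\<forall>\<^sub>F k in sequentially. norm (norm (1 / (z + of_nat k) ^ Suc n)) \<le> 2 ^ Suc n * inverse (real k ^ Suc n)"
    using eventually_ge_at_top[of "nat \<lceil>2 * norm z\<rceil> + 1"]
  proof eventually_elim
    case (elim k)
    then have k: "real k \<ge> 2 * norm z" "k > 0"
      by linarith+
    have "real k = norm ((z + of_nat k) - z)"
      by simp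
    also have "\<dots> \<le> norm (z + of_nat k) + norm z"
      by (rule norm_triangle_ineq4)
    finally have le: "real k / 2 \<le> norm (z + of_nat k)"
      using k by simp
    have "1 / norm (z + of_nat k) ^ Suc n \<le> 1 / (real k / 2) ^ Suc n"
      using le k by (intro divide_left_mono power_mono mult_pos_pos zero_less_power) auto
    also have "\<dots> = 2 ^ Suc n * inverse (real k ^ Suc n)"
      by (simp add: power_divide field_simps)
    finally show ?case
      by (simp add: norm_divide norm_power del: power_Suc)
  qed
qed

lemma has_sum_Polygamma:
  fixes z :: complex
  assumes "n \<ge> 1" "z \<noteq> 0"
  shows "((\<lambda>k. 1 / (z + of_nat k) ^ Suc n) has_sum ((-1) ^ Suc n * Polygamma n z / fact n)) UNIV"
  using Polygamma_LIMSEQ[of z n] assms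
  by (intro norm_summable_imp_has_sum summable_norm_Polygamma_terms) (auto simp: inverse_eq_divide)

text \<open>The two halves of the integers give polygamma values at z and at 1 - z. For odd n the
  exponent n + 1 is even, so the sign of z + d is irrelevant and the factor (-1)^(n+1)
  disappears.\<close>

lemma has_sum_int_Polygamma:
  fixes z :: complex
  assumes z: "z \<notin> \<int>" and n: "n \<ge> 1" "odd n"
  shows "((\<lambda>d. 1 / (z + of_int d) ^ Suc n) has_sum ((Polygamma n z + Polygamma n (1 - z)) / fact n)) UNIV"
proof -
  have nz: "z \<noteq> 0" "1 - z \<noteq> 0"
    using z by auto
  have 1: "((\<lambda>d. 1 / (z + of_int d) ^ Suc n) has_sum (Polygamma n z / fact n)) {0..}"
    using has_sum_Polygamma[OF n(1) nz(1)] n(2)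
    by (subst has_sum_reindex_bij_witness[where S = "{0..}" and T = UNIV and i = int and j = nat
          and h = "\<lambda>k. 1 / (z + of_nat k) ^ Suc n"]) auto
  have aux: "(1 - z + of_nat (nat (- d - 1))) ^ Suc n = (z + of_int d) ^ Suc n" if "d \<le> -1" for d
  proof -
    have "of_nat (nat (- d - 1)) = (of_int (- d - 1) :: complex)"
      using that by simp
    then have eq: "1 - z + of_nat (nat (- d - 1)) = - (z + of_int d)"
      by simp
    show ?thesis
      unfolding eq using n(2) by (intro power_minus_even) simp
  qed
  have 2: "((\<lambda>d. 1 / (z + of_int d) ^ Suc n) has_sum (Polygamma n (1 - z) / fact n)) {..-1}"
    by (subst has_sum_reindex_bij_witness[where S = "{..-1}" and T = UNIV and i = "\<lambda>k. - int k - 1" and j = "\<lambda>d. nat (- d - 1)"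
          and h = "\<lambda>k. 1 / (1 - z + of_nat k) ^ Suc n"])
      (use aux has_sum_Polygamma[OF n(1) nz(2)] n(2) in \<open>simp_all del: power_Suc\<close>)
  have "((\<lambda>d. 1 / (z + of_int d) ^ Suc n) has_sum (Polygamma n z / fact n + Polygamma n (1 - z) / fact n)) ({0..} \<union> {..-1})"
    by (intro has_sum_Un_disjoint 1 2) auto
  moreover have "{0..} \<union> {..-1} = (UNIV :: int set)"
    by auto
  ultimately show ?thesis
    by (simp add: add_divide_distrib)
qed

text \<open>Lipschitz's formula for the exponents 2 and 4; the second constant is 16 \<pi>^4 /
  3!.\<close>

lemma has_sum_int_uhp:
  assumes "z \<in> upper_half_plane"
  shows "((\<lambda>d. 1 / (z + of_int d) ^ 2) has_sum (- 4 * of_real pi ^ 2 * eval_fps (powerfps 1) (qexp z))) UNIV"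
    and "((\<lambda>d. 1 / (z + of_int d) ^ 4) has_sum (8 / 3 * of_real pi ^ 4 * eval_fps (powerfps 3) (qexp z))) UNIV"
proof -
  have e: "Suc 1 = 2" "Suc 3 = 4" "fact 1 = (1 :: complex)" "fact 3 = (6 :: complex)"
    by (simp_all add: fact_numeral)
  have "((\<lambda>d. 1 / (z + of_int d) ^ Suc 1) has_sum ((Polygamma 1 z + Polygamma 1 (1 - z)) / fact 1)) UNIV"
    "((\<lambda>d. 1 / (z + of_int d) ^ Suc 3) has_sum ((Polygamma 3 z + Polygamma 3 (1 - z)) / fact 3)) UNIV"
    by (rule has_sum_int_Polygamma[OF uhp_notin_Ints[OF assms]]; simp)+
  then show "((\<lambda>d. 1 / (z + of_int d) ^ 2) has_sum (- 4 * of_real pi ^ 2 * eval_fps (powerfps 1) (qexp z))) UNIV"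
    "((\<lambda>d. 1 / (z + of_int d) ^ 4) has_sum (8 / 3 * of_real pi ^ 4 * eval_fps (powerfps 3) (qexp z))) UNIV"
    unfolding Polygamma_uhp[OF assms] e by (simp_all add: mult_ac)
qed

definition sigma :: "nat \<Rightarrow> nat \<Rightarrow> nat" where
  "sigma r n = (\<Sum>d | d dvd n. d ^ r)"

definition sigmafps :: "nat \<Rightarrow> complex fps" where
  "sigmafps r = Abs_fps (\<lambda>n. of_nat (sigma r n))"

lemma sigma_0 [simp]: "sigma r 0 = 0"
  by (simp add: sigma_def)

lemma eval_powerfps_sums:
  assumes "norm (q :: complex) < 1" "r > 0"
  shows "((\<lambda>k. of_nat (Suc k) ^ r * q ^ Suc k) has_sum eval_fps (powerfps r) q) UNIV"
proof (rule norm_summable_imp_has_sum)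
  show "summable (\<lambda>k. norm (of_nat (Suc k) ^ r * q ^ Suc k :: complex))"
    using summable_norm_powerfps[OF assms(1), of r, THEN summable_ignore_initial_segment, of 1]
    by (simp add: norm_mult norm_power del: of_nat_Suc power_Suc)
  have "(\<lambda>k. of_nat k ^ r * q ^ k) sums eval_fps (powerfps r) q"
    using sums_eval_fps[OF powerfps_radius[OF assms(1)], of r] unfolding powerfps_def fps_nth_Abs_fps .
  then show "(\<lambda>k. of_nat (Suc k) ^ r * q ^ Suc k) sums eval_fps (powerfps r) q"
    using assms(2) by (subst sums_Suc_iff) (simp add: zero_power)
qed

text \<open>The double series with terms (k+1)^r q^((c+1)(k+1)) converges absolutely. Grouping by
  the product (c+1)(k+1) gives the divisor sums, grouping by c gives the shape in which Lipschitz's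
  formula delivers the rows of a lattice sum.\<close>

lemma lambert_series:
  assumes q: "norm (q :: complex) < 1" and r: "r > 0"
  shows "(\<lambda>n. of_nat (sigma r n) * q ^ n) sums eval_fps (sigmafps r) q"
    and "((\<lambda>c. eval_fps (powerfps r) (q ^ Suc c)) has_sum eval_fps (sigmafps r) q) UNIV"
proof -
  define f :: "nat \<times> nat \<Rightarrow> complex" where "f = (\<lambda>(c, k). of_nat (Suc k) ^ r * q ^ (Suc c * Suc k))"
  have 1: "(\<lambda>c. norm q ^ c) abs_summable_on UNIV"
    using q by (intro norm_summable_imp_summable_on) (auto simp: norm_power intro!: summable_geometric)
  have 2: "(\<lambda>k. real (Suc k) ^ r * norm q ^ Suc k) abs_summable_on UNIV"
    using summable_norm_powerfps[OF q, of r, THEN summable_ignore_initial_segment, of 1]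
    by (intro norm_summable_imp_summable_on) (simp add: norm_mult norm_power del: of_nat_Suc power_Suc)
  have "f abs_summable_on UNIV \<times> UNIV"
  proof (rule Infinite_Sum.abs_summable_on_comparison_test[OF abs_summable_on_prod[OF 1 2]])
    fix x :: "nat \<times> nat" 
    obtain c k where x: "x = (c, k)"
      by (cases x)
    \<comment> \<open>(c+1)(k+1) \<ge> c+k+1, so the double series is dominated by a product of two
      single series.\<close>
    have "norm q ^ (Suc c * Suc k) \<le> norm q ^ (c + Suc k)"
      using q by (intro power_decreasing) auto
    then have "real (Suc k) ^ r * norm q ^ (Suc c * Suc k) \<le> real (Suc k) ^ r * norm q ^ (c + Suc k)"
      by (intro mult_left_mono) auto
    moreover have "norm (f x) = real (Suc k) ^ r * norm q ^ (Suc c * Suc k)"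
      by (simp add: x f_def norm_mult norm_power del: of_nat_Suc power_Suc mult_Suc mult_Suc_right)
    moreover have "norm (case x of (c, k) \<Rightarrow> norm q ^ c * (real (Suc k) ^ r * norm q ^ Suc k)) =
        real (Suc k) ^ r * norm q ^ (c + Suc k)"
      by (simp add: x power_add abs_mult mult_ac del: of_nat_Suc power_Suc add_Suc_right)
    ultimately show "norm (f x) \<le> norm (case x of (c, k) \<Rightarrow> norm q ^ c * (real (Suc k) ^ r * norm q ^ Suc k))"
      by simp
  qed
  then have "f summable_on UNIV \<times> UNIV"
    by (rule abs_summable_summable)
  then obtain S where S: "(f has_sum S) (UNIV \<times> UNIV)"
    by (auto simp: summable_on_def)
  have "((\<lambda>(n, d). of_nat d ^ r * q ^ n) has_sum S) (Sigma {1..} (\<lambda>n. {d. d dvd n}))"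
    using S
  proof (subst has_sum_reindex_bij_witness[where T = "UNIV \<times> UNIV" and i = "\<lambda>(c, k). (Suc c * Suc k, Suc k)"
        and j = "\<lambda>(n, d). (n div d - 1, d - 1)" and h = f], goal_cases)
    case (1 a)
    then obtain d e where "a = (d * e, d)" "d > 0" "e > 0"
      by (auto elim!: dvdE)
    moreover from this have "Suc (e - 1) * Suc (d - 1) = d * e"
      by simp
    ultimately show ?case
      by (simp del: mult_Suc mult_Suc_right)
  next
    case (3 b)
    then show ?case
      by (cases b) (simp del: mult_Suc mult_Suc_right)
  next
    case (4 b)
    obtain c k where "b = (c, k)"
      by (cases b)
    then show ?case
      using dvd_triv_right[of "Suc k" "Suc c"] by (simp del: mult_Suc mult_Suc_right)
  next
    case (5 a)
    then obtain d e where "a = (d * e, d)" "d > 0" "e > 0"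
      by (auto elim!: dvdE)
    moreover from this have "Suc (e - 1) * Suc (d - 1) = d * e"
      by simp
    ultimately show ?case
      by (simp add: f_def mult.commute del: power_Suc mult_Suc mult_Suc_right)
  qed auto
  then have "((\<lambda>n. \<Sum>d | d dvd n. of_nat d ^ r * q ^ n) has_sum S) {1..}"
    by (rule has_sum_SigmaD) (auto intro!: has_sum_finiteI)
  then have "((\<lambda>n. of_nat (sigma r n) * q ^ n) has_sum S) {1..}"
    by (simp add: sigma_def sum_distrib_right)
  then have "((\<lambda>n. of_nat (sigma r n) * q ^ n) has_sum S) UNIV"
    by (subst has_sum_cong_neutral[where T = UNIV and S = "{1..}" and g = "\<lambda>n. of_nat (sigma r n) * q ^ n", symmetric])
      (auto simp: not_less_eq_eq)
  then have sums: "(\<lambda>n. of_nat (sigma r n) * q ^ n) sums S"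
    by (rule has_sum_imp_sums)
  then have S_eq: "S = eval_fps (sigmafps r) q"
    by (simp add: eval_fps_def sigmafps_def sums_iff)
  with sums show "(\<lambda>n. of_nat (sigma r n) * q ^ n) sums eval_fps (sigmafps r) q"
    by simp
  have "((\<lambda>k. f (c, k)) has_sum eval_fps (powerfps r) (q ^ Suc c)) UNIV" for c
  proof -
    have "norm (q ^ Suc c) < 1"
      using q power_Suc_less_one[of "norm q" c] by (cases "q = 0") (simp_all add: norm_power norm_mult)
    then show ?thesis
      unfolding f_def prod.case power_mult using r by (rule eval_powerfps_sums)
  qed
  then show "((\<lambda>c. eval_fps (powerfps r) (q ^ Suc c)) has_sum eval_fps (sigmafps r) q) UNIV"
    using has_sum_SigmaD[OF S, of "\<lambda>c. eval_fps (powerfps r) (q ^ Suc c)"] by (simp add: S_eq)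
qed

lemma conv_radius_sigmafps:
  assumes "r > 0"
  shows "fps_conv_radius (sigmafps r) \<ge> 1"
  unfolding fps_conv_radius_def
proof (rule conv_radius_geI_ex')
  fix x :: real assume "0 < x" "ereal x < 1"
  then show "summable (\<lambda>n. fps_nth (sigmafps r) n * of_real x ^ n)"
    using lambert_series(1)[of "of_real x" r] assms by (simp add: sigmafps_def sums_iff)
qed

lemma sigmafps_radius [simp]:
  assumes "norm (q :: complex) < 1" "r > 0"
  shows "ereal (norm q) < fps_conv_radius (sigmafps r)"
  using conv_radius_sigmafps[OF assms(2)] assms(1) by (metis ereal_less(3) less_le_trans)

lemma E4_eq:
  assumes "z \<in> upper_half_plane"
  shows "E4 z = 1 + 240 * eval_fps (sigmafps 3) (qexp z)"
proof -
  have "(\<lambda>n. of_nat (sigma 3 n) * qexp z ^ n) sums eval_fps (sigmafps 3) (qexp z)"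
    using assms by (intro lambert_series) (simp_all add: norm_qexp_less_1)
  then have "(\<lambda>n. of_nat (sigma 3 (Suc n)) * qexp z ^ Suc n) sums eval_fps (sigmafps 3) (qexp z)"
    by (subst sums_Suc_iff) simp
  moreover have "exp (2 * of_real pi * \<i> * of_nat (Suc n) * z) = qexp z ^ Suc n" for n
    unfolding qexp_of_nat_mult [symmetric] by (simp add: qexp_def mult_ac)
  ultimately show ?thesis
    unfolding E4_def sigma3_def sigma_def by (simp only: sums_iff)
qed

section \<open>Lattice sums and the law of E_4\<close>

text \<open>The bound has product form so that the lattice sum can be compared with a product of
  one-dimensional sums. \<open>M\<close> comes from |cz+d|^2 = (cx+d)^2 + c^2 y^2, which gives c^2 +
  d^2 \<le> M |cz+d|^2; and (1+|c|)(1+|d|) \<le> 4(c^2+d^2) for integers not both zero.\<close>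

lemma lattice_bound:
  assumes "z \<in> upper_half_plane"
  obtains \<kappa> :: real where "\<kappa> > 0"
    "\<And>c d :: int. (c, d) \<noteq> (0, 0) \<Longrightarrow> \<kappa> * ((1 + \<bar>c\<bar>) * (1 + \<bar>d\<bar>)) \<le> (cmod (of_int c * z + of_int d))\<^sup>2"
proof (rule that)
  define y x where "y = Im z" and "x = Re z"
  have y: "y > 0"
    using assms by (simp add: mem_uhp y_def)
  define M where "M = 1 / y\<^sup>2 + 2 + 2 * x\<^sup>2 / y\<^sup>2"
  have M: "M > 0"
    using y unfolding M_def by (intro add_pos_nonneg add_pos_pos) auto
  show "1 / (4 * M) > 0"
    using M by simp
  fix c d :: int assume cd: "(c, d) \<noteq> (0, 0)"
  define C D where "C = real_of_int c" and "D = real_of_int d"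
  define N where "N = (cmod (of_int c * z + of_int d))\<^sup>2"
  have N: "N = (C * x + D)\<^sup>2 + C\<^sup>2 * y\<^sup>2"
    unfolding N_def cmod_power2 by (simp add: x_def y_def C_def D_def power_mult_distrib)
  have C: "C\<^sup>2 \<le> N / y\<^sup>2"
    using y by (simp add: N field_simps)
  have "D\<^sup>2 \<le> 2 * (C * x + D)\<^sup>2 + 2 * (C * x)\<^sup>2"
    using sum_squares_bound[of "C * x + D" "C * x"] zero_le_power2[of "2 * C * x + D"]
    by (simp add: power2_eq_square algebra_simps)
  also have "\<dots> \<le> 2 * N + 2 * (N / y\<^sup>2 * x\<^sup>2)"
  proof -
    have "(C * x + D)\<^sup>2 \<le> N"
      by (simp add: N)
    then show ?thesis
      using mult_right_mono[OF C, of "x\<^sup>2"] by (simp add: power_mult_distrib)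
  qed
  finally have "C\<^sup>2 + D\<^sup>2 \<le> N * M"
    using C by (simp add: M_def algebra_simps)
  have "\<bar>c\<bar> \<le> c\<^sup>2" "\<bar>d\<bar> \<le> d\<^sup>2"
    using self_le_power[of "\<bar>c\<bar>" 2] self_le_power[of "\<bar>d\<bar>" 2] by (cases "c = 0"; cases "d = 0"; simp)+
  moreover have "\<bar>c\<bar> * \<bar>d\<bar> \<le> c\<^sup>2 + d\<^sup>2"
  proof -
    have "0 \<le> (\<bar>c\<bar> - \<bar>d\<bar>)\<^sup>2" "0 \<le> \<bar>c\<bar> * \<bar>d\<bar>"
      by simp_all
    moreover have "(\<bar>c\<bar> - \<bar>d\<bar>)\<^sup>2 = c\<^sup>2 + d\<^sup>2 - 2 * (\<bar>c\<bar> * \<bar>d\<bar>)"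
      by (simp add: power2_diff)
    ultimately show ?thesis
      by linarith
  qed
  moreover have "1 \<le> c\<^sup>2 + d\<^sup>2"
  proof -
    have "0 < c\<^sup>2 + d\<^sup>2"
      using cd by (auto simp: sum_power2_gt_zero_iff)
    then show ?thesis
      by linarith
  qed
  ultimately have "(1 + \<bar>c\<bar>) * (1 + \<bar>d\<bar>) \<le> 4 * (c\<^sup>2 + d\<^sup>2)"
    by (simp add: algebra_simps)
  then have "real_of_int ((1 + \<bar>c\<bar>) * (1 + \<bar>d\<bar>)) \<le> real_of_int (4 * (c\<^sup>2 + d\<^sup>2))"
    unfolding of_int_le_iff .
  also have "\<dots> = 4 * (C\<^sup>2 + D\<^sup>2)"
    by (simp add: C_def D_def)
  also have "\<dots> \<le> 4 * (N * M)"
    using \<open>C\<^sup>2 + D\<^sup>2 \<le> N * M\<close> by simp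
  finally show "1 / (4 * M) * ((1 + \<bar>c\<bar>) * (1 + \<bar>d\<bar>)) \<le> (cmod (of_int c * z + of_int d))\<^sup>2"
    using M unfolding N_def [symmetric] by (simp add: field_simps)
qed

lemma summable_on_int_powr:
  assumes "s > 1"
  shows "(\<lambda>d :: int. (1 + real_of_int \<bar>d\<bar>) powr - s) summable_on UNIV"
proof -
  have "summable (\<lambda>k. real k powr - s)"
    using assms by (simp add: summable_real_powr_iff)
  then have "summable (\<lambda>k. real (k + 2) powr - s)"
    by (rule summable_ignore_initial_segment)
  then have "(\<lambda>k. real (k + 2) powr - s) summable_on UNIV"
    by (intro norm_summable_imp_summable_on) simp
  then obtain A where "((\<lambda>k. real (k + 2) powr - s) has_sum A) UNIV"
    by (auto simp: summable_on_def)
  then have "((\<lambda>d :: int. (1 + real_of_int \<bar>d\<bar>) powr - s) has_sum ((1 + real_of_int \<bar>0\<bar>) powr - s + A + A)) UNIV"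
    by (intro has_sum_int_split) (simp_all add: add_ac)
  then show ?thesis
    by (auto simp: summable_on_def)
qed

lemma lattice_summable:
  assumes z: "z \<in> upper_half_plane" and s: "s > 2"
  shows "(\<lambda>(c, d). cmod (of_int c * z + of_int d) powr - s) summable_on (UNIV :: (int \<times> int) set)"
proof -
  obtain \<kappa> :: real where \<kappa>: "\<kappa> > 0"
    "\<And>c d :: int. (c, d) \<noteq> (0, 0) \<Longrightarrow> \<kappa> * ((1 + \<bar>c\<bar>) * (1 + \<bar>d\<bar>)) \<le> (cmod (of_int c * z + of_int d))\<^sup>2"
    using lattice_bound[OF z] by blast
  define w where "w = (\<lambda>d :: int. (1 + real_of_int \<bar>d\<bar>) powr - (s / 2))"
  have w: "w abs_summable_on UNIV"
    using summable_on_int_powr[of "s / 2"] s by (simp add: w_def)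
  have "(\<lambda>(c, d). (\<kappa> powr - (s / 2) * w c) * w d) abs_summable_on UNIV \<times> UNIV"
    by (intro abs_summable_on_prod w) (use w in \<open>simp add: summable_on_cmult_right abs_mult\<close>)
  then have "(\<lambda>(c, d). cmod (of_int c * z + of_int d) powr - s) abs_summable_on UNIV \<times> UNIV"
  proof (rule Infinite_Sum.abs_summable_on_comparison_test)
    fix x :: "int \<times> int"
    obtain c d where x: "x = (c, d)"
      by (cases x)
    show "norm (case x of (c, d) \<Rightarrow> cmod (of_int c * z + of_int d) powr - s) \<le>
        norm (case x of (c, d) \<Rightarrow> \<kappa> powr - (s / 2) * w c * w d)"
    proof (cases "(c, d) = (0, 0)")
      case False
      have pos: "0 < \<kappa> * ((1 + real_of_int \<bar>c\<bar>) * (1 + real_of_int \<bar>d\<bar>))"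
        using \<kappa>(1) by simp
      define N where "N = (cmod (of_int c * z + of_int d))\<^sup>2"
      have le: "\<kappa> * ((1 + real_of_int \<bar>c\<bar>) * (1 + real_of_int \<bar>d\<bar>)) \<le> N"
        using \<kappa>(2)[OF False] by (simp add: N_def)
      have "cmod (of_int c * z + of_int d) powr - s = N powr - (s / 2)"
        by (simp add: N_def powr_powr flip: powr_numeral powr_half_sqrt)
      also have "\<dots> \<le> (\<kappa> * ((1 + real_of_int \<bar>c\<bar>) * (1 + real_of_int \<bar>d\<bar>))) powr - (s / 2)"
        using le pos s by (intro powr_mono2') auto
      also have "\<dots> = \<kappa> powr - (s / 2) * w c * w d"
        using \<kappa>(1) by (simp add: powr_mult w_def)
      finally show ?thesis
        by (simp add: x)
    qed (simp add: x)
  qed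
  then show ?thesis
    by (simp add: case_prod_unfold)
qed

text \<open>The sum runs over all pairs since the term at (0,0) is 1/0 = 0. Row 0 equals 2
  \<zeta>(4) = \<pi>^4/45. The rows c and -c agree and come from Lipschitz's formula; twice 8/3 is
  240/45, the normalization of E_4.\<close>

lemma Eisenstein_4:
  assumes z: "z \<in> upper_half_plane"
  shows "((\<lambda>(c, d). 1 / (of_int c * z + of_int d) ^ 4) has_sum (of_real pi ^ 4 / 45 * E4 z)) (UNIV :: (int \<times> int) set)"
proof -
  define f where "f = (\<lambda>(c :: int, d :: int). 1 / (of_int c * z + of_int d) ^ 4)"
  have "f abs_summable_on UNIV"
    using lattice_summable[OF z, of 4]
    by (rule summable_on_cong[THEN iffD1, rotated])
      (auto simp: f_def norm_divide norm_power powr_minus inverse_eq_divide powr_numeral)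
  then obtain S where S: "(f has_sum S) (UNIV \<times> UNIV)"
    using abs_summable_summable by (auto simp: summable_on_def)
  define row where "row c = (\<Sum>\<^sub>\<infinity>d. f (c, d))" for c
  have r: "((\<lambda>d. f (c, d)) has_sum row c) UNIV" for c
    unfolding row_def
    by (rule has_sum_infsum, rule summable_on_SigmaD1[where f = "\<lambda>c d. f (c, d)" and A = UNIV and B = "\<lambda>_. UNIV"])
      (use S in \<open>auto simp: summable_on_def\<close>)
  have row: "(row has_sum S) UNIV"
    by (rule has_sum_SigmaD[OF S]) (use r in auto)
  have "((\<lambda>k. 1 / of_nat (Suc k) ^ 4) has_sum (of_real pi ^ 4 / 90 :: complex)) UNIV"
    using summable_norm_Polygamma_terms[of 3 1] inverse_fourth_powers_sums
    by (intro norm_summable_imp_has_sum) (simp_all add: numeral_eq_Suc)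
  moreover have "f (0, int k + 1) = 1 / of_nat (Suc k) ^ 4" for k
    by (simp add: f_def add_ac)
  moreover have "f (0, - int k - 1) = 1 / of_nat (Suc k) ^ 4" for k
  proof -
    have eq: "of_int (- int k - 1) = - (of_nat (Suc k) :: complex)"
      by simp
    have "f (0, - int k - 1) = 1 / (of_int (- int k - 1)) ^ 4"
      by (simp add: f_def)
    also have "(of_int (- int k - 1)) ^ 4 = (of_nat (Suc k) :: complex) ^ 4"
      unfolding eq by (rule power_minus_even) simp
    finally show ?thesis .
  qed
  ultimately have "((\<lambda>d. f (0, d)) has_sum (f (0, 0) + of_real pi ^ 4 / 90 + of_real pi ^ 4 / 90)) UNIV"
    by (intro has_sum_int_split) simp_all
  then have row0: "row 0 = of_real pi ^ 4 / 45"
    using has_sum_unique[OF r] by (simp add: f_def)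
  define L where "L = (\<lambda>k. 8 / 3 * of_real pi ^ 4 * eval_fps (powerfps 3) (qexp z ^ Suc k))"
  have L: "row (int k + 1) = L k" "row (- int k - 1) = L k" for k
  proof -
    have "of_nat (Suc k) * z \<in> upper_half_plane"
      using z by (simp add: mem_uhp)
    then have *: "((\<lambda>d. 1 / (of_nat (Suc k) * z + of_int d) ^ 4) has_sum L k) UNIV"
      using has_sum_int_uhp(2)[of "of_nat (Suc k) * z"] by (simp add: L_def qexp_of_nat_mult del: of_nat_Suc power_Suc)
    then show "row (int k + 1) = L k"
      using has_sum_unique[OF r[of "int k + 1"]] by (simp add: f_def add_ac)
    have "((\<lambda>d. 1 / (of_nat (Suc k) * z + of_int (- d)) ^ 4) has_sum L k) UNIV"
      using * by (subst has_sum_reindex_bij_witness[where T = UNIV and i = uminus and j = uminus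
            and h = "\<lambda>d. 1 / (of_nat (Suc k) * z + of_int d) ^ 4"]) auto
    also have "(\<lambda>d. 1 / (of_nat (Suc k) * z + of_int (- d)) ^ 4) = (\<lambda>d. f (- int k - 1, d))"
    proof
      fix d
      show "1 / (of_nat (Suc k) * z + of_int (- d)) ^ 4 = f (- int k - 1, d)"
        using power_minus_even[of 4 "of_nat (Suc k) * z + of_int (- d)"] by (simp add: f_def algebra_simps)
    qed
    finally show "row (- int k - 1) = L k"
      using has_sum_unique[OF r[of "- int k - 1"]] by simp
  qed
  have "(L has_sum (8 / 3 * of_real pi ^ 4 * eval_fps (sigmafps 3) (qexp z))) UNIV" (is "(_ has_sum ?A) _")
    unfolding L_def using z by (intro has_sum_cmult_right lambert_series) (auto simp: norm_qexp_less_1)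
  then have "(row has_sum (row 0 + ?A + ?A)) UNIV"
    by (intro has_sum_int_split) (simp_all add: L)
  then have "S = row 0 + ?A + ?A"
    using row has_sum_unique by blast
  also have "\<dots> = of_real pi ^ 4 / 45 * E4 z"
    using z by (simp add: row0 E4_eq algebra_simps)
  finally have eq: "S = of_real pi ^ 4 / 45 * E4 z" .
  show ?thesis
    unfolding eq [symmetric] using S by (simp add: f_def)
qed

text \<open>The map (c,d) -> (-d,c) permutes the index set, and the unordered sum is unaffected; z^4
  arises from (-d)(-1/z) + c = (cz+d)/z.\<close>

theorem E4_inversion:
  assumes z: "z \<in> upper_half_plane"
  shows "E4 (- 1 / z) = z ^ 4 * E4 z"
proof -
  have z0: "z \<noteq> 0"
    using z by (auto simp: mem_uhp)
  have w: "- 1 / z \<in> upper_half_plane"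
    using lin_frac_in_uhp[OF inversion_in_SL2Z z] by simp
  have "((\<lambda>(c, d). z ^ 4 * (1 / (of_int c * z + of_int d) ^ 4)) has_sum (z ^ 4 * (of_real pi ^ 4 / 45 * E4 z)))
      (UNIV :: (int \<times> int) set)"
    using has_sum_cmult_right[OF Eisenstein_4[OF z], of "z ^ 4"] by (simp add: case_prod_unfold)
  also have "?this \<longleftrightarrow> ((\<lambda>(c, d). 1 / (of_int c * (- 1 / z) + of_int d) ^ 4) has_sum (z ^ 4 * (of_real pi ^ 4 / 45 * E4 z)))
      (UNIV :: (int \<times> int) set)"
  proof (rule has_sum_reindex_bij_witness[where j = "\<lambda>(c, d). (- d, c)" and i = "\<lambda>(c, d). (d, - c)"], goal_cases)
    case (5 a)
    obtain c d where a: "a = (c, d)"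
      by (cases a)
    have eq: "of_int (- d) * (- 1 / z) + of_int c = (of_int c * z + of_int d) / z"
      using z0 by (simp add: field_simps)
    show ?case
      unfolding a prod.case eq by (simp add: power_divide)
  qed auto
  finally have "of_real pi ^ 4 / 45 * E4 (- 1 / z) = z ^ 4 * (of_real pi ^ 4 / 45 * E4 z)"
    using Eisenstein_4[OF w] has_sum_unique by blast
  then show ?thesis
    by simp
qed

section \<open>E_2 and its defect of modularity\<close>

text \<open>The intervals are half-open because a sum of differences f(d) - f(d+1) over them
  collapses to the values at -N and N.\<close>

lemma has_sum_int_imp_tendsto:
  fixes f :: "int \<Rightarrow> 'a :: {topological_comm_monoid_add}"
  assumes "(f has_sum S) UNIV"
  shows "(\<lambda>N. \<Sum>d\<in>{- int N..<int N}. f d) \<longlonglongrightarrow> S"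
proof -
  have "filterlim (\<lambda>N. {- int N..<int N}) (finite_subsets_at_top UNIV) sequentially"
    unfolding filterlim_finite_subsets_at_top
  proof (intro allI impI)
    fix X :: "int set" assume X: "finite X \<and> X \<subseteq> UNIV"
    have "x \<le> Max (insert 0 (abs ` X))" if "x \<in> abs ` X" for x
      using X that by (intro Max_ge) auto
    then have *: "\<bar>x\<bar> \<le> Max (insert 0 (abs ` X))" if "x \<in> X" for x
      using that by blast
    show "\<forall>\<^sub>F N in sequentially. finite {- int N..<int N} \<and> X \<subseteq> {- int N..<int N} \<and> {- int N..<int N} \<subseteq> UNIV"
      using eventually_gt_at_top[of "nat (Max (insert 0 (abs ` X)))"]
    proof eventually_elim
      case (elim N)
      have "\<bar>x\<bar> < int N" if "x \<in> X" for x
        using *[OF that] elim by linarith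
      then show ?case
        by (fastforce simp: abs_less_iff)
    qed
  qed
  then show ?thesis
    using assms unfolding has_sum_def by (rule filterlim_compose[rotated])
qed

lemma sum_int_telescope:
  fixes f :: "int \<Rightarrow> 'a :: ab_group_add"
  shows "(\<Sum>d\<in>{- int N..<int N}. f d - f (d + 1)) = f (- int N) - f (int N)"
proof (induction N)
  case (Suc N)
  have "{- int (Suc N)..<int (Suc N)} = insert (- int (Suc N)) (insert (int N) {- int N..<int N})"
    by auto
  then show ?case
    using Suc by (simp add: add.commute)
qed simp

definition E2 :: "complex \<Rightarrow> complex" where
  "E2 z = 1 - 24 * eval_fps (sigmafps 1) (qexp z)"

lemma Polygamma_1_1: "Polygamma 1 1 = (of_real pi ^ 2 / 6 :: complex)"
proof -
  have "(\<lambda>k. 1 / (1 + of_nat k) ^ Suc 1) sums ((-1) ^ Suc 1 * Polygamma 1 1 / fact 1 :: complex)"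
    using has_sum_Polygamma[of 1 "1 :: complex"] by (intro has_sum_imp_sums) simp
  then have "(\<lambda>k. 1 / (1 + of_nat k) ^ 2) sums (Polygamma 1 1 :: complex)"
    by (simp add: numeral_2_eq_2)
  moreover have "(\<lambda>k. of_real (1 / (1 + real k) ^ 2)) sums (of_real (pi\<^sup>2 / 6) :: complex)"
    using inverse_squares_sums by (subst sums_of_real_iff) (simp add: add.commute)
  then have "(\<lambda>k. 1 / (1 + of_nat k) ^ 2) sums (of_real pi ^ 2 / 6 :: complex)"
    by simp
  ultimately show ?thesis
    by (rule sums_unique2)
qed

lemma Digamma_diff_sums:
  fixes w :: complex
  assumes "1 + w \<noteq> 0" "1 - w \<noteq> 0"
  shows "(\<lambda>k. 1 / (1 + w + of_nat k) - 1 / (1 - w + of_nat k)) sums (Digamma (1 - w) - Digamma (1 + w))"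
proof -
  have "(\<lambda>k. inverse (of_nat (Suc k)) - inverse (u + of_nat k)) sums (Digamma u + euler_mascheroni)" if "u \<noteq> 0" for u :: complex
    using summable_Digamma[OF that] by (simp add: Digamma_def summable_sums)
  from sums_diff[OF this[OF assms(2)] this[OF assms(1)]] show ?thesis
    by (simp add: inverse_eq_divide)
qed

lemma tendsto_inverse_of_nat_shift: "(\<lambda>N. 1 / (a + of_nat N :: complex)) \<longlonglongrightarrow> 0"
  by (rule tendsto_divide_0[OF tendsto_const tendsto_add_filterlim_at_infinity[OF tendsto_const tendsto_of_nat]])

context
  fixes z :: complex
  assumes z: "z \<in> upper_half_plane"
begin

text \<open>The lattice sum of weight 2 is only conditionally convergent. Here the rows c and -c
  with c = k + 1 are paired, and from each 1/w^2 the telescoping difference 1/w - 1/(w+1) is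
  subtracted. What is left, 1/(w^2 (w+1)), is absolutely summable, so rows and columns may be
  interchanged. The telescoping part disappears along rows but not in the sum over columns, and that
  is the defect of modularity of \<open>E2\<close>.\<close>

definition eis_term :: "nat \<Rightarrow> int \<Rightarrow> complex" where
  "eis_term k d = (1 / (of_nat (Suc k) * z + of_int d) ^ 2 + 1 / (of_int d - of_nat (Suc k) * z) ^ 2) -
     ((1 / (of_nat (Suc k) * z + of_int d) + 1 / (of_int d - of_nat (Suc k) * z)) -
      (1 / (of_nat (Suc k) * z + of_int (d + 1)) + 1 / (of_int (d + 1) - of_nat (Suc k) * z)))"

lemma z_nonzero: "z \<noteq> 0" and Im_z: "Im z > 0"
  using z by (auto simp: mem_uhp)

lemma eis_term_bound:
  fixes w :: complex
  assumes "Im z \<le> \<bar>Im w\<bar>"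
  shows "norm (1 / w ^ 2 - (1 / w - 1 / (w + 1))) \<le> (1 + 1 / Im z) * norm w powr - 3"
proof -
  have w: "norm w > 0" "norm (w + 1) \<ge> Im z"
    using assms Im_z abs_Im_le_cmod[of "w + 1"] by auto
  then have w': "w \<noteq> 0" "w + 1 \<noteq> 0"
    using Im_z by auto
  have "norm w \<le> norm (w + 1) + 1"
    using norm_triangle_ineq4[of "w + 1" 1] by simp
  also have "\<dots> \<le> norm (w + 1) * (1 + 1 / Im z)"
    using w Im_z by (simp add: field_simps)
  finally have "norm w / norm (w + 1) \<le> 1 + 1 / Im z"
    using w' by (simp add: divide_le_eq mult.commute)
  have "1 / w ^ 2 - (1 / w - 1 / (w + 1)) = 1 / (w ^ 2 * (w + 1))"
    using w' by (simp add: divide_simps power2_eq_square)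
  then have "norm (1 / w ^ 2 - (1 / w - 1 / (w + 1))) = norm (1 / (w ^ 2 * (w + 1)))"
    by (simp only:)
  also have "\<dots> = (norm w / norm (w + 1)) * (1 / norm w ^ 3)"
  proof -
    have "norm (1 / (w ^ 2 * (w + 1))) = 1 / (norm w ^ 2 * norm (w + 1))"
      by (simp add: norm_divide norm_mult norm_power)
    also have "\<dots> = (norm w / norm (w + 1)) * (1 / norm w ^ 3)"
      using w(1) by (simp add: divide_simps power2_eq_square power3_eq_cube)
    finally show ?thesis .
  qed
  also have "\<dots> = (norm w / norm (w + 1)) * norm w powr - 3"
    using w by (simp add: powr_minus powr_numeral inverse_eq_divide)
  also have "\<dots> \<le> (1 + 1 / Im z) * norm w powr - 3"
    using \<open>norm w / norm (w + 1) \<le> 1 + 1 / Im z\<close> by (intro mult_right_mono) auto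
  finally show ?thesis .
qed

lemma eis_term_summable: "(\<lambda>(k, d). eis_term k d) summable_on UNIV \<times> UNIV"
proof -
  define g where "g = (\<lambda>(c :: int, d :: int). cmod (of_int c * z + of_int d) powr - 3)"
  have g: "g summable_on UNIV"
    unfolding g_def by (rule lattice_summable[OF z]) simp
  have 1: "(\<lambda>(k, d). g (int (Suc k), d)) summable_on UNIV \<times> UNIV"
  proof -
    have "inj (\<lambda>(k, d :: int). (int (Suc k), d))"
      by (auto simp: inj_on_def)
    then have "g \<circ> (\<lambda>(k, d). (int (Suc k), d)) summable_on UNIV"
      by (subst summable_on_reindex [symmetric]) (auto intro: summable_on_subset[OF g])
    then show ?thesis
      by (simp add: o_def case_prod_unfold)
  qed
  have 2: "(\<lambda>(k, d). g (- int (Suc k), d)) summable_on UNIV \<times> UNIV"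
  proof -
    have "inj (\<lambda>(k, d :: int). (- int (Suc k), d))"
      by (auto simp: inj_on_def)
    then have "g \<circ> (\<lambda>(k, d). (- int (Suc k), d)) summable_on UNIV"
      by (subst summable_on_reindex [symmetric]) (auto intro: summable_on_subset[OF g])
    then show ?thesis
      by (simp add: o_def case_prod_unfold)
  qed
  have "(\<lambda>x. (1 + 1 / Im z) * ((\<lambda>(k, d). g (int (Suc k), d)) x + (\<lambda>(k, d). g (- int (Suc k), d)) x)) summable_on UNIV \<times> UNIV"
    by (intro summable_on_cmult_right summable_on_add 1 2)
  then have "(\<lambda>(k, d). eis_term k d) abs_summable_on UNIV \<times> UNIV"
  proof (rule summable_on_comparison_test)
    fix x :: "nat \<times> int"
    obtain k d where x: "x = (k, d)"
      by (cases x)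
    define a where "a = of_nat (Suc k) * z + of_int d"
    define b where "b = of_int d - of_nat (Suc k) * z"
    have "Im z \<le> \<bar>Im a\<bar>" "Im z \<le> \<bar>Im b\<bar>"
    proof -
      have "Im a = Im z + Im z * real k" "Im b = - (Im z + Im z * real k)"
        by (simp_all add: a_def b_def algebra_simps)
      moreover have "0 \<le> Im z * real k"
        using Im_z by simp
      ultimately show "Im z \<le> \<bar>Im a\<bar>" "Im z \<le> \<bar>Im b\<bar>"
        using Im_z by linarith+
    qed
    note bounds = this[THEN eis_term_bound]
    have "eis_term k d = (1 / a ^ 2 - (1 / a - 1 / (a + 1))) + (1 / b ^ 2 - (1 / b - 1 / (b + 1)))"
      by (simp add: eis_term_def a_def b_def algebra_simps)
    then have "norm (eis_term k d) \<le> norm (1 / a ^ 2 - (1 / a - 1 / (a + 1))) + norm (1 / b ^ 2 - (1 / b - 1 / (b + 1)))"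
      by (simp only: norm_triangle_ineq)
    also have "\<dots> \<le> (1 + 1 / Im z) * norm a powr - 3 + (1 + 1 / Im z) * norm b powr - 3"
      by (intro add_mono bounds)
    also have "\<dots> = (1 + 1 / Im z) * (g (int (Suc k), d) + g (- int (Suc k), d))"
      by (simp add: g_def a_def b_def algebra_simps)
    finally show "norm (case x of (k, d) \<Rightarrow> eis_term k d) \<le>
        (1 + 1 / Im z) * ((\<lambda>(k, d). g (int (Suc k), d)) x + (\<lambda>(k, d). g (- int (Suc k), d)) x)"
      by (simp add: x)
  qed auto
  then show ?thesis
    by (rule abs_summable_summable)
qed

text \<open>Along a row the subtracted terms collapse to B(-N) - B(N), which tends to 0. What
  remains is Lipschitz's formula, once for each of the two paired rows.\<close>

lemma eis_term_row:
  "((\<lambda>d. eis_term k d) has_sum (- 8 * of_real pi ^ 2 * eval_fps (powerfps 1) (qexp z ^ Suc k))) UNIV"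
proof -
  define L where "L = - 4 * of_real pi ^ 2 * eval_fps (powerfps 1) (qexp z ^ Suc k)"
  define w where "w = of_nat (Suc k) * z"
  have w: "w \<in> upper_half_plane"
    using Im_z by (simp add: w_def mem_uhp)
  define B where "B d = 1 / (w + of_int d) + 1 / (of_int d - w)" for d
  have "eis_term k summable_on UNIV"
    by (rule summable_on_SigmaD1[OF eis_term_summable]) simp
  then obtain S where S: "(eis_term k has_sum S) UNIV"
    by (auto simp: summable_on_def)
  have L: "((\<lambda>d. 1 / (w + of_int d) ^ 2) has_sum L) UNIV"
    using has_sum_int_uhp(1)[OF w] by (simp add: L_def w_def qexp_of_nat_mult del: of_nat_Suc power_Suc)
  have "((\<lambda>d. 1 / (of_int d - w) ^ 2) has_sum L) UNIV"
    using L
  proof (subst has_sum_reindex_bij_witness[where T = UNIV and i = uminus and j = uminus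
            and h = "\<lambda>d. 1 / (w + of_int d) ^ 2"])
    show "1 / (w + of_int (- d)) ^ 2 = 1 / (of_int d - w) ^ 2" for d
      by (simp add: power2_commute)
  qed auto
  from has_sum_int_imp_tendsto[OF has_sum_add[OF L this]]
  have "(\<lambda>N. (\<Sum>d\<in>{- int N..<int N}. 1 / (w + of_int d) ^ 2 + 1 / (of_int d - w) ^ 2) - (B (- int N) - B (int N)))
      \<longlonglongrightarrow> (L + L) - (0 - 0)"
  proof (intro tendsto_diff)
    have "(\<lambda>N. 1 / (w + of_nat N) - 1 / (- w + of_nat N)) \<longlonglongrightarrow> 0 - 0" "(\<lambda>N. 1 / (w + of_nat N) + 1 / (- w + of_nat N)) \<longlonglongrightarrow> 0 + 0"
      by (intro tendsto_intros tendsto_inverse_of_nat_shift)+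
    moreover have "(\<lambda>N. B (int N)) = (\<lambda>N. 1 / (w + of_nat N) + 1 / (- w + of_nat N))"
      by (simp add: B_def)
    moreover have "(\<lambda>N. B (- int N)) = (\<lambda>N. - (1 / (w + of_nat N) + 1 / (- w + of_nat N)))"
    proof
      fix N
      have "w - of_nat N = - (- w + of_nat N)" "- of_nat N - w = - (w + of_nat N)"
        by simp_all
      then show "B (- int N) = - (1 / (w + of_nat N) + 1 / (- w + of_nat N))"
        unfolding B_def by (simp only: of_int_minus of_int_of_nat_eq add_uminus_conv_diff minus_divide_right[symmetric]) simp
    qed
    ultimately show "(\<lambda>N. B (- int N)) \<longlonglongrightarrow> 0" "(\<lambda>N. B (int N)) \<longlonglongrightarrow> 0"
      using tendsto_minus[of "\<lambda>N. 1 / (w + of_nat N) + 1 / (- w + of_nat N)" 0] by auto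
  qed
  also have "(\<lambda>N. (\<Sum>d\<in>{- int N..<int N}. 1 / (w + of_int d) ^ 2 + 1 / (of_int d - w) ^ 2) - (B (- int N) - B (int N))) =
      (\<lambda>N. \<Sum>d\<in>{- int N..<int N}. eis_term k d)"
  proof -
    have tele: "B (- int N) - B (int N) = (\<Sum>d\<in>{- int N..<int N}. B d - B (d + 1))" for N
      by (rule sum_int_telescope [symmetric])
    show ?thesis
      unfolding tele unfolding sum_subtractf [symmetric] unfolding eis_term_def B_def w_def ..
  qed
  finally have "S = L + L"
    using has_sum_int_imp_tendsto[OF S] LIMSEQ_unique by force
  then have "S = - 8 * of_real pi ^ 2 * eval_fps (powerfps 1) (qexp z ^ Suc k)"
    by (simp add: L_def)
  with S show ?thesis
    by (simp only:)
qed

text \<open>Column sums at fixed d with powers of z taken out: \<open>mcol\<close> from the squares,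
  \<open>bcol\<close> from the telescoping part. The arguments are 1 \<plusminus> d/z because the
  row index starts at 1.\<close>

definition mcol :: "int \<Rightarrow> complex" where
  "mcol d = Polygamma 1 (1 + of_int d / z) + Polygamma 1 (1 - of_int d / z)"

definition bcol :: "int \<Rightarrow> complex" where
  "bcol d = (Digamma (1 - of_int d / z) - Digamma (1 + of_int d / z)) / z"

lemma one_pm_nonzero: "1 + of_int d / z \<noteq> 0" "1 - of_int d / z \<noteq> 0"
proof -
  have "z + of_int d \<noteq> 0" "z - of_int d \<noteq> 0"
    using Im_z by (auto simp: complex_eq_iff)
  then show "1 + of_int d / z \<noteq> 0" "1 - of_int d / z \<noteq> 0"
    using z_nonzero by (simp_all add: field_simps add_eq_0_iff)
qed

lemma eis_term_col: "(\<lambda>k. eis_term k d) sums (mcol d / z ^ 2 - (bcol d - bcol (d + 1)))"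
proof -
  define w where "w d = of_int d / z" for d
  have e: "of_nat (Suc k) * z + of_int d = z * (1 + w d + of_nat k)"
     "of_int d - of_nat (Suc k) * z = - z * (1 - w d + of_nat k)" for k d
    using z_nonzero by (simp_all add: w_def field_simps)
  have "(\<lambda>k. 1 / (1 + w d + of_nat k) ^ 2) sums Polygamma 1 (1 + w d)" "(\<lambda>k. 1 / (1 - w d + of_nat k) ^ 2) sums Polygamma 1 (1 - w d)" for d
    using has_sum_Polygamma[of 1, OF _ one_pm_nonzero(1)[of d]] has_sum_Polygamma[of 1, OF _ one_pm_nonzero(2)[of d]]
    by (auto intro!: has_sum_imp_sums simp: numeral_2_eq_2 w_def)
  from sums_divide[OF sums_add[OF this], where c = "z ^ 2"]
  have 1: "(\<lambda>k. 1 / (of_nat (Suc k) * z + of_int d) ^ 2 + 1 / (of_int d - of_nat (Suc k) * z) ^ 2) sums (mcol d / z ^ 2)"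
    unfolding e mcol_def w_def by (simp add: power_mult_distrib add_divide_distrib mult.commute)
  have 2: "(\<lambda>k. 1 / (of_nat (Suc k) * z + of_int d) + 1 / (of_int d - of_nat (Suc k) * z)) sums bcol d" for d
    using sums_divide[OF Digamma_diff_sums[OF one_pm_nonzero[of d]], where c = z]
    unfolding e bcol_def w_def by (simp add: diff_divide_distrib mult.commute)
  show ?thesis
    unfolding eis_term_def by (intro sums_diff 1 2)
qed

lemma of_nat_inverse_uhp: "of_nat (Suc k) * (- 1 / z) \<in> upper_half_plane"
proof -
  have "- 1 / z \<in> upper_half_plane"
    using lin_frac_in_uhp[OF inversion_in_SL2Z z] by simp
  then show ?thesis
    unfolding mem_uhp times_complex.sel by (simp add: mult_pos_neg del: of_nat_Suc)
qed

text \<open>v = (k+1)(-1/z) lies in the upper half-plane, so the formula for the arguments v and 1 -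
  v applies. Shifting 1 + v to v costs 1/v^2, which accounts for the row 0 that the column does not
  contain.\<close>

lemma mcol_Suc:
  "mcol (int k + 1) = - 4 * of_real pi ^ 2 * eval_fps (powerfps 1) (qexp (- 1 / z) ^ Suc k) - z ^ 2 * (1 / of_nat (Suc k) ^ 2)"
  "mcol (- int k - 1) = mcol (int k + 1)"
proof -
  define v where "v = of_nat (Suc k) * (- 1 / z)"
  have v: "v \<in> upper_half_plane" "v \<noteq> 0"
    using of_nat_inverse_uhp[of k] by (auto simp: v_def mem_uhp)
  have d: "of_int (int k + 1) / z = - v" "of_int (- int k - 1) / z = v"
    using z_nonzero by (simp_all add: v_def field_simps)
  have "mcol (int k + 1) = Polygamma 1 (v + 1) + Polygamma 1 (1 - v)"
    unfolding mcol_def d by (simp add: add.commute)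
  also have "\<dots> = Polygamma 1 v + Polygamma 1 (1 - v) - 1 / v ^ 2"
    using Polygamma_plus1[OF v(2), of 1] by (simp add: power2_eq_square)
  also have "\<dots> = - 4 * of_real pi ^ 2 * eval_fps (powerfps 1) (qexp v) - 1 / v ^ 2"
    by (simp only: Polygamma_uhp(1)[OF v(1)])
  also have "qexp v = qexp (- 1 / z) ^ Suc k"
    unfolding v_def by (rule qexp_of_nat_mult)
  also have "1 / v ^ 2 = z ^ 2 * (1 / of_nat (Suc k) ^ 2)"
    unfolding v_def by (simp add: power_mult_distrib power_divide del: of_nat_Suc)
  finally show "mcol (int k + 1) = - 4 * of_real pi ^ 2 * eval_fps (powerfps 1) (qexp (- 1 / z) ^ Suc k) - z ^ 2 * (1 / of_nat (Suc k) ^ 2)" .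
  show "mcol (- int k - 1) = mcol (int k + 1)"
    unfolding mcol_def d by (simp add: add.commute)
qed

lemma mcol_has_sum:
  "(mcol has_sum (of_real pi ^ 2 / 3 + 2 * (- 4 * of_real pi ^ 2 * eval_fps (sigmafps 1) (qexp (- 1 / z)) - z ^ 2 * (of_real pi ^ 2 / 6)))) UNIV"
proof -
  have "norm (qexp (- 1 / z)) < 1"
    using of_nat_inverse_uhp[of 0] by (intro norm_qexp_less_1) simp
  then have 1: "((\<lambda>k. eval_fps (powerfps 1) (qexp (- 1 / z) ^ Suc k)) has_sum eval_fps (sigmafps 1) (qexp (- 1 / z))) UNIV"
    by (intro lambert_series) auto
  have 2: "((\<lambda>k. 1 / of_nat (Suc k) ^ 2) has_sum (of_real pi ^ 2 / 6 :: complex)) UNIV"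
    unfolding Polygamma_1_1 [symmetric] using has_sum_Polygamma[of 1 "1 :: complex"] by (simp add: numeral_2_eq_2)
  have 3: "((\<lambda>k. mcol (int k + 1)) has_sum (- 4 * of_real pi ^ 2 * eval_fps (sigmafps 1) (qexp (- 1 / z)) - z ^ 2 * (of_real pi ^ 2 / 6))) UNIV"
    unfolding mcol_Suc(1) diff_conv_add_uminus minus_mult_left
    by (intro has_sum_add has_sum_cmult_right 1 2)
  have "mcol 0 = of_real pi ^ 2 / 3"
    by (simp add: mcol_def Polygamma_1_1[unfolded One_nat_def])
  with has_sum_int_split[of mcol, OF 3, unfolded mcol_Suc(2), OF 3] show ?thesis
    by (simp add: algebra_simps)
qed

text \<open>For d = N the value is \<pi> cot(\<pi>N/z)/z up to a term tending to 0. As N/z moves off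
  to infinity in the lower half-plane, the cotangent tends to i. This nonzero limit is the origin of
  6i/(\<pi>z).\<close>

lemma bcol_limit: "(\<lambda>N. bcol (int N)) \<longlonglongrightarrow> of_real pi * \<i> / z"
proof -
  define u where "u = qexp (- 1 / z)"
  have u: "norm u < 1"
    unfolding u_def using of_nat_inverse_uhp[of 0] by (intro norm_qexp_less_1) simp
  have "(\<lambda>N. (of_real pi * \<i> * ((1 + u ^ N) / (1 - u ^ N)) - z * (1 / (0 + of_nat N))) / z) \<longlonglongrightarrow>
      (of_real pi * \<i> * ((1 + 0) / (1 - 0)) - z * 0) / z"
    using u z_nonzero by (intro tendsto_intros tendsto_inverse_of_nat_shift LIMSEQ_power_zero) auto
  also have "?this \<longleftrightarrow> ?thesis"
  proof (intro filterlim_cong eventually_mono[OF eventually_gt_at_top[of 0]])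
    fix N :: nat assume "N > 0"
    then obtain k where k: "N = Suc k"
      by (cases N) auto
    define w where "w = of_int (int N) / z"
    have v: "- w \<in> upper_half_plane"
      using of_nat_inverse_uhp[of k] by (simp add: w_def k)
    then have w: "w \<notin> \<int>" "w \<noteq> 0"
      using uhp_notin_Ints[OF v] by auto
    have "qexp (- w) = u ^ N"
      using qexp_of_nat_mult[of N "- 1 / z"] by (simp add: w_def u_def)
    then have q: "qexp w = 1 / u ^ N"
      using qexp_uminus[of "- w"] by (simp add: divide_inverse)
    have "u \<noteq> 0"
      by (simp add: u_def)
    then have "u ^ N \<noteq> 0" "u ^ N \<noteq> 1"
      using v \<open>qexp (- w) = u ^ N\<close> uhp_notin_Ints[OF v] qexp_eq_1_iff[of "- w"] by auto
    then have "(qexp w + 1) / (qexp w - 1) = (1 + u ^ N) / (1 - u ^ N)"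
      unfolding q by (simp add: field_simps)
    moreover have "Digamma (1 - w) - Digamma (1 + w) = of_real pi * \<i> * ((qexp w + 1) / (qexp w - 1)) - 1 / w"
      using Digamma_reflection[OF w(1)] Digamma_plus1[OF w(2)] by (simp add: add.commute algebra_simps)
    ultimately show "(of_real pi * \<i> * ((1 + u ^ N) / (1 - u ^ N)) - z * (1 / (0 + of_nat N))) / z = bcol (int N)"
      unfolding bcol_def by (simp add: w_def)
  qed auto
  finally show ?thesis
    by simp
qed

lemma bcol_minus: "bcol (- d) = - bcol d"
  by (simp add: bcol_def diff_divide_distrib)

lemma E2_inversion_aux: "E2 z = E2 (- 1 / z) / z ^ 2 + 6 * \<i> / (of_real pi * z)"
proof -
  obtain S where S: "((\<lambda>(k, d). eis_term k d) has_sum S) (UNIV \<times> UNIV)"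
    using eis_term_summable by (auto simp: summable_on_def)
  define X where "X = - 8 * of_real pi ^ 2 * eval_fps (sigmafps 1) (qexp z)"
  define Y where "Y = of_real pi ^ 2 / 3 + 2 * (- 4 * of_real pi ^ 2 * eval_fps (sigmafps 1) (qexp (- 1 / z)) - z ^ 2 * (of_real pi ^ 2 / 6))"
  have "((\<lambda>k. - 8 * of_real pi ^ 2 * eval_fps (powerfps 1) (qexp z ^ Suc k)) has_sum S) UNIV"
    by (rule has_sum_SigmaD[OF S]) (use eis_term_row in simp)
  moreover have "((\<lambda>k. - 8 * of_real pi ^ 2 * eval_fps (powerfps 1) (qexp z ^ Suc k)) has_sum X) UNIV"
    unfolding X_def using z by (intro has_sum_cmult_right lambert_series) (auto simp: norm_qexp_less_1)
  ultimately have SX: "S = X"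
    by (rule has_sum_unique)
  have S': "((\<lambda>(d, k). eis_term k d) has_sum S) (UNIV \<times> UNIV)"
    using S by (subst has_sum_swap) (simp add: case_prod_unfold)
  have "((\<lambda>d. mcol d / z ^ 2 - (bcol d - bcol (d + 1))) has_sum S) UNIV"
  proof (rule has_sum_SigmaD[OF S'])
    fix d :: int
    have "(\<lambda>k. eis_term k d) summable_on UNIV"
      using S' summable_on_SigmaD1[of "\<lambda>d k. eis_term k d" UNIV "\<lambda>_. UNIV" d] by (auto simp: summable_on_def)
    then obtain T where "((\<lambda>k. eis_term k d) has_sum T) UNIV"
      by (auto simp: summable_on_def)
    then show "((\<lambda>k. case (d, k) of (d, k) \<Rightarrow> eis_term k d) has_sum (mcol d / z ^ 2 - (bcol d - bcol (d + 1)))) UNIV"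
      using eis_term_col[of d] has_sum_imp_sums sums_unique2 by (metis (no_types, lifting) case_prod_conv has_sum_cong)
  qed
  from has_sum_int_imp_tendsto[OF this]
  have lim1: "(\<lambda>N. (\<Sum>d\<in>{- int N..<int N}. mcol d) / z ^ 2 - (bcol (- int N) - bcol (int N))) \<longlonglongrightarrow> S"
    by (simp only: sum_subtractf[of "\<lambda>d. mcol d / z ^ 2" "\<lambda>d. bcol d - bcol (d + 1)"] sum_int_telescope sum_divide_distrib)
  have "(\<lambda>N. (\<Sum>d\<in>{- int N..<int N}. mcol d) / z ^ 2 - (- bcol (int N) - bcol (int N))) \<longlonglongrightarrow>
      Y / z ^ 2 - (- (of_real pi * \<i> / z) - of_real pi * \<i> / z)"
    using z_nonzero unfolding Y_def by (intro tendsto_intros has_sum_int_imp_tendsto mcol_has_sum bcol_limit) auto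
  \<comment> \<open>One double sum, evaluated by rows and by columns. The last two terms are the
    limits of \<open>bcol\<close> at -N and at N, opposite to each other since \<open>bcol\<close>
    is odd.\<close>
  with lim1 have "X = Y / z ^ 2 - (- (of_real pi * \<i> / z) - of_real pi * \<i> / z)"
    unfolding bcol_minus SX by (rule LIMSEQ_unique)
  then have eq: "X * z ^ 2 = Y + 2 * of_real pi * \<i> * z"
    using z_nonzero by (simp add: field_simps power2_eq_square)
  have "of_real pi ^ 2 * (E2 z * z ^ 2) = of_real pi ^ 2 * z ^ 2 + 3 * (X * z ^ 2)"
    by (simp add: X_def E2_def algebra_simps)
  also have "\<dots> = of_real pi ^ 2 * z ^ 2 + 3 * (Y + 2 * of_real pi * \<i> * z)"
    by (simp only: eq)
  also have "\<dots> = of_real pi ^ 2 * E2 (- 1 / z) + of_real pi * (6 * \<i> * z)"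
    by (simp add: Y_def E2_def algebra_simps)
  finally have "of_real pi ^ 2 * (E2 z * z ^ 2) = of_real pi ^ 2 * E2 (- 1 / z) + of_real pi * (6 * \<i> * z)" .
  then have "of_real pi * (of_real pi * (E2 z * z ^ 2)) = of_real pi * (of_real pi * E2 (- 1 / z) + 6 * \<i> * z)"
    by (simp only: power2_eq_square distrib_left mult.assoc)
  then have "of_real pi * (E2 z * z ^ 2) = of_real pi * E2 (- 1 / z) + 6 * \<i> * z"
    by (subst (asm) mult_cancel_left) simp
  then show ?thesis
    using z_nonzero by (simp add: field_simps power2_eq_square)
qed

end

theorem E2_inversion:
  assumes "z \<in> upper_half_plane"
  shows "E2 (- 1 / z) / z ^ 2 = E2 z - 6 * \<i> / (of_real pi * z)"
  using E2_inversion_aux[OF assms] by simp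

lemma qexp_in_disc [simp]: "z \<in> upper_half_plane \<Longrightarrow> qexp z \<in> ball 0 1"
  by (simp add: norm_qexp_less_1)

lemma ball_radius:
  assumes "fps_conv_radius F \<ge> 1" "norm (q :: complex) < 1"
  shows "ereal (norm q) < fps_conv_radius F"
  using assms by (metis ereal_less(3) less_le_trans)

section \<open>Solutions of the linear equation\<close>

text \<open>The series of -log of the product of all (1 - q^n), so that \<open>eta2\<close> is
  q^(1/12) times the product of all (1 - q^n)^2. Applying q d/dq gives the divisor sums in
  \<open>E2\<close>.\<close>

definition logfps :: "complex fps" where
  "logfps = Abs_fps (\<lambda>n. of_nat (sigma 1 n) / of_nat n)"

lemma conv_radius_logfps: "fps_conv_radius logfps \<ge> 1"
  unfolding fps_conv_radius_def
proof (rule conv_radius_geI_ex')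
  fix x :: real assume x: "0 < x" "ereal x < 1"
  have "summable (\<lambda>n. norm (fps_nth (sigmafps 1) n * (of_real x) ^ n))"
    using x by (intro abs_summable_in_conv_radius) (use sigmafps_radius[of "of_real x" 1] in \<open>simp add: fps_conv_radius_def\<close>)
  then show "summable (\<lambda>n. fps_nth logfps n * of_real x ^ n)"
  proof (rule summable_comparison_test_ev[rotated], intro eventually_mono[OF eventually_gt_at_top[of 0]])
    fix n :: nat assume "n > 0"
    then have "real (sigma 1 n) / real n \<le> real (sigma 1 n)"
      by (simp add: divide_le_eq mult_le_cancel_left1)
    then show "norm (fps_nth logfps n * complex_of_real x ^ n) \<le> norm (fps_nth (sigmafps 1) n * (of_real x) ^ n)"
      using x mult_right_mono[of "real (sigma 1 n) / real n" "real (sigma 1 n)" "x ^ n"]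
      by (simp add: logfps_def sigmafps_def norm_mult norm_divide norm_power)
  qed
qed

lemma eval_logfps_deriv:
  assumes "norm q < 1"
  shows "(eval_fps logfps has_field_derivative eval_fps (fps_deriv logfps) q) (at q)"
    and "q * eval_fps (fps_deriv logfps) q = eval_fps (sigmafps 1) q"
proof -
  note r = ball_radius[OF conv_radius_logfps assms]
  show "(eval_fps logfps has_field_derivative eval_fps (fps_deriv logfps) q) (at q)"
    by (rule has_field_derivative_eval_fps[OF r])
  have "fps_X * fps_deriv logfps = sigmafps 1"
    by (rule fps_ext) (auto simp: logfps_def sigmafps_def fps_X_mult_nth gr0_conv_Suc simp del: of_nat_Suc)
  moreover have "ereal (norm q) < fps_conv_radius (fps_deriv logfps)"
    using r fps_conv_radius_deriv[of logfps] by (rule less_le_trans)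
  ultimately show "q * eval_fps (fps_deriv logfps) q = eval_fps (sigmafps 1) q"
    using eval_fps_mult[of q fps_X "fps_deriv logfps"] by simp
qed

text \<open>The square of the Dedekind eta function, as the exponential of a primitive of \<open>(\<pi>i/6) E\<^sub>2\<close>.\<close>

definition eta2 :: "complex \<Rightarrow> complex" where
  "eta2 z = qexp (z / 12) * exp (- 2 * eval_fps logfps (qexp z))"

lemma eta2_nonzero [simp]: "eta2 z \<noteq> 0"
  by (simp add: eta2_def)

lemma DERIV_eta2 [derivative_intros]:
  assumes z: "z \<in> upper_half_plane"
  shows "(eta2 has_field_derivative (of_real pi * \<i> / 6 * E2 z * eta2 z)) (at z)"
proof -
  have q: "norm (qexp z) < 1"
    using z by (rule norm_qexp_less_1)
  define D where "D = eval_fps (fps_deriv logfps) (qexp z)"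
  have "(eta2 has_field_derivative 2 * of_real pi * \<i> * (1 / 12) * qexp (z / 12) * exp (- 2 * eval_fps logfps (qexp z)) +
      qexp (z / 12) * (exp (- 2 * eval_fps logfps (qexp z)) * (- 2 * (D * (2 * of_real pi * \<i> * 1 * qexp z))))) (at z)"
  proof -
    have [derivative_intros]: "((\<lambda>z. eval_fps logfps (qexp z)) has_field_derivative D * (2 * of_real pi * \<i> * 1 * qexp z)) (at z)"
      unfolding D_def by (rule DERIV_chain2[where f = "eval_fps logfps" and g = qexp, OF eval_logfps_deriv(1)[OF q]])
        (auto intro!: derivative_eq_intros)
    show ?thesis
      unfolding eta2_def by (auto intro!: derivative_eq_intros simp: algebra_simps)
  qed
  also have "2 * of_real pi * \<i> * (1 / 12) * qexp (z / 12) * exp (- 2 * eval_fps logfps (qexp z)) +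
      qexp (z / 12) * (exp (- 2 * eval_fps logfps (qexp z)) * (- 2 * (D * (2 * of_real pi * \<i> * 1 * qexp z)))) =
      of_real pi * \<i> / 6 * (1 - 24 * (qexp z * D)) * eta2 z"
    by (simp add: eta2_def algebra_simps)
  also have "1 - 24 * (qexp z * D) = E2 z"
    unfolding D_def eval_logfps_deriv(2)[OF q] E2_def ..
  finally show ?thesis .
qed

lemma eta2_translation: "eta2 (z + of_int k) = qexp (of_int k / 12) * eta2 z"
  by (simp add: eta2_def qexp_add add_divide_distrib)

text \<open>The quotient g has derivative 0: by the law of \<open>E2\<close>, the logarithmic
  derivative of \<eta>^2(-1/z) exceeds that of \<eta>^2(z) by 1/z, which is that of the factor z.
  The constant 1/i is found at the fixed point z = i.\<close>

theorem eta2_inversion: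
  assumes z: "z \<in> upper_half_plane"
  shows "eta2 (- 1 / z) = - \<i> * z * eta2 z"
proof -
  define g where "g z = eta2 (- 1 / z) / (z * eta2 z)" for z
  have inv: "- 1 / w \<in> upper_half_plane" "w \<noteq> 0" if "w \<in> upper_half_plane" for w
    using lin_frac_in_uhp[OF inversion_in_SL2Z that] that by (auto simp: mem_uhp)
  have "(g has_field_derivative 0) (at w within upper_half_plane)" if w: "w \<in> upper_half_plane" for w
  proof -
    have 1: "((\<lambda>w. eta2 (- 1 / w)) has_field_derivative
        (of_real pi * \<i> / 6 * E2 (- 1 / w) * eta2 (- 1 / w)) * (1 / w ^ 2)) (at w)"
      by (rule DERIV_chain2[where f = eta2 and g = "\<lambda>w. - 1 / w", OF DERIV_eta2[OF inv(1)[OF w]]])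
        (use inv[OF w] in \<open>auto intro!: derivative_eq_intros simp: power2_eq_square\<close>)
    have 2: "((\<lambda>w. w * eta2 w) has_field_derivative (eta2 w + w * (of_real pi * \<i> / 6 * E2 w * eta2 w))) (at w)"
      using w by (auto intro!: derivative_eq_intros)
    have "(of_real pi * \<i> / 6 * E2 (- 1 / w) * eta2 (- 1 / w)) * (1 / w ^ 2) =
        of_real pi * \<i> / 6 * eta2 (- 1 / w) * (E2 (- 1 / w) / w ^ 2)"
      by simp
    also have "\<dots> = eta2 (- 1 / w) * (of_real pi * \<i> / 6 * E2 w + 1 / w)"
      unfolding E2_inversion[OF w] using inv[OF w] by (simp add: field_simps)
    finally have eq: "(of_real pi * \<i> / 6 * E2 (- 1 / w) * eta2 (- 1 / w)) * (1 / w ^ 2) =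
        eta2 (- 1 / w) * (of_real pi * \<i> / 6 * E2 w + 1 / w)" .
    have "(g has_field_derivative
        (eta2 (- 1 / w) * (of_real pi * \<i> / 6 * E2 w + 1 / w) * (w * eta2 w) -
         eta2 (- 1 / w) * (eta2 w + w * (of_real pi * \<i> / 6 * E2 w * eta2 w))) / ((w * eta2 w) * (w * eta2 w))) (at w)"
      unfolding g_def using inv[OF w] by (intro DERIV_divide 1[unfolded eq] 2) auto
    note D = this
    have z0: "eta2 (- 1 / w) * (of_real pi * \<i> / 6 * E2 w + 1 / w) * (w * eta2 w) -
         eta2 (- 1 / w) * (eta2 w + w * (of_real pi * \<i> / 6 * E2 w * eta2 w)) = 0"
      using inv[OF w] by (simp add: field_simps)
    from D[unfolded z0] show ?thesis
      by (simp add: has_field_derivative_at_within)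
  qed
  then obtain c where c: "\<And>w. w \<in> upper_half_plane \<Longrightarrow> g w = c"
    using has_field_derivative_zero_constant[OF convex_uhp, of g] by blast
  have "c = - \<i>"
    using c[of \<i>] by (simp add: g_def mem_uhp)
  then show ?thesis
    using c[OF z] inv[OF z] by (simp add: g_def field_simps)
qed

lemma qexp_translation [simp]: "qexp (z + of_int k) = qexp z"
  by (simp add: qexp_add)

section \<open>The linear equation and its Frobenius solutions\<close>

definition ode :: "complex set \<Rightarrow> complex \<Rightarrow> (complex \<Rightarrow> complex) \<Rightarrow> bool" where
  "ode S c y \<longleftrightarrow> y holomorphic_on S \<and> (\<forall>z\<in>S. deriv (deriv y) z = - c * E4 z * y z)"

text \<open>The sign is chosen so that (f/g)' = W/g^2.\<close>

definition wronskian :: "(complex \<Rightarrow> complex) \<Rightarrow> (complex \<Rightarrow> complex) \<Rightarrow> complex \<Rightarrow> complex" where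
  "wronskian f g z = deriv f z * g z - f z * deriv g z"

lemma ode_subset: "ode S c y \<Longrightarrow> T \<subseteq> S \<Longrightarrow> ode T c y"
  by (auto simp: ode_def intro: holomorphic_on_subset)

lemma ode_derivs:
  assumes "open S" "ode S c y" "z \<in> S"
  shows "(y has_field_derivative deriv y z) (at z)"
    and "(deriv y has_field_derivative - c * E4 z * y z) (at z)"
proof -
  have "y holomorphic_on S" "deriv y holomorphic_on S"
    using assms holomorphic_deriv by (auto simp: ode_def)
  from this[THEN holomorphic_derivI, OF assms(1,3)]
  show "(y has_field_derivative deriv y z) (at z)" "(deriv y has_field_derivative - c * E4 z * y z) (at z)"
    using assms(2,3) by (simp_all add: ode_def)
qed

lemma odeI:
  assumes "open S" "\<And>z. z \<in> S \<Longrightarrow> (y has_field_derivative y' z) (at z)"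
    and "\<And>z. z \<in> S \<Longrightarrow> (y' has_field_derivative - c * E4 z * y z) (at z)"
  shows "ode S c y"
  unfolding ode_def
proof (intro conjI ballI)
  show "y holomorphic_on S"
    using assms(1,2) by (auto simp: holomorphic_on_open)
  fix z assume z: "z \<in> S"
  have "(deriv y has_field_derivative - c * E4 z * y z) (at z)"
    using assms(3)[OF z] by (rule has_field_derivative_transform_within_open[OF _ assms(1) z])
      (metis DERIV_imp_deriv assms(2))
  then show "deriv (deriv y) z = - c * E4 z * y z"
    by (rule DERIV_imp_deriv)
qed

lemma wronskian_constant:
  assumes S: "open S" "convex S" and "ode S c f" "ode S c g"
  obtains w where "\<And>z. z \<in> S \<Longrightarrow> wronskian f g z = w"
proof -
  have "(wronskian f g has_field_derivative 0) (at z within S)" if z: "z \<in> S" for z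
  proof -
    note d = ode_derivs[OF S(1) assms(3) z] ode_derivs[OF S(1) assms(4) z]
    have "((\<lambda>z. deriv f z * g z - f z * deriv g z) has_field_derivative
      ((- c * E4 z * f z) * g z + deriv g z * deriv f z) - (deriv f z * deriv g z + (- c * E4 z * g z) * f z)) (at z)"
      by (intro DERIV_diff DERIV_mult d)
    moreover have "((- c * E4 z * f z) * g z + deriv g z * deriv f z) - (deriv f z * deriv g z + (- c * E4 z * g z) * f z) = 0"
      by (simp add: algebra_simps)
    moreover have "wronskian f g = (\<lambda>z. deriv f z * g z - f z * deriv g z)"
      by (simp add: fun_eq_iff wronskian_def)
    ultimately show ?thesis
      by (metis has_field_derivative_at_within)
  qed
  then have "\<exists>w. \<forall>z\<in>S. wronskian f g z = w"
    by (rule has_field_derivative_zero_constant[OF S(2)])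
  then show ?thesis
    using that by blast
qed

text \<open>Cramer's rule: v W(y1,y2) = W(v,y2) y1 - W(v,y1) y2 identically, and all three
  Wronskians are constant.\<close>

lemma ode_lincomb:
  assumes S: "open S" "convex S" and y: "ode S c y1" "ode S c y2" and v: "ode S c v"
    and w: "w \<noteq> 0" "\<And>z. z \<in> S \<Longrightarrow> wronskian y1 y2 z = w"
  obtains a b where "\<And>z. z \<in> S \<Longrightarrow> v z = a * y1 z + b * y2 z"
proof -
  obtain w1 where w1: "\<And>z. z \<in> S \<Longrightarrow> wronskian v y1 z = w1"
    using wronskian_constant[OF S v y(1)] by blast
  obtain w2 where w2: "\<And>z. z \<in> S \<Longrightarrow> wronskian v y2 z = w2"
    using wronskian_constant[OF S v y(2)] by blast
  have "v z = w2 / w * y1 z + (- w1 / w) * y2 z" if z: "z \<in> S" for z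
  proof -
    have "v z * wronskian y1 y2 z = wronskian v y2 z * y1 z - wronskian v y1 z * y2 z"
      by (simp add: wronskian_def algebra_simps)
    then have "v z * w = w2 * y1 z - w1 * y2 z"
      using w(2) w1 w2 z by simp
    then show ?thesis
      using w(1) by (simp add: field_simps)
  qed
  then show ?thesis
    using that by blast
qed

text \<open>Solutions have weight -1.\<close>

lemma ode_inversion:
  assumes "ode upper_half_plane c y"
  shows "ode upper_half_plane c (\<lambda>z. z * y (- 1 / z))"
proof (rule odeI[OF open_uhp])
  fix z assume z: "z \<in> upper_half_plane"
  then have inv: "- 1 / z \<in> upper_half_plane" "z \<noteq> 0"
    using lin_frac_in_uhp[OF inversion_in_SL2Z z] by (auto simp: mem_uhp)
  have i: "((\<lambda>z. - 1 / z) has_field_derivative 1 / z ^ 2) (at z)"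
    using inv by (auto intro!: derivative_eq_intros simp: power2_eq_square)
  note d = ode_derivs[OF open_uhp assms inv(1)]
  have d1: "((\<lambda>z. y (- 1 / z)) has_field_derivative deriv y (- 1 / z) * (1 / z ^ 2)) (at z)"
    by (rule DERIV_chain2[where f = y and g = "\<lambda>z. - 1 / z", OF d(1) i])
  have d2: "((\<lambda>z. deriv y (- 1 / z)) has_field_derivative (- c * E4 (- 1 / z) * y (- 1 / z)) * (1 / z ^ 2)) (at z)"
    by (rule DERIV_chain2[where f = "deriv y" and g = "\<lambda>z. - 1 / z", OF d(2) i])
  show "((\<lambda>z. z * y (- 1 / z)) has_field_derivative y (- 1 / z) + deriv y (- 1 / z) / z) (at z)"
    using DERIV_mult[OF DERIV_ident d1] inv by (simp add: power2_eq_square field_simps)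
  have "((\<lambda>z. y (- 1 / z) + deriv y (- 1 / z) / z) has_field_derivative
     deriv y (- 1 / z) * (1 / z ^ 2) + (((- c * E4 (- 1 / z) * y (- 1 / z)) * (1 / z ^ 2)) * z - deriv y (- 1 / z) * 1) / (z * z)) (at z)"
    using inv by (intro DERIV_add d1 DERIV_divide d2 DERIV_ident)
  also have "deriv y (- 1 / z) * (1 / z ^ 2) + (((- c * E4 (- 1 / z) * y (- 1 / z)) * (1 / z ^ 2)) * z - deriv y (- 1 / z) * 1) / (z * z)
     = - c * E4 z * (z * y (- 1 / z))"
    unfolding E4_inversion[OF z] using inv(2) by (simp add: field_simps power2_eq_square power4_eq_xxxx)
  finally show "((\<lambda>z. y (- 1 / z) + deriv y (- 1 / z) / z) has_field_derivative - c * E4 z * (z * y (- 1 / z))) (at z)" .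
qed

text \<open>
  The recursion for the coefficients of a solution \<open>q\<^sup>s \<Sum> c\<^sub>k q\<^sup>k\<close> of \<open>y'' = -4\<pi>\<^sup>2 s\<^sup>2 E\<^sub>4 y\<close>.
\<close>

fun frobenius :: "complex \<Rightarrow> nat \<Rightarrow> complex" where
  "frobenius s k = (if k = 0 then 1 else
     240 * s ^ 2 / (of_nat k * (of_nat k + 2 * s)) * (\<Sum>j<k. of_nat (sigma 3 (k - j)) * frobenius s j))"

declare frobenius.simps [simp del]

lemma frobenius_0 [simp]: "frobenius s 0 = 1"
  by (simp add: frobenius.simps)

definition frobfps :: "complex \<Rightarrow> complex fps" where
  "frobfps s = Abs_fps (frobenius s)"

text \<open>Majorant argument: \<open>M\<close> bounds the convolution with the divisor sums at
  radius r, and beyond \<open>K\<close> the factor 240 |s|^2 M / (k |k+2s|) of the recursion is at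
  most 1. So the maximum \<open>C\<close> over k \<le> K is never exceeded.\<close>

lemma frobenius_bounded:
  assumes r: "0 < r" "r < 1"
  obtains C where "\<And>k. norm (frobenius s k) * r ^ k \<le> C"
proof -
  have sm: "summable (\<lambda>n. real (sigma 3 n) * r ^ n)"
    using abs_summable_in_conv_radius[of "of_real r :: complex" "fps_nth (sigmafps 3)"] sigmafps_radius[of "of_real r" 3] r
    by (simp add: fps_conv_radius_def sigmafps_def norm_mult norm_power)
  define M where "M = (\<Sum>n. real (sigma 3 n) * r ^ n)"
  have M: "M \<ge> 0"
    unfolding M_def using r by (intro suminf_nonneg sm) auto
  define K where "K = nat \<lceil>2 * norm s + 1 + 240 * norm s ^ 2 * M\<rceil>"
  define C where "C = Max ((\<lambda>k. norm (frobenius s k) * r ^ k) ` {..K})"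
  have C0: "C \<ge> 0"
  proof -
    have "norm (frobenius s 0) * r ^ 0 \<le> C"
      unfolding C_def by (rule Max_ge, simp, rule imageI) simp
    then show ?thesis
      by simp
  qed
  have "norm (frobenius s k) * r ^ k \<le> C" for k
  proof (induction k rule: less_induct)
    case (less k)
    show ?case
    proof (cases "k \<le> K")
      case True
      then show ?thesis
        unfolding C_def by (intro Max_ge) auto
    next
      case False
      then have k: "real k \<ge> 2 * norm s + 1 + 240 * norm s ^ 2 * M" "k > 0"
        unfolding K_def by linarith+
      have "real k - 2 * norm s \<le> norm (of_nat k + 2 * s)"
        using norm_diff_ineq[of "of_nat k :: complex" "2 * s"] by (simp add: norm_mult)
      then have n1: "norm (of_nat k + 2 * s) \<ge> 1"
        using k M by (smt (verit) mult_nonneg_nonneg zero_le_power2)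
      have "240 * norm s ^ 2 * M \<le> real k * 1"
        using k by (smt (verit) norm_ge_zero)
      also have "\<dots> \<le> real k * norm (of_nat k + 2 * s)"
        using n1 by (intro mult_left_mono) auto
      finally have le0: "240 * norm s ^ 2 * M \<le> real k * norm (of_nat k + 2 * s)" .
      have le: "240 * norm s ^ 2 * M / (real k * norm (of_nat k + 2 * s)) \<le> 1"
      proof -
        have "0 < real k * norm (of_nat k + 2 * s)"
          using n1 k(2) by (intro mult_pos_pos) linarith+
        with le0 show ?thesis
          by (simp only: divide_le_eq_1_pos)
      qed
      have "norm (\<Sum>j<k. of_nat (sigma 3 (k - j)) * frobenius s j) * r ^ k \<le>
          (\<Sum>j<k. norm (of_nat (sigma 3 (k - j)) * frobenius s j)) * r ^ k"
        using r by (intro mult_right_mono norm_sum) auto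
      also have "\<dots> = (\<Sum>j<k. (real (sigma 3 (k - j)) * r ^ (k - j)) * (norm (frobenius s j) * r ^ j))"
      proof -
        have "r ^ k = r ^ (k - j) * r ^ j" if "j < k" for j
          using that by (simp flip: power_add)
        then show ?thesis
          unfolding sum_distrib_right by (intro sum.cong refl) (simp add: norm_mult)
      qed
      also have "\<dots> \<le> (\<Sum>j<k. (real (sigma 3 (k - j)) * r ^ (k - j)) * C)"
        using less r by (intro sum_mono mult_left_mono) auto
      also have "\<dots> = (\<Sum>j<k. real (sigma 3 (k - j)) * r ^ (k - j)) * C"
        by (simp add: sum_distrib_right)
      also have "(\<Sum>j<k. real (sigma 3 (k - j)) * r ^ (k - j)) = (\<Sum>i\<in>{1..k}. real (sigma 3 i) * r ^ i)"
        by (rule sum.reindex_bij_witness[where i = "\<lambda>i. k - i" and j = "\<lambda>j. k - j"]) auto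
      also have "\<dots> \<le> M"
        unfolding M_def using r by (intro sum_le_suminf sm) auto
      finally have S: "norm (\<Sum>j<k. of_nat (sigma 3 (k - j)) * frobenius s j) * r ^ k \<le> M * C"
        using C0 by (simp add: mult_right_mono)
      have "norm (frobenius s k) * r ^ k =
        240 * norm s ^ 2 / (real k * norm (of_nat k + 2 * s)) * (norm (\<Sum>j<k. of_nat (sigma 3 (k - j)) * frobenius s j) * r ^ k)"
        using k(2) by (subst frobenius.simps) (simp add: norm_mult norm_divide norm_power)
      also have "\<dots> \<le> 240 * norm s ^ 2 / (real k * norm (of_nat k + 2 * s)) * (M * C)"
        using S by (intro mult_left_mono) auto
      also have "\<dots> = (240 * norm s ^ 2 * M / (real k * norm (of_nat k + 2 * s))) * C"
        by simp
      also have "\<dots> \<le> C"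
        using mult_right_mono[OF le C0] by simp
      finally show ?thesis .
    qed
  qed
  then show ?thesis
    using that by blast
qed

lemma conv_radius_frobfps: "fps_conv_radius (frobfps s) \<ge> 1"
  unfolding fps_conv_radius_def
proof (rule conv_radius_geI_ex')
  fix x :: real assume x: "0 < x" "ereal x < 1"
  define r where "r = (x + 1) / 2"
  have r: "0 < r" "r < 1" "x < r"
    using x by (simp_all add: r_def)
  obtain C where C: "\<And>k. norm (frobenius s k) * r ^ k \<le> C"
    using frobenius_bounded[OF r(1,2)] by blast
  show "summable (\<lambda>n. fps_nth (frobfps s) n * of_real x ^ n)"
  proof (rule summable_comparison_test[OF exI[of _ 0]], intro allI impI)
    show "summable (\<lambda>n. C * (x / r) ^ n)"
      using r x by (intro summable_mult summable_geometric) simp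
    fix n
    have "norm (fps_nth (frobfps s) n * of_real x ^ n) = (norm (frobenius s n) * r ^ n) * (x / r) ^ n"
      using r x by (simp add: frobfps_def norm_mult norm_power power_divide)
    also have "\<dots> \<le> C * (x / r) ^ n"
      using C r x by (intro mult_right_mono) auto
    finally show "norm (fps_nth (frobfps s) n * of_real x ^ n) \<le> C * (x / r) ^ n" .
  qed
qed

text \<open>Euler's operator q d/dq; in the variable z, differentiation is 2\<pi>i times this
  operator.\<close>

definition thetafps :: "complex fps \<Rightarrow> complex fps" where
  "thetafps F = fps_X * fps_deriv F"

lemma thetafps_nth [simp]: "fps_nth (thetafps F) k = of_nat k * fps_nth F k"
  by (cases k) (simp_all add: thetafps_def fps_X_mult_nth)

lemma conv_radius_thetafps: "fps_conv_radius F \<ge> 1 \<Longrightarrow> fps_conv_radius (thetafps F) \<ge> 1"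
  using fps_conv_radius_mult[of fps_X "fps_deriv F"] fps_conv_radius_deriv[of F]
  by (auto simp: thetafps_def min_def split: if_splits)

lemma DERIV_eval_fps_qexp:
  assumes F: "fps_conv_radius F \<ge> 1" and z: "z \<in> upper_half_plane"
  shows "((\<lambda>z. eval_fps F (qexp z)) has_field_derivative 2 * of_real pi * \<i> * eval_fps (thetafps F) (qexp z)) (at z)"
proof -
  note r = ball_radius[OF F norm_qexp_less_1[OF z]]
  have "((\<lambda>z. eval_fps F (qexp z)) has_field_derivative eval_fps (fps_deriv F) (qexp z) * (2 * of_real pi * \<i> * 1 * qexp z)) (at z)"
    by (rule DERIV_chain2[where f = "eval_fps F" and g = qexp, OF has_field_derivative_eval_fps[OF r]])
      (auto intro!: derivative_eq_intros)
  moreover have "eval_fps (thetafps F) (qexp z) = qexp z * eval_fps (fps_deriv F) (qexp z)"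
    unfolding thetafps_def using r fps_conv_radius_deriv[of F] by (subst eval_fps_mult) (auto intro: less_le_trans)
  ultimately show ?thesis
    by (simp add: mult_ac)
qed

lemma frobenius_equation:
  assumes "\<And>k. k > 0 \<Longrightarrow> of_nat k + 2 * s \<noteq> 0"
  shows "thetafps (thetafps (frobfps s)) + fps_const (2 * s) * thetafps (frobfps s) =
    fps_const (240 * s ^ 2) * (sigmafps 3 * frobfps s)"
proof (rule fps_ext)
  fix k
  have sum: "fps_nth (sigmafps 3 * frobfps s) k = (\<Sum>j<k. of_nat (sigma 3 (k - j)) * frobenius s j)"
  proof -
    have "fps_nth (sigmafps 3 * frobfps s) k = (\<Sum>j=0..k. frobenius s j * of_nat (sigma 3 (k - j)))"
      by (subst mult.commute) (simp add: fps_mult_nth sigmafps_def frobfps_def)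
    \<comment> \<open>The term j = k drops out because \<open>sigma 3 0 = 0\<close>; the constant
      term of E_4 has already cancelled against s^2.\<close>
    also have "{0..k} = insert k {..<k}"
      by auto
    finally show ?thesis
      by (simp add: mult.commute)
  qed
  have "of_nat k * (of_nat k + 2 * s) * frobenius s k = 240 * s ^ 2 * (\<Sum>j<k. of_nat (sigma 3 (k - j)) * frobenius s j)"
    using assms[of k] by (cases "k = 0") (simp_all add: frobenius.simps[of s k])
  then show "fps_nth (thetafps (thetafps (frobfps s)) + fps_const (2 * s) * thetafps (frobfps s)) k =
      fps_nth (fps_const (240 * s ^ 2) * (sigmafps 3 * frobfps s)) k"
    by (simp add: sum) (simp add: frobfps_def algebra_simps)
qed

definition frob_solution :: "complex \<Rightarrow> complex \<Rightarrow> complex" where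
  "frob_solution s z = qexp (s * z) * eval_fps (frobfps s) (qexp z)"

lemma frob_solution_deriv:
  assumes z: "z \<in> upper_half_plane"
  shows "(frob_solution s has_field_derivative
    2 * of_real pi * \<i> * (qexp (s * z) * (s * eval_fps (frobfps s) (qexp z) + eval_fps (thetafps (frobfps s)) (qexp z)))) (at z)"
proof -
  have "((\<lambda>z. qexp (s * z)) has_field_derivative 2 * of_real pi * \<i> * s * qexp (s * z)) (at z)"
    by (auto intro!: derivative_eq_intros)
  from DERIV_mult[OF this DERIV_eval_fps_qexp[OF conv_radius_frobfps z]] show ?thesis
    unfolding frob_solution_def by (simp add: algebra_simps)
qed

lemma ode_frob_solution:
  assumes s: "\<And>k. k > 0 \<Longrightarrow> of_nat k + 2 * s \<noteq> 0"
  shows "ode upper_half_plane (4 * of_real pi ^ 2 * s ^ 2) (frob_solution s)"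
proof (rule odeI[OF open_uhp frob_solution_deriv], assumption)
  fix z assume z: "z \<in> upper_half_plane"
  let ?F = "frobfps s"
  define f0 f1 f2 where "f0 = eval_fps ?F (qexp z)" and "f1 = eval_fps (thetafps ?F) (qexp z)"
    and "f2 = eval_fps (thetafps (thetafps ?F)) (qexp z)"
  have q: "norm (qexp z) < 1"
    using z by (rule norm_qexp_less_1)
  have r: "fps_conv_radius ?F \<ge> 1" "fps_conv_radius (thetafps ?F) \<ge> 1" "fps_conv_radius (thetafps (thetafps ?F)) \<ge> 1"
    by (intro conv_radius_thetafps conv_radius_frobfps)+
  note r' = r[THEN ball_radius, OF q] sigmafps_radius[OF q, of 3]
  have "eval_fps (thetafps (thetafps ?F) + fps_const (2 * s) * thetafps ?F) (qexp z) =
     eval_fps (fps_const (240 * s ^ 2) * (sigmafps 3 * ?F)) (qexp z)"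
    by (simp only: frobenius_equation[OF s])
  also have "eval_fps (thetafps (thetafps ?F) + fps_const (2 * s) * thetafps ?F) (qexp z) = f2 + 2 * s * f1"
    unfolding f2_def f1_def using r'
      less_le_trans[OF _ fps_conv_radius_mult, of "ereal (norm (qexp z))" "fps_const (2 * s)" "thetafps ?F"]
    by (simp add: eval_fps_add eval_fps_mult)
  also have "eval_fps (fps_const (240 * s ^ 2) * (sigmafps 3 * ?F)) (qexp z) = 240 * s ^ 2 * (eval_fps (sigmafps 3) (qexp z) * f0)"
    unfolding f0_def using r'
      less_le_trans[OF _ fps_conv_radius_mult, of "ereal (norm (qexp z))" "sigmafps 3" ?F]
    by (simp add: eval_fps_mult)
  finally have eq: "f2 + 2 * s * f1 = 240 * s ^ 2 * (eval_fps (sigmafps 3) (qexp z) * f0)" .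
  have "((\<lambda>z. 2 * of_real pi * \<i> * (qexp (s * z) * (s * eval_fps ?F (qexp z) + eval_fps (thetafps ?F) (qexp z)))) has_field_derivative
     (2 * of_real pi * \<i>) ^ 2 * (qexp (s * z) * (s ^ 2 * f0 + (f2 + 2 * s * f1)))) (at z)"
  proof -
    have 1: "((\<lambda>z. qexp (s * z)) has_field_derivative 2 * of_real pi * \<i> * s * qexp (s * z)) (at z)"
      by (auto intro!: derivative_eq_intros)
    have 2: "((\<lambda>z. s * eval_fps ?F (qexp z) + eval_fps (thetafps ?F) (qexp z)) has_field_derivative
        s * (2 * of_real pi * \<i> * f1) + 2 * of_real pi * \<i> * f2) (at z)"
      unfolding f1_def f2_def by (intro DERIV_add DERIV_cmult DERIV_eval_fps_qexp r z)
    from DERIV_cmult[OF DERIV_mult[OF 1 2], of "2 * of_real pi * \<i>"] show ?thesis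
      by (rule DERIV_cong) (simp add: f0_def f1_def algebra_simps power2_eq_square)
  qed
  also have "(2 * of_real pi * \<i>) ^ 2 * (qexp (s * z) * (s ^ 2 * f0 + (f2 + 2 * s * f1))) =
     - (4 * of_real pi ^ 2 * s ^ 2) * E4 z * frob_solution s z"
    unfolding eq E4_eq[OF z] frob_solution_def f0_def by (simp add: power_mult_distrib algebra_simps)
  finally show "((\<lambda>z. 2 * of_real pi * \<i> * (qexp (s * z) * (s * eval_fps ?F (qexp z) + eval_fps (thetafps ?F) (qexp z)))) has_field_derivative
      - (4 * of_real pi ^ 2 * s ^ 2) * E4 z * frob_solution s z) (at z)" .
qed

text \<open>The point q = 0 is not reached by any z; the value there is recovered along the sequence
  q = e(ik), which tends to 0.\<close>

lemma continuous_at_cusp: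
  fixes g :: "complex \<Rightarrow> complex"
  assumes "isCont g 0" and "\<And>z. z \<in> upper_half_plane \<Longrightarrow> g (qexp (z / of_nat m)) = c" and "m > 0"
  shows "g 0 = c"
proof -
  have "(\<lambda>k. qexp (of_nat k * \<i>)) \<longlonglongrightarrow> 0"
    unfolding qexp_of_nat_mult by (rule LIMSEQ_power_zero) (simp add: norm_qexp_less_1 mem_uhp)
  then have "(\<lambda>k. g (qexp (of_nat (Suc k) * \<i>))) \<longlonglongrightarrow> g 0"
    using isCont_tendsto_compose[OF assms(1)] LIMSEQ_Suc by blast
  moreover have "g (qexp (of_nat (Suc k) * \<i>)) = c" for k
    using assms(2)[of "of_nat m * (of_nat (Suc k) * \<i>)"] assms(3) by (simp add: mem_uhp del: of_nat_Suc)
  ultimately have "(\<lambda>k. c) \<longlonglongrightarrow> g 0"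
    by (simp del: of_nat_Suc)
  then show ?thesis
    by (rule LIMSEQ_unique[OF _ tendsto_const])
qed

text \<open>The Wronskian is constant and can be read off at the cusp: e(sz) and e(-sz) cancel, the
  rest is continuous in q, and at q = 0 only 2\<pi>i (s - (-s)) survives.\<close>

lemma wronskian_frob_solution:
  assumes s: "\<And>k. k > 0 \<Longrightarrow> of_nat k + 2 * s \<noteq> 0" "\<And>k. k > 0 \<Longrightarrow> of_nat k - 2 * s \<noteq> 0"
    and z: "z \<in> upper_half_plane"
  shows "wronskian (frob_solution s) (frob_solution (- s)) z = 4 * of_real pi * \<i> * s"
proof -
  have o1: "ode upper_half_plane (4 * of_real pi ^ 2 * s ^ 2) (frob_solution s)"
    by (rule ode_frob_solution[OF s(1)])
  have o2: "ode upper_half_plane (4 * of_real pi ^ 2 * s ^ 2) (frob_solution (- s))"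
    using ode_frob_solution[of "- s"] s(2) by simp
  obtain w where w: "\<And>z. z \<in> upper_half_plane \<Longrightarrow> wronskian (frob_solution s) (frob_solution (- s)) z = w"
    using wronskian_constant[OF open_uhp convex_uhp o1 o2] by blast
  let ?F = "frobfps s" and ?G = "frobfps (- s)"
  define g where "g q = 2 * of_real pi * \<i> * ((s * eval_fps ?F q + eval_fps (thetafps ?F) q) * eval_fps ?G q -
     eval_fps ?F q * (- s * eval_fps ?G q + eval_fps (thetafps ?G) q))" for q
  have "wronskian (frob_solution s) (frob_solution (- s)) z = g (qexp z)" if "z \<in> upper_half_plane" for z
  proof -
    have "qexp (s * z) * qexp (- s * z) = 1"
      by (simp flip: qexp_add)
    then have e: "(qexp (s * z) * X) * (qexp (- s * z) * Y) = X * Y" for X Y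
      by (metis (no_types, opaque_lifting) mult.assoc mult.commute mult.left_neutral)
    have "wronskian (frob_solution s) (frob_solution (- s)) z = 2 * of_real pi * \<i> *
        ((qexp (s * z) * (s * eval_fps ?F (qexp z) + eval_fps (thetafps ?F) (qexp z))) * (qexp (- s * z) * eval_fps ?G (qexp z)) -
         (qexp (s * z) * eval_fps ?F (qexp z)) * (qexp (- s * z) * (- s * eval_fps ?G (qexp z) + eval_fps (thetafps ?G) (qexp z))))"
      unfolding wronskian_def DERIV_imp_deriv[OF frob_solution_deriv[OF that]] frob_solution_def
      by (simp only: right_diff_distrib mult_ac)
    then show ?thesis
      unfolding e g_def .
  qed
  moreover have "isCont g 0"
    unfolding g_def using conv_radius_frobfps conv_radius_thetafps ball_radius[of _ 0]
    by (intro continuous_intros continuous_on_interior) auto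
  ultimately have "g 0 = w"
    using continuous_at_cusp[of g 1 w] w by simp
  moreover have "g 0 = 4 * of_real pi * \<i> * s"
    by (simp add: g_def eval_fps_at_0 frobfps_def)
  ultimately show ?thesis
    using w z by simp
qed

section \<open>Functions of weight 0\<close>

text \<open>The branch used in \<open>cusp_fun\<close>, a right inverse of z -> e(z/m) on the
  punctured disc.\<close>

definition cusp_log :: "nat \<Rightarrow> complex \<Rightarrow> complex" where
  "cusp_log m q = of_nat m * Ln q / (2 * of_real pi * \<i>)"

lemma cusp_log:
  assumes "m > 0" "q \<noteq> 0" "norm q < 1"
  shows "cusp_log m q \<in> upper_half_plane" "qexp (cusp_log m q / of_nat m) = q"
proof -
  have "ln (norm q) < 0"
    using assms by simp
  moreover have "cusp_log m q = of_real (real m / (2 * pi)) * (- \<i> * Ln q)"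
    by (simp add: cusp_log_def field_simps)
  then have "Im (cusp_log m q) = real m / (2 * pi) * - ln (norm q)"
    using assms by (simp only: times_complex.sel) (simp add: Re_Ln)
  ultimately show "cusp_log m q \<in> upper_half_plane"
    using assms unfolding mem_uhp by (simp add: mult_pos_neg divide_neg_pos)
  show "qexp (cusp_log m q / of_nat m) = q"
    using assms by (simp add: qexp_def cusp_log_def)
qed

lemma finite_coset_representatives:
  assumes "m > 0"
  obtains X where "finite X" "X \<subseteq> SL2Z" "\<And>A. A \<in> SL2Z \<Longrightarrow> \<exists>B\<in>X. \<exists>g\<in>Gpm m. A = g ** B"
proof -
  define r where "r A = (A $ 1 $ 1 mod int m, A $ 1 $ 2 mod int m, A $ 2 $ 1 mod int m, A $ 2 $ 2 mod int m)"
    for A :: "int ^ 2 ^ 2"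
  define X where "X = (\<lambda>t. SOME A. A \<in> SL2Z \<and> r A = t) ` (r ` SL2Z)"
  have "r ` SL2Z \<subseteq> {0..<int m} \<times> {0..<int m} \<times> {0..<int m} \<times> {0..<int m}"
    using assms by (auto simp: r_def)
  then have "finite (r ` SL2Z)"
    by (rule finite_subset) simp
  then have "finite X"
    unfolding X_def by (rule finite_imageI)
  moreover have some: "(SOME B. B \<in> SL2Z \<and> r B = r A) \<in> SL2Z \<and> r (SOME B. B \<in> SL2Z \<and> r B = r A) = r A" if "A \<in> SL2Z" for A
    by (rule someI[of "\<lambda>B. B \<in> SL2Z \<and> r B = r A" A]) (use that in simp)
  then have "X \<subseteq> SL2Z"
    unfolding X_def by auto
  moreover have "\<exists>B\<in>X. \<exists>g\<in>Gpm m. A = g ** B" if A: "A \<in> SL2Z" for A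
  proof -
    define B where "B = (SOME B. B \<in> SL2Z \<and> r B = r A)"
    have B: "B \<in> SL2Z" "r B = r A" "B \<in> X"
      using some[OF A] A by (auto simp: B_def X_def)
    have c: "[A $ 1 $ 1 = B $ 1 $ 1] (mod int m)" "[A $ 1 $ 2 = B $ 1 $ 2] (mod int m)"
      "[A $ 2 $ 1 = B $ 2 $ 1] (mod int m)" "[A $ 2 $ 2 = B $ 2 $ 2] (mod int m)"
      using B(2) by (simp_all add: r_def cong_def)
    have "[(A ** adj2 B) $ 1 $ 1 = (B ** adj2 B) $ 1 $ 1] (mod int m)" "[(A ** adj2 B) $ 1 $ 2 = (B ** adj2 B) $ 1 $ 2] (mod int m)"
      "[(A ** adj2 B) $ 2 $ 1 = (B ** adj2 B) $ 2 $ 1] (mod int m)" "[(A ** adj2 B) $ 2 $ 2 = (B ** adj2 B) $ 2 $ 2] (mod int m)"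
      unfolding mult2_nth by (intro cong_add cong_mult c cong_refl)+
    then have "A ** adj2 B \<in> Gpm m"
      using A B(1) by (simp add: Gpm_def pcs_iff del: mult2_nth)
    moreover have "A = (A ** adj2 B) ** B"
      using B(1) by (simp flip: matrix_mul_assoc)
    ultimately show ?thesis
      using B(3) by blast
  qed
  ultimately show ?thesis
    using that by blast
qed

text \<open>
  Holomorphic functions of weight 0 whose absolute value is invariant under \<open>\<Gamma>(m)\<close>, with order at
  least \<open>\<kappa>\<close> at all cusps (\<open>m\<kappa>\<close> in terms of \<open>q\<close>) and local exponents in \<open>\<kappa> + (1/m)\<int>\<close>.
\<close>

definition mform :: "nat \<Rightarrow> real \<Rightarrow> (complex \<Rightarrow> complex) \<Rightarrow> bool" where
  "mform m \<kappa> f \<longleftrightarrow> f holomorphic_on upper_half_plane \<and>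
     (\<forall>g\<in>Gpm m. \<forall>z\<in>upper_half_plane. norm (f (lin_frac g z)) = norm (f z)) \<and>
     (\<forall>A\<in>SL2Z. \<exists>G. G holomorphic_on ball 0 1 \<and>
        (\<forall>z\<in>upper_half_plane. f (lin_frac A z) = qexp (of_real \<kappa> * z) * G (qexp (z / of_nat m))))"

lemma uhp_div_of_nat [simp]: "m > 0 \<Longrightarrow> z \<in> upper_half_plane \<Longrightarrow> z / of_nat m \<in> upper_half_plane"
  by (simp add: mem_uhp)

lemma qexp_div_in_ball [simp]: "m > 0 \<Longrightarrow> z \<in> upper_half_plane \<Longrightarrow> norm (qexp (z / of_nat m)) < 1"
  by (rule norm_qexp_less_1) simp

lemma disc_continuous:
  assumes "G holomorphic_on ball 0 1" "norm q < 1"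
  shows "isCont G q"
  using assms holomorphic_on_imp_continuous_on[OF assms(1)] continuous_on_eq_continuous_at[of "ball 0 1" G] by auto

lemma cusp_expansion_unique:
  assumes m: "m > 0" and G: "G holomorphic_on ball 0 1" "G' holomorphic_on ball 0 1"
    and eq: "\<And>z. z \<in> upper_half_plane \<Longrightarrow> G (qexp (z / of_nat m)) = G' (qexp (z / of_nat m))"
    and q: "norm q < 1"
  shows "G q = G' q"
proof (cases "q = 0")
  case True
  have "isCont (\<lambda>q. G q - G' q) 0"
    using disc_continuous G by (intro continuous_intros) auto
  then have "G 0 - G' 0 = 0"
    by (rule continuous_at_cusp[OF _ _ m]) (use eq in simp)
  then show ?thesis
    using True by simp
next
  case False
  then show ?thesis
    using eq[OF cusp_log(1)[OF m False q]] cusp_log(2)[OF m False q] by simp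
qed

text \<open>Finitely many discs |q| \<le> \<open>r0\<close> cover the compactified curve, so |f| has
  a maximum on it. If it is attained in the half-plane, or at q = 0 with \<kappa> = 0, the maximum
  principle gives constancy; if at q = 0 with \<kappa> > 0, its value is 0.\<close>

theorem mform_constant:
  assumes m: "m > 0" and f: "mform m \<kappa> f" and \<kappa>: "\<kappa> \<ge> 0"
  obtains c where "\<And>z. z \<in> upper_half_plane \<Longrightarrow> f z = c" "\<kappa> > 0 \<Longrightarrow> c = 0"
proof -
  have hol: "f holomorphic_on upper_half_plane"
    and inv: "\<And>g z. g \<in> Gpm m \<Longrightarrow> z \<in> upper_half_plane \<Longrightarrow> norm (f (lin_frac g z)) = norm (f z)"
    using f by (auto simp: mform_def)
  define P where "P A G \<longleftrightarrow> G holomorphic_on ball 0 1 \<and>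
      (\<forall>z\<in>upper_half_plane. f (lin_frac A z) = qexp (of_real \<kappa> * z) * G (qexp (z / of_nat m)))" for A G
  have "\<forall>A\<in>SL2Z. \<exists>G. P A G"
    using f unfolding P_def mform_def by (elim conjE)
  then obtain G where "\<forall>A\<in>SL2Z. P A (G A)"
    by (rule bchoice[THEN exE])
  then have G: "\<And>A. A \<in> SL2Z \<Longrightarrow> G A holomorphic_on ball 0 1"
    "\<And>A z. A \<in> SL2Z \<Longrightarrow> z \<in> upper_half_plane \<Longrightarrow> f (lin_frac A z) = qexp (of_real \<kappa> * z) * G A (qexp (z / of_nat m))"
    unfolding P_def by blast+
  \<comment> \<open>|f| in the chart at the cusp of A. The case distinction is due to
    \<open>0 powr 0 = 0\<close>: for \<kappa> = 0 the factor has to be 1 also at q = 0.\<close>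
  define M where "M A q = (if \<kappa> = 0 then 1 else norm q powr (\<kappa> * real m)) * norm (G A q)" for A q
  have fM: "norm (f (lin_frac A z)) = M A (qexp (z / of_nat m))" if "A \<in> SL2Z" "z \<in> upper_half_plane" for A z
  proof -
    have "norm (qexp (of_real \<kappa> * z)) = (if \<kappa> = 0 then 1 else norm (qexp (z / of_nat m)) powr (\<kappa> * real m))"
      using m by (simp add: norm_qexp exp_powr_real)
    then show ?thesis
      by (simp add: G(2)[OF that] M_def norm_mult)
  qed
  obtain X where X: "finite X" "X \<subseteq> SL2Z" "\<And>A. A \<in> SL2Z \<Longrightarrow> \<exists>B\<in>X. \<exists>g\<in>Gpm m. A = g ** B"
    using finite_coset_representatives[OF m] by blast
  \<comment> \<open>The value of |e(z/m)| at height Im z = 1/2, the bound from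
    \<open>fundamental_domain\<close>.\<close>
  define r0 where "r0 = exp (- pi / real m)"
  have r0: "0 < r0" "r0 < 1"
    using m by (simp_all add: r0_def)
  have "\<exists>q\<in>cball 0 r0. \<forall>q'\<in>cball 0 r0. M A q' \<le> M A q" if "A \<in> X" for A
  proof -
    have "continuous_on (cball 0 r0) (G A)"
    proof (rule holomorphic_on_imp_continuous_on, rule holomorphic_on_subset)
      show "G A holomorphic_on ball 0 1"
        using that X(2) by (intro G(1)) blast
      show "cball 0 r0 \<subseteq> ball (0 :: complex) 1"
        using r0 by (auto simp: dist_norm)
    qed
    moreover have "continuous_on (cball 0 r0) (\<lambda>q :: complex. if \<kappa> = 0 then 1 else norm q powr (\<kappa> * real m))"
      using \<kappa> m by (cases "\<kappa> = 0") (auto intro!: continuous_on_powr' continuous_on_norm continuous_on_id continuous_on_const)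
    ultimately have "continuous_on (cball 0 r0) (M A)"
      unfolding M_def[abs_def] by (intro continuous_on_mult continuous_on_norm)
    then show ?thesis
      using r0 by (intro continuous_attains_sup) auto
  qed
  then obtain Q where Q: "\<And>A. A \<in> X \<Longrightarrow> Q A \<in> cball 0 r0"
    "\<And>A q'. A \<in> X \<Longrightarrow> q' \<in> cball 0 r0 \<Longrightarrow> M A q' \<le> M A (Q A)"
    using bchoice[of X "\<lambda>A q. q \<in> cball 0 r0 \<and> (\<forall>q'\<in>cball 0 r0. M A q' \<le> M A q)"] by blast
  have "X \<noteq> {}"
    using X(3)[OF SL2Z_one] by auto
  then obtain A0 where A0: "A0 \<in> X" "\<And>A. A \<in> X \<Longrightarrow> M A (Q A) \<le> M A0 (Q A0)"
  proof -
    have "Max ((\<lambda>A. M A (Q A)) ` X) \<in> (\<lambda>A. M A (Q A)) ` X"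
      using X(1) \<open>X \<noteq> {}\<close> by (intro Max_in) auto
    then obtain A where A: "A \<in> X" "Max ((\<lambda>A. M A (Q A)) ` X) = M A (Q A)"
      by auto
    have "M B (Q B) \<le> M A (Q A)" if "B \<in> X" for B
      using X(1) that unfolding A(2) [symmetric] by (intro Max_ge) auto
    then show thesis
      using that A(1) by blast
  qed
  define q0 M0 where "q0 = Q A0" and "M0 = M A0 q0"
  have A0': "A0 \<in> SL2Z"
    using A0(1) X(2) by blast
  have bound: "norm (f z) \<le> M0" if z: "z \<in> upper_half_plane" for z
  proof -
    obtain C where C: "C \<in> SL2Z" "1 / 2 < Im (lin_frac C z)"
      using fundamental_domain[OF z] by blast
    define w where "w = lin_frac C z"
    have w: "w \<in> upper_half_plane"
      using C z by (simp add: w_def)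
    obtain B g where B: "B \<in> X" "g \<in> Gpm m" "adj2 C = g ** B"
      using X(3)[of "adj2 C"] C by auto
    have B': "B \<in> SL2Z"
      using B X by blast
    have "z = lin_frac (g ** B) w"
      using C z B by (simp add: w_def flip: B(3))
    then have "norm (f z) = norm (f (lin_frac B w))"
      using inv[OF B(2), of "lin_frac B w"] B' w by (simp add: lin_frac_mult)
    also have "\<dots> = M B (qexp (w / of_nat m))"
      using fM B' w by simp
    also have "norm (qexp (w / of_nat m)) \<le> r0"
      using m C by (simp add: r0_def norm_qexp w_def [symmetric] field_simps)
    then have "M B (qexp (w / of_nat m)) \<le> M B (Q B)"
      using Q(2)[OF B(1)] by simp
    also have "\<dots> \<le> M0"
      using A0(2)[OF B(1)] by (simp add: M0_def q0_def)
    finally show ?thesis .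
  qed
  have "norm q0 < 1"
    using Q(1)[OF A0(1)] r0 by (simp add: q0_def)
  have "f constant_on upper_half_plane"
  proof (cases "q0 = 0")
    case False
    define z0 where "z0 = cusp_log m q0"
    have z0: "z0 \<in> upper_half_plane" "qexp (z0 / of_nat m) = q0"
      using cusp_log[OF m False \<open>norm q0 < 1\<close>] by (simp_all add: z0_def)
    have "norm (f (lin_frac A0 z0)) = M0"
      using fM[OF A0' z0(1)] z0(2) by (simp add: M0_def)
    then show ?thesis
      using bound A0' z0(1)
      by (intro maximum_modulus_principle[OF hol open_uhp connected_uhp open_uhp order_refl, of "lin_frac A0 z0"]) auto
  next
    case q0: True
    show ?thesis
    proof (cases "\<kappa> = 0")
      case False
      then have "M0 = 0"
        using m by (simp add: M0_def M_def q0)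
      then show ?thesis
        using bound unfolding constant_on_def by (metis norm_le_zero_iff)
    next
      case True
      have "norm (G A0 q) \<le> norm (G A0 0)" if "q \<in> ball 0 1" for q
      proof (cases "q = 0")
        case False
        have q: "norm q < 1"
          using that by simp
        have "norm (G A0 q) = M A0 q"
          by (simp add: M_def True)
        also have "\<dots> = norm (f (lin_frac A0 (cusp_log m q)))"
          using fM[OF A0' cusp_log(1)[OF m False q]] cusp_log(2)[OF m False q] by simp
        also have "\<dots> \<le> M0"
          using A0' cusp_log(1)[OF m False q] by (intro bound) simp
        finally show ?thesis
          by (simp add: M0_def M_def q0 True)
      qed simp
      then have "G A0 constant_on ball 0 1"
        using G(1)[OF A0'] by (intro maximum_modulus_principle[of "G A0" "ball 0 1" "ball 0 1" 0]) auto
      then obtain c where c: "\<And>q. norm q < 1 \<Longrightarrow> G A0 q = c"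
        by (auto simp: constant_on_def)
      have "f z = c" if z: "z \<in> upper_half_plane" for z
        using G(2)[OF A0', of "lin_frac (adj2 A0) z"] A0' z c m by (simp add: True)
      then show ?thesis
        by (auto simp: constant_on_def)
    qed
  qed
  then obtain c where c: "\<And>z. z \<in> upper_half_plane \<Longrightarrow> f z = c"
    by (auto simp: constant_on_def)
  \<comment> \<open>Along z = im(k+1) the factor e(\<kappa>z) tends to 0 while the value of G
    converges.\<close>
  moreover have "c = 0" if "\<kappa> > 0"
  proof -
    have G1: "isCont (G (mat 1)) 0"
      using disc_continuous[OF G(1)[OF SL2Z_one]] by simp
    have "(\<lambda>k. qexp (of_nat k * \<i>)) \<longlonglongrightarrow> 0"
      unfolding qexp_of_nat_mult by (rule LIMSEQ_power_zero) (simp add: norm_qexp_less_1 mem_uhp)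
    then have 1: "(\<lambda>k. G (mat 1) (qexp (of_nat k * \<i>))) \<longlonglongrightarrow> G (mat 1) 0"
      by (rule isCont_tendsto_compose[OF G1])
    have "(\<lambda>k. qexp (of_real (\<kappa> * real m) * \<i>) ^ k) \<longlonglongrightarrow> 0"
      using m that by (intro LIMSEQ_power_zero) (simp add: norm_qexp)
    from tendsto_mult[OF this 1]
    have "(\<lambda>k. qexp (of_real (\<kappa> * real m) * \<i>) ^ Suc k * G (mat 1) (qexp (of_nat (Suc k) * \<i>))) \<longlonglongrightarrow> 0"
      using LIMSEQ_Suc by fastforce
    moreover have "qexp (of_real (\<kappa> * real m) * \<i>) ^ Suc k * G (mat 1) (qexp (of_nat (Suc k) * \<i>)) = c" for k
    proof -
      define w where "w = of_nat m * (of_nat (Suc k) * \<i>)"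
      have w: "w \<in> upper_half_plane"
        using m by (simp add: w_def mem_uhp)
      have "of_real \<kappa> * w = of_nat (Suc k) * (of_real (\<kappa> * real m) * \<i>)"
        by (simp add: w_def mult_ac)
      then have "qexp (of_real \<kappa> * w) = qexp (of_real (\<kappa> * real m) * \<i>) ^ Suc k"
        by (simp only: qexp_of_nat_mult)
      moreover have "w / of_nat m = of_nat (Suc k) * \<i>"
        using m by (simp add: w_def)
      ultimately show ?thesis
        using G(2)[OF SL2Z_one w] c[OF w] by simp
    qed
    ultimately show ?thesis
      by (simp only: LIMSEQ_const_iff)
  qed
  ultimately show ?thesis
    using that by blast
qed

lemma mform_const_ex:
  assumes "m > 0" "mform m \<kappa> f" "\<kappa> \<ge> 0"
  shows "\<exists>c. \<forall>z\<in>upper_half_plane. f z = c"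
proof (rule mform_constant[OF assms])
  fix c assume "\<And>z. z \<in> upper_half_plane \<Longrightarrow> f z = c"
  then show ?thesis
    by blast
qed

lemma mform_zero:
  assumes "m > 0" "mform m \<kappa> f" "\<kappa> > 0"
  shows "\<forall>z\<in>upper_half_plane. f z = 0"
proof (rule mform_constant[OF assms(1,2)])
  show "0 \<le> \<kappa>"
    using assms(3) by simp
  fix c assume "\<And>z. z \<in> upper_half_plane \<Longrightarrow> f z = c" "\<kappa> > 0 \<Longrightarrow> c = 0"
  then show ?thesis
    using assms(3) by simp
qed

text \<open>
  \<open>U\<^sub>1\<close>, \<open>U\<^sub>2\<close> are \<open>\<eta>\<^sup>2\<close> times the solutions with exponents \<open>\<plusminus>n/(2m)\<close>, and \<open>\<kappa>\<close> is the smaller of the two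
  resulting exponents at the cusp.
\<close>

locale modular_pair =
  fixes m n :: nat and \<kappa> :: real and U1 U2 p0 p2 :: "complex \<Rightarrow> complex"
  assumes m: "2 \<le> m" "m \<le> 5" and n: "n > 0"
    and p0_hol: "p0 holomorphic_on ball 0 1" and p2_hol: "p2 holomorphic_on ball 0 1"
    and p0_0: "p0 0 = 1" and p2_0: "p2 0 = 1"
    and U1_eq: "z \<in> upper_half_plane \<Longrightarrow>
      U1 z = qexp (of_real \<kappa> * z) * (qexp (z / of_nat m) ^ n * p0 (qexp (z / of_nat m)))"
    and U2_eq: "z \<in> upper_half_plane \<Longrightarrow> U2 z = qexp (of_real \<kappa> * z) * p2 (qexp (z / of_nat m))"
    and wronskian_nonzero: "z \<in> upper_half_plane \<Longrightarrow> wronskian U1 U2 z \<noteq> 0"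
    and kappa: "\<kappa> = 1 / 12 - real n / (2 * real m)"
    and U_transl: "\<exists>a b. norm a = 1 \<and> norm b = 1 \<and>
      (\<forall>z\<in>upper_half_plane. U1 (z + of_int k) = a * U1 z \<and> U2 (z + of_int k) = b * U2 z)"
    and U_inversion: "\<exists>a b c d. norm (a * d - b * c) = 1 \<and>
      (\<forall>z\<in>upper_half_plane. U1 (- 1 / z) = a * U1 z + b * U2 z \<and> U2 (- 1 / z) = c * U1 z + d * U2 z)"
begin

lemma m_pos: "m > 0"
  using m by simp

definition p1 :: "complex \<Rightarrow> complex" where
  "p1 q = q ^ n * p0 q"

lemma p1_hol: "p1 holomorphic_on ball 0 1"
  unfolding p1_def by (intro holomorphic_intros p0_hol)

lemma p1_0 [simp]: "p1 0 = 0"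
  using n by (simp add: p1_def)

lemma U1_hol: "U1 holomorphic_on upper_half_plane"
proof -
  have "(p1 \<circ> (\<lambda>z. qexp (z / of_nat m))) holomorphic_on upper_half_plane"
    using m_pos by (intro holomorphic_on_compose_gen[OF _ p1_hol] holomorphic_intros) auto
  then have "(\<lambda>z. qexp (of_real \<kappa> * z) * (p1 \<circ> (\<lambda>z. qexp (z / of_nat m))) z) holomorphic_on upper_half_plane"
    by (intro holomorphic_intros)
  then show ?thesis
    by (rule holomorphic_transform) (simp add: U1_eq p1_def)
qed

lemma U2_hol: "U2 holomorphic_on upper_half_plane"
proof -
  have "(p2 \<circ> (\<lambda>z. qexp (z / of_nat m))) holomorphic_on upper_half_plane"
    using m_pos by (intro holomorphic_on_compose_gen[OF _ p2_hol] holomorphic_intros) auto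
  then have "(\<lambda>z. qexp (of_real \<kappa> * z) * (p2 \<circ> (\<lambda>z. qexp (z / of_nat m))) z) holomorphic_on upper_half_plane"
    by (intro holomorphic_intros)
  then show ?thesis
    by (rule holomorphic_transform) (simp add: U2_eq)
qed

lemma U_DERIV:
  assumes "z \<in> upper_half_plane"
  shows "(U1 has_field_derivative deriv U1 z) (at z)" "(U2 has_field_derivative deriv U2 z) (at z)"
  using holomorphic_derivI[OF U1_hol open_uhp assms] holomorphic_derivI[OF U2_hol open_uhp assms] by auto

lemma U_independent:
  assumes "\<And>z. z \<in> upper_half_plane \<Longrightarrow> a * U1 z + b * U2 z = 0"
  shows "a = 0" "b = 0"
proof -
  define d1 d2 where "d1 = deriv U1 \<i>" and "d2 = deriv U2 \<i>"
  have D: "((\<lambda>z. a * U1 z + b * U2 z) has_field_derivative a * d1 + b * d2) (at \<i>)"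
    unfolding d1_def d2_def by (intro DERIV_add DERIV_cmult U_DERIV ii_in_uhp)
  have 1: "a * d1 + b * d2 = 0"
    by (rule has_field_derivative_eq_on_open[OF open_uhp ii_in_uhp _ D, of "\<lambda>_. 0"]) (use assms in auto)
  have 2: "a * U1 \<i> + b * U2 \<i> = 0"
    using assms by simp
  have w: "d1 * U2 \<i> - U1 \<i> * d2 \<noteq> 0"
    using wronskian_nonzero[OF ii_in_uhp] by (simp add: wronskian_def d1_def d2_def)
  have "a * (d1 * U2 \<i> - U1 \<i> * d2) = (a * d1 + b * d2) * U2 \<i> - (a * U1 \<i> + b * U2 \<i>) * d2"
    by (simp add: algebra_simps)
  then show "a = 0"
    using w 1 2 by simp
  have "b * (d1 * U2 \<i> - U1 \<i> * d2) = d1 * (a * U1 \<i> + b * U2 \<i>) - U1 \<i> * (a * d1 + b * d2)"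
    by (simp add: algebra_simps)
  then show "b = 0"
    using w 1 2 by simp
qed

text \<open>
  Row convention: \<open>\<rho>\<close> is multiplicative in the order of \<open>lin_frac\<close>.
\<close>

definition rho :: "int ^ 2 ^ 2 \<Rightarrow> complex \<Rightarrow> complex \<Rightarrow> complex \<Rightarrow> complex \<Rightarrow> bool" where
  "rho A a b c d \<longleftrightarrow> norm (a * d - b * c) = 1 \<and> (\<forall>z\<in>upper_half_plane.
     U1 (lin_frac A z) = a * U1 z + b * U2 z \<and> U2 (lin_frac A z) = c * U1 z + d * U2 z)"

lemma rhoD:
  assumes "rho A a b c d"
  shows "norm (a * d - b * c) = 1"
    and "z \<in> upper_half_plane \<Longrightarrow> U1 (lin_frac A z) = a * U1 z + b * U2 z"
    and "z \<in> upper_half_plane \<Longrightarrow> U2 (lin_frac A z) = c * U1 z + d * U2 z"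
  using assms by (auto simp: rho_def)

lemma rho_det: "rho A a b c d \<Longrightarrow> a * d - b * c \<noteq> 0"
  using rhoD(1) by fastforce

lemma rho_mult:
  assumes A: "rho A a b c d" and B: "rho B a' b' c' d'" "B \<in> SL2Z"
  shows "rho (A ** B) (a * a' + b * c') (a * b' + b * d') (c * a' + d * c') (c * b' + d * d')"
  unfolding rho_def
proof (intro conjI ballI)
  have "(a * a' + b * c') * (c * b' + d * d') - (a * b' + b * d') * (c * a' + d * c') =
      (a * d - b * c) * (a' * d' - b' * c')"
    by (simp add: algebra_simps)
  then show "norm ((a * a' + b * c') * (c * b' + d * d') - (a * b' + b * d') * (c * a' + d * c')) = 1"
    using rhoD(1)[OF A] rhoD(1)[OF B(1)] by (simp add: norm_mult)
  fix z assume z: "z \<in> upper_half_plane"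
  then have Bz: "lin_frac B z \<in> upper_half_plane"
    using B(2) by simp
  show "U1 (lin_frac (A ** B) z) = (a * a' + b * c') * U1 z + (a * b' + b * d') * U2 z"
    "U2 (lin_frac (A ** B) z) = (c * a' + d * c') * U1 z + (c * b' + d * d') * U2 z"
    unfolding lin_frac_mult[OF B(2) z] rhoD(2,3)[OF A Bz] rhoD(2,3)[OF B(1) z] by (simp_all add: algebra_simps)
qed

lemma rho_transl: "\<exists>a d. rho (transl k) a 0 0 d"
proof -
  obtain a b where "norm a = 1" "norm b = 1"
    "\<forall>z\<in>upper_half_plane. U1 (z + of_int k) = a * U1 z \<and> U2 (z + of_int k) = b * U2 z"
    using U_transl by blast
  then have "rho (transl k) a 0 0 b"
    by (simp add: rho_def norm_mult)
  then show ?thesis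
    by blast
qed

lemma rho_exists:
  assumes "A \<in> SL2Z"
  obtains a b c d where "rho A a b c d"
proof -
  have "\<exists>a b c d. rho A a b c d"
    using assms
  proof (induction A rule: SL2Z_induct)
    case (transl k)
    then show ?case
      using rho_transl by blast
  next
    case (mult_transl A k)
    then show ?case
      using rho_transl[of k] rho_mult by meson
  next
    case (mult_inversion A)
    have "\<exists>a b c d. rho inversion a b c d"
      using U_inversion by (simp add: rho_def)
    then show ?case
      using mult_inversion rho_mult by meson
  qed
  then show ?thesis
    using that by blast
qed

lemma rho_unique:
  assumes "rho A a b c d" "rho A a' b' c' d'"
  shows "a = a'" "b = b'" "c = c'" "d = d'"
proof -
  have "(a - a') * U1 z + (b - b') * U2 z = 0" "(c - c') * U1 z + (d - d') * U2 z = 0" if "z \<in> upper_half_plane" for z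
    using rhoD(2,3)[OF assms(1) that] rhoD(2,3)[OF assms(2) that] by (simp_all add: algebra_simps)
  from U_independent[OF this(1)] U_independent[OF this(2)]
  show "a = a'" "b = b'" "c = c'" "d = d'"
    by auto
qed

lemma rho_one: "rho (mat 1) 1 0 0 1"
  by (simp add: rho_def)

text \<open>The kernel of the projective action on the space spanned by \<open>U1\<close> and
  \<open>U2\<close>; being normal, it is accessible to \<open>Gpm_subset_normal\<close>.\<close>

definition scalars :: "(int ^ 2 ^ 2) set" where
  "scalars = {A \<in> SL2Z. \<exists>\<sigma>. rho A \<sigma> 0 0 \<sigma>}"

lemma sl2_normal_scalars: "sl2_normal scalars"
  unfolding sl2_normal_def
proof (intro conjI ballI subsetI)
  show "A \<in> SL2Z" if "A \<in> scalars" for A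
    using that by (simp add: scalars_def)
  show "mat 1 \<in> scalars"
    using rho_one by (auto simp: scalars_def)
  show "A ** B \<in> scalars" if AB: "A \<in> scalars" "B \<in> scalars" for A B
  proof -
    obtain \<sigma> \<mu> where "rho A \<sigma> 0 0 \<sigma>" "rho B \<mu> 0 0 \<mu>" "A \<in> SL2Z" "B \<in> SL2Z"
      using AB by (auto simp: scalars_def)
    then have "rho (A ** B) (\<sigma> * \<mu>) 0 0 (\<sigma> * \<mu>)"
      using rho_mult[of A \<sigma> 0 0 \<sigma> B \<mu> 0 0 \<mu>] by simp
    then show ?thesis
      using \<open>A \<in> SL2Z\<close> \<open>B \<in> SL2Z\<close> by (auto simp: scalars_def)
  qed
  show "adj2 A \<in> scalars" if A: "A \<in> scalars" for A
  proof -
    obtain \<sigma> where l: "rho A \<sigma> 0 0 \<sigma>" "A \<in> SL2Z"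
      using A by (auto simp: scalars_def)
    obtain a b c d where B: "rho (adj2 A) a b c d"
      using rho_exists[OF SL2Z_adj[OF l(2)]] .
    have "rho (mat 1) (a * \<sigma>) (b * \<sigma>) (c * \<sigma>) (d * \<sigma>)"
      using rho_mult[OF B l] l(2) by simp
    from rho_unique[OF this rho_one] have *: "a * \<sigma> = 1" "b * \<sigma> = 0" "c * \<sigma> = 0" "d * \<sigma> = 1"
      by auto
    then have "\<sigma> \<noteq> 0"
      by auto
    with * have "b = 0" "c = 0" "d = a"
      using mult_right_cancel[of \<sigma> d a] by simp_all
    then show ?thesis
      using B l(2) by (auto simp: scalars_def)
  qed
  show "B ** A ** adj2 B \<in> scalars" if A: "A \<in> scalars" and B: "B \<in> SL2Z" for A B
  proof -
    obtain \<sigma> where l: "rho A \<sigma> 0 0 \<sigma>" "A \<in> SL2Z"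
      using A by (auto simp: scalars_def)
    obtain a b c d where b: "rho B a b c d"
      using rho_exists[OF B] .
    obtain a' b' c' d' where b': "rho (adj2 B) a' b' c' d'"
      using rho_exists[OF SL2Z_adj[OF B]] .
    have "rho (B ** adj2 B) (a * a' + b * c') (a * b' + b * d') (c * a' + d * c') (c * b' + d * d')"
      using rho_mult[OF b b'] B by simp
    then have *: "a * a' + b * c' = 1" "a * b' + b * d' = 0" "c * a' + d * c' = 0" "c * b' + d * d' = 1"
      using rho_unique[OF _ rho_one] B by auto
    have BA: "rho (B ** A) (\<sigma> * a) (\<sigma> * b) (\<sigma> * c) (\<sigma> * d)"
      using rho_mult[OF b l] by (simp add: mult.commute)
    have "rho (B ** A ** adj2 B) (\<sigma> * (a * a' + b * c')) (\<sigma> * (a * b' + b * d')) (\<sigma> * (c * a' + d * c')) (\<sigma> * (c * b' + d * d'))"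
      using rho_mult[OF BA b'] B by (simp add: algebra_simps)
    then show ?thesis
      using * B l(2) by (auto simp: scalars_def)
  qed
qed

lemma Gpm_scalar:
  assumes "g \<in> Gpm m"
  obtains \<sigma> where "norm \<sigma> = 1" "rho g \<sigma> 0 0 \<sigma>"
proof -
  have "qexp ((z + of_nat m) / of_nat m) = qexp (z / of_nat m)" for z
    using m qexp_translation[of "z / of_nat m" 1] by (simp add: add_divide_distrib)
  moreover have "z + of_nat m \<in> upper_half_plane" if "z \<in> upper_half_plane" for z
    using that by (simp add: mem_uhp)
  moreover have "norm (qexp (of_real (\<kappa> * real m))) = 1"
    by (simp add: norm_qexp)
  ultimately have "rho (transl (int m)) (qexp (of_real (\<kappa> * real m))) 0 0 (qexp (of_real (\<kappa> * real m)))"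
    by (simp add: rho_def U1_eq U2_eq norm_mult distrib_left qexp_add)
  moreover have "rho (- mat 1) 1 0 0 1"
    by (simp add: rho_def)
  ultimately have "transl (int m) \<in> scalars" "- mat 1 \<in> scalars"
    by (auto simp: scalars_def)
  then have "g \<in> scalars"
    using Gpm_subset_normal[OF m sl2_normal_scalars] assms by blast
  then obtain \<sigma> where l: "rho g \<sigma> 0 0 \<sigma>"
    by (auto simp: scalars_def)
  \<comment> \<open>The square of \<sigma> is the determinant of the transformation, which has
    absolute value 1 by construction of \<open>rho\<close>.\<close>
  have "norm \<sigma> * norm \<sigma> = 1"
    using rhoD(1)[OF l] by (simp add: norm_mult)
  then have "norm \<sigma> = 1"
    by (metis norm_ge_zero abs_of_nonneg abs_1 mult_1 power2_eq_square real_sqrt_abs real_sqrt_one)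
  then show ?thesis
    using l that by blast
qed

definition lin :: "complex \<Rightarrow> complex \<Rightarrow> complex \<Rightarrow> complex" where
  "lin a b z = a * U1 z + b * U2 z"

lemma lin_hol: "lin a b holomorphic_on upper_half_plane"
  unfolding lin_def by (intro holomorphic_intros U1_hol U2_hol)

lemma lin_rho:
  assumes "rho A a b c d" "z \<in> upper_half_plane"
  shows "lin x y (lin_frac A z) = lin (x * a + y * c) (x * b + y * d) z"
  unfolding lin_def rhoD(2,3)[OF assms] by (simp add: algebra_simps)

lemma lin_expansion:
  assumes "z \<in> upper_half_plane"
  shows "lin a b z = qexp (of_real \<kappa> * z) * (a * p1 (qexp (z / of_nat m)) + b * p2 (qexp (z / of_nat m)))"
  by (simp add: lin_def U1_eq[OF assms] U2_eq[OF assms] p1_def algebra_simps)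

lemma mform_lin: "mform m \<kappa> (lin a b)"
  unfolding mform_def
proof (intro conjI ballI lin_hol)
  fix g z assume g: "g \<in> Gpm m" and z: "z \<in> upper_half_plane"
  obtain \<sigma> where l: "norm \<sigma> = 1" "rho g \<sigma> 0 0 \<sigma>"
    using Gpm_scalar[OF g] .
  have "lin a b (lin_frac g z) = \<sigma> * lin a b z"
    using lin_rho[OF l(2) z] by (simp add: lin_def algebra_simps)
  then show "norm (lin a b (lin_frac g z)) = norm (lin a b z)"
    using l(1) by (simp add: norm_mult)
next
  fix A assume "A \<in> SL2Z"
  then obtain \<alpha> \<beta> \<gamma> \<delta> where r: "rho A \<alpha> \<beta> \<gamma> \<delta>"
    using rho_exists by blast
  show "\<exists>G. G holomorphic_on ball 0 1 \<and> (\<forall>z\<in>upper_half_plane. lin a b (lin_frac A z) =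
      qexp (of_real \<kappa> * z) * G (qexp (z / of_nat m)))"
    using lin_rho[OF r] lin_expansion
    by (intro exI[of _ "\<lambda>q. (a * \<alpha> + b * \<gamma>) * p1 q + (a * \<beta> + b * \<delta>) * p2 q"] conjI holomorphic_intros p1_hol p2_hol) auto
qed

lemma lin_eq_0_iff: "(\<forall>z\<in>upper_half_plane. lin a b z = 0) \<longleftrightarrow> a = 0 \<and> b = 0"
  using U_independent[of a b] by (auto simp: lin_def)

end

section \<open>The case n = 1: \<open>U1\<close> has no zeros\<close>

text \<open>Holomorphic functions on a connected open set have no zero divisors: where one factor is
  nonzero, the product of the others vanishes on an open set, hence everywhere.\<close>

lemma holomorphic_prod_zero:
  assumes "finite I" "open S" "connected S" "S \<noteq> {}" "\<And>i. i \<in> I \<Longrightarrow> f i holomorphic_on S"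
    and "\<And>z. z \<in> S \<Longrightarrow> (\<Prod>i\<in>I. f i z) = 0"
  shows "\<exists>i\<in>I. \<forall>z\<in>S. f i z = (0 :: complex)"
  using assms(1,5,6)
proof (induction I rule: finite_induct)
  case empty
  then show ?case
    using assms(4) by auto
next
  case (insert i I)
  show ?case
  proof (cases "\<forall>z\<in>S. f i z = 0")
    case False
    then obtain z0 where z0: "z0 \<in> S" "f i z0 \<noteq> 0"
      by blast
    have cont: "continuous_on S (f i)"
      using insert.prems(1) holomorphic_on_imp_continuous_on by blast
    define V where "V = {z \<in> S. f i z \<noteq> 0}"
    have "open V"
    proof -
      have "open (S \<inter> f i -` (- {0}))"
        using cont assms(2) by (intro continuous_open_preimage) auto
      moreover have "S \<inter> f i -` (- {0}) = V"
        by (auto simp: V_def)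
      ultimately show ?thesis
        by simp
    qed
    have "(\<Prod>i\<in>I. f i z) = 0" if "z \<in> S" for z
    proof (rule analytic_continuation_open[where s = V and s' = S and f = "\<lambda>z. \<Prod>i\<in>I. f i z" and g = "\<lambda>_. 0"])
      show "(\<lambda>z. \<Prod>i\<in>I. f i z) holomorphic_on S"
        using insert.prems(1) by (intro holomorphic_on_prod) auto
      show "(\<Prod>i\<in>I. f i z) = 0" if "z \<in> V" for z
        using insert.prems(2)[of z] insert.hyps that by (simp add: V_def)
    qed (use \<open>open V\<close> assms z0 that in \<open>auto simp: V_def\<close>)
    then show ?thesis
      using insert.IH insert.prems(1) by blast
  qed blast
qed

text \<open>For n = 1 the exponents of \<open>U1\<close> and \<open>U2\<close> differ by exactly one
  power of q = e(z/m), so that their quotient is a local coordinate at the cusp.\<close>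

locale modular_pair1 = modular_pair +
  assumes n_eq_1: "n = 1"
begin

lemma kappa1: "\<kappa> = 1 / 12 - 1 / (2 * real m)"
  using kappa by (simp add: n_eq_1)

lemma p1_eq: "p1 q = q * p0 q"
  by (subst p1_def) (simp only: n_eq_1 power_one_right)

lemma kappa_neg: "\<kappa> < 0"
  using m by (simp add: kappa1 field_simps)

text \<open>There are 12/(6-m) cusps, and \<kappa> = -(6-m)/(12m).\<close>

lemma card_kappa: "real (card (cusp_vectors m)) * \<kappa> = - 1 / real m"
proof -
  have "real (card (cusp_vectors m)) * (6 - real m) = 12"
    using arg_cong[OF card_cusp_vectors[OF m], of real] m by (simp add: of_nat_diff)
  then have "real (card (cusp_vectors m)) = 12 / (6 - real m)"
    using m by (simp add: field_simps)
  then show ?thesis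
    using m by (simp add: kappa1 field_simps)
qed

text \<open>
  One translate of \<open>U\<^sub>1\<close> for each cusp: at every cusp one factor has order \<open>\<kappa> + 1/m\<close>, the others have order
  at least \<open>\<kappa>\<close>, and \<open>\<nu>\<^sub>\<infinity>\<kappa> = -1/m\<close>.
\<close>

definition vprod :: "complex \<Rightarrow> complex" where
  "vprod z = (\<Prod>v\<in>cusp_vectors m. U1 (lin_frac (adj2 (cusp_mat v)) z))"

text \<open>The coefficients of U1(Az) in terms of \<open>U1\<close> and \<open>U2\<close>, unique
  by \<open>rho_unique\<close>. If the second one is 0, then U1(Az) is a multiple of
  \<open>U1\<close>.\<close>

definition cof :: "int ^ 2 ^ 2 \<Rightarrow> complex \<times> complex" where
  "cof A = (SOME (a, b). \<exists>c d. rho A a b c d)"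

lemma cof:
  assumes "rho A a b c d"
  shows "cof A = (a, b)"
  unfolding cof_def by (rule some_equality) (use assms rho_unique in \<open>auto split: prod.splits\<close>)

lemma U1_cof:
  assumes "A \<in> SL2Z" "z \<in> upper_half_plane"
  shows "U1 (lin_frac A z) = qexp (of_real \<kappa> * z) *
    (fst (cof A) * p1 (qexp (z / of_nat m)) + snd (cof A) * p2 (qexp (z / of_nat m)))"
proof -
  obtain a b c d where r: "rho A a b c d"
    using rho_exists[OF assms(1)] .
  then show ?thesis
    using rhoD(2)[OF r assms(2)] lin_expansion[OF assms(2), of a b] cof[OF r] by (simp add: lin_def)
qed

lemma cof_zero:
  assumes "g \<in> Gpm m"
  shows "snd (cof (g ** transl k)) = 0"
proof -
  obtain \<sigma> where l: "rho g \<sigma> 0 0 \<sigma>"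
    using Gpm_scalar[OF assms] by blast
  obtain a d where t: "rho (transl k) a 0 0 d"
    using rho_transl by blast
  show ?thesis
    using cof[OF rho_mult[OF l t]] by simp
qed

text \<open>Expansion of the product at the cusp of A, where v0 is the representative whose factor
  becomes a multiple of \<open>U1\<close>. The zero of p1 = q p0 in that factor has cancelled
  q^(-1), the contribution of the \<kappa>'s, so p0 remains.\<close>

definition vprod_fun :: "int ^ 2 ^ 2 \<Rightarrow> int \<times> int \<Rightarrow> complex \<Rightarrow> complex" where
  "vprod_fun A v0 q = fst (cof (adj2 (cusp_mat v0) ** A)) * p0 q * (\<Prod>v\<in>cusp_vectors m - {v0}.
     fst (cof (adj2 (cusp_mat v) ** A)) * p1 q + snd (cof (adj2 (cusp_mat v) ** A)) * p2 q)"

lemma vprod_expansion: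
  assumes A: "A \<in> SL2Z" and v0: "v0 \<in> cusp_vectors m" "snd (cof (adj2 (cusp_mat v0) ** A)) = 0"
    and z: "z \<in> upper_half_plane"
  shows "vprod (lin_frac A z) = vprod_fun A v0 (qexp (z / of_nat m))"
proof -
  define q where "q = qexp (z / of_nat m)"
  define h where "h v = fst (cof (adj2 (cusp_mat v) ** A)) * p1 q + snd (cof (adj2 (cusp_mat v) ** A)) * p2 q" for v
  have "U1 (lin_frac (adj2 (cusp_mat v)) (lin_frac A z)) = qexp (of_real \<kappa> * z) * h v" if "v \<in> cusp_vectors m" for v
    using U1_cof[of "adj2 (cusp_mat v) ** A" z] cusp_mat(1)[OF that] A z by (simp add: lin_frac_mult h_def q_def)
  then have "vprod (lin_frac A z) = (\<Prod>v\<in>cusp_vectors m. qexp (of_real \<kappa> * z) * h v)"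
    unfolding vprod_def by (intro prod.cong) auto
  also have "\<dots> = qexp (of_real \<kappa> * z) ^ card (cusp_vectors m) * (h v0 * (\<Prod>v\<in>cusp_vectors m - {v0}. h v))"
    using v0(1) by (simp add: prod.distrib prod.remove)
  also have "qexp (of_real \<kappa> * z) ^ card (cusp_vectors m) = qexp (of_real (real (card (cusp_vectors m)) * \<kappa>) * z)"
    by (simp add: mult.assoc flip: qexp_of_nat_mult)
  also have "\<dots> = inverse q"
    unfolding card_kappa q_def by (simp flip: qexp_uminus)
  also have "h v0 = q * (fst (cof (adj2 (cusp_mat v0) ** A)) * p0 q)"
    using v0(2) by (simp add: h_def p1_eq)
  finally show ?thesis
    by (simp add: vprod_fun_def h_def q_def)
qed

lemma vprod_fun_hol: "vprod_fun A v0 holomorphic_on ball 0 1"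
  unfolding vprod_fun_def by (intro holomorphic_intros p0_hol p1_hol p2_hol)

lemma mform_vprod: "mform m 0 vprod"
  unfolding mform_def
proof (intro conjI ballI)
  show "vprod holomorphic_on upper_half_plane"
    unfolding vprod_def
  proof (intro holomorphic_on_prod)
    fix v assume v: "v \<in> cusp_vectors m"
    have "U1 \<circ> lin_frac (adj2 (cusp_mat v)) holomorphic_on upper_half_plane"
      using cusp_mat(1)[OF v] by (intro holomorphic_on_compose_gen[OF _ U1_hol] holomorphic_lin_frac) auto
    then show "(\<lambda>z. U1 (lin_frac (adj2 (cusp_mat v)) z)) holomorphic_on upper_half_plane"
      by (simp add: o_def)
  qed
next
  fix g z assume g: "g \<in> Gpm m" and z: "z \<in> upper_half_plane"
  have "norm (U1 (lin_frac (adj2 (cusp_mat v)) (lin_frac g z))) = norm (U1 (lin_frac (adj2 (cusp_mat v)) z))"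
    if v: "v \<in> cusp_vectors m" for v
  proof -
    define B where "B = adj2 (cusp_mat v)"
    have B: "B \<in> SL2Z"
      using cusp_mat(1)[OF v] by (simp add: B_def)
    have g': "B ** g ** adj2 B \<in> Gpm m"
      using sl2_normal_Gpm[of m] g B by (simp add: sl2_normal_def)
    have "B ** g = (B ** g ** adj2 B) ** B"
      using B by (simp flip: matrix_mul_assoc)
    then have "lin_frac B (lin_frac g z) = lin_frac (B ** g ** adj2 B) (lin_frac B z)"
      using B Gpm_SL2Z[OF g] z by (metis lin_frac_mult)
    then show ?thesis
      using mform_lin[of 1 0] g' B z unfolding mform_def lin_def B_def [symmetric] by simp
  qed
  then show "norm (vprod (lin_frac g z)) = norm (vprod z)"
    by (simp add: vprod_def prod_norm [symmetric])
next
  fix A assume A: "A \<in> SL2Z"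
  obtain v0 g k where v0: "v0 \<in> cusp_vectors m" "g \<in> Gpm m" "A = g ** cusp_mat v0 ** transl k"
    using cusp_decomposition[OF m sl2_normal_Gpm Gpm_contains A] .
  \<comment> \<open>The factor of v0 is U1(BAz), and BA is an element of \<plusminus>\<Gamma>(m)
    times a translation; both multiply \<open>U1\<close> by constants.\<close>
  define B where "B = adj2 (cusp_mat v0)"
  have B: "B \<in> SL2Z" "cusp_mat v0 = adj2 B"
    using cusp_mat(1)[OF v0(1)] by (simp_all add: B_def)
  have "B ** g ** adj2 B \<in> Gpm m"
    using sl2_normal_Gpm[of m] v0(2) B by (simp add: sl2_normal_def)
  moreover have "B ** A = (B ** g ** adj2 B) ** transl k"
    using B by (simp add: v0(3) matrix_mul_assoc)
  ultimately have "snd (cof (B ** A)) = 0"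
    using cof_zero by simp
  then show "\<exists>G. G holomorphic_on ball 0 1 \<and> (\<forall>z\<in>upper_half_plane. vprod (lin_frac A z) =
      qexp (of_real 0 * z) * G (qexp (z / of_nat m)))"
    using vprod_expansion[OF A v0(1)] by (intro exI[of _ "vprod_fun A v0"] conjI vprod_fun_hol) (auto simp: B_def)
qed

lemma vprod_constant: "\<exists>c. c \<noteq> 0 \<and> (\<forall>z\<in>upper_half_plane. vprod z = c)"
proof -
  obtain c where "\<forall>z\<in>upper_half_plane. vprod z = c"
    using mform_const_ex[OF m_pos mform_vprod order_refl] by blast
  then have c: "\<And>z. z \<in> upper_half_plane \<Longrightarrow> vprod z = c"
    by blast
  have "c \<noteq> 0"
  proof
    assume "c = 0"
    have "\<exists>v\<in>cusp_vectors m. \<forall>z\<in>upper_half_plane. U1 (lin_frac (adj2 (cusp_mat v)) z) = 0"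
    proof (rule holomorphic_prod_zero[OF finite_cusp_vectors open_uhp connected_uhp])
      show "upper_half_plane \<noteq> {}"
        using ii_in_uhp by blast
      show "(\<Prod>v\<in>cusp_vectors m. U1 (lin_frac (adj2 (cusp_mat v)) z)) = 0" if "z \<in> upper_half_plane" for z
        using c[OF that] \<open>c = 0\<close> by (simp add: vprod_def)
      fix v assume v: "v \<in> cusp_vectors m"
      have "U1 \<circ> lin_frac (adj2 (cusp_mat v)) holomorphic_on upper_half_plane"
        using cusp_mat(1)[OF v] by (intro holomorphic_on_compose_gen[OF _ U1_hol] holomorphic_lin_frac) auto
      then show "(\<lambda>z. U1 (lin_frac (adj2 (cusp_mat v)) z)) holomorphic_on upper_half_plane"
        by (simp add: o_def)
    qed
    then obtain v where v: "v \<in> cusp_vectors m" "\<And>z. z \<in> upper_half_plane \<Longrightarrow> U1 (lin_frac (adj2 (cusp_mat v)) z) = 0"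
      by blast
    have "1 * U1 z + 0 * U2 z = 0" if "z \<in> upper_half_plane" for z
      using v(2)[of "lin_frac (cusp_mat v) z"] cusp_mat(1)[OF v(1)] that by simp
    from U_independent(1)[OF this] show False
      by simp
  qed
  then show ?thesis
    using c by blast
qed

theorem U1_nonzero:
  assumes z: "z \<in> upper_half_plane"
  shows "U1 z \<noteq> 0"
proof
  assume "U1 z = 0"
  then have "vprod z = 0"
    unfolding vprod_def by (intro prod_zero finite_cusp_vectors bexI[of _ "(1, 0)"]) (simp_all add: mat2_eq_iff lin_frac_def)
  moreover obtain c where "c \<noteq> 0" "\<forall>z\<in>upper_half_plane. vprod z = c"
    using vprod_constant by blast
  ultimately show False
    using z by simp
qed

text \<open>A factor other than that of (1,0) with a zero in its expansion at \<infinity> would make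
  the nonzero constant \<open>vprod\<close> vanish at q = 0.\<close>

lemma cof_cusp_mat:
  assumes v: "v \<in> cusp_vectors m" "snd (cof (adj2 (cusp_mat v))) = 0"
  shows "v = (1, 0)"
proof (rule ccontr)
  assume "v \<noteq> (1, 0)"
  have adj1: "adj2 (mat 1) = mat 1"
    by (simp add: mat2_eq_iff)
  obtain c where c: "c \<noteq> 0" "\<forall>z\<in>upper_half_plane. vprod z = c"
    using vprod_constant by blast
  have e: "snd (cof (adj2 (cusp_mat (1, 0)) ** mat 1)) = 0"
    using cof[OF rho_one] by (simp add: adj1)
  have cont: "isCont (vprod_fun (mat 1) (1, 0)) 0"
    by (rule disc_continuous[OF vprod_fun_hol]) simp
  have "vprod_fun (mat 1) (1, 0) (qexp (z / of_nat m)) = c" if z: "z \<in> upper_half_plane" for z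
    using vprod_expansion[OF SL2Z_one cusp_vectors_10 e z] c z by simp
  then have "vprod_fun (mat 1) (1, 0) 0 = c"
    by (rule continuous_at_cusp[OF cont _ m_pos])
  moreover have "(\<Prod>v\<in>cusp_vectors m - {(1, 0)}.
     fst (cof (adj2 (cusp_mat v) ** mat 1)) * p1 0 + snd (cof (adj2 (cusp_mat v) ** mat 1)) * p2 0) = 0"
    using v \<open>v \<noteq> (1, 0)\<close> by (intro prod_zero bexI[of _ v]) auto
  ultimately show False
    using c(1) unfolding vprod_fun_def by (metis mult_zero_right)
qed

text \<open>The hypothesis says that U1(Az) is a multiple of \<open>U1\<close>. The decomposition is
  applied to A^{-1}, since the product runs over inverses of the cusp matrices, and
  \<open>cof_cusp_mat\<close> leaves only the class of \<infinity>. This is what separates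
  inequivalent cusps later.\<close>

theorem rho_b_zero:
  assumes A: "A \<in> SL2Z" "rho A a 0 c d"
  shows "col_cong m A (mat 1)"
proof -
  have "adj2 A \<in> SL2Z"
    using A by simp
  then obtain v g k where v: "v \<in> cusp_vectors m" "g \<in> Gpm m" "adj2 A = g ** cusp_mat v ** transl k"
    using cusp_decomposition[OF m sl2_normal_Gpm Gpm_contains] by blast
  define C where "C = adj2 (cusp_mat v)"
  have C: "C \<in> SL2Z"
    using cusp_mat(1)[OF v(1)] by (simp add: C_def)
  have g: "g \<in> SL2Z" "adj2 g \<in> Gpm m" "adj2 g \<in> SL2Z"
    using v(2) sl2_normal_Gpm[of m] Gpm_SL2Z by (auto simp: sl2_normal_def)
  have "A = adj2 (adj2 A)"
    by simp
  also have "\<dots> = transl (- k) ** (C ** adj2 g)"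
    unfolding v(3) by (simp add: adj2_mult adj2_transl C_def)
  finally have A_eq: "A = transl (- k) ** (C ** adj2 g)" .
  obtain t u where t: "rho (transl (- k)) t 0 0 u"
    using rho_transl by blast
  obtain a' b' c' d' where r: "rho C a' b' c' d'"
    using rho_exists[OF C] .
  obtain \<sigma> where l: "norm \<sigma> = 1" "rho (adj2 g) \<sigma> 0 0 \<sigma>"
    using Gpm_scalar[OF g(2)] .
  have "rho A (t * (a' * \<sigma>)) (t * (b' * \<sigma>)) (u * (c' * \<sigma>)) (u * (d' * \<sigma>))"
    unfolding A_eq using rho_mult[OF t rho_mult[OF r l(2) g(3)]] C g(3) by simp
  then have "t * (b' * \<sigma>) = 0"
    using rho_unique(2)[OF A(2)] by metis
  moreover have "t \<noteq> 0" "\<sigma> \<noteq> 0"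
    using rho_det[OF t] l(1) by auto
  ultimately have "snd (cof C) = 0"
    using cof[OF r] by simp
  then have "v = (1, 0)"
    using cof_cusp_mat v(1) by (simp add: C_def)
  then have "C = mat 1"
    by (simp add: C_def mat2_eq_iff)
  then have "A = transl (- k) ** adj2 g"
    using A_eq by simp
  also have "\<dots> = (transl (- k) ** adj2 g ** adj2 (transl (- k))) ** mat 1 ** transl (- k)"
    by (simp flip: matrix_mul_assoc)
  finally have "A = (transl (- k) ** adj2 g ** adj2 (transl (- k))) ** mat 1 ** transl (- k)" .
  moreover have "transl (- k) ** adj2 g ** adj2 (transl (- k)) \<in> Gpm m"
    using sl2_normal_Gpm[of m] g(2) by (simp add: sl2_normal_def)
  ultimately show ?thesis
    using col_cong_mult by metis
qed

end

section \<open>The ratio of two solutions is injective modulo \<open>\<Gamma>(m)\<close>\<close>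

lemma LIMSEQ_eqI:
  fixes L R :: "nat \<Rightarrow> complex"
  assumes "\<And>k. L k = R k" "L \<longlonglongrightarrow> a" "R \<longlonglongrightarrow> b"
  shows "a = b"
proof -
  have "L = R"
    using assms(1) by blast
  then show ?thesis
    using assms(2,3) by (auto intro: LIMSEQ_unique)
qed

lemma continuous_lin_frac: "A \<in> SL2Z \<Longrightarrow> z \<in> upper_half_plane \<Longrightarrow> isCont (lin_frac A) z"
  using lin_frac_has_field_derivative DERIV_isCont by blast

section \<open>Orbits in the upper half-plane and compactness\<close>

definition gequiv :: "nat \<Rightarrow> complex \<Rightarrow> complex \<Rightarrow> bool" where
  "gequiv m z w \<longleftrightarrow> (\<exists>g\<in>Gpm m. w = lin_frac g z)"

lemma gequiv_trans:
  assumes "gequiv m u v" "gequiv m v w" "u \<in> upper_half_plane"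
  shows "gequiv m u w"
proof -
  obtain g h where "g \<in> Gpm m" "v = lin_frac g u" "h \<in> Gpm m" "w = lin_frac h v"
    using assms by (auto simp: gequiv_def)
  then have "h ** g \<in> Gpm m" "w = lin_frac (h ** g) u"
    using assms(3) sl2_normal_Gpm[of m] Gpm_SL2Z by (auto simp: sl2_normal_def lin_frac_mult)
  then show ?thesis
    by (auto simp: gequiv_def)
qed

lemma gequiv_sym:
  assumes "gequiv m u v" "u \<in> upper_half_plane"
  shows "gequiv m v u"
proof -
  obtain g where g: "g \<in> Gpm m" "v = lin_frac g u"
    using assms by (auto simp: gequiv_def)
  then have "adj2 g \<in> Gpm m" "u = lin_frac (adj2 g) v"
    using assms(2) sl2_normal_Gpm[of m] Gpm_SL2Z by (auto simp: sl2_normal_def)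
  then show ?thesis
    by (auto simp: gequiv_def)
qed

lemma same_row:
  assumes "A \<in> SL2Z" "B \<in> SL2Z" "A $ 2 $ 1 = B $ 2 $ 1" "A $ 2 $ 2 = B $ 2 $ 2"
  obtains k where "A = transl k ** B"
proof -
  have "(A ** adj2 B) $ 2 $ 1 = 0" "(A ** adj2 B) $ 2 $ 2 = 1"
    using assms by (simp_all add: SL2Z_iff algebra_simps)
  moreover have "A ** adj2 B \<in> SL2Z"
    using assms by simp
  ultimately have "A ** adj2 B = transl ((A ** adj2 B) $ 1 $ 2)"
    unfolding mat2_eq_iff SL2Z_iff by (simp del: mult2_nth)
  moreover have "A = (A ** adj2 B) ** B"
    using assms(2) by (simp flip: matrix_mul_assoc)
  ultimately show ?thesis
    using that by metis
qed

text \<open>Proper discontinuity: |cZ+d|^2 = Im Z / Im W stays bounded, so only finitely many bottom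
  rows occur. On a subsequence with constant bottom row the matrices differ by translations, whose
  integers converge and are eventually constant.\<close>

lemma gequiv_closed:
  assumes z: "z \<in> upper_half_plane" "Z \<longlonglongrightarrow> z" "\<And>k. Z k \<in> upper_half_plane"
    and w: "w \<in> upper_half_plane" "W \<longlonglongrightarrow> w" "\<And>k. W k \<in> upper_half_plane"
    and eq: "\<And>k. gequiv m (Z k) (W k)"
  shows "gequiv m z w"
proof -
  obtain g where g: "\<And>k. g k \<in> Gpm m" "\<And>k. W k = lin_frac (g k) (Z k)"
    using eq unfolding gequiv_def by metis
  note gSL = Gpm_SL2Z[OF g(1)]
  define y where "y = Im z"
  have y: "y > 0" "Im w > 0"
    using z w by (simp_all add: mem_uhp y_def)
  define R where "R = sqrt (2 * y / Im w + 1)"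
  have den: "(cmod (denom (g k) (Z k)))\<^sup>2 = Im (Z k) / Im (W k)" for k
    unfolding g(2) Im_lin_frac[OF gSL z(3)] using z(3)[of k] denom_nonzero[OF gSL z(3)] by (simp add: mem_uhp)
  have "(\<lambda>k. Im (Z k) / Im (W k)) \<longlonglongrightarrow> y / Im w"
    unfolding y_def using y by (intro tendsto_intros z w) auto
  then have "\<forall>\<^sub>F k in sequentially. Im (Z k) / Im (W k) < 2 * y / Im w + 1"
    using y by (intro order_tendstoD(2)) (auto simp: field_simps add_pos_pos)
  moreover have "\<forall>\<^sub>F k in sequentially. y / 2 < Im (Z k)"
    using y tendsto_Im[OF z(2)] by (intro order_tendstoD(1)[of _ y]) (auto simp: y_def)
  moreover have "\<forall>\<^sub>F k in sequentially. dist (Z k) z < 1"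
    using z(2) by (intro tendstoD) auto
  ultimately have "\<forall>\<^sub>F k in sequentially. (g k $ 2 $ 1, g k $ 2 $ 2) \<in>
      {(c, d). cmod (of_int c * z + of_int d) \<le> R + 2 * R / y}"
  proof eventually_elim
    case (elim k)
    define c d where "c = g k $ 2 $ 1" and "d = g k $ 2 $ 2"
    have R: "R \<ge> 0"
      unfolding R_def using y by (intro real_sqrt_ge_zero) (simp add: add_nonneg_nonneg)
    have "(cmod (denom (g k) (Z k)))\<^sup>2 \<le> R\<^sup>2"
      unfolding den R_def using elim(1) y by (simp add: add_nonneg_nonneg)
    then have 1: "cmod (of_int c * Z k + of_int d) \<le> R"
      using R power2_le_imp_le by (auto simp: denom_def c_def d_def)
    have "\<bar>real_of_int c * Im (Z k)\<bar> \<le> R"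
      using abs_Im_le_cmod[of "of_int c * Z k + of_int d"] 1 by simp
    then have "\<bar>real_of_int c\<bar> * (y / 2) \<le> R"
      using elim(2) y mult_left_mono[of "y / 2" "\<bar>Im (Z k)\<bar>" "\<bar>real_of_int c\<bar>"] by (simp add: abs_mult)
    then have c: "\<bar>real_of_int c\<bar> \<le> 2 * R / y"
      using y by (simp add: field_simps)
    have "cmod (of_int c * z + of_int d) \<le> cmod (of_int c * Z k + of_int d) + cmod (of_int c * (z - Z k))"
      using norm_triangle_ineq[of "of_int c * Z k + of_int d" "of_int c * (z - Z k)"] by (simp add: algebra_simps)
    also have "\<dots> \<le> R + \<bar>real_of_int c\<bar> * 1"
      using elim(3) 1 mult_left_mono[of "cmod (z - Z k)" 1 "\<bar>real_of_int c\<bar>"]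
      by (intro add_mono) (simp_all add: norm_mult dist_norm norm_minus_commute)
    finally have "cmod (of_int c * z + of_int d) \<le> R + 2 * R / y"
      using c by simp
    then show ?case
      by (simp add: c_def d_def)
  qed
  then obtain N where N: "\<And>k. k \<ge> N \<Longrightarrow> (g k $ 2 $ 1, g k $ 2 $ 2) \<in>
      {(c, d). cmod (of_int c * z + of_int d) \<le> R + 2 * R / y}"
    by (auto simp: eventually_sequentially)
  have "finite ((\<lambda>k. (g k $ 2 $ 1, g k $ 2 $ 2)) ` {N..})"
    by (rule finite_subset[OF _ finite_small_denom[of z "R + 2 * R / y"]]) (use N y in \<open>auto simp: y_def\<close>)
  then obtain k0 where k0: "k0 \<in> {N..}" "infinite {k \<in> {N..}. (g k $ 2 $ 1, g k $ 2 $ 2) = (g k0 $ 2 $ 1, g k0 $ 2 $ 2)}"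
    using pigeonhole_infinite[of "{N..}" "\<lambda>k. (g k $ 2 $ 1, g k $ 2 $ 2)"] infinite_Ici by blast
  define K where "K = {k \<in> {N..}. (g k $ 2 $ 1, g k $ 2 $ 2) = (g k0 $ 2 $ 1, g k0 $ 2 $ 2)}"
  have "infinite K"
    using k0(2) by (simp only: K_def not_False_eq_True)
  from infinite_enumerate[OF this] obtain r :: "nat \<Rightarrow> nat" where r: "strict_mono r" "\<And>i. r i \<in> K"
    by blast
  have "\<exists>j. g (r i) = transl j ** g k0" for i
  proof -
    have "g (r i) $ 2 $ 1 = g k0 $ 2 $ 1" "g (r i) $ 2 $ 2 = g k0 $ 2 $ 2"
      using r(2)[of i] by (auto simp: K_def)
    then show ?thesis
      using same_row[OF gSL gSL] by metis
  qed
  then obtain j where j: "\<And>i. g (r i) = transl (j i) ** g k0"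
    by metis
  have "(\<lambda>i. W (r i) - lin_frac (g k0) (Z (r i))) \<longlonglongrightarrow> w - lin_frac (g k0) z"
    using LIMSEQ_subseq_LIMSEQ[OF w(2) r(1)] LIMSEQ_subseq_LIMSEQ[OF z(2) r(1)]
    by (intro tendsto_diff isCont_tendsto_compose[OF continuous_lin_frac[OF gSL z(1)]]) (auto simp: o_def)
  moreover have ji: "W (r i) - lin_frac (g k0) (Z (r i)) = of_int (j i)" for i
    unfolding g(2) j using gSL z(3) by (simp add: lin_frac_mult)
  ultimately have lim: "(\<lambda>i. of_int (j i) :: complex) \<longlonglongrightarrow> w - lin_frac (g k0) z"
    by simp
  then have "\<forall>\<^sub>F i in sequentially. dist (of_int (j i) :: complex) (w - lin_frac (g k0) z) < 1 / 2"
    by (rule tendstoD) simp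
  then obtain M where M: "\<And>i. i \<ge> M \<Longrightarrow> dist (of_int (j i) :: complex) (w - lin_frac (g k0) z) < 1 / 2"
    by (auto simp: eventually_sequentially)
  have const: "j i = j M" if "i \<ge> M" for i
  proof -
    have "dist (of_int (j i) :: complex) (of_int (j M)) < 1 / 2 + 1 / 2"
      using M[OF that] M[OF order_refl] dist_triangle_less_add by (metis dist_commute)
    then have "norm (of_int (j i - j M) :: complex) < 1"
      by (simp add: dist_norm)
    then show ?thesis
      unfolding norm_of_int by linarith
  qed
  have "(\<lambda>i. of_int (j i) :: complex) \<longlonglongrightarrow> of_int (j M)"
    by (rule tendsto_eventually, rule eventually_mono[OF eventually_ge_at_top[of M]]) (metis const)
  then have "w - lin_frac (g k0) z = of_int (j M)"
    by (rule LIMSEQ_unique[OF lim])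
  then have "w = lin_frac (g (r M)) z"
    unfolding j using gSL z(1) by (simp add: lin_frac_mult algebra_simps)
  then show ?thesis
    using g(1) by (auto simp: gequiv_def)
qed

lemma gequiv_separated:
  assumes "z \<in> upper_half_plane" "w \<in> upper_half_plane" "\<not> gequiv m z w"
  shows "\<exists>\<epsilon>>0. \<forall>z'\<in>ball z \<epsilon> \<inter> upper_half_plane. \<forall>w'\<in>ball w \<epsilon> \<inter> upper_half_plane. \<not> gequiv m z' w'"
proof (rule ccontr)
  assume neg: "\<not> ?thesis"
  have "\<exists>z' w'. z' \<in> ball z (1 / real (Suc k)) \<inter> upper_half_plane \<and> w' \<in> ball w (1 / real (Suc k)) \<inter> upper_half_plane \<and> gequiv m z' w'" for k
  proof -
    have "0 < 1 / real (Suc k)"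
      by simp
    with neg show ?thesis
      by blast
  qed
  then obtain Z W where ZW: "\<And>k. Z k \<in> ball z (1 / real (Suc k)) \<inter> upper_half_plane"
    "\<And>k. W k \<in> ball w (1 / real (Suc k)) \<inter> upper_half_plane" "\<And>k. gequiv m (Z k) (W k)"
    by metis
  have lim: "X \<longlonglongrightarrow> x" if "\<And>k. X k \<in> ball x (1 / real (Suc k)) \<inter> upper_half_plane" for X and x :: complex
  proof (rule metric_LIMSEQ_I)
    fix e :: real assume "e > 0"
    then obtain N where N: "1 / real (Suc N) < e"
      using nat_approx_posE by blast
    have "dist (X k) x < e" if "k \<ge> N" for k
    proof -
      have "dist (X k) x < 1 / real (Suc k)"
        using \<open>\<And>k. X k \<in> ball x (1 / real (Suc k)) \<inter> upper_half_plane\<close>[of k] by (simp add: dist_commute)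
      also have "\<dots> \<le> 1 / real (Suc N)"
        using that by (simp add: field_simps)
      finally show ?thesis
        using N by simp
    qed
    then show "\<exists>N. \<forall>k\<ge>N. dist (X k) x < e"
      by blast
  qed
  have "gequiv m z w"
    by (rule gequiv_closed[OF assms(1) lim[OF ZW(1)] _ assms(2) lim[OF ZW(2)] _ ZW(3)]) (use ZW in auto)
  then show False
    using assms(3) by simp
qed

text \<open>
  The second alternative is convergence to the cusp \<open>A\<infinity>\<close>. Convergence is tested on \<open>1/\<sigma>\<close>, which
  stays bounded in the fundamental domain.
\<close>

lemma modular_subsequence:
  fixes W :: "nat \<Rightarrow> complex"
  assumes m: "m > 0" and W: "\<And>k. W k \<in> upper_half_plane"
  obtains A and r :: "nat \<Rightarrow> nat" and \<sigma> where "A \<in> SL2Z" "strict_mono r" "\<And>k :: nat. \<sigma> k \<in> upper_half_plane"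
    "\<And>k. gequiv m (W (r k)) (lin_frac A (\<sigma> k))"
    "(\<exists>l\<in>upper_half_plane. \<sigma> \<longlonglongrightarrow> l) \<or> (\<lambda>k. qexp (\<sigma> k / of_nat m)) \<longlonglongrightarrow> 0"
proof -
  obtain X where X: "finite X" "X \<subseteq> SL2Z" "\<And>A. A \<in> SL2Z \<Longrightarrow> \<exists>B\<in>X. \<exists>g\<in>Gpm m. A = g ** B"
    using finite_coset_representatives[OF m] by blast
  have "\<exists>B\<in>X. \<exists>\<tau>. \<bar>Re \<tau>\<bar> \<le> 1 / 2 \<and> 1 / 2 < Im \<tau> \<and> gequiv m (W k) (lin_frac B \<tau>)" for k
  proof -
    obtain C where C: "C \<in> SL2Z" "\<bar>Re (lin_frac C (W k))\<bar> \<le> 1 / 2" "1 / 2 < Im (lin_frac C (W k))"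
      using fundamental_domain[OF W] by blast
    obtain B g where B: "B \<in> X" "g \<in> Gpm m" "adj2 C = g ** B"
      using X(3)[of "adj2 C"] C by auto
    have B': "B \<in> SL2Z"
      using B X by blast
    define \<tau> where "\<tau> = lin_frac C (W k)"
    have t: "\<tau> \<in> upper_half_plane"
      using C W by (simp add: \<tau>_def)
    have "W k = lin_frac (adj2 C) \<tau>"
      using C W by (simp add: \<tau>_def)
    also have "\<dots> = lin_frac g (lin_frac B \<tau>)"
      unfolding B(3) using B' t by (rule lin_frac_mult)
    finally have "gequiv m (lin_frac B \<tau>) (W k)"
      using B by (auto simp: gequiv_def)
    then have "gequiv m (W k) (lin_frac B \<tau>)"
      using gequiv_sym B' t by simp
    then show ?thesis
      using B(1) C \<tau>_def by blast
  qed
  then obtain B \<tau> where B: "\<And>k. B k \<in> X" and \<tau>: "\<And>k. \<bar>Re (\<tau> k)\<bar> \<le> 1 / 2" "\<And>k. 1 / 2 < Im (\<tau> k)"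
    "\<And>k. gequiv m (W k) (lin_frac (B k) (\<tau> k))"
    by metis
  have "finite (B ` UNIV)"
    using B X(1) by (meson finite_subset image_subset_iff)
  then obtain k0 where k0: "infinite {k \<in> UNIV. B k = B k0}"
    using pigeonhole_infinite[OF infinite_UNIV_nat, of B] by auto
  obtain r1 :: "nat \<Rightarrow> nat" where r1: "strict_mono r1" "\<And>i. B (r1 i) = B k0"
    using infinite_enumerate[OF k0] by auto
  have t0: "\<tau> k \<noteq> 0" for k
    using \<tau>(2)[of k] by auto
  have bdd: "1 / \<tau> (r1 k) \<in> cball 0 2" for k
  proof -
    have "1 / 2 \<le> norm (\<tau> (r1 k))"
      using abs_Im_le_cmod[of "\<tau> (r1 k)"] \<tau>(2)[of "r1 k"] by linarith
    then show ?thesis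
      using t0[of "r1 k"] by (simp add: norm_divide field_simps)
  qed
  obtain l and r2 :: "nat \<Rightarrow> nat" where l: "strict_mono r2" "((\<lambda>k. 1 / \<tau> (r1 k)) \<circ> r2) \<longlonglongrightarrow> l"
    using compact_cball[of "0 :: complex" 2] bdd unfolding compact_def by metis
  define r \<sigma> where "r = r1 \<circ> r2" and "\<sigma> = \<tau> \<circ> r"
  have lim: "(\<lambda>k. 1 / \<sigma> k) \<longlonglongrightarrow> l"
    using l(2) by (simp add: \<sigma>_def r_def o_def)
  have Im: "Im (\<sigma> k) > 1 / 2" and Re: "\<bar>Re (\<sigma> k)\<bar> \<le> 1 / 2" for k
    using \<tau> by (simp_all add: \<sigma>_def)
  have "(\<exists>l\<in>upper_half_plane. \<sigma> \<longlonglongrightarrow> l) \<or> (\<lambda>k. qexp (\<sigma> k / of_nat m)) \<longlonglongrightarrow> 0"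
  proof (cases "l = 0")
    case False
    have "(\<lambda>k. 1 / (1 / \<sigma> k)) \<longlonglongrightarrow> 1 / l"
      using False by (intro tendsto_intros lim)
    then have lim': "\<sigma> \<longlonglongrightarrow> 1 / l"
      by simp
    have "1 / 2 \<le> Im (1 / l)"
      by (rule LIMSEQ_le_const[OF tendsto_Im[OF lim']]) (use Im less_imp_le in blast)
    then have "1 / l \<in> upper_half_plane"
      by (simp add: mem_uhp)
    then show ?thesis
      using lim' by blast
  next
    case True
    have n0: "(\<lambda>k. norm (1 / \<sigma> k)) \<longlonglongrightarrow> 0"
      using tendsto_norm_zero[OF lim[unfolded True]] .
    have ne: "\<sigma> k \<noteq> 0" for k
    proof
      assume "\<sigma> k = 0"
      then show False
        using Im[of k] by simp
    qed
    have inf: "filterlim (\<lambda>k. inverse (norm (1 / \<sigma> k))) at_top sequentially"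
      by (rule filterlim_inverse_at_top[OF n0]) (intro always_eventually allI, use ne in simp)
    have "filterlim (\<lambda>k. Im (\<sigma> k)) at_top sequentially"
    proof (rule filterlim_at_top_mono)
      show "filterlim (\<lambda>k. - 1 / 2 + norm (\<sigma> k)) at_top sequentially"
        using inf by (intro filterlim_tendsto_add_at_top[OF tendsto_const]) (simp add: norm_divide)
      show "\<forall>\<^sub>F k in sequentially. - 1 / 2 + norm (\<sigma> k) \<le> Im (\<sigma> k)"
      proof (intro always_eventually allI)
        fix k
        have "norm (\<sigma> k) \<le> \<bar>Re (\<sigma> k)\<bar> + \<bar>Im (\<sigma> k)\<bar>"
          by (rule cmod_le)
        then show "- 1 / 2 + norm (\<sigma> k) \<le> Im (\<sigma> k)"
          using Re[of k] Im[of k] by linarith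
      qed
    qed
    then have "filterlim (\<lambda>k. 2 * pi / real m * Im (\<sigma> k)) at_top sequentially"
      using m by (intro filterlim_tendsto_pos_mult_at_top[OF tendsto_const]) auto
    then have "filterlim (\<lambda>k. - (2 * pi / real m * Im (\<sigma> k))) at_bot sequentially"
      by (subst filterlim_uminus_at_bot) simp
    then have "(\<lambda>k. exp (- (2 * pi / real m * Im (\<sigma> k)))) \<longlonglongrightarrow> 0"
      by (rule filterlim_compose[OF exp_at_bot])
    then have "(\<lambda>k. norm (qexp (\<sigma> k / of_nat m))) \<longlonglongrightarrow> 0"
      by (simp add: norm_qexp)
    then have "(\<lambda>k. qexp (\<sigma> k / of_nat m)) \<longlonglongrightarrow> 0"
      by (rule tendsto_norm_zero_cancel)
    then show ?thesis
      by (rule disjI2)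
  qed
  moreover have "strict_mono r"
    unfolding r_def using r1(1) l(1) by (rule strict_mono_o)
  moreover have "gequiv m (W (r k)) (lin_frac (B k0) (\<sigma> k))" for k
    using \<tau>(3)[of "r k"] r1(2)[of "r2 k"] by (simp add: \<sigma>_def r_def)
  moreover have "\<sigma> k \<in> upper_half_plane" for k
    using Im[of k] by (simp add: mem_uhp)
  moreover have "B k0 \<in> SL2Z"
    using B X(2) by blast
  ultimately show ?thesis
    by (intro that[of "B k0" r \<sigma>]) simp_all
qed

section \<open>Injectivity of the quotient U2/U1\<close>

context modular_pair1
begin

text \<open>Away from 0 this is the Wronskian of \<open>U1\<close> and \<open>U2\<close> up to
  nonzero factors. At 0 it equals p1'(0) p2(0) = 1, by the simple zero of p1.\<close>

lemma p_wronskian: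
  assumes q: "norm q < 1"
  shows "deriv p1 q * p2 q - p1 q * deriv p2 q \<noteq> 0"
proof (cases "q = 0")
  case True
  have p0: "(p0 has_field_derivative deriv p0 0) (at 0)"
    using p0_hol by (intro holomorphic_derivI[of _ "ball 0 1"]) auto
  have "((\<lambda>q. q * p0 q) has_field_derivative 1 * p0 0 + deriv p0 0 * 0) (at 0)"
    by (intro DERIV_mult DERIV_ident p0)
  then have "(p1 has_field_derivative 1) (at 0)"
    by (simp add: p1_eq[abs_def] p0_0)
  then show ?thesis
    by (simp add: True DERIV_imp_deriv p2_0)
next
  case False
  define z where "z = cusp_log m q"
  have z: "z \<in> upper_half_plane" "qexp (z / of_nat m) = q"
    using cusp_log[OF m_pos False q] by (simp_all add: z_def)
  have D: "((\<lambda>z. qexp (of_real \<kappa> * z) * f (qexp (z / of_nat m))) has_field_derivative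
     (2 * of_real pi * \<i> * of_real \<kappa> * qexp (of_real \<kappa> * z)) * f q +
     (deriv f q * (2 * of_real pi * \<i> * (1 / of_nat m) * q)) * qexp (of_real \<kappa> * z)) (at z)"
    if f: "f holomorphic_on ball 0 1" for f
  proof -
    have 1: "((\<lambda>z. qexp (of_real \<kappa> * z)) has_field_derivative 2 * of_real pi * \<i> * of_real \<kappa> * qexp (of_real \<kappa> * z)) (at z)"
      by (auto intro!: derivative_eq_intros)
    have 2: "((\<lambda>z. qexp (z / of_nat m)) has_field_derivative 2 * of_real pi * \<i> * (1 / of_nat m) * q) (at z)"
      using m_pos z(2) by (auto intro!: derivative_eq_intros)
    have 3: "(f has_field_derivative deriv f q) (at (qexp (z / of_nat m)))"
      unfolding z(2) using f q by (intro holomorphic_derivI[of _ "ball 0 1"]) auto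
    have 4: "((\<lambda>z. f (qexp (z / of_nat m))) has_field_derivative deriv f q * (2 * of_real pi * \<i> * (1 / of_nat m) * q)) (at z)"
      by (rule DERIV_chain2[where f = f and g = "\<lambda>z. qexp (z / of_nat m)", OF 3 2])
    from DERIV_mult[OF 1 4] show ?thesis
      by (simp add: z(2))
  qed
  have U: "U1 w = qexp (of_real \<kappa> * w) * p1 (qexp (w / of_nat m))" "U2 w = qexp (of_real \<kappa> * w) * p2 (qexp (w / of_nat m))"
    if "w \<in> upper_half_plane" for w
    using U1_eq[OF that] U2_eq[OF that] by (simp_all add: p1_def)
  have d1: "deriv U1 z = (2 * of_real pi * \<i> * of_real \<kappa> * qexp (of_real \<kappa> * z)) * p1 q +
     (deriv p1 q * (2 * of_real pi * \<i> * (1 / of_nat m) * q)) * qexp (of_real \<kappa> * z)"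
    by (rule has_field_derivative_eq_on_open[OF open_uhp z(1) U(1) U_DERIV(1)[OF z(1)] D[OF p1_hol]])
  have d2: "deriv U2 z = (2 * of_real pi * \<i> * of_real \<kappa> * qexp (of_real \<kappa> * z)) * p2 q +
     (deriv p2 q * (2 * of_real pi * \<i> * (1 / of_nat m) * q)) * qexp (of_real \<kappa> * z)"
    by (rule has_field_derivative_eq_on_open[OF open_uhp z(1) U(2) U_DERIV(2)[OF z(1)] D[OF p2_hol]])
  \<comment> \<open>The terms with T stem from differentiating e(\<kappa>z); they are the same for
    both functions and cancel.\<close>
  have expand: "((T * E) * a + (a' * R) * E) * (E * b) - (E * a) * ((T * E) * b + (b' * R) * E) =
      E ^ 2 * R * (a' * b - a * b')" for T E R a b a' b' :: complex
    by (simp add: power2_eq_square algebra_simps)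
  have "wronskian U1 U2 z = qexp (of_real \<kappa> * z) ^ 2 * (2 * of_real pi * \<i> * (1 / of_nat m) * q) *
      (deriv p1 q * p2 q - p1 q * deriv p2 q)"
    unfolding wronskian_def d1 d2 U[OF z(1)] z(2) by (rule expand)
  then show ?thesis
    using wronskian_nonzero[OF z(1)] by auto
qed

text \<open>The reciprocal of the future Hauptmodul: since \<open>U1\<close> has no zeros, s is
  holomorphic on the whole half-plane, and the value infinity is left to the cusp.\<close>

definition s :: "complex \<Rightarrow> complex" where
  "s z = U2 z / U1 z"

lemma s_hol: "s holomorphic_on upper_half_plane"
  unfolding s_def by (intro holomorphic_intros U1_hol U2_hol U1_nonzero)

lemma s_eq_iff:
  assumes "z \<in> upper_half_plane" "w \<in> upper_half_plane"
  shows "s z = s w \<longleftrightarrow> U1 z * U2 w = U2 z * U1 w"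
  using U1_nonzero[OF assms(1)] U1_nonzero[OF assms(2)] by (auto simp: s_def field_simps)

lemma s_deriv:
  assumes z: "z \<in> upper_half_plane"
  shows "deriv s z \<noteq> 0"
proof -
  have "(s has_field_derivative (deriv U2 z * U1 z - U2 z * deriv U1 z) / (U1 z * U1 z)) (at z)"
    unfolding s_def[abs_def] by (intro DERIV_divide U_DERIV z U1_nonzero)
  moreover have "deriv U2 z * U1 z - U2 z * deriv U1 z = - wronskian U1 U2 z"
    by (simp add: wronskian_def algebra_simps)
  ultimately show ?thesis
    using wronskian_nonzero[OF z] U1_nonzero[OF z] by (simp add: DERIV_imp_deriv)
qed

lemma s_invariant:
  assumes "gequiv m z w" "z \<in> upper_half_plane"
  shows "s w = s z"
proof -
  obtain g where g: "g \<in> Gpm m" "w = lin_frac g z"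
    using assms(1) by (auto simp: gequiv_def)
  obtain \<sigma> where l: "norm \<sigma> = 1" "rho g \<sigma> 0 0 \<sigma>"
    using Gpm_scalar[OF g(1)] .
  have "\<sigma> \<noteq> 0"
    using l(1) by auto
  then show ?thesis
    using rhoD(2,3)[OF l(2) assms(2)] by (simp add: s_def g(2))
qed

lemma s_not_constant: "\<not> s constant_on upper_half_plane"
proof
  assume "s constant_on upper_half_plane"
  then obtain c where c: "\<And>z. z \<in> upper_half_plane \<Longrightarrow> s z = c"
    by (auto simp: constant_on_def)
  have "c * U1 z + (- 1) * U2 z = 0" if "z \<in> upper_half_plane" for z
    using U1_nonzero[OF that] c[OF that, symmetric] by (simp add: s_def)
  from U_independent(2)[OF this] show False
    by simp
qed

lemma s_locally_injective:
  assumes z: "z \<in> upper_half_plane" and X: "X \<longlonglongrightarrow> z" and Y: "Y \<longlonglongrightarrow> z"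
    and eq: "\<And>k :: nat. s (X k) = s (Y k)"
  shows "\<exists>k. X k = Y k"
proof -
  obtain r where r: "r > 0" "ball z r \<subseteq> upper_half_plane" "inj_on s (ball z r)"
    using has_complex_derivative_locally_injective[OF s_hol z open_uhp s_deriv[OF z]] .
  have "\<forall>\<^sub>F k in sequentially. dist (X k) z < r" "\<forall>\<^sub>F k in sequentially. dist (Y k) z < r"
    using tendstoD[OF X r(1)] tendstoD[OF Y r(1)] by auto
  then have "\<forall>\<^sub>F k in sequentially. X k = Y k"
  proof eventually_elim
    case (elim k)
    then show ?case
      using inj_onD[OF r(3) eq[of k]] by (simp add: dist_commute)
  qed
  then show ?thesis
    by (auto simp: eventually_sequentially)
qed

text \<open>
  Points at which \<open>s\<close> is not injective modulo \<open>\<Gamma>(m)\<close>. Openness comes from the open mapping theorem, closedness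
  from compactness of the modular curve; near \<open>\<infinity>\<close> a double point would contradict local injectivity
  of \<open>p\<^sub>1/p\<^sub>2\<close>, or identify \<open>\<infinity>\<close> with another point.
\<close>

definition double :: "complex set" where
  "double = {z \<in> upper_half_plane. \<exists>w\<in>upper_half_plane. s w = s z \<and> \<not> gequiv m z w}"

lemma open_double: "open double"
  unfolding open_contains_ball
proof
  fix z assume "z \<in> double"
  then obtain w where z: "z \<in> upper_half_plane" and w: "w \<in> upper_half_plane" "s w = s z" "\<not> gequiv m z w"
    by (auto simp: double_def)
  obtain e where e: "e > 0" "\<And>z' w'. z' \<in> ball z e \<inter> upper_half_plane \<Longrightarrow> w' \<in> ball w e \<inter> upper_half_plane \<Longrightarrow> \<not> gequiv m z' w'"
    using gequiv_separated[OF z w(1,3)] by blast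
  have op: "open (s ` (ball w e \<inter> upper_half_plane))"
    by (rule open_mapping_thm[OF s_hol open_uhp connected_uhp _ _ s_not_constant]) (auto intro: open_Int)
  have sz: "s z \<in> s ` (ball w e \<inter> upper_half_plane)"
    using w e(1) by (intro image_eqI[of _ _ w]) auto
  have "open (upper_half_plane \<inter> s -` (s ` (ball w e \<inter> upper_half_plane)))"
    by (rule continuous_open_preimage[OF holomorphic_on_imp_continuous_on[OF s_hol] open_uhp op])
  then have "open ((upper_half_plane \<inter> s -` (s ` (ball w e \<inter> upper_half_plane))) \<inter> ball z e)"
    by (rule open_Int[OF _ open_ball])
  moreover have "z \<in> (upper_half_plane \<inter> s -` (s ` (ball w e \<inter> upper_half_plane))) \<inter> ball z e"
    using z e(1) sz by simp
  ultimately obtain d where d: "d > 0" "ball z d \<subseteq> (upper_half_plane \<inter> s -` (s ` (ball w e \<inter> upper_half_plane))) \<inter> ball z e"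
    unfolding open_contains_ball by blast
  have "ball z d \<subseteq> double"
  proof
    fix z' assume "z' \<in> ball z d"
    then have z': "z' \<in> upper_half_plane" "z' \<in> ball z e" "s z' \<in> s ` (ball w e \<inter> upper_half_plane)"
      using d(2) by blast+
    then obtain w' where "w' \<in> ball w e \<inter> upper_half_plane" "s z' = s w'"
      by blast
    then show "z' \<in> double"
      using z' e(2)[of z' w'] by (auto simp: double_def)
  qed
  then show "\<exists>d>0. ball z d \<subseteq> double"
    using d(1) by blast
qed

text \<open>Chooses inequivalent partners with equal value of s and moves them by \<Gamma>(m) up to
  sign, so that along a subsequence they converge to a point or to a cusp.\<close>

lemma double_sequence:
  fixes Z :: "nat \<Rightarrow> complex"
  assumes Z: "\<And>k. Z k \<in> double"
  obtains A and r :: "nat \<Rightarrow> nat" and \<sigma> where "A \<in> SL2Z" "strict_mono r" "\<And>k :: nat. \<sigma> k \<in> upper_half_plane"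
    "\<And>k. s (lin_frac A (\<sigma> k)) = s (Z (r k))" "\<And>k. \<not> gequiv m (Z (r k)) (lin_frac A (\<sigma> k))"
    "(\<exists>l\<in>upper_half_plane. \<sigma> \<longlonglongrightarrow> l) \<or> (\<lambda>k. qexp (\<sigma> k / of_nat m)) \<longlonglongrightarrow> 0"
proof -
  have "\<forall>k. \<exists>w. w \<in> upper_half_plane \<and> s w = s (Z k) \<and> \<not> gequiv m (Z k) w"
    using Z unfolding double_def by blast
  from choice[OF this] obtain W where
    W: "\<And>k. W k \<in> upper_half_plane" "\<And>k. s (W k) = s (Z k)" "\<And>k. \<not> gequiv m (Z k) (W k)"
    by blast
  have ZH: "Z k \<in> upper_half_plane" for k
    using Z[of k] by (simp add: double_def)
  show ?thesis
  proof (rule modular_subsequence[OF m_pos W(1)])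
    fix A and r :: "nat \<Rightarrow> nat" and \<sigma>
    assume *: "A \<in> SL2Z" "strict_mono r" "\<And>k :: nat. \<sigma> k \<in> upper_half_plane"
      "\<And>k. gequiv m (W (r k)) (lin_frac A (\<sigma> k))"
      "(\<exists>l\<in>upper_half_plane. \<sigma> \<longlonglongrightarrow> l) \<or> (\<lambda>k. qexp (\<sigma> k / of_nat m)) \<longlonglongrightarrow> 0"
    show ?thesis
    proof (rule that[of A r \<sigma>])
      fix k
      show "s (lin_frac A (\<sigma> k)) = s (Z (r k))"
        using s_invariant[OF *(4) W(1)] W(2) by simp
      show "\<not> gequiv m (Z (r k)) (lin_frac A (\<sigma> k))"
      proof
        assume "gequiv m (Z (r k)) (lin_frac A (\<sigma> k))"
        moreover have "gequiv m (lin_frac A (\<sigma> k)) (W (r k))"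
          using *(4) W(1) by (rule gequiv_sym)
        ultimately have "gequiv m (Z (r k)) (W (r k))"
          using ZH by (rule gequiv_trans)
        then show False
          using W(3) by simp
      qed
    qed (use * in auto)
  qed
qed

lemma closed_double:
  assumes z: "z \<in> upper_half_plane" and Z: "\<And>k. Z k \<in> double" "Z \<longlonglongrightarrow> z"
  shows "z \<in> double"
proof (rule double_sequence[OF Z(1)])
  fix A and r :: "nat \<Rightarrow> nat" and \<sigma>
  assume A: "A \<in> SL2Z" and r: "strict_mono r" and \<sigma>: "\<And>k :: nat. \<sigma> k \<in> upper_half_plane"
    and eq: "\<And>k. s (lin_frac A (\<sigma> k)) = s (Z (r k))" and neq: "\<And>k. \<not> gequiv m (Z (r k)) (lin_frac A (\<sigma> k))"
    and lim: "(\<exists>l\<in>upper_half_plane. \<sigma> \<longlonglongrightarrow> l) \<or> (\<lambda>k. qexp (\<sigma> k / of_nat m)) \<longlonglongrightarrow> 0"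
  have ZH: "Z k \<in> upper_half_plane" for k
    using Z(1)[of k] by (simp add: double_def)
  have Zr: "(\<lambda>k. Z (r k)) \<longlonglongrightarrow> z"
    using LIMSEQ_subseq_LIMSEQ[OF Z(2) r] by (simp add: o_def)
  have s_cont: "isCont s w" if "w \<in> upper_half_plane" for w
    using holomorphic_on_imp_continuous_on[OF s_hol] that continuous_on_eq_continuous_at[OF open_uhp] by blast
  have sZ: "(\<lambda>k. s (Z (r k))) \<longlonglongrightarrow> s z"
    by (rule isCont_tendsto_compose[OF s_cont[OF z] Zr])
  show "z \<in> double"
    using lim
  proof
    assume "\<exists>l\<in>upper_half_plane. \<sigma> \<longlonglongrightarrow> l"
    then obtain l where l: "l \<in> upper_half_plane" "\<sigma> \<longlonglongrightarrow> l"
      by blast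
    define w where "w = lin_frac A l"
    have w: "w \<in> upper_half_plane"
      using A l by (simp add: w_def)
    have W: "(\<lambda>k. lin_frac A (\<sigma> k)) \<longlonglongrightarrow> w"
      unfolding w_def by (rule isCont_tendsto_compose[OF continuous_lin_frac[OF A l(1)] l(2)])
    have "(\<lambda>k. s (Z (r k))) \<longlonglongrightarrow> s w"
      using isCont_tendsto_compose[OF s_cont[OF w] W] by (simp only: eq)
    then have sw: "s w = s z"
      by (rule LIMSEQ_unique[OF _ sZ])
    \<comment> \<open>Were the limits equivalent, g^{-1} would bring the partners close to z as
      well; local injectivity of s at z would then make one of them equal to its Z, against the
      choice of the partners.\<close>
    have "\<not> gequiv m z w"
    proof
      assume "gequiv m z w"
      then obtain g where g: "g \<in> Gpm m" "w = lin_frac g z"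
        by (auto simp: gequiv_def)
      have gS: "g \<in> SL2Z" "adj2 g \<in> SL2Z" "adj2 g \<in> Gpm m"
        using g(1) Gpm_SL2Z sl2_normal_Gpm[of m] by (auto simp: sl2_normal_def)
      define Y where "Y k = lin_frac (adj2 g) (lin_frac A (\<sigma> k))" for k
      have "Y \<longlonglongrightarrow> lin_frac (adj2 g) w"
        unfolding Y_def by (rule isCont_tendsto_compose[OF continuous_lin_frac[OF gS(2) w] W])
      then have Yz: "Y \<longlonglongrightarrow> z"
        using g(2) gS(1) z by simp
      have gY: "gequiv m (lin_frac A (\<sigma> k)) (Y k)" for k
        using gS(3) by (auto simp: gequiv_def Y_def)
      have "s (Y k) = s (Z (r k))" for k
        using s_invariant[OF gY] A \<sigma> eq by simp
      then obtain k where k: "Y k = Z (r k)"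
        using s_locally_injective[OF z Yz Zr] by blast
      have "gequiv m (Z (r k)) (lin_frac A (\<sigma> k))"
        using gequiv_sym[OF gY[of k]] A \<sigma> k by simp
      then show False
        using neq by simp
    qed
    then show ?thesis
      using z w sw by (auto simp: double_def)
  next
    assume q: "(\<lambda>k. qexp (\<sigma> k / of_nat m)) \<longlonglongrightarrow> 0"
    obtain a b c d where rh: "rho A a b c d"
      using rho_exists[OF A] .
    have cont: "isCont p1 0" "isCont p2 0"
      by (rule disc_continuous[OF p1_hol] disc_continuous[OF p2_hol]; simp)+
    note P = isCont_tendsto_compose[OF cont(1) q] isCont_tendsto_compose[OF cont(2) q]
    have "s (Z (r k)) * (a * p1 (qexp (\<sigma> k / of_nat m)) + b * p2 (qexp (\<sigma> k / of_nat m))) =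
        c * p1 (qexp (\<sigma> k / of_nat m)) + d * p2 (qexp (\<sigma> k / of_nat m))" for k
    proof -
      have e: "U1 (lin_frac A (\<sigma> k)) = qexp (of_real \<kappa> * \<sigma> k) * (a * p1 (qexp (\<sigma> k / of_nat m)) + b * p2 (qexp (\<sigma> k / of_nat m)))"
        "U2 (lin_frac A (\<sigma> k)) = qexp (of_real \<kappa> * \<sigma> k) * (c * p1 (qexp (\<sigma> k / of_nat m)) + d * p2 (qexp (\<sigma> k / of_nat m)))"
        using rhoD(2,3)[OF rh \<sigma>] lin_expansion[OF \<sigma>, of a b k] lin_expansion[OF \<sigma>, of c d k] by (simp_all add: lin_def)
      have "U1 (lin_frac A (\<sigma> k)) \<noteq> 0"
        using U1_nonzero A \<sigma> by simp
      then have "s (lin_frac A (\<sigma> k)) * U1 (lin_frac A (\<sigma> k)) = U2 (lin_frac A (\<sigma> k))"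
        by (simp add: s_def)
      then show ?thesis
        unfolding e eq by simp
    qed
    moreover have "(\<lambda>k. s (Z (r k)) * (a * p1 (qexp (\<sigma> k / of_nat m)) + b * p2 (qexp (\<sigma> k / of_nat m)))) \<longlonglongrightarrow>
        s z * (a * p1 0 + b * p2 0)"
      by (intro tendsto_intros sZ P)
    moreover have "(\<lambda>k. c * p1 (qexp (\<sigma> k / of_nat m)) + d * p2 (qexp (\<sigma> k / of_nat m))) \<longlonglongrightarrow> c * p1 0 + d * p2 0"
      by (intro tendsto_intros P)
    ultimately have "s z * (a * p1 0 + b * p2 0) = c * p1 0 + d * p2 0"
      by (rule LIMSEQ_eqI)
    \<comment> \<open>In the limit p1 = 0 and p2 = 1. Evaluating U2 - s(z) U1 at z then gives c =
      s(z) a as well, because \<open>U1\<close> has no zeros, and the determinant would vanish: a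
      point and a cusp cannot share a value.\<close>
    then have d: "d = s z * b"
      by (simp add: p2_0)
    define v where "v = lin_frac (adj2 A) z"
    have v: "v \<in> upper_half_plane" "lin_frac A v = z"
      using A z by (simp_all add: v_def)
    have "U2 z - s z * U1 z = 0"
      using U1_nonzero[OF z] by (simp add: s_def)
    moreover have "U2 z - s z * U1 z = (c - s z * a) * U1 v + (d - s z * b) * U2 v"
      using rhoD(2,3)[OF rh v(1)] by (simp add: v(2) algebra_simps)
    ultimately have "c = s z * a"
      using d U1_nonzero[OF v(1)] by simp
    then show ?thesis
      using d rho_det[OF rh] by simp
  qed
qed

lemma double_not_everything: "double \<noteq> upper_half_plane"
proof
  assume "double = upper_half_plane"
  then have Z: "of_nat (Suc k) * \<i> \<in> double" for k
    by (simp add: mem_uhp del: of_nat_Suc)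
  define Z where "Z k = of_nat (Suc k) * \<i>" for k
  have ZH: "Z k \<in> upper_half_plane" for k
    by (simp add: Z_def mem_uhp del: of_nat_Suc)
  have "Z k \<in> double" for k
    unfolding Z_def by (rule Z)
  then show False
  proof (rule double_sequence)
    fix A and r :: "nat \<Rightarrow> nat" and \<sigma>
    assume A: "A \<in> SL2Z" and r: "strict_mono r" and \<sigma>: "\<And>k :: nat. \<sigma> k \<in> upper_half_plane"
      and eq: "\<And>k. s (lin_frac A (\<sigma> k)) = s (Z (r k))" and neq: "\<And>k. \<not> gequiv m (Z (r k)) (lin_frac A (\<sigma> k))"
      and lim: "(\<exists>l\<in>upper_half_plane. \<sigma> \<longlonglongrightarrow> l) \<or> (\<lambda>k. qexp (\<sigma> k / of_nat m)) \<longlonglongrightarrow> 0"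
    define Q where "Q k = qexp (Z (r k) / of_nat m)" for k
    have "(\<lambda>k. qexp (\<i> / of_nat m) ^ k) \<longlonglongrightarrow> 0"
      using m_pos by (intro LIMSEQ_power_zero qexp_div_in_ball ii_in_uhp)
    then have "(\<lambda>k. qexp (\<i> / of_nat m) ^ Suc k) \<longlonglongrightarrow> 0"
      by (rule LIMSEQ_Suc)
    then have Z0: "(\<lambda>k. qexp (Z k / of_nat m)) \<longlonglongrightarrow> 0"
      unfolding qexp_of_nat_mult [symmetric] by (simp add: Z_def)
    have Q: "Q \<longlonglongrightarrow> 0"
      using LIMSEQ_subseq_LIMSEQ[OF Z0 r] by (simp add: Q_def[abs_def] o_def)
    have cont: "isCont p1 0" "isCont p2 0"
      by (rule disc_continuous[OF p1_hol] disc_continuous[OF p2_hol]; simp)+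
    note PQ = isCont_tendsto_compose[OF cont(1) Q] isCont_tendsto_compose[OF cont(2) Q]
    have key: "U1 w * p2 (Q k) = U2 w * p1 (Q k)" if w: "w \<in> upper_half_plane" "s w = s (Z (r k))" for w k
    proof -
      have "U1 w * U2 (Z (r k)) = U2 w * U1 (Z (r k))"
        using s_eq_iff[OF w(1) ZH[of "r k"]] w(2) by blast
      then show ?thesis
        by (simp add: U1_eq[OF ZH] U2_eq[OF ZH] p1_def Q_def)
    qed
    show False
      using lim
    proof
      assume "\<exists>l\<in>upper_half_plane. \<sigma> \<longlonglongrightarrow> l"
      then obtain l where l: "l \<in> upper_half_plane" "\<sigma> \<longlonglongrightarrow> l"
        by blast
      define w where "w = lin_frac A l"
      have w: "w \<in> upper_half_plane"
        using A l by (simp add: w_def)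
      have W: "(\<lambda>k. lin_frac A (\<sigma> k)) \<longlonglongrightarrow> w"
        unfolding w_def by (rule isCont_tendsto_compose[OF continuous_lin_frac[OF A l(1)] l(2)])
      have c: "isCont U1 w" "isCont U2 w"
        using DERIV_isCont U_DERIV[OF w] by blast+
      have "(\<lambda>k. U1 (lin_frac A (\<sigma> k)) * p2 (Q k)) \<longlonglongrightarrow> U1 w * p2 0"
        by (intro tendsto_mult PQ isCont_tendsto_compose[OF c(1) W])
      moreover have "(\<lambda>k. U2 (lin_frac A (\<sigma> k)) * p1 (Q k)) \<longlonglongrightarrow> U2 w * p1 0"
        by (intro tendsto_mult PQ isCont_tendsto_compose[OF c(2) W])
      ultimately have "U1 w * p2 0 = U2 w * p1 0"
        by (intro LIMSEQ_eqI[OF key[OF lin_frac_in_uhp[OF A \<sigma>] eq]])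
      then show False
        using U1_nonzero[OF w] by (simp add: p2_0)
    next
      assume q: "(\<lambda>k. qexp (\<sigma> k / of_nat m)) \<longlonglongrightarrow> 0"
      note Pq = isCont_tendsto_compose[OF cont(1) q] isCont_tendsto_compose[OF cont(2) q]
      obtain a b c d where rh: "rho A a b c d"
        using rho_exists[OF A] .
      have "(a * p1 (qexp (\<sigma> k / of_nat m)) + b * p2 (qexp (\<sigma> k / of_nat m))) * p2 (Q k) =
          (c * p1 (qexp (\<sigma> k / of_nat m)) + d * p2 (qexp (\<sigma> k / of_nat m))) * p1 (Q k)" for k
      proof -
        have e: "U1 (lin_frac A (\<sigma> k)) = qexp (of_real \<kappa> * \<sigma> k) * (a * p1 (qexp (\<sigma> k / of_nat m)) + b * p2 (qexp (\<sigma> k / of_nat m)))"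
          "U2 (lin_frac A (\<sigma> k)) = qexp (of_real \<kappa> * \<sigma> k) * (c * p1 (qexp (\<sigma> k / of_nat m)) + d * p2 (qexp (\<sigma> k / of_nat m)))"
          using rhoD(2,3)[OF rh \<sigma>] lin_expansion[OF \<sigma>, of a b k] lin_expansion[OF \<sigma>, of c d k] by (simp_all add: lin_def)
        have "U1 (lin_frac A (\<sigma> k)) * p2 (Q k) = U2 (lin_frac A (\<sigma> k)) * p1 (Q k)"
          using key A \<sigma> eq by simp
        then show ?thesis
          unfolding e by simp
      qed
      moreover have "(\<lambda>k. (a * p1 (qexp (\<sigma> k / of_nat m)) + b * p2 (qexp (\<sigma> k / of_nat m))) * p2 (Q k)) \<longlonglongrightarrow>
          (a * p1 0 + b * p2 0) * p2 0"
        by (intro tendsto_intros PQ Pq)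
      moreover have "(\<lambda>k. (c * p1 (qexp (\<sigma> k / of_nat m)) + d * p2 (qexp (\<sigma> k / of_nat m))) * p1 (Q k)) \<longlonglongrightarrow>
          (c * p1 0 + d * p2 0) * p1 0"
        by (intro tendsto_intros PQ Pq)
      ultimately have "(a * p1 0 + b * p2 0) * p2 0 = (c * p1 0 + d * p2 0) * p1 0"
        by (rule LIMSEQ_eqI)
      \<comment> \<open>The cusp of the partners takes the same value as \<infinity>, so by
        \<open>rho_b_zero\<close> it is equivalent to \<infinity>. After a translation and an
        element of \<plusminus>\<Gamma>(m) both sequences tend to the centre of the same
        disc.\<close>
      then have "b = 0"
        by (simp add: p2_0)
      then have "col_cong m A (mat 1)"
        using rho_b_zero[OF A] rh by simp
      then obtain g j where g: "g \<in> Gpm m" "A = g ** mat 1 ** transl j"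
        using col_congD[OF m A SL2Z_one] by blast
      define Y where "Y k = \<sigma> k + of_int j" for k
      have YH: "Y k \<in> upper_half_plane" for k
        using \<sigma>[of k] by (simp add: Y_def mem_uhp)
      have AY: "lin_frac A (\<sigma> k) = lin_frac g (Y k)" for k
        using \<sigma> by (simp add: g(2) lin_frac_mult Y_def)
      have gY: "gequiv m (Y k) (lin_frac A (\<sigma> k))" for k
        using g(1) AY by (auto simp: gequiv_def)
      have sY: "s (Y k) = s (Z (r k))" for k
        using s_invariant[OF gY YH] eq by simp
      define Q' where "Q' k = qexp (Y k / of_nat m)" for k
      have "(\<lambda>k. qexp (\<sigma> k / of_nat m) * qexp (of_int j / of_nat m)) \<longlonglongrightarrow> 0 * qexp (of_int j / of_nat m)"
        by (intro tendsto_intros q)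
      then have Q': "Q' \<longlonglongrightarrow> 0"
        by (simp add: Q'_def[abs_def] Y_def add_divide_distrib qexp_add)
      have cross: "p1 (Q' k) * p2 (Q k) = p2 (Q' k) * p1 (Q k)" for k
        using key[OF YH sY, of k] by (simp add: mult_ac U1_eq[OF YH] U2_eq[OF YH] p1_def Q'_def)
      define S where "S = {q \<in> ball 0 1. p2 q \<noteq> 0}"
      have "open S"
      proof -
        have "open (ball 0 1 \<inter> p2 -` (- {0}))"
          by (intro continuous_open_preimage holomorphic_on_imp_continuous_on p2_hol) auto
        moreover have "ball 0 1 \<inter> p2 -` (- {0}) = S"
          by (auto simp: S_def)
        ultimately show ?thesis
          by simp
      qed
      have S0: "0 \<in> S"
        by (simp add: S_def p2_0)
      have SD: "(p1 has_field_derivative deriv p1 q) (at q)" "(p2 has_field_derivative deriv p2 q) (at q)" if "q \<in> S" for q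
        using that by (auto simp: S_def intro!: holomorphic_derivI[OF p1_hol] holomorphic_derivI[OF p2_hol])
      have D: "((\<lambda>q. p1 q / p2 q) has_field_derivative (deriv p1 q * p2 q - p1 q * deriv p2 q) / (p2 q * p2 q)) (at q)" if "q \<in> S" for q
        using that by (intro DERIV_divide SD) (simp_all add: S_def)
      have hol: "(\<lambda>q. p1 q / p2 q) holomorphic_on S"
        using D \<open>open S\<close> by (auto simp: holomorphic_on_open)
      have "deriv (\<lambda>q. p1 q / p2 q) 0 \<noteq> 0"
        unfolding DERIV_imp_deriv[OF D[OF S0]] using p_wronskian[of 0] by (simp add: p2_0)
      then obtain \<rho> where \<rho>: "\<rho> > 0" "ball 0 \<rho> \<subseteq> S" "inj_on (\<lambda>q. p1 q / p2 q) (ball 0 \<rho>)"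
        using has_complex_derivative_locally_injective[OF hol S0 \<open>open S\<close>] by blast
      have "\<forall>\<^sub>F k in sequentially. dist (Q k) 0 < \<rho> \<and> dist (Q' k) 0 < \<rho>"
        using tendstoD[OF Q \<rho>(1)] tendstoD[OF Q' \<rho>(1)] by (rule eventually_conj)
      then obtain k where k: "Q k \<in> ball 0 \<rho>" "Q' k \<in> ball 0 \<rho>"
        by (auto simp: eventually_sequentially)
      then have "p2 (Q k) \<noteq> 0" "p2 (Q' k) \<noteq> 0"
        using \<rho>(2) by (auto simp: S_def)
      then have "p1 (Q k) / p2 (Q k) = p1 (Q' k) / p2 (Q' k)"
        using cross[of k] by (simp add: field_simps)
      then have "Q k = Q' k"
        using inj_onD[OF \<rho>(3)] k by blast
      \<comment> \<open>Equal coordinates q mean a translation by a multiple of m, which is an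
        element of \<plusminus>\<Gamma>(m), contrary to the choice of the partners.\<close>
      then have "qexp (Y k / of_nat m + - (Z (r k) / of_nat m)) = 1"
        unfolding qexp_add by (simp add: Q_def Q'_def qexp_uminus)
      then have "qexp ((Y k - Z (r k)) / of_nat m) = 1"
        by (simp add: diff_divide_distrib)
      then obtain i where "(Y k - Z (r k)) / of_nat m = of_int i"
        unfolding qexp_eq_1_iff by (elim Ints_cases)
      then have "Y k = lin_frac (transl (int m * i)) (Z (r k))"
        using m_pos by (simp add: field_simps)
      then have "gequiv m (Z (r k)) (Y k)"
        unfolding gequiv_def by (intro bexI[of _ "transl (int m * i)"]) (simp_all add: Gpm_transl)
      then have "gequiv m (Z (r k)) (lin_frac A (\<sigma> k))"
        using gY ZH gequiv_trans by blast
      then show False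
        using neq by simp
    qed
  qed
qed

theorem s_injective:
  assumes z: "z \<in> upper_half_plane" and w: "w \<in> upper_half_plane" and "s z = s w"
  shows "gequiv m z w"
proof -
  have sub: "double \<subseteq> upper_half_plane"
    by (auto simp: double_def)
  have "openin (top_of_set upper_half_plane) double"
    using open_double sub by (rule open_subset[rotated])
  moreover have "closedin (top_of_set upper_half_plane) double"
    unfolding closedin_limpt
  proof (intro conjI allI impI sub)
    fix x assume x: "x islimpt double \<and> x \<in> upper_half_plane"
    then obtain f where "\<And>k. f k \<in> double - {x}" "f \<longlonglongrightarrow> x"
      unfolding islimpt_sequential by blast
    then show "x \<in> double"
      using closed_double[of x f] x by blast
  qed
  ultimately have "double = {}"
    using connected_uhp double_not_everything unfolding connected_clopen by blast
  then show ?thesis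
    using assms unfolding double_def by auto
qed

end

section \<open>Factorization into linear forms\<close>

text \<open>Near a zero of l, the quotient of the difference quotients of f and l is holomorphic,
  with value f'/l' at the zero.\<close>

lemma holomorphic_quotient_simple_zeros:
  assumes S: "open S" and f: "f holomorphic_on S" and l: "l holomorphic_on S"
    and zeros: "\<And>z. z \<in> S \<Longrightarrow> l z = 0 \<Longrightarrow> f z = 0 \<and> deriv l z \<noteq> 0"
  shows "\<exists>g. g holomorphic_on S \<and> (\<forall>z\<in>S. f z = l z * g z)"
proof -
  define g where "g z = (if l z = 0 then deriv f z / deriv l z else f z / l z)" for z
  have "g analytic_on S"
    unfolding analytic_on_def
  proof
    fix x assume x: "x \<in> S"
    show "\<exists>e>0. g holomorphic_on ball x e"
    proof (cases "l x = 0")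
      case False
      have "continuous (at x) l"
        using l x S by (meson continuous_on_eq_continuous_at holomorphic_on_imp_continuous_on)
      then obtain e where e: "e > 0" "\<forall>y. dist x y < e \<longrightarrow> l y \<noteq> 0"
        using continuous_at_avoid[of x l 0] False by blast
      obtain e' where e': "e' > 0" "ball x e' \<subseteq> S"
        using S x open_contains_ball by blast
      have "(\<lambda>z. f z / l z) holomorphic_on ball x (min e e')"
        using e e' by (intro holomorphic_on_divide holomorphic_on_subset[OF f] holomorphic_on_subset[OF l]) auto
      then have "g holomorphic_on ball x (min e e')"
        by (rule holomorphic_transform) (use e in \<open>auto simp: g_def\<close>)
      then show ?thesis
        using e(1) e'(1) by (intro exI[of _ "min e e'"]) simp
    next
      case True
      then have fx: "f x = 0" and dl: "deriv l x \<noteq> 0"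
        using zeros[OF x] by auto
      define F where "F z = (if z = x then deriv f x else (f z - f x) / (z - x))" for z
      define L where "L z = (if z = x then deriv l x else (l z - l x) / (z - x))" for z
      have F: "F holomorphic_on S" and L: "L holomorphic_on S"
        unfolding F_def L_def using x S by (auto intro!: pole_lemma f l simp: interior_open)
      have "continuous (at x) L"
        using L x S by (meson continuous_on_eq_continuous_at holomorphic_on_imp_continuous_on)
      moreover have "L x \<noteq> 0"
        using dl by (simp add: L_def)
      ultimately obtain e where e: "e > 0" "\<forall>y. dist x y < e \<longrightarrow> L y \<noteq> 0"
        using continuous_at_avoid[of x L 0] by blast
      obtain e' where e': "e' > 0" "ball x e' \<subseteq> S"
        using S x open_contains_ball by blast
      have "(\<lambda>z. F z / L z) holomorphic_on ball x (min e e')"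
        using e e' by (intro holomorphic_on_divide holomorphic_on_subset[OF F] holomorphic_on_subset[OF L]) auto
      moreover have "F z / L z = g z" if "z \<in> ball x (min e e')" for z
      proof (cases "z = x")
        case False
        then have "l z \<noteq> 0"
          using e(2) that True by (auto simp: L_def)
        then show ?thesis
          using False True fx by (simp add: F_def L_def g_def)
      qed (simp add: F_def L_def g_def True)
      ultimately have "g holomorphic_on ball x (min e e')"
        by (rule holomorphic_transform)
      then show ?thesis
        using e(1) e'(1) by (intro exI[of _ "min e e'"]) simp
    qed
  qed
  then have "g holomorphic_on S"
    by (rule analytic_imp_holomorphic)
  moreover have "\<forall>z\<in>S. f z = l z * g z"
    using zeros by (simp add: g_def)
  ultimately show ?thesis
    by blast
qed

lemma eventually_nonzero_simple_zero:
  assumes S: "open S" "z \<in> S" and l: "l holomorphic_on S" "l z \<noteq> 0 \<or> deriv l z \<noteq> 0"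
  shows "\<forall>\<^sub>F w in at z. l w \<noteq> 0"
proof (cases "l z = 0")
  case False
  have "isCont l z"
    using l(1) S by (meson continuous_on_eq_continuous_at holomorphic_on_imp_continuous_on)
  then show ?thesis
    using False tendsto_imp_eventually_ne by (auto simp: isCont_def)
next
  case True
  then have "deriv l z \<noteq> 0"
    using l(2) by simp
  then obtain r where r: "r > 0" "ball z r \<subseteq> S" "inj_on l (ball z r)"
    using has_complex_derivative_locally_injective[OF l(1) S(2,1)] by blast
  have "\<forall>\<^sub>F w in at z. w \<in> ball z r - {z}"
    using r(1) by (intro eventually_at_in_open) auto
  then show ?thesis
  proof eventually_elim
    case (elim w)
    then show ?case
      using inj_onD[OF r(3), of w z] r(1) True by auto
  qed
qed

text \<open>Carries identities for a quotient across the zeros of the divisor, which are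
  isolated.\<close>

lemma eq_off_simple_zero:
  fixes u v :: "complex \<Rightarrow> 'a :: t2_space"
  assumes S: "open S" "z \<in> S" and l: "l holomorphic_on S" "l z \<noteq> 0 \<or> deriv l z \<noteq> 0"
    and u: "isCont u z" and v: "isCont v z" and eq: "\<And>w. w \<in> S \<Longrightarrow> l w \<noteq> 0 \<Longrightarrow> u w = v w"
  shows "u z = v z"
proof -
  have "\<forall>\<^sub>F w in at z. w \<in> S - {z}"
    using S by (intro eventually_at_in_open)
  with eventually_nonzero_simple_zero[OF S l] have "\<forall>\<^sub>F w in at z. u w = v w"
    by eventually_elim (use eq in auto)
  then have "u \<midarrow>z\<rightarrow> v z"
    using v unfolding isCont_def by (simp add: tendsto_cong)
  then show ?thesis
    using u unfolding isCont_def by (rule LIM_unique[rotated])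
qed

text \<open>Otherwise 1/f would be a form of positive order -\<kappa>, hence identically 0. The zero
  found may lie at a cusp, where it shows as G 0 = 0.\<close>

lemma mform_has_zero:
  assumes m: "m > 0" and f: "mform m \<kappa> f" and neg: "\<kappa> < 0" and nz: "\<And>z. z \<in> upper_half_plane \<Longrightarrow> f z \<noteq> 0"
  shows "\<exists>A\<in>SL2Z. \<exists>G. G holomorphic_on ball 0 1 \<and> G 0 = 0 \<and>
    (\<forall>z\<in>upper_half_plane. f (lin_frac A z) = qexp (of_real \<kappa> * z) * G (qexp (z / of_nat m)))"
proof (rule ccontr)
  assume contra: "\<not> ?thesis"
  have "mform m (- \<kappa>) (\<lambda>z. inverse (f z))"
    unfolding mform_def
  proof (intro conjI ballI)
    show "(\<lambda>z. inverse (f z)) holomorphic_on upper_half_plane"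
      using f nz by (intro holomorphic_intros) (auto simp: mform_def)
    show "norm (inverse (f (lin_frac g z))) = norm (inverse (f z))" if "g \<in> Gpm m" "z \<in> upper_half_plane" for g z
      using f that by (simp add: mform_def norm_inverse)
    fix A assume A: "A \<in> SL2Z"
    then obtain G where G: "G holomorphic_on ball 0 1"
      "\<forall>z\<in>upper_half_plane. f (lin_frac A z) = qexp (of_real \<kappa> * z) * G (qexp (z / of_nat m))"
      using f unfolding mform_def by blast
    have "G q \<noteq> 0" if "q \<in> ball 0 1" for q
    proof (cases "q = 0")
      case True
      then show ?thesis
        using contra A G by blast
    next
      case False
      have q: "norm q < 1"
        using that by simp
      have "f (lin_frac A (cusp_log m q)) \<noteq> 0"
        using A cusp_log(1)[OF m False q] by (intro nz) simp
      then show ?thesis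
        using G(2) cusp_log[OF m False q] by auto
    qed
    then have "(\<lambda>q. inverse (G q)) holomorphic_on ball 0 1"
      by (intro holomorphic_intros G)
    moreover have "inverse (f (lin_frac A z)) = qexp (of_real (- \<kappa>) * z) * inverse (G (qexp (z / of_nat m)))"
      if "z \<in> upper_half_plane" for z
      using G(2) that by (simp add: qexp_uminus)
    ultimately show "\<exists>G. G holomorphic_on ball 0 1 \<and> (\<forall>z\<in>upper_half_plane.
        inverse (f (lin_frac A z)) = qexp (of_real (- \<kappa>) * z) * G (qexp (z / of_nat m)))"
      by (intro exI[of _ "\<lambda>q. inverse (G q)"]) blast
  qed
  then have "inverse (f \<i>) = 0"
    using mform_zero[OF m, of "- \<kappa>" "\<lambda>z. inverse (f z)"] neg ii_in_uhp by simp
  then show False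
    using nz[of \<i>] by simp
qed

context modular_pair1
begin

lemma lin_simple:
  assumes "(a, b) \<noteq> (0, 0)" and z: "z \<in> upper_half_plane"
  shows "lin a b z \<noteq> 0 \<or> deriv (lin a b) z \<noteq> 0"
proof (rule ccontr)
  assume "\<not> ?thesis"
  moreover have "(lin a b has_field_derivative a * deriv U1 z + b * deriv U2 z) (at z)"
    unfolding lin_def[abs_def] by (intro DERIV_add DERIV_cmult U_DERIV z)
  ultimately have *: "a * U1 z + b * U2 z = 0" "a * deriv U1 z + b * deriv U2 z = 0"
    by (auto simp: lin_def DERIV_imp_deriv)
  have "a * wronskian U1 U2 z = U2 z * (a * deriv U1 z + b * deriv U2 z) - deriv U2 z * (a * U1 z + b * U2 z)"
    "b * wronskian U1 U2 z = deriv U1 z * (a * U1 z + b * U2 z) - U1 z * (a * deriv U1 z + b * deriv U2 z)"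
    by (simp_all add: wronskian_def algebra_simps)
  then show False
    using * assms wronskian_nonzero[OF z] by auto
qed

lemma p_simple:
  assumes "(a, b) \<noteq> (0, 0)" and q: "norm q < 1"
  shows "a * p1 q + b * p2 q \<noteq> 0 \<or> deriv (\<lambda>q. a * p1 q + b * p2 q) q \<noteq> 0"
proof (rule ccontr)
  assume "\<not> ?thesis"
  moreover have "(p1 has_field_derivative deriv p1 q) (at q)" "(p2 has_field_derivative deriv p2 q) (at q)"
    using p1_hol p2_hol q by (auto intro!: holomorphic_derivI[of _ "ball 0 1"])
  then have "((\<lambda>q. a * p1 q + b * p2 q) has_field_derivative a * deriv p1 q + b * deriv p2 q) (at q)"
    by (intro DERIV_add DERIV_cmult)
  ultimately have *: "a * p1 q + b * p2 q = 0" "a * deriv p1 q + b * deriv p2 q = 0"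
    by (auto simp: DERIV_imp_deriv)
  have "a * (deriv p1 q * p2 q - p1 q * deriv p2 q) = p2 q * (a * deriv p1 q + b * deriv p2 q) - deriv p2 q * (a * p1 q + b * p2 q)"
    "b * (deriv p1 q * p2 q - p1 q * deriv p2 q) = deriv p1 q * (a * p1 q + b * p2 q) - p1 q * (a * deriv p1 q + b * deriv p2 q)"
    by (simp_all add: algebra_simps)
  then show False
    using * assms p_wronskian[OF q] by auto
qed

text \<open>The leading coefficient of the linear form at the cusp of A is a\<beta> + b\<delta>; the
  last hypothesis asks f to vanish at the cusps where it is 0. All zeros of linear forms, also in
  the cusp discs, are simple, so the division succeeds everywhere and the orders subtract.\<close>

lemma mform_divide:
  assumes f: "mform m \<kappa>' f" and ab: "(a, b) \<noteq> (0, 0)"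
    and zero: "\<And>z. z \<in> upper_half_plane \<Longrightarrow> lin a b z = 0 \<Longrightarrow> f z = 0"
    and cusp: "\<And>A \<alpha> \<beta> \<gamma> \<delta> G. A \<in> SL2Z \<Longrightarrow> rho A \<alpha> \<beta> \<gamma> \<delta> \<Longrightarrow> a * \<beta> + b * \<delta> = 0 \<Longrightarrow> G holomorphic_on ball 0 1 \<Longrightarrow>
      \<forall>z\<in>upper_half_plane. f (lin_frac A z) = qexp (of_real \<kappa>' * z) * G (qexp (z / of_nat m)) \<Longrightarrow> G 0 = 0"
  shows "\<exists>g. mform m (\<kappa>' - \<kappa>) g \<and> (\<forall>z\<in>upper_half_plane. f z = lin a b z * g z)"
proof -
  have f_hol: "f holomorphic_on upper_half_plane"
    using f by (simp add: mform_def)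
  obtain g where g: "g holomorphic_on upper_half_plane" "\<forall>z\<in>upper_half_plane. f z = lin a b z * g z"
    using holomorphic_quotient_simple_zeros[OF open_uhp f_hol lin_hol[of a b]] zero lin_simple[OF ab] by blast
  have g_cont: "isCont g z" if "z \<in> upper_half_plane" for z
    using holomorphic_on_imp_continuous_on[OF g(1)] that continuous_on_eq_continuous_at[OF open_uhp] by blast
  have gA_cont: "isCont (\<lambda>z. g (lin_frac A z)) z" if "A \<in> SL2Z" "z \<in> upper_half_plane" for A z
    using isCont_o2[OF continuous_lin_frac[OF that] g_cont] that by simp
  have "mform m (\<kappa>' - \<kappa>) g"
    unfolding mform_def
  proof (intro conjI ballI g(1))
    fix h z assume h: "h \<in> Gpm m" and z: "z \<in> upper_half_plane"
    have hS: "h \<in> SL2Z"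
      using h Gpm_SL2Z by blast
    show "norm (g (lin_frac h z)) = norm (g z)"
    proof (rule eq_off_simple_zero[OF open_uhp z lin_hol lin_simple[OF ab z], of "\<lambda>z. norm (g (lin_frac h z))" "\<lambda>z. norm (g z)"])
      show "isCont (\<lambda>z. norm (g (lin_frac h z))) z"
        by (intro continuous_norm gA_cont hS z)
      show "isCont (\<lambda>z. norm (g z)) z"
        by (intro continuous_norm g_cont z)
      fix w assume w: "w \<in> upper_half_plane" "lin a b w \<noteq> 0"
      have "norm (f (lin_frac h w)) = norm (f w)" "norm (lin a b (lin_frac h w)) = norm (lin a b w)"
        using f mform_lin[of a b] h w(1) by (auto simp: mform_def)
      then show "norm (g (lin_frac h w)) = norm (g w)"
        using g(2) w hS by (simp add: norm_mult)
    qed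
  next
    fix A assume A: "A \<in> SL2Z"
    then obtain F where F: "F holomorphic_on ball 0 1"
      "\<forall>z\<in>upper_half_plane. f (lin_frac A z) = qexp (of_real \<kappa>' * z) * F (qexp (z / of_nat m))"
      using f unfolding mform_def by blast
    obtain \<alpha> \<beta> \<gamma> \<delta> where r: "rho A \<alpha> \<beta> \<gamma> \<delta>"
      using rho_exists[OF A] .
    define x y where "x = a * \<alpha> + b * \<gamma>" and "y = a * \<beta> + b * \<delta>"
    have linA: "lin a b (lin_frac A z) = lin x y z" if "z \<in> upper_half_plane" for z
      using lin_rho[OF r that] by (simp add: x_def y_def)
    have "a * (\<alpha> * \<delta> - \<beta> * \<gamma>) = x * \<delta> - y * \<gamma>" "b * (\<alpha> * \<delta> - \<beta> * \<gamma>) = y * \<alpha> - x * \<beta>"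
      by (simp_all add: x_def y_def algebra_simps)
    then have xy: "(x, y) \<noteq> (0, 0)"
      using ab rho_det[OF r] by auto
    define L where "L q = x * p1 q + y * p2 q" for q
    have L: "L holomorphic_on ball 0 1"
      unfolding L_def by (intro holomorphic_intros p1_hol p2_hol)
    have "F q = 0 \<and> deriv L q \<noteq> 0" if q: "q \<in> ball 0 1" "L q = 0" for q
    proof
      show "deriv L q \<noteq> 0"
        using p_simple[OF xy, of q] q by (auto simp: L_def[abs_def])
      show "F q = 0"
      proof (cases "q = 0")
        case True
        then show ?thesis
          using cusp[OF A r _ F] q(2) by (simp add: L_def y_def p1_0 p2_0)
      next
        case False
        have c: "cusp_log m q \<in> upper_half_plane" "qexp (cusp_log m q / of_nat m) = q"
          using cusp_log[OF m_pos False] q by auto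
        have "lin a b (lin_frac A (cusp_log m q)) = 0"
          using linA[OF c(1)] lin_expansion[OF c(1)] q(2) by (simp add: c(2) L_def)
        then have "f (lin_frac A (cusp_log m q)) = 0"
          using A c(1) by (intro zero) auto
        then show ?thesis
          using F(2) c by auto
      qed
    qed
    then obtain K where K: "K holomorphic_on ball 0 1" "\<forall>q\<in>ball 0 1. F q = L q * K q"
      using holomorphic_quotient_simple_zeros[OF open_ball F(1) L] by blast
    have "g (lin_frac A z) = qexp (of_real (\<kappa>' - \<kappa>) * z) * K (qexp (z / of_nat m))" if z: "z \<in> upper_half_plane" for z
    proof (rule eq_off_simple_zero[OF open_uhp z lin_hol lin_simple[OF xy z], of "\<lambda>z. g (lin_frac A z)"])
      show "isCont (\<lambda>z. g (lin_frac A z)) z"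
        by (intro gA_cont A z)
      have "isCont (\<lambda>z. K (qexp (z / of_nat m))) z"
      proof (rule isCont_o2[where g = K])
        show "isCont (\<lambda>z. qexp (z / of_nat m)) z"
          unfolding qexp_def using m_pos by (intro continuous_intros) auto
        show "isCont K (qexp (z / of_nat m))"
          using m_pos z by (intro disc_continuous[OF K(1)]) simp
      qed
      then show "isCont (\<lambda>z. qexp (of_real (\<kappa>' - \<kappa>) * z) * K (qexp (z / of_nat m))) z"
        unfolding qexp_def by (intro continuous_intros)
      fix w assume w: "w \<in> upper_half_plane" "lin x y w \<noteq> 0"
      have "lin x y w = qexp (of_real \<kappa> * w) * L (qexp (w / of_nat m))"
        using lin_expansion[OF w(1)] by (simp add: L_def)
      moreover have "f (lin_frac A w) = lin x y w * g (lin_frac A w)"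
        using g(2) A w(1) linA by simp
      moreover have "f (lin_frac A w) = qexp (of_real \<kappa>' * w) * (L (qexp (w / of_nat m)) * K (qexp (w / of_nat m)))"
        using F(2) K(2) w(1) m_pos by simp
      moreover have "qexp (of_real \<kappa>' * w) = qexp (of_real \<kappa> * w) * qexp (of_real (\<kappa>' - \<kappa>) * w)"
        by (simp flip: qexp_add add: algebra_simps)
      ultimately have "lin x y w * g (lin_frac A w) = lin x y w * (qexp (of_real (\<kappa>' - \<kappa>) * w) * K (qexp (w / of_nat m)))"
        by (simp only: mult_ac)
      then show "g (lin_frac A w) = qexp (of_real (\<kappa>' - \<kappa>) * w) * K (qexp (w / of_nat m))"
        using w(2) by simp
    qed
    then show "\<exists>G. G holomorphic_on ball 0 1 \<and> (\<forall>z\<in>upper_half_plane.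
        g (lin_frac A z) = qexp (of_real (\<kappa>' - \<kappa>) * z) * G (qexp (z / of_nat m)))"
      using K(1) by blast
  qed
  then show ?thesis
    using g(2) by blast
qed

text \<open>A zero x in the half-plane is divided out by the form vanishing at x: its zeros are the
  orbit of x and no cusp. If there is no such x, then f vanishes at a cusp A0\<infinity>, and the
  divisor is U1(A0^{-1} z), which is nonzero in the half-plane and vanishes only at cusps equivalent
  to A0\<infinity>.\<close>

lemma mform_split_linear:
  assumes f: "mform m \<kappa>' f" and neg: "\<kappa>' < 0"
  shows "\<exists>a b g. (a, b) \<noteq> (0, 0) \<and> mform m (\<kappa>' - \<kappa>) g \<and> (\<forall>z\<in>upper_half_plane. f z = lin a b z * g z)"
proof (cases "\<exists>x\<in>upper_half_plane. f x = 0")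
  case True
  then obtain x where x: "x \<in> upper_half_plane" "f x = 0"
    by blast
  have U1x: "U1 x \<noteq> 0"
    using U1_nonzero x(1) .
  have "\<exists>g. mform m (\<kappa>' - \<kappa>) g \<and> (\<forall>z\<in>upper_half_plane. f z = lin (U2 x) (- U1 x) z * g z)"
  proof (rule mform_divide[OF f])
    show "(U2 x, - U1 x) \<noteq> (0, 0)"
      using U1x by simp
  next
    fix z assume z: "z \<in> upper_half_plane" "lin (U2 x) (- U1 x) z = 0"
    then have "s x = s z"
      using s_eq_iff[OF x(1) z(1)] by (simp add: lin_def)
    then obtain g where "g \<in> Gpm m" "z = lin_frac g x"
      using s_injective[OF x(1) z(1)] by (auto simp: gequiv_def)
    then have "norm (f z) = norm (f x)"
      using f x(1) by (simp add: mform_def)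
    then show "f z = 0"
      using x(2) by simp
  next
    fix A \<alpha> \<beta> \<gamma> \<delta> and G :: "complex \<Rightarrow> complex"
    assume A: "A \<in> SL2Z" and r: "rho A \<alpha> \<beta> \<gamma> \<delta>" and zero: "U2 x * \<beta> + - U1 x * \<delta> = 0"
    define w where "w = lin_frac (adj2 A) x"
    have w: "w \<in> upper_half_plane" "lin_frac A w = x"
      using A x(1) lin_frac_adj2[of "adj2 A" x] by (simp_all add: w_def)
    \<comment> \<open>A form vanishing at the cusp of A is a multiple of U1(A^{-1} z) and thus has
      no zero at x unless it is identically 0.\<close>
    have "lin (U2 x) (- U1 x) x = (U2 x * \<alpha> + - U1 x * \<gamma>) * U1 w"
      using lin_rho[OF r w(1), of "U2 x" "- U1 x"] zero unfolding w(2) by (simp add: lin_def)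
    then have "U2 x * \<alpha> + - U1 x * \<gamma> = 0"
      using U1_nonzero[OF w(1)] by (simp add: lin_def)
    then have "U1 x * (\<alpha> * \<delta> - \<beta> * \<gamma>) = 0"
      using zero by algebra
    then show "G 0 = 0"
      using U1x rho_det[OF r] by simp
  qed
  then show ?thesis
    using U1x by (intro exI[of _ "U2 x"] exI[of _ "- U1 x"]) simp
next
  case False
  then obtain A0 F0 where A0: "A0 \<in> SL2Z" and F0: "F0 holomorphic_on ball 0 1" "F0 0 = 0"
    "\<forall>z\<in>upper_half_plane. f (lin_frac A0 z) = qexp (of_real \<kappa>' * z) * F0 (qexp (z / of_nat m))"
    using mform_has_zero[OF m_pos f neg] by blast
  obtain a b c d where r0: "rho (adj2 A0) a b c d"
    using rho_exists[OF SL2Z_adj[OF A0]] .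
  have lin0: "lin a b z = U1 (lin_frac (adj2 A0) z)" if "z \<in> upper_half_plane" for z
    using rhoD(2)[OF r0 that] by (simp add: lin_def)
  have ab: "(a, b) \<noteq> (0, 0)"
    using rho_det[OF r0] by auto
  have "\<exists>g. mform m (\<kappa>' - \<kappa>) g \<and> (\<forall>z\<in>upper_half_plane. f z = lin a b z * g z)"
  proof (rule mform_divide[OF f ab])
    fix z assume "z \<in> upper_half_plane" "lin a b z = 0"
    then show "f z = 0"
      using lin0[of z] U1_nonzero[of "lin_frac (adj2 A0) z"] A0 by simp
  next
    fix A \<alpha> \<beta> \<gamma> \<delta> G
    assume A: "A \<in> SL2Z" and r: "rho A \<alpha> \<beta> \<gamma> \<delta>" and zero: "a * \<beta> + b * \<delta> = 0"
      and G: "G holomorphic_on ball 0 1"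
        "\<forall>z\<in>upper_half_plane. f (lin_frac A z) = qexp (of_real \<kappa>' * z) * G (qexp (z / of_nat m))"
    have "col_cong m (adj2 A0 ** A) (mat 1)"
      using rho_b_zero[of "adj2 A0 ** A" "a * \<alpha> + b * \<gamma>" "c * \<alpha> + d * \<gamma>" "c * \<beta> + d * \<delta>"]
        rho_mult[OF r0 r A] A0 A zero by simp
    then obtain g k where g: "g \<in> Gpm m" "adj2 A0 ** A = g ** mat 1 ** transl k"
      using col_congD[OF m, of "adj2 A0 ** A" "mat 1"] A0 A by auto
    have gS: "g \<in> SL2Z"
      using g(1) Gpm_SL2Z by blast
    define g' where "g' = A0 ** g ** adj2 A0"
    have g': "g' \<in> Gpm m"
      using sl2_normal_Gpm[of m] g(1) A0 by (auto simp: sl2_normal_def g'_def)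
    have "A = A0 ** (adj2 A0 ** A)"
      using A0 by (simp add: matrix_mul_assoc)
    also have "\<dots> = g' ** (A0 ** transl k)"
      unfolding g(2) g'_def using A0 by (simp flip: matrix_mul_assoc)
    finally have A_eq: "A = g' ** (A0 ** transl k)" .
    define \<zeta> where "\<zeta> = qexp (of_int k / of_nat m)"
    have n\<zeta>: "norm \<zeta> = 1"
      by (simp add: \<zeta>_def norm_qexp)
    \<comment> \<open>Expansions at equivalent cusps are related only in absolute value, so |G| and
      |F0| are compared; the embedding into the complex numbers fits
      \<open>continuous_at_cusp\<close>.\<close>
    define D where "D q = complex_of_real (norm (G q) - norm (F0 (\<zeta> * q)))" for q
    have "isCont D 0"
    proof -
      have c1: "isCont G 0"
        by (rule disc_continuous[OF G(1)]) simp
      have c2: "isCont F0 (\<zeta> * 0)"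
        by (rule disc_continuous[OF F0(1)]) simp
      have c3: "isCont (\<lambda>q. \<zeta> * q) 0"
        by (intro continuous_intros)
      show ?thesis
        unfolding D_def by (intro continuous_intros c1 isCont_o2[OF c3 c2])
    qed
    moreover have "D (qexp (z / of_nat m)) = 0" if z: "z \<in> upper_half_plane" for z
    proof -
      have zk: "z + of_int k \<in> upper_half_plane"
        using z by (simp add: mem_uhp)
      have "norm (f (lin_frac A z)) = norm (f (lin_frac A0 (z + of_int k)))"
        unfolding A_eq using f g' A0 z zk Gpm_SL2Z by (simp add: mform_def lin_frac_mult)
      moreover have "norm (qexp (of_real \<kappa>' * (z + of_int k))) = norm (qexp (of_real \<kappa>' * z))"
        by (simp add: norm_qexp)
      moreover have "qexp ((z + of_int k) / of_nat m) = \<zeta> * qexp (z / of_nat m)"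
        by (simp add: \<zeta>_def add_divide_distrib qexp_add)
      ultimately show ?thesis
        using F0(3) G(2) z zk by (simp add: D_def norm_mult)
    qed
    ultimately have "D 0 = 0"
      by (rule continuous_at_cusp[OF _ _ m_pos])
    then show "G 0 = 0"
      by (simp add: D_def F0(2))
  qed
  then show ?thesis
    using ab by blast
qed

text \<open>Each division raises the order by -\<kappa>; after d of them order 0 is reached, where
  only constants are left.\<close>

lemma mform_factorization:
  assumes "mform m (real d * \<kappa>) f" "\<exists>z\<in>upper_half_plane. f z \<noteq> 0"
  shows "\<exists>c a b. c \<noteq> 0 \<and> (\<forall>i<d. (a i, b i) \<noteq> (0, 0)) \<and>
    (\<forall>z\<in>upper_half_plane. f z = c * (\<Prod>i<d. lin (a i) (b i) z))"
  using assms
proof (induction d arbitrary: f)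
  case 0
  then obtain c where "\<forall>z\<in>upper_half_plane. f z = c"
    using mform_const_ex[OF m_pos, of 0 f] by auto
  then show ?case
    using 0 by (intro exI[of _ c]) auto
next
  case (Suc d)
  have "real (Suc d) * \<kappa> < 0"
    using kappa_neg by (simp add: mult_pos_neg)
  then obtain x y g where g: "(x, y) \<noteq> (0, 0)" "mform m (real (Suc d) * \<kappa> - \<kappa>) g"
    "\<forall>z\<in>upper_half_plane. f z = lin x y z * g z"
    using mform_split_linear[OF Suc.prems(1)] by blast
  have "real (Suc d) * \<kappa> - \<kappa> = real d * \<kappa>"
    by (simp add: algebra_simps)
  moreover have "\<exists>z\<in>upper_half_plane. g z \<noteq> 0"
    using Suc.prems(2) g(3) by auto
  ultimately obtain c a b where IH: "c \<noteq> 0" "\<forall>i<d. (a i, b i) \<noteq> (0, 0)"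
    "\<forall>z\<in>upper_half_plane. g z = c * (\<Prod>i<d. lin (a i) (b i) z)"
    using Suc.IH[of g] g(2) by auto
  have "\<forall>z\<in>upper_half_plane. f z = c * (\<Prod>i<Suc d. lin ((a(d := x)) i) ((b(d := y)) i) z)"
    using IH(3) g(3) by (simp add: mult_ac)
  then show ?case
    using IH(1,2) g(1) by (intro exI[of _ c] exI[of _ "a(d := x)"] exI[of _ "b(d := y)"]) (auto simp: less_Suc_eq)
qed

end

section \<open>Linearization of the Schwarz equation\<close>

definition proj :: "complex \<Rightarrow> complex \<Rightarrow> complex option" where
  "proj u v = (if v = 0 then None else Some (u / v))"

lemma proj_eq_iff:
  assumes "(u, v) \<noteq> (0, 0)" "(u', v') \<noteq> (0, 0)"
  shows "proj u v = proj u' v' \<longleftrightarrow> u * v' = u' * v"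
  using assms by (auto simp: proj_def field_simps)

lemma value_P1_cong:
  assumes "\<forall>\<^sub>F w in at z. f w = g w"
  shows "value_P1 f z = value_P1 g z"
  unfolding value_P1_def using is_pole_cong[OF assms refl] remove_sings_cong[OF assms refl] by simp

lemma deriv_remove_sings_cong:
  assumes "\<forall>\<^sub>F w in at z. f w = g w"
  shows "deriv (remove_sings f) z = deriv (remove_sings g) z"
proof (rule deriv_cong_ev[OF _ refl])
  obtain T where T: "open T" "z \<in> T" "\<And>w. w \<in> T \<Longrightarrow> w \<noteq> z \<Longrightarrow> f w = g w"
    using assms unfolding eventually_at_topological by blast
  have "remove_sings f w = remove_sings g w" if w: "w \<in> T" for w
  proof (rule remove_sings_cong[OF _ refl])
    show "\<forall>\<^sub>F x in at w. f x = g x"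
    proof (cases "w = z")
      case False
      have "\<forall>\<^sub>F x in at w. x \<in> T - {z} - {w}"
        using T(1) w False by (intro eventually_at_in_open) auto
      then show ?thesis
        by eventually_elim (use T(3) in auto)
    qed (use assms in simp)
  qed
  then show "\<forall>\<^sub>F w in nhds z. remove_sings f w = remove_sings g w"
    using T(1,2) unfolding eventually_nhds by blast
qed

lemma locally_biholomorphic_at_cong:
  assumes "\<forall>\<^sub>F w in at z. f w = g w"
  shows "locally_biholomorphic_at f z = locally_biholomorphic_at g z"
proof -
  have "\<forall>\<^sub>F w in at z. inverse (f w) = inverse (g w)"
    using assms by eventually_elim simp
  then show ?thesis
    unfolding locally_biholomorphic_at_def
    using is_pole_cong[OF assms refl] deriv_remove_sings_cong[OF assms] deriv_remove_sings_cong[of "\<lambda>w. inverse (f w)" "\<lambda>w. inverse (g w)" z]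
    by simp
qed

lemma eventually_at_open_eq:
  assumes "open S" "\<And>z. z \<in> S \<Longrightarrow> f z = g z" "z \<in> S"
  shows "\<forall>\<^sub>F w in at z. f w = g w"
  unfolding eventually_at_topological using assms by blast

lemma nicely_meromorphic_on_cong_open:
  assumes S: "open S" and eq: "\<And>z. z \<in> S \<Longrightarrow> f z = g z" and g: "g nicely_meromorphic_on S"
  shows "f nicely_meromorphic_on S"
  unfolding nicely_meromorphic_on_def
proof (intro conjI ballI)
  show "f meromorphic_on S"
    using g meromorphic_on_cong[of S f g S] eventually_at_open_eq[OF S eq] by (simp add: nicely_meromorphic_on_def)
  fix z assume z: "z \<in> S"
  note ev = eventually_at_open_eq[of S f g, OF S eq z]
  show "is_pole f z \<and> f z = 0 \<or> f \<midarrow>z\<rightarrow> f z"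
    using g z is_pole_cong[OF ev refl] tendsto_cong[OF ev] eq[OF z] by (simp add: nicely_meromorphic_on_def)
qed

text \<open>The identity theorem for actual values: at a common pole both functions have the dummy
  value 0, elsewhere both are continuous.\<close>

lemma nicely_meromorphic_on_identity:
  assumes f: "f nicely_meromorphic_on S" and g: "g nicely_meromorphic_on S" and S: "open S" "connected S"
    and x: "x \<in> S" "\<forall>\<^sub>F z in at x. f z = g z" and z: "z \<in> S"
  shows "f z = g z"
proof -
  have m: "(\<lambda>z. f z - g z) meromorphic_on S"
    using f g by (auto intro!: meromorphic_intros simp: nicely_meromorphic_on_def)
  then have n: "remove_sings (\<lambda>z. f z - g z) nicely_meromorphic_on S"
    by (rule remove_sings_nicely_meromorphic)
  have ev: "\<forall>\<^sub>F w in at y. remove_sings (\<lambda>z. f z - g z) w = f w - g w" if "y \<in> S" for y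
    by (intro eventually_remove_sings_eq_at meromorphic_on_isolated_singularity meromorphic_on_subset[OF m]) (use that in auto)
  have "\<forall>\<^sub>F w in at x. remove_sings (\<lambda>z. f z - g z) w = 0"
    using ev[OF x(1)] x(2) by eventually_elim simp
  then have "\<exists>\<^sub>F w in at x. remove_sings (\<lambda>z. f z - g z) w = 0"
    by (intro eventually_frequently) auto
  note zero = frequently_eq_meromorphic_imp_constant[OF this n S x(1)]
  have "\<forall>\<^sub>F w in at z. w \<in> S - {z}"
    using S z by (intro eventually_at_in_open) auto
  with ev[OF z] have fg: "\<forall>\<^sub>F w in at z. f w = g w"
    by eventually_elim (use zero in auto)
  show ?thesis
  proof (cases "is_pole f z")
    case True
    then have "is_pole g z"
      using is_pole_cong[OF fg refl] by simp
    then have "\<not> f \<midarrow>z\<rightarrow> f z" "\<not> g \<midarrow>z\<rightarrow> g z"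
      using True not_tendsto_and_filterlim_at_infinity[of "at z"] by (auto simp: is_pole_def)
    then have "f z = 0" "g z = 0"
      using f g z unfolding nicely_meromorphic_on_def by blast+
    then show ?thesis
      by simp
  next
    case False
    then have "\<not> is_pole g z"
      using is_pole_cong[OF fg refl] by simp
    then have "f \<midarrow>z\<rightarrow> f z" "g \<midarrow>z\<rightarrow> g z"
      using False f g z by (auto simp: nicely_meromorphic_on_def)
    then have "f \<midarrow>z\<rightarrow> f z" "f \<midarrow>z\<rightarrow> g z"
      using tendsto_cong[OF fg] by auto
    then show ?thesis
      by (rule LIM_unique)
  qed
qed

context
  fixes S u v
  assumes S: "open S" and u: "u holomorphic_on S" and v: "v holomorphic_on S"
    and W: "\<And>z. z \<in> S \<Longrightarrow> deriv u z * v z - u z * deriv v z \<noteq> 0"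
begin

lemma quotient_deriv:
  assumes "z \<in> S" "v z \<noteq> 0"
  shows "deriv (\<lambda>z. u z / v z) z \<noteq> 0"
proof -
  have "((\<lambda>z. u z / v z) has_field_derivative (deriv u z * v z - u z * deriv v z) / (v z * v z)) (at z)"
    using assms by (intro DERIV_divide holomorphic_derivI[OF u S] holomorphic_derivI[OF v S])
  then show ?thesis
    using W[OF assms(1)] assms(2) by (simp add: DERIV_imp_deriv)
qed

lemma quotient_analytic:
  assumes "z \<in> S" "v z \<noteq> 0"
  shows "(\<lambda>z. u z / v z) analytic_on {z}"
proof -
  have "u analytic_on {z}" "v analytic_on {z}"
    using u v S assms(1) by (auto simp: analytic_at)
  then show ?thesis
    using assms(2) by (intro analytic_on_divide) auto
qed

lemma quotient_pole:
  assumes z: "z \<in> S" "v z = 0"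
  shows "is_pole (\<lambda>z. u z / v z) z"
proof (rule is_pole_divide)
  have cont: "isCont u z" "isCont v z"
    using u v z(1) S by (meson continuous_on_eq_continuous_at holomorphic_on_imp_continuous_on)+
  then show "isCont u z"
    by blast
  show "u z \<noteq> 0"
    using W[OF z(1)] z(2) by auto
  have "v z \<noteq> 0 \<or> deriv v z \<noteq> 0"
    using W[OF z(1)] by auto
  then have "\<forall>\<^sub>F w in at z. v w \<noteq> 0"
    by (rule eventually_nonzero_simple_zero[OF S z(1) v])
  then show "filterlim v (at 0) (at z)"
    using cont(2) z(2) by (auto simp: filterlim_at isCont_def)
qed

lemma quotient_nicely_meromorphic: "(\<lambda>z. u z / v z) nicely_meromorphic_on S"
  unfolding nicely_meromorphic_on_def
proof (intro conjI ballI)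
  have "u analytic_on S" "v analytic_on S"
    using u v S by (auto simp: analytic_on_open)
  then show "(\<lambda>z. u z / v z) meromorphic_on S"
    by (intro meromorphic_intros analytic_on_imp_meromorphic_on)
  fix z assume z: "z \<in> S"
  show "is_pole (\<lambda>z. u z / v z) z \<and> u z / v z = 0 \<or> (\<lambda>z. u z / v z) \<midarrow>z\<rightarrow> u z / v z"
  proof (cases "v z = 0")
    case False
    then have "isCont (\<lambda>z. u z / v z) z"
      using quotient_analytic[OF z] analytic_at_imp_isCont by blast
    then show ?thesis
      by (simp add: isCont_def)
  qed (use quotient_pole[OF z] in simp)
qed

lemma quotient_value_P1:
  assumes z: "z \<in> S"
  shows "value_P1 (\<lambda>z. u z / v z) z = proj (u z) (v z)"
proof (cases "v z = 0")
  case False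
  note a = quotient_analytic[OF z False]
  show ?thesis
    using analytic_at_imp_no_pole[OF a] remove_sings_at_analytic[OF a] False by (simp add: value_P1_def proj_def)
qed (use quotient_pole[OF z] in \<open>simp add: value_P1_def proj_def\<close>)

end

lemma deriv_remove_sings_analytic:
  assumes "f analytic_on {z}"
  shows "deriv (remove_sings f) z = deriv f z"
  using eventually_remove_sings_eq_nhds[OF assms] by (rule deriv_cong_ev) simp

text \<open>At a pole the chart 1/w exchanges u and v, and the Wronskian merely changes its
  sign.\<close>

lemma quotient_locally_biholomorphic:
  assumes S: "open S" and u: "u holomorphic_on S" and v: "v holomorphic_on S"
    and W: "\<And>z. z \<in> S \<Longrightarrow> deriv u z * v z - u z * deriv v z \<noteq> 0" and z: "z \<in> S"
  shows "locally_biholomorphic_at (\<lambda>z. u z / v z) z"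
proof (cases "v z = 0")
  case False
  note a = quotient_analytic[OF S u v W z False]
  show ?thesis
    using analytic_at_imp_no_pole[OF a] deriv_remove_sings_analytic[OF a] quotient_deriv[OF S u v W z False]
    by (simp add: locally_biholomorphic_at_def)
next
  case True
  then have uz: "u z \<noteq> 0"
    using W[OF z] by auto
  have W': "deriv v z * u z - v z * deriv u z \<noteq> 0" if "z \<in> S" for z
    using W[OF that] by (simp add: algebra_simps)
  have "deriv (remove_sings (\<lambda>w. v w / u w)) z \<noteq> 0"
    using deriv_remove_sings_analytic[OF quotient_analytic[OF S v u W' z uz]] quotient_deriv[OF S v u W' z uz] by simp
  then show ?thesis
    using quotient_pole[OF S u v W z True] by (simp add: locally_biholomorphic_at_def)
qed

lemma holomorphic_E4: "E4 holomorphic_on upper_half_plane"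
proof -
  have h: "eval_fps (sigmafps 3) holomorphic_on ball 0 1"
    unfolding holomorphic_on_open[OF open_ball]
    using has_field_derivative_eval_fps[OF sigmafps_radius[of _ 3]] by fastforce
  have "eval_fps (sigmafps 3) \<circ> qexp holomorphic_on upper_half_plane"
    by (rule holomorphic_on_compose_gen[OF holomorphic_qexp[OF holomorphic_on_ident] h]) (auto simp: norm_qexp_less_1)
  then have "(\<lambda>z. 1 + 240 * eval_fps (sigmafps 3) (qexp z)) holomorphic_on upper_half_plane"
    by (auto intro!: holomorphic_intros simp: o_def)
  then show ?thesis
    by (rule holomorphic_transform) (simp add: E4_eq)
qed

section \<open>From the Schwarz equation to the linear equation\<close>

text \<open>v is (h')^(-1/2), the root being defined by a logarithm of h' on the convex set. It
  satisfies v'' = -(1/2){h,z} v, whence c/2, and h v is a companion solution with h as their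
  quotient.\<close>

lemma schwarz_linearize:
  assumes B: "open B" "convex B" and h: "h holomorphic_on B" "\<And>z. z \<in> B \<Longrightarrow> deriv h z \<noteq> 0"
    and eq: "\<And>z. z \<in> B \<Longrightarrow> schwarz_derivative h z = c * E4 z"
  shows "\<exists>v. ode B (c / 2) v \<and> ode B (c / 2) (\<lambda>z. h z * v z) \<and> (\<forall>z\<in>B. v z \<noteq> 0)"
proof -
  have D1: "(h has_field_derivative deriv h z) (at z)" if "z \<in> B" for z
    using holomorphic_derivI[OF h(1) B(1) that] .
  have h1: "deriv h holomorphic_on B"
    using h(1) B(1) by (rule holomorphic_deriv)
  have D2: "(deriv h has_field_derivative deriv (deriv h) z) (at z)" if "z \<in> B" for z
    using holomorphic_derivI[OF h1 B(1) that] .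
  have h2: "deriv (deriv h) holomorphic_on B"
    using h1 B(1) by (rule holomorphic_deriv)
  have D3: "(deriv (deriv h) has_field_derivative deriv (deriv (deriv h)) z) (at z)" if "z \<in> B" for z
    using holomorphic_derivI[OF h2 B(1) that] .
  obtain g where g: "g holomorphic_on B" "\<And>z. z \<in> B \<Longrightarrow> deriv h z = exp (g z)"
    using contractible_imp_holomorphic_log[OF h1 convex_imp_contractible[OF B(2)]] h(2) by blast
  have G1: "(g has_field_derivative deriv g z) (at z)" if "z \<in> B" for z
    using holomorphic_derivI[OF g(1) B(1) that] .
  have G2: "(deriv g has_field_derivative deriv (deriv g) z) (at z)" if "z \<in> B" for z
    using holomorphic_derivI[OF holomorphic_deriv[OF g(1) B(1)] B(1) that] .
  have d2: "deriv (deriv h) z = deriv g z * deriv h z" if z: "z \<in> B" for z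
  proof (rule has_field_derivative_eq_on_open[OF B(1) z g(2) D2[OF z]])
    show "((\<lambda>z. exp (g z)) has_field_derivative deriv g z * deriv h z) (at z)"
      using G1[OF z] g(2)[OF z] by (auto intro!: derivative_eq_intros)
  qed
  have d3: "deriv (deriv (deriv h)) z = deriv (deriv g) z * deriv h z + deriv g z * (deriv g z * deriv h z)" if z: "z \<in> B" for z
  proof (rule has_field_derivative_eq_on_open[OF B(1) z d2 D3[OF z]])
    show "((\<lambda>z. deriv g z * deriv h z) has_field_derivative
        deriv (deriv g) z * deriv h z + deriv g z * (deriv g z * deriv h z)) (at z)"
      using DERIV_mult[OF G2[OF z] D2[OF z]] d2[OF z] by (simp add: algebra_simps)
  qed
  have key: "deriv (deriv g) z = c * E4 z + (deriv g z) ^ 2 / 2" if z: "z \<in> B" for z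
  proof -
    have "schwarz_derivative h z = deriv (deriv g) z + deriv g z * deriv g z - 3 / 2 * (deriv g z) ^ 2"
      using h(2)[OF z] by (simp add: schwarz_derivative_def eval_nat_numeral d3[OF z] d2[OF z] add_divide_distrib)
    then show ?thesis
      unfolding eq[OF z] by (simp add: power2_eq_square field_simps)
  qed
  define v where "v z = exp (- (g z / 2))" for z
  define v' where "v' z = - (deriv g z / 2) * v z" for z
  have V1: "(v has_field_derivative v' z) (at z)" if "z \<in> B" for z
    unfolding v_def[abs_def] v'_def using G1[OF that] by (auto intro!: derivative_eq_intros simp: v_def)
  have V2: "(v' has_field_derivative - (c / 2) * E4 z * v z) (at z)" if z: "z \<in> B" for z
  proof -
    have "((\<lambda>z. - (deriv g z / 2) * v z) has_field_derivative - (deriv (deriv g) z / 2) * v z + v' z * - (deriv g z / 2)) (at z)"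
      by (intro DERIV_mult V1 z DERIV_minus DERIV_cdivide G2)
    moreover have "- (deriv (deriv g) z / 2) * v z + v' z * - (deriv g z / 2) = - (c / 2) * E4 z * v z"
      unfolding v'_def key[OF z] by (simp add: power2_eq_square field_simps)
    ultimately show ?thesis
      by (simp add: v'_def[abs_def])
  qed
  have "ode B (c / 2) v"
    using B(1) V1 V2 by (rule odeI)
  moreover have "ode B (c / 2) (\<lambda>z. h z * v z)"
  proof (rule odeI[OF B(1), of _ "\<lambda>z. deriv h z * v z + v' z * h z"])
    fix z assume z: "z \<in> B"
    show "((\<lambda>z. h z * v z) has_field_derivative deriv h z * v z + v' z * h z) (at z)"
      by (intro DERIV_mult D1 V1 z)
    have "((\<lambda>z. deriv h z * v z + v' z * h z) has_field_derivative (deriv (deriv h) z * v z + v' z * deriv h z) +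
        ((- (c / 2) * E4 z * v z) * h z + deriv h z * v' z)) (at z)"
      by (intro DERIV_add DERIV_mult D1 D2 V1 V2 z)
    moreover have "(deriv (deriv h) z * v z + v' z * deriv h z) + ((- (c / 2) * E4 z * v z) * h z + deriv h z * v' z) =
        - (c / 2) * E4 z * (h z * v z)"
      unfolding d2[OF z] v'_def by (simp add: algebra_simps)
    ultimately show "((\<lambda>z. deriv h z * v z + v' z * h z) has_field_derivative - (c / 2) * E4 z * (h z * v z)) (at z)"
      by simp
  qed
  ultimately show ?thesis
    by (intro exI[of _ v]) (simp add: v_def)
qed

text \<open>The equation is given only off a discrete set. Since h is not constant, there is a ball
  on which h is holomorphic and h' has no zero; both sides are continuous there, so the equation
  holds at each of its points.\<close>

lemma schwarz_solution_regular_ball: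
  assumes h: "schwarz_solution c h"
  shows "\<exists>x r. r > 0 \<and> ball x r \<subseteq> upper_half_plane \<and> h holomorphic_on ball x r \<and>
    (\<forall>z\<in>ball x r. deriv h z \<noteq> 0 \<and> schwarz_derivative h z = c * E4 z)"
proof -
  have mero: "h nicely_meromorphic_on upper_half_plane" and nc: "\<not> h constant_on upper_half_plane"
    and eq: "\<forall>\<^sub>\<approx>z\<in>upper_half_plane. schwarz_derivative h z = c * E4 z"
    using h by (auto simp: schwarz_solution_def)
  have ana: "\<forall>\<^sub>\<approx>z\<in>upper_half_plane. h analytic_on {z}"
    using mero by (intro meromorphic_on_imp_analytic_cosparse) (simp add: nicely_meromorphic_on_def)
  have "\<forall>\<^sub>F z in at \<i>. h analytic_on {z}"
    using ana by (rule eventually_cosparse_imp_eventually_at) simp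
  moreover have "\<forall>\<^sub>F z in at \<i>. z \<in> upper_half_plane - {\<i>}"
    by (rule eventually_at_in_open) auto
  ultimately have "\<forall>\<^sub>F z in at \<i>. h analytic_on {z} \<and> z \<in> upper_half_plane"
    by eventually_elim simp
  then obtain x1 where x1: "h analytic_on {x1}" "x1 \<in> upper_half_plane"
    using eventually_happens[of _ "at \<i>"] by fastforce
  then obtain T where T: "open T" "x1 \<in> T" "h holomorphic_on T"
    by (auto simp: analytic_at)
  obtain r1 where r1: "r1 > 0" "ball x1 r1 \<subseteq> T \<inter> upper_half_plane"
    by (rule openE[OF open_Int[OF T(1) open_uhp], of x1], use T(2) x1(2) in blast, rule that)
  have h1: "h holomorphic_on ball x1 r1"
    using holomorphic_on_subset[OF T(3)] r1(2) by blast
  have "\<exists>x2\<in>ball x1 r1. deriv h x2 \<noteq> 0"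
  proof (rule ccontr)
    assume contra: "\<not> ?thesis"
    have "(h has_field_derivative 0) (at z within ball x1 r1)" if "z \<in> ball x1 r1" for z
    proof -
      have "(h has_field_derivative deriv h z) (at z)"
        using holomorphic_derivI[OF h1 open_ball that] .
      then show ?thesis
        using contra that has_field_derivative_at_within by fastforce
    qed
    then obtain k where k: "\<And>z. z \<in> ball x1 r1 \<Longrightarrow> h z = k"
      using has_field_derivative_zero_constant[of "ball x1 r1" h] by auto
    have "h z = k" if "z \<in> upper_half_plane" for z
    proof (rule nicely_meromorphic_on_identity[OF mero _ open_uhp connected_uhp x1(2) _ that])
      show "(\<lambda>_. k) nicely_meromorphic_on upper_half_plane"
        by (rule nicely_meromorphic_on_const)
      show "\<forall>\<^sub>F z in at x1. h z = k"
        by (rule eventually_at_open_eq[of "ball x1 r1"]) (use k r1 in auto)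
    qed
    then show False
      using nc by (auto simp: constant_on_def)
  qed
  then obtain x2 where x2: "x2 \<in> ball x1 r1" "deriv h x2 \<noteq> 0"
    by blast
  have hol1: "deriv h holomorphic_on ball x1 r1"
    using h1 by (intro holomorphic_deriv) auto
  have "isCont (deriv h) x2"
    using holomorphic_on_imp_continuous_on[OF hol1] x2(1) by (simp add: continuous_on_eq_continuous_at)
  then obtain r2 where r2: "r2 > 0" "\<forall>y. dist x2 y < r2 \<longrightarrow> deriv h y \<noteq> 0"
    using continuous_at_avoid[of x2 "deriv h" 0] x2(2) by blast
  obtain r3 where r3: "r3 > 0" "ball x2 r3 \<subseteq> ball x1 r1"
    by (rule openE[OF open_ball x2(1)], rule that)
  define r where "r = min r2 r3"
  have r: "r > 0" "ball x2 r \<subseteq> upper_half_plane" "ball x2 r \<subseteq> ball x1 r1"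
    using r1 r2 r3 by (auto simp: r_def)
  have h2: "h holomorphic_on ball x2 r"
    using holomorphic_on_subset[OF h1 r(3)] .
  have d2: "deriv h z \<noteq> 0" if "z \<in> ball x2 r" for z
    using r2(2) that by (simp add: r_def)
  have "schwarz_derivative h z = c * E4 z" if z: "z \<in> ball x2 r" for z
  proof -
    have zH: "z \<in> upper_half_plane"
      using z r(2) by blast
    have hd: "(deriv ^^ 3) h holomorphic_on ball x2 r" "(deriv ^^ 2) h holomorphic_on ball x2 r" "deriv h holomorphic_on ball x2 r"
      using h2 by (auto intro!: holomorphic_higher_deriv holomorphic_deriv)
    have "schwarz_derivative h holomorphic_on ball x2 r"
      unfolding schwarz_derivative_def[abs_def]
      by (intro holomorphic_on_diff holomorphic_on_mult holomorphic_on_power holomorphic_on_divide holomorphic_on_const hd d2)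
    then have "isCont (schwarz_derivative h) z"
      using z holomorphic_on_imp_continuous_on continuous_on_eq_continuous_at[OF open_ball] by blast
    then have 1: "schwarz_derivative h \<midarrow>z\<rightarrow> schwarz_derivative h z"
      by (simp add: isCont_def)
    have "isCont (\<lambda>z. c * E4 z) z"
      using holomorphic_on_imp_continuous_on[OF holomorphic_E4] zH continuous_on_eq_continuous_at[OF open_uhp]
      by (intro continuous_intros) blast
    then have 2: "(\<lambda>z. c * E4 z) \<midarrow>z\<rightarrow> c * E4 z"
      by (simp add: isCont_def)
    have "\<forall>\<^sub>F w in at z. schwarz_derivative h w = c * E4 w"
      using eq zH by (rule eventually_cosparse_imp_eventually_at)
    from tendsto_cong[OF this] 2 have "schwarz_derivative h \<midarrow>z\<rightarrow> c * E4 z"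
      by simp
    then show ?thesis
      using 1 LIM_unique by blast
  qed
  then show ?thesis
    using r h2 d2 by blast
qed

text \<open>In a small ball h = (h v)/v, and both solutions are combinations of the global ones. The
  identity theorem extends the resulting quotient to the half-plane.\<close>

lemma schwarz_solution_quotient:
  assumes h: "schwarz_solution k h"
    and y: "ode upper_half_plane (k / 2) y1" "ode upper_half_plane (k / 2) y2"
    and w: "w \<noteq> 0" "\<And>z. z \<in> upper_half_plane \<Longrightarrow> wronskian y1 y2 z = w"
  shows "\<exists>a b c d. a * d - b * c \<noteq> 0 \<and>
    (\<forall>z\<in>upper_half_plane. h z = (a * y1 z + b * y2 z) / (c * y1 z + d * y2 z))"
proof -
  have mero: "h nicely_meromorphic_on upper_half_plane"
    using h by (simp add: schwarz_solution_def)
  obtain x r where r: "r > 0" "ball x r \<subseteq> upper_half_plane" "h holomorphic_on ball x r"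
    "\<forall>z\<in>ball x r. deriv h z \<noteq> 0 \<and> schwarz_derivative h z = k * E4 z"
    using schwarz_solution_regular_ball[OF h] by blast
  obtain v where v: "ode (ball x r) (k / 2) v" "ode (ball x r) (k / 2) (\<lambda>z. h z * v z)" "\<forall>z\<in>ball x r. v z \<noteq> 0"
    using schwarz_linearize[OF open_ball convex_ball r(3)] r(4) by blast
  note y' = ode_subset[OF y(1) r(2)] ode_subset[OF y(2) r(2)]
  have w': "wronskian y1 y2 z = w" if "z \<in> ball x r" for z
    using w(2) that r(2) by blast
  obtain a b where ab: "\<And>z. z \<in> ball x r \<Longrightarrow> h z * v z = a * y1 z + b * y2 z"
    by (rule ode_lincomb[OF open_ball convex_ball y' v(2) w(1) w'], simp, rule that, blast)
  obtain c d where cd: "\<And>z. z \<in> ball x r \<Longrightarrow> v z = c * y1 z + d * y2 z"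
    by (rule ode_lincomb[OF open_ball convex_ball y' v(1) w(1) w'], simp, rule that, blast)
  have x: "x \<in> ball x r" "x \<in> upper_half_plane"
    using r(1,2) by auto
  \<comment> \<open>Proportional numerator and denominator would make h constant on the ball, where
    h' is nonzero.\<close>
  have det: "a * d - b * c \<noteq> 0"
  proof
    assume det: "a * d - b * c = 0"
    define m where "m = h x"
    have "h z = m" if z: "z \<in> ball x r" for z
    proof -
      have "(h z - h x) * (v z * v x) = (h z * v z) * v x - (h x * v x) * v z"
        by (simp add: algebra_simps)
      also have "\<dots> = (a * y1 z + b * y2 z) * (c * y1 x + d * y2 x) - (a * y1 x + b * y2 x) * (c * y1 z + d * y2 z)"
        using ab cd z x(1) by simp
      also have "\<dots> = (a * d - b * c) * (y1 z * y2 x - y2 z * y1 x)"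
        by (simp add: algebra_simps)
      finally show ?thesis
        using det v(3) z x(1) by (simp add: m_def)
    qed
    then have "deriv h x = deriv (\<lambda>_. m) x"
      using x(1) by (intro deriv_cong_ev[OF _ refl]) (auto simp: eventually_nhds intro!: exI[of _ "ball x r"])
    then show False
      using r(4) x(1) by simp
  qed
  have hol: "y1 holomorphic_on upper_half_plane" "y2 holomorphic_on upper_half_plane"
    using y by (auto simp: ode_def)
  have "(\<lambda>z. (a * y1 z + b * y2 z) / (c * y1 z + d * y2 z)) nicely_meromorphic_on upper_half_plane"
  proof (rule quotient_nicely_meromorphic[OF open_uhp])
    show "(\<lambda>z. a * y1 z + b * y2 z) holomorphic_on upper_half_plane" "(\<lambda>z. c * y1 z + d * y2 z) holomorphic_on upper_half_plane"
      by (intro holomorphic_intros hol)+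
    fix z assume z: "z \<in> upper_half_plane"
    have "((\<lambda>z. a * y1 z + b * y2 z) has_field_derivative a * deriv y1 z + b * deriv y2 z) (at z)" for a b
      by (intro DERIV_add DERIV_cmult holomorphic_derivI[OF hol(1) open_uhp z] holomorphic_derivI[OF hol(2) open_uhp z])
    then have d: "deriv (\<lambda>z. a * y1 z + b * y2 z) z = a * deriv y1 z + b * deriv y2 z" for a b
      by (rule DERIV_imp_deriv)
    have "deriv (\<lambda>z. a * y1 z + b * y2 z) z * (c * y1 z + d * y2 z) - (a * y1 z + b * y2 z) * deriv (\<lambda>z. c * y1 z + d * y2 z) z =
        (a * d - b * c) * wronskian y1 y2 z"
      unfolding d wronskian_def by (simp add: algebra_simps)
    then show "deriv (\<lambda>z. a * y1 z + b * y2 z) z * (c * y1 z + d * y2 z) - (a * y1 z + b * y2 z) * deriv (\<lambda>z. c * y1 z + d * y2 z) z \<noteq> 0"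
      using det w(1) w(2)[OF z] by simp
  qed
  moreover have "\<forall>\<^sub>F z in at x. h z = (a * y1 z + b * y2 z) / (c * y1 z + d * y2 z)"
  proof (rule eventually_at_open_eq[OF open_ball _ x(1)])
    fix z assume z: "z \<in> ball x r"
    show "h z = (a * y1 z + b * y2 z) / (c * y1 z + d * y2 z)"
      using ab[OF z] cd[OF z] v(3) z by (metis nonzero_eq_divide_eq)
  qed
  ultimately have "h z = (a * y1 z + b * y2 z) / (c * y1 z + d * y2 z)" if "z \<in> upper_half_plane" for z
    using nicely_meromorphic_on_identity[OF mero _ open_uhp connected_uhp x(2) _ that] by blast
  then show ?thesis
    using det by blast
qed

section \<open>The Hauptmodul\<close>

lemma Gpm_pcs: "A \<in> principal_congruence_subgroup m \<Longrightarrow> A \<in> Gpm m"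
  by (simp add: Gpm_def)

lemma bij_betw_quotient_the_elem:
  assumes R: "equiv E R" and f: "\<And>x y. x \<in> E \<Longrightarrow> y \<in> E \<Longrightarrow> (x, y) \<in> R \<longleftrightarrow> f x = f y" and surj: "f ` E = UNIV"
  shows "bij_betw (\<lambda>X. the_elem (f ` X)) (E // R) UNIV"
proof -
  have val: "the_elem (f ` (R `` {x})) = f x" if x: "x \<in> E" for x
  proof -
    have "f ` (R `` {x}) = {f x}"
    proof
      show "f ` (R `` {x}) \<subseteq> {f x}"
      proof
        fix y assume "y \<in> f ` (R `` {x})"
        then obtain z where z: "(x, z) \<in> R" "y = f z"
          by blast
        then have "z \<in> E"
          using equiv_class_eq_iff[OF R] by blast
        then show "y \<in> {f x}"
          using f[OF x] z by simp
      qed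
      show "{f x} \<subseteq> f ` (R `` {x})"
        using equiv_class_self[OF R x] by blast
    qed
    then show ?thesis
      by simp
  qed
  show ?thesis
    unfolding bij_betw_def
  proof
    show "inj_on (\<lambda>X. the_elem (f ` X)) (E // R)"
    proof (rule inj_onI)
      fix X Y assume XY: "X \<in> E // R" "Y \<in> E // R" "the_elem (f ` X) = the_elem (f ` Y)"
      obtain x where x: "x \<in> E" "X = R `` {x}"
        using XY(1) by (rule quotientE)
      obtain y where y: "y \<in> E" "Y = R `` {y}"
        using XY(2) by (rule quotientE)
      have "f x = f y"
        using XY(3) val x y by simp
      then have "(x, y) \<in> R"
        using f x y by simp
      then show "X = Y"
        unfolding x(2) y(2) by (rule equiv_class_eq[OF R])
    qed
    show "(\<lambda>X. the_elem (f ` X)) ` (E // R) = UNIV"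
    proof (rule equalityI[OF subset_UNIV subsetI])
      fix y
      obtain x where x: "x \<in> E" "y = f x"
        using surj by blast
      then show "y \<in> (\<lambda>X. the_elem (f ` X)) ` (E // R)"
        using val[OF x(1)] quotientI[OF x(1), of R] by (intro image_eqI[of _ _ "R `` {x}"]) auto
    qed
  qed
qed

context modular_pair
begin

lemma lin_wronskian:
  assumes z: "z \<in> upper_half_plane"
  shows "deriv (lin a b) z * lin c d z - lin a b z * deriv (lin c d) z = (a * d - b * c) * wronskian U1 U2 z"
proof -
  have "(lin a b has_field_derivative a * deriv U1 z + b * deriv U2 z) (at z)" for a b
    unfolding lin_def[abs_def] by (intro DERIV_add DERIV_cmult U_DERIV z)
  then have d: "deriv (lin a b) z = a * deriv U1 z + b * deriv U2 z" for a b
    by (rule DERIV_imp_deriv)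
  show ?thesis
    unfolding d wronskian_def by (simp add: lin_def algebra_simps)
qed

lemma lin_wronskian_nonzero:
  assumes "a * d - b * c \<noteq> 0" "z \<in> upper_half_plane"
  shows "deriv (lin a b) z * lin c d z - lin a b z * deriv (lin c d) z \<noteq> 0"
  unfolding lin_wronskian[OF assms(2)] using assms wronskian_nonzero by simp

text \<open>The factor e(\<kappa>z), which is in general not a function of q, occurs in numerator
  and denominator and cancels.\<close>

lemma cusp_fun_eq:
  assumes A: "A \<in> SL2Z" "rho A \<alpha> \<beta> \<gamma> \<delta>" and h: "\<And>z. z \<in> upper_half_plane \<Longrightarrow> h z = lin a b z / lin c d z"
    and q: "q \<noteq> 0" "norm q < 1"
  shows "cusp_fun m h A q = ((a * \<alpha> + b * \<gamma>) * p1 q + (a * \<beta> + b * \<delta>) * p2 q) /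
    ((c * \<alpha> + d * \<gamma>) * p1 q + (c * \<beta> + d * \<delta>) * p2 q)"
proof -
  define z where "z = cusp_log m q"
  have z: "z \<in> upper_half_plane" "qexp (z / of_nat m) = q"
    using cusp_log[OF m_pos q] by (simp_all add: z_def)
  have "cusp_fun m h A q = h (lin_frac A z)"
    by (simp add: cusp_fun_def z_def cusp_log_def)
  also have "\<dots> = lin (a * \<alpha> + b * \<gamma>) (a * \<beta> + b * \<delta>) z / lin (c * \<alpha> + d * \<gamma>) (c * \<beta> + d * \<delta>) z"
    using h[of "lin_frac A z"] A(1) z(1) lin_rho[OF A(2) z(1)] by simp
  finally show ?thesis
    by (simp add: lin_expansion[OF z(1)] z(2))
qed

lemma eventually_cusp_fun_eq:
  assumes A: "A \<in> SL2Z" "rho A \<alpha> \<beta> \<gamma> \<delta>" and h: "\<And>z. z \<in> upper_half_plane \<Longrightarrow> h z = lin a b z / lin c d z"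
  shows "\<forall>\<^sub>F q in at 0. cusp_fun m h A q = ((a * \<alpha> + b * \<gamma>) * p1 q + (a * \<beta> + b * \<delta>) * p2 q) /
    ((c * \<alpha> + d * \<gamma>) * p1 q + (c * \<beta> + d * \<delta>) * p2 q)"
proof -
  have "\<forall>\<^sub>F q in at 0. q \<in> ball 0 1 - {0 :: complex}"
    by (rule eventually_at_in_open) auto
  then show ?thesis
    by eventually_elim (use cusp_fun_eq[OF A h] in auto)
qed

lemma modular_function_quotient:
  assumes det: "a * d - b * c \<noteq> 0" and h: "\<And>z. z \<in> upper_half_plane \<Longrightarrow> h z = lin a b z / lin c d z"
  shows "modular_function m h"
  unfolding modular_function_def
proof (intro conjI ballI)
  show "h nicely_meromorphic_on upper_half_plane"
    by (rule nicely_meromorphic_on_cong_open[OF open_uhp h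
        quotient_nicely_meromorphic[OF open_uhp lin_hol lin_hol lin_wronskian_nonzero[OF det]]])
  fix A z assume A: "A \<in> principal_congruence_subgroup m" and z: "z \<in> upper_half_plane"
  obtain \<sigma> where l: "norm \<sigma> = 1" "rho A \<sigma> 0 0 \<sigma>"
    using Gpm_scalar[OF Gpm_pcs[OF A]] .
  have "lin x y (lin_frac A z) = \<sigma> * lin x y z" for x y
    using lin_rho[OF l(2) z] by (simp add: lin_def algebra_simps)
  moreover have "\<sigma> \<noteq> 0"
    using l(1) by auto
  ultimately show "h (lin_frac A z) = h z"
    using h[of "lin_frac A z"] h[OF z] z Gpm_SL2Z[OF Gpm_pcs[OF A]] by simp
next
  fix A assume A: "A \<in> SL2Z"
  obtain \<alpha> \<beta> \<gamma> \<delta> where r: "rho A \<alpha> \<beta> \<gamma> \<delta>"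
    using rho_exists[OF A] .
  have "p1 analytic_on {0}" "p2 analytic_on {0}"
    using p1_hol p2_hol by (auto simp: analytic_at intro!: exI[of _ "ball 0 1"])
  then have "(\<lambda>q. ((a * \<alpha> + b * \<gamma>) * p1 q + (a * \<beta> + b * \<delta>) * p2 q) /
    ((c * \<alpha> + d * \<gamma>) * p1 q + (c * \<beta> + d * \<delta>) * p2 q)) meromorphic_on {0}"
    by (intro meromorphic_intros analytic_on_imp_meromorphic_on)
  then show "cusp_fun m h A meromorphic_on {0}"
    using meromorphic_on_cong[of "{0}" "cusp_fun m h A" _ "{0}"] eventually_cusp_fun_eq[OF A r h] by simp
qed

end

section \<open>The Hauptmodul and its values on the modular curve\<close>

context modular_pair1
begin

definition t :: "complex \<Rightarrow> complex" where
  "t z = U1 z / U2 z"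

lemma t_eq: "t z = lin 1 0 z / lin 0 1 z"
  by (simp add: t_def lin_def)

lemma lin_p_wronskian:
  assumes det: "a * d - b * c \<noteq> 0" and q: "q \<in> ball 0 1"
  shows "deriv (\<lambda>q. a * p1 q + b * p2 q) q * (c * p1 q + d * p2 q) - (a * p1 q + b * p2 q) * deriv (\<lambda>q. c * p1 q + d * p2 q) q \<noteq> 0"
proof -
  have "(p1 has_field_derivative deriv p1 q) (at q)" "(p2 has_field_derivative deriv p2 q) (at q)"
    using p1_hol p2_hol q by (auto intro!: holomorphic_derivI[of _ "ball 0 1"])
  then have "((\<lambda>q. a * p1 q + b * p2 q) has_field_derivative a * deriv p1 q + b * deriv p2 q) (at q)" for a b
    by (intro DERIV_add DERIV_cmult)
  then have d: "deriv (\<lambda>q. a * p1 q + b * p2 q) q = a * deriv p1 q + b * deriv p2 q" for a b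
    by (rule DERIV_imp_deriv)
  have "deriv (\<lambda>q. a * p1 q + b * p2 q) q * (c * p1 q + d * p2 q) - (a * p1 q + b * p2 q) * deriv (\<lambda>q. c * p1 q + d * p2 q) q =
      (a * d - b * c) * (deriv p1 q * p2 q - p1 q * deriv p2 q)"
    unfolding d by (simp add: algebra_simps)
  then show ?thesis
    using det p_wronskian[of q] q by simp
qed

lemma eventually_cusp_fun_t:
  assumes A: "A \<in> SL2Z" "rho A \<alpha> \<beta> \<gamma> \<delta>"
  shows "\<forall>\<^sub>F q in at 0. cusp_fun m t A q = (\<alpha> * p1 q + \<beta> * p2 q) / (\<gamma> * p1 q + \<delta> * p2 q)"
  using eventually_cusp_fun_eq[OF A t_eq] by simp

lemma comb_p_hol: "(\<lambda>q. a * p1 q + b * p2 q) holomorphic_on ball 0 1"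
  by (intro holomorphic_intros p1_hol p2_hol)

lemma map_P1_Some:
  assumes z: "z \<in> upper_half_plane"
  shows "map_P1 m t (Some z) = proj (U1 z) (U2 z)"
proof -
  have "value_P1 (\<lambda>z. U1 z / U2 z) z = proj (U1 z) (U2 z)"
    by (rule quotient_value_P1[OF open_uhp U1_hol U2_hol _ z]) (use wronskian_nonzero in \<open>simp add: wronskian_def\<close>)
  then show ?thesis
    using cusp_not_Some_uhp[OF z] by (simp add: map_P1_def t_def[abs_def])
qed

text \<open>The matrix A is the one selected inside \<open>map_P1\<close>. At q = 0 one has p1 = 0
  and p2 = 1, so the value is the second column of the transformation in homogeneous
  coordinates.\<close>

lemma map_P1_cusp:
  assumes x: "x \<in> cusps"
  obtains A \<alpha> \<beta> \<gamma> \<delta> where "A \<in> SL2Z" "x = cusp_of A" "rho A \<alpha> \<beta> \<gamma> \<delta>" "map_P1 m t x = proj \<beta> \<delta>"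
proof -
  define A where "A = (SOME A. A \<in> SL2Z \<and> lin_frac_P1 A None = x)"
  obtain B where "B \<in> SL2Z" "x = cusp_of B"
    using cusp_obtain[OF x] .
  then have A: "A \<in> SL2Z \<and> lin_frac_P1 A None = x"
    unfolding A_def by (intro someI[of "\<lambda>A. A \<in> SL2Z \<and> lin_frac_P1 A None = x" B]) (simp add: cusp_of_def)
  obtain \<alpha> \<beta> \<gamma> \<delta> where r: "rho A \<alpha> \<beta> \<gamma> \<delta>"
    using rho_exists A by blast
  have "map_P1 m t x = value_P1 (cusp_fun m t A) 0"
    using x by (simp add: map_P1_def A_def)
  also have "\<dots> = value_P1 (\<lambda>q. (\<alpha> * p1 q + \<beta> * p2 q) / (\<gamma> * p1 q + \<delta> * p2 q)) 0"
    by (rule value_P1_cong[OF eventually_cusp_fun_t[OF conjunct1[OF A] r]])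
  also have "\<dots> = proj (\<alpha> * p1 0 + \<beta> * p2 0) (\<gamma> * p1 0 + \<delta> * p2 0)"
    by (rule quotient_value_P1[OF open_ball comb_p_hol comb_p_hol lin_p_wronskian[OF rho_det[OF r]]]) auto
  finally show ?thesis
    using that[of A \<alpha> \<beta> \<gamma> \<delta>] A r by (simp add: cusp_of_def p1_0 p2_0)
qed

text \<open>Equality would make \<open>U1\<close> vanish at A^{-1} z.\<close>

lemma interior_ne_cusp:
  assumes z: "z \<in> upper_half_plane" and A: "A \<in> SL2Z" "rho A \<alpha> \<beta> \<gamma> \<delta>"
  shows "U1 z * \<delta> \<noteq> \<beta> * U2 z"
proof
  assume eq: "U1 z * \<delta> = \<beta> * U2 z"
  define w where "w = lin_frac (adj2 A) z"
  have w: "w \<in> upper_half_plane" "lin_frac A w = z"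
    using A(1) z lin_frac_adj2[of "adj2 A" z] by (simp_all add: w_def)
  have "U1 z = \<alpha> * U1 w + \<beta> * U2 w" "U2 z = \<gamma> * U1 w + \<delta> * U2 w"
    using rhoD(2,3)[OF A(2) w(1)] w(2) by simp_all
  then have "U1 w * (\<alpha> * \<delta> - \<beta> * \<gamma>) = U1 z * \<delta> - \<beta> * U2 z"
    by (simp add: algebra_simps)
  then show False
    using eq U1_nonzero[OF w(1)] rho_det[OF A(2)] by simp
qed

text \<open>For M = A^{-1} B, equality of the two points of the projective line says that M has
  upper right coefficient b = 0, the situation of \<open>rho_b_zero\<close>.\<close>

lemma cusp_eq_iff:
  assumes A: "A \<in> SL2Z" "rho A \<alpha> \<beta> \<gamma> \<delta>" and B: "B \<in> SL2Z" "rho B \<alpha>' \<beta>' \<gamma>' \<delta>'"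
  shows "col_cong m A B \<longleftrightarrow> \<beta> * \<delta>' = \<beta>' * \<delta>"
proof
  assume "col_cong m A B"
  then obtain g k where g: "g \<in> Gpm m" "A = g ** B ** transl k"
    using col_congD[OF m A(1) B(1)] by blast
  obtain \<sigma> where l: "rho g \<sigma> 0 0 \<sigma>"
    using Gpm_scalar[OF g(1)] by blast
  obtain u v where t: "rho (transl k) u 0 0 v"
    using rho_transl by blast
  have "rho A (\<sigma> * \<alpha>' * u) (\<sigma> * \<beta>' * v) (\<sigma> * \<gamma>' * u) (\<sigma> * \<delta>' * v)"
    using rho_mult[OF rho_mult[OF l B(2,1)] t] g(2) by simp
  from rho_unique[OF A(2) this] show "\<beta> * \<delta>' = \<beta>' * \<delta>"
    by simp
next
  assume eq: "\<beta> * \<delta>' = \<beta>' * \<delta>"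
  define M where "M = adj2 A ** B"
  have M: "M \<in> SL2Z"
    using A(1) B(1) by (simp add: M_def)
  obtain a b c d where r: "rho M a b c d"
    using rho_exists[OF M] .
  have AM: "A ** M = B"
    using A(1) by (simp add: M_def matrix_mul_assoc)
  have "rho B (\<alpha> * a + \<beta> * c) (\<alpha> * b + \<beta> * d) (\<gamma> * a + \<delta> * c) (\<gamma> * b + \<delta> * d)"
    using rho_mult[OF A(2) r M] AM by simp
  from rho_unique[OF B(2) this] have "\<beta>' = \<alpha> * b + \<beta> * d" "\<delta>' = \<gamma> * b + \<delta> * d"
    by auto
  then have "b * (\<alpha> * \<delta> - \<beta> * \<gamma>) = \<beta>' * \<delta> - \<beta> * \<delta>'"
    by (simp add: algebra_simps)
  then have "b = 0"
    using eq rho_det[OF A(2)] by simp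
  then have "col_cong m M (mat 1)"
    using rho_b_zero[OF M] r by simp
  then obtain g k where g: "g \<in> Gpm m" "M = g ** mat 1 ** transl k"
    using col_congD[OF m M SL2Z_one] by blast
  have "B = A ** g ** adj2 A ** A ** transl k"
    using A(1) AM unfolding g(2) by (simp flip: matrix_mul_assoc)
  moreover have "A ** g ** adj2 A \<in> Gpm m"
    using sl2_normal_Gpm[of m] A(1) g(1) by (simp add: sl2_normal_def)
  ultimately have "col_cong m B A"
    using col_cong_mult by metis
  then show "col_cong m A B"
    by (rule col_cong_sym)
qed

lemma map_P1_eq_iff:
  assumes x: "x \<in> extended_upper_half_plane" and y: "y \<in> extended_upper_half_plane"
  shows "(x, y) \<in> orbit_rel m \<longleftrightarrow> map_P1 m t x = map_P1 m t y"
proof -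
  have nz: "(U1 z, U2 z) \<noteq> (0, 0)" if "z \<in> upper_half_plane" for z
    using U1_nonzero[OF that] by simp
  have nz': "(\<beta>, \<delta>) \<noteq> (0, 0)" if "rho A \<alpha> \<beta> \<gamma> \<delta>" for A \<alpha> \<beta> \<gamma> \<delta>
    using rho_det[OF that] by auto
  have mixed: "(Some z, c) \<notin> orbit_rel m \<and> (c, Some z) \<notin> orbit_rel m \<and> map_P1 m t (Some z) \<noteq> map_P1 m t c"
    if z: "z \<in> upper_half_plane" and c: "c \<in> cusps" for z c
  proof -
    obtain A \<alpha> \<beta> \<gamma> \<delta> where A: "A \<in> SL2Z" "c = cusp_of A" "rho A \<alpha> \<beta> \<gamma> \<delta>" "map_P1 m t c = proj \<beta> \<delta>"
      using map_P1_cusp[OF c] .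
    have "map_P1 m t (Some z) \<noteq> map_P1 m t c"
      using interior_ne_cusp[OF z A(1,3)] proj_eq_iff[OF nz[OF z] nz'[OF A(3)]] by (simp add: A(4) map_P1_Some[OF z])
    moreover have no: "(Some z, c) \<notin> orbit_rel m"
    proof
      assume "(Some z, c) \<in> orbit_rel m"
      then obtain B where "B \<in> SL2Z" "c = lin_frac_P1 B (Some z)"
        using pcs_SL2Z by (auto simp: orbit_rel_def)
      then have "c = Some (lin_frac B z)" "lin_frac B z \<in> upper_half_plane"
        using lin_frac_P1_Some[of B z] z by auto
      then show False
        using cusp_not_Some_uhp c by blast
    qed
    moreover have "(c, Some z) \<notin> orbit_rel m"
      using no equiv_orbit_rel[of m] by (meson equivE symD)
    ultimately show ?thesis
      by blast
  qed
  show ?thesis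
    using x
  proof (cases rule: extended_cases)
    case (1 z)
    note z = 1
    show ?thesis
      using y
    proof (cases rule: extended_cases)
      case (1 w)
      have "map_P1 m t x = map_P1 m t y \<longleftrightarrow> U1 z * U2 w = U1 w * U2 z"
        using proj_eq_iff[OF nz[OF z(1)] nz[OF 1(1)]] by (simp add: z(2) 1(2) map_P1_Some z(1) 1(1))
      also have "\<dots> \<longleftrightarrow> s z = s w"
        using s_eq_iff[OF z(1) 1(1)] by (simp add: mult.commute)
      also have "\<dots> \<longleftrightarrow> gequiv m z w"
        using s_injective[OF z(1) 1(1)] s_invariant[of z w] z(1) by auto
      also have "\<dots> \<longleftrightarrow> (x, y) \<in> orbit_rel m"
      proof
        assume "gequiv m z w"
        then obtain g where g: "g \<in> Gpm m" "w = lin_frac g z"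
          by (auto simp: gequiv_def)
        then have "\<exists>g'\<in>principal_congruence_subgroup m. w = lin_frac g' z"
          unfolding Gpm_def by (auto intro: bexI[of _ "- g"])
        then obtain g' where g': "g' \<in> principal_congruence_subgroup m" "w = lin_frac g' z"
          by blast
        then have "y = lin_frac_P1 g' x"
          using lin_frac_P1_Some[OF pcs_SL2Z[OF g'(1)] z(1)] z(2) 1(2) by simp
        then show "(x, y) \<in> orbit_rel m"
          using x g'(1) by (auto simp: orbit_rel_def)
      next
        assume "(x, y) \<in> orbit_rel m"
        then obtain g where g: "g \<in> principal_congruence_subgroup m" "y = lin_frac_P1 g x"
          by (auto simp: orbit_rel_def)
        then have "w = lin_frac g z"
          using lin_frac_P1_Some[OF pcs_SL2Z[OF g(1)] z(1)] z(2) 1(2) by simp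
        then show "gequiv m z w"
          using Gpm_pcs[OF g(1)] by (auto simp: gequiv_def)
      qed
      finally show ?thesis
        by blast
    next
      case (2 A)
      then show ?thesis
        using mixed[OF z(1), of y] z(2) by simp
    qed
  next
    case (2 A)
    then have xc: "x \<in> cusps"
      by simp
    show ?thesis
      using y
    proof (cases rule: extended_cases)
      case (1 w)
      then show ?thesis
        using mixed[OF 1(1) xc] by auto
    next
      case (2 B)
      then have yc: "y \<in> cusps"
        by simp
      obtain A \<alpha> \<beta> \<gamma> \<delta> where A: "A \<in> SL2Z" "x = cusp_of A" "rho A \<alpha> \<beta> \<gamma> \<delta>" "map_P1 m t x = proj \<beta> \<delta>"
        using map_P1_cusp[OF xc] .
      obtain B \<alpha>' \<beta>' \<gamma>' \<delta>' where B: "B \<in> SL2Z" "y = cusp_of B" "rho B \<alpha>' \<beta>' \<gamma>' \<delta>'" "map_P1 m t y = proj \<beta>' \<delta>'"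
        using map_P1_cusp[OF yc] .
      show ?thesis
        unfolding A(4) B(4) unfolding A(2) B(2)
        using orbit_rel_cusp_iff[OF m A(1) B(1)] cusp_eq_iff[OF A(1,3) B(1,3)]
          proj_eq_iff[OF nz'[OF A(3)] nz'[OF B(3)]] by simp
    qed
  qed
qed

text \<open>The value [u : v] is taken where the form v U1 - u U2 vanishes. Such a place exists, in
  the half-plane or at a cusp, because \<kappa> is negative.\<close>

lemma map_P1_surj: "map_P1 m t ` extended_upper_half_plane = UNIV"
proof (rule equalityI[OF subset_UNIV subsetI])
  fix y :: "complex option"
  obtain u v where uv: "(u, v) \<noteq> (0, 0)" "y = proj u v"
  proof (cases y)
    case None
    then show ?thesis
      using that[of 1 0] by (simp add: proj_def)
  next
    case (Some w)
    then show ?thesis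
      using that[of w 1] by (simp add: proj_def)
  qed
  show "y \<in> map_P1 m t ` extended_upper_half_plane"
  proof (cases "\<exists>z\<in>upper_half_plane. lin v (- u) z = 0")
    case True
    then obtain z where z: "z \<in> upper_half_plane" "lin v (- u) z = 0"
      by blast
    then have "map_P1 m t (Some z) = y"
      using proj_eq_iff[of "U1 z" "U2 z" u v] U1_nonzero[OF z(1)] uv
      by (simp add: map_P1_Some lin_def mult.commute)
    then show ?thesis
      using z(1) by (intro image_eqI[of _ _ "Some z"]) (auto simp: extended_upper_half_plane_def)
  next
    case False
    then obtain A G where A: "A \<in> SL2Z" and G: "G holomorphic_on ball 0 1" "G 0 = 0"
      "\<forall>z\<in>upper_half_plane. lin v (- u) (lin_frac A z) = qexp (of_real \<kappa> * z) * G (qexp (z / of_nat m))"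
      using mform_has_zero[OF m_pos mform_lin kappa_neg] by blast
    obtain \<alpha> \<beta> \<gamma> \<delta> where r: "rho A \<alpha> \<beta> \<gamma> \<delta>"
      using rho_exists[OF A] .
    have "G 0 = (v * \<alpha> + - u * \<gamma>) * p1 0 + (v * \<beta> + - u * \<delta>) * p2 0"
    proof (rule cusp_expansion_unique[OF m_pos G(1) comb_p_hol])
      fix z assume z: "z \<in> upper_half_plane"
      show "G (qexp (z / of_nat m)) = (v * \<alpha> + - u * \<gamma>) * p1 (qexp (z / of_nat m)) + (v * \<beta> + - u * \<delta>) * p2 (qexp (z / of_nat m))"
        using G(3) z lin_rho[OF r z, of v "- u"] lin_expansion[OF z] by simp
    qed simp
    then have zero: "v * \<beta> = u * \<delta>"
      using G(2) by (simp add: p1_0 p2_0)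
    have xc: "cusp_of A \<in> cusps"
      by simp
    \<comment> \<open>\<open>map_P1\<close> may have selected another matrix for the same cusp; its
      second column is proportional to that of A.\<close>
    obtain B \<alpha>' \<beta>' \<gamma>' \<delta>' where B: "B \<in> SL2Z" "cusp_of A = cusp_of B" "rho B \<alpha>' \<beta>' \<gamma>' \<delta>'" "map_P1 m t (cusp_of A) = proj \<beta>' \<delta>'"
      using map_P1_cusp[OF xc] .
    have "(cusp_of A, cusp_of B) \<in> orbit_rel m"
      using equiv_orbit_rel[of m] xc B(2) by (auto simp: equiv_def refl_on_def extended_upper_half_plane_def)
    then have "\<beta> * \<delta>' = \<beta>' * \<delta>"
      using orbit_rel_cusp_iff[OF m A B(1)] cusp_eq_iff[OF A r B(1,3)] by simp
    moreover have "(\<beta>, \<delta>) \<noteq> (0, 0)" "(\<beta>', \<delta>') \<noteq> (0, 0)"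
      using rho_det[OF r] rho_det[OF B(3)] by auto
    ultimately have "map_P1 m t (cusp_of A) = y"
      using proj_eq_iff[of \<beta>' \<delta>' \<beta> \<delta>] proj_eq_iff[of \<beta> \<delta> u v] uv zero B(4) by (simp add: mult.commute)
    then show ?thesis
      using xc by (intro image_eqI[of _ _ "cusp_of A"]) (auto simp: extended_upper_half_plane_def)
  qed
qed

theorem hauptmodul_t: "hauptmodul m t"
  unfolding hauptmodul_def
proof (intro conjI ballI)
  show "modular_function m t"
    by (rule modular_function_quotient[OF _ t_eq]) simp
  show "bij_betw (\<lambda>X. the_elem (map_P1 m t ` X)) (modular_curve m) UNIV"
    unfolding modular_curve_def by (rule bij_betw_quotient_the_elem[OF equiv_orbit_rel map_P1_eq_iff map_P1_surj])
  fix z assume z: "z \<in> upper_half_plane"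
  show "locally_biholomorphic_at t z"
    unfolding t_def[abs_def]
    by (rule quotient_locally_biholomorphic[OF open_uhp U1_hol U2_hol _ z]) (use wronskian_nonzero in \<open>simp add: wronskian_def\<close>)
next
  fix A assume A: "A \<in> SL2Z"
  obtain \<alpha> \<beta> \<gamma> \<delta> where r: "rho A \<alpha> \<beta> \<gamma> \<delta>"
    using rho_exists[OF A] .
  have "locally_biholomorphic_at (\<lambda>q. (\<alpha> * p1 q + \<beta> * p2 q) / (\<gamma> * p1 q + \<delta> * p2 q)) 0"
    by (rule quotient_locally_biholomorphic[OF open_ball comb_p_hol comb_p_hol lin_p_wronskian[OF rho_det[OF r]]]) auto
  then show "locally_biholomorphic_at (cusp_fun m t A) 0"
    using locally_biholomorphic_at_cong[OF eventually_cusp_fun_t[OF A r]] by simp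
qed

end

section \<open>The pairs of solutions and the degree\<close>

definition Upair :: "real \<Rightarrow> complex \<Rightarrow> complex" where
  "Upair s z = eta2 z * frob_solution (of_real s) z"

text \<open>The variable is e(z/m), hence the power q^m in the place of e(z).\<close>

definition ppart :: "nat \<Rightarrow> real \<Rightarrow> complex \<Rightarrow> complex" where
  "ppart m s q = exp (- 2 * eval_fps logfps (q ^ m)) * eval_fps (frobfps (of_real s)) (q ^ m)"

lemma holomorphic_eval_fps_power:
  assumes "fps_conv_radius F \<ge> 1" "m > 0"
  shows "(\<lambda>q :: complex. eval_fps F (q ^ m)) holomorphic_on ball 0 1"
proof -
  have h: "eval_fps F holomorphic_on ball 0 1"
    unfolding holomorphic_on_open[OF open_ball]
    using has_field_derivative_eval_fps[OF ball_radius[OF assms(1)]] by fastforce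
  have "eval_fps F \<circ> (\<lambda>q. q ^ m) holomorphic_on ball 0 1"
    by (rule holomorphic_on_compose_gen[OF _ h])
      (use assms(2) in \<open>auto intro!: holomorphic_intros simp: norm_power power_less_one_iff\<close>)
  then show ?thesis
    by (simp add: o_def)
qed

lemma holomorphic_ppart: "m > 0 \<Longrightarrow> ppart m s holomorphic_on ball 0 1"
  unfolding ppart_def[abs_def]
  by (intro holomorphic_intros holomorphic_eval_fps_power conv_radius_logfps conv_radius_frobfps)

lemma ppart_0: "m > 0 \<Longrightarrow> ppart m s 0 = 1"
  by (simp add: ppart_def eval_fps_at_0 logfps_def frobfps_def zero_power)

lemma Upair_eq:
  assumes "m > 0"
  shows "Upair s z = qexp (of_real (1 / 12 + s) * z) * ppart m s (qexp (z / of_nat m))"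
proof -
  have "qexp (z / of_nat m) ^ m = qexp z"
    using assms by (simp flip: qexp_of_nat_mult)
  moreover have "qexp (of_real (1 / 12 + s) * z) = qexp (z / 12) * qexp (of_real s * z)"
    by (simp add: distrib_right flip: qexp_add)
  ultimately show ?thesis
    by (simp add: Upair_def eta2_def frob_solution_def ppart_def)
qed

lemma Upair_translation:
  "Upair s (z + of_int k) = qexp (of_real (real_of_int k * (1 / 12 + s))) * Upair s z"
proof -
  have "qexp (of_real (real_of_int k * (1 / 12 + s))) = qexp (of_int k / 12) * qexp (of_real s * of_int k)"
    by (simp add: algebra_simps flip: qexp_add)
  then show ?thesis
    by (simp add: Upair_def eta2_translation frob_solution_def distrib_left qexp_add qexp_translation)
qed

context
  fixes m n :: nat
  assumes m: "2 \<le> m" "m \<le> 5" and n: "n > 0" "gcd m n = 1"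
begin

lemma exponents_not_resonant:
  assumes "k > 0"
  shows "of_nat k + 2 * of_real (real n / (2 * real m)) \<noteq> (0 :: complex)"
    "of_nat k - 2 * of_real (real n / (2 * real m)) \<noteq> (0 :: complex)"
proof -
  have "real k + 2 * (real n / (2 * real m)) > 0"
    using assms by (intro add_pos_nonneg) auto
  moreover have "of_nat k + 2 * of_real (real n / (2 * real m)) = complex_of_real (real k + 2 * (real n / (2 * real m)))"
    by simp
  ultimately show "of_nat k + 2 * of_real (real n / (2 * real m)) \<noteq> (0 :: complex)"
    by (metis of_real_eq_0_iff less_irrefl)
  have "real k - 2 * (real n / (2 * real m)) \<noteq> 0"
  proof
    assume "real k - 2 * (real n / (2 * real m)) = 0"
    then have "real (k * m) = real n"
      using m by (simp add: field_simps)
    then have "m dvd n"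
      by (metis dvd_triv_right of_nat_eq_iff)
    then show False
      using n m by (simp add: gcd_nat.absorb1)
  qed
  moreover have "of_nat k - 2 * of_real (real n / (2 * real m)) = complex_of_real (real k - 2 * (real n / (2 * real m)))"
    by simp
  ultimately show "of_nat k - 2 * of_real (real n / (2 * real m)) \<noteq> (0 :: complex)"
    by (metis of_real_eq_0_iff)
qed

lemma ode_frob_pair:
  "ode upper_half_plane (4 * of_real pi ^ 2 * of_real (real n / (2 * real m)) ^ 2) (frob_solution (of_real (real n / (2 * real m))))"
  "ode upper_half_plane (4 * of_real pi ^ 2 * of_real (real n / (2 * real m)) ^ 2) (frob_solution (of_real (- (real n / (2 * real m)))))"
proof -
  show "ode upper_half_plane (4 * of_real pi ^ 2 * of_real (real n / (2 * real m)) ^ 2) (frob_solution (of_real (real n / (2 * real m))))"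
    by (rule ode_frob_solution[OF exponents_not_resonant(1)])
  have "of_nat k + 2 * - of_real (real n / (2 * real m)) \<noteq> (0 :: complex)" if "k > 0" for k
    using exponents_not_resonant(2)[OF that] by simp
  from ode_frob_solution[OF this]
  show "ode upper_half_plane (4 * of_real pi ^ 2 * of_real (real n / (2 * real m)) ^ 2) (frob_solution (of_real (- (real n / (2 * real m)))))"
    by (simp only: power2_minus of_real_minus)
qed

lemma wronskian_frob_pair:
  assumes "z \<in> upper_half_plane"
  shows "wronskian (frob_solution (of_real (real n / (2 * real m)))) (frob_solution (of_real (- (real n / (2 * real m))))) z =
    4 * of_real pi * \<i> * of_real (real n / (2 * real m))"
  unfolding of_real_minus by (rule wronskian_frob_solution[OF exponents_not_resonant assms])

text \<open>Comparing values and derivatives of z y(-1/z) at the fixed point i shows that the change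
  of basis preserves the Wronskian, so its determinant is 1. The law of \<eta>^2 multiplies each row
  by -i, which turns the determinant into -1.\<close>

lemma Upair_inversion:
  "\<exists>a b c d. norm (a * d - b * c) = 1 \<and> (\<forall>z\<in>upper_half_plane.
     Upair (real n / (2 * real m)) (- 1 / z) = a * Upair (real n / (2 * real m)) z + b * Upair (- (real n / (2 * real m))) z \<and>
     Upair (- (real n / (2 * real m))) (- 1 / z) = c * Upair (real n / (2 * real m)) z + d * Upair (- (real n / (2 * real m))) z)"
proof -
  define y1 y2 where "y1 = frob_solution (of_real (real n / (2 * real m)))"
    and "y2 = frob_solution (of_real (- (real n / (2 * real m))))"
  define w where "w = 4 * of_real pi * \<i> * of_real (real n / (2 * real m))"
  have w: "w \<noteq> 0"
    using m n by (simp add: w_def)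
  have W: "wronskian y1 y2 z = w" if "z \<in> upper_half_plane" for z
    using wronskian_frob_pair[OF that] by (simp only: y1_def y2_def w_def)
  note y = ode_frob_pair[folded y1_def y2_def]
  obtain a b where ab: "\<forall>z\<in>upper_half_plane. z * y1 (- 1 / z) = a * y1 z + b * y2 z"
    by (rule ode_lincomb[OF open_uhp convex_uhp y ode_inversion[OF y(1)] w W], simp, rule that, blast)
  obtain c d where cd: "\<forall>z\<in>upper_half_plane. z * y2 (- 1 / z) = c * y1 z + d * y2 z"
    by (rule ode_lincomb[OF open_uhp convex_uhp y ode_inversion[OF y(2)] w W], simp, rule that, blast)
  have D: "((\<lambda>z. z * y (- 1 / z)) has_field_derivative y (- 1 / z) + deriv y (- 1 / z) / z) (at z)"
    if y: "ode upper_half_plane k y" and z: "z \<in> upper_half_plane" for y k z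
  proof -
    have inv: "- 1 / z \<in> upper_half_plane" "z \<noteq> 0"
      using lin_frac_in_uhp[OF inversion_in_SL2Z z] z by (auto simp: mem_uhp)
    have i: "((\<lambda>z. - 1 / z) has_field_derivative 1 / z ^ 2) (at z)"
      using inv by (auto intro!: derivative_eq_intros simp: power2_eq_square)
    have "((\<lambda>z. y (- 1 / z)) has_field_derivative deriv y (- 1 / z) * (1 / z ^ 2)) (at z)"
      by (rule DERIV_chain2[where f = y and g = "\<lambda>z. - 1 / z", OF ode_derivs(1)[OF open_uhp y inv(1)] i])
    from DERIV_mult[OF DERIV_ident this] show ?thesis
      using inv by (simp add: power2_eq_square field_simps)
  qed
  have L: "((\<lambda>z. x * y1 z + x' * y2 z) has_field_derivative x * deriv y1 z + x' * deriv y2 z) (at z)"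
    if "z \<in> upper_half_plane" for x x' z
    using ode_derivs(1)[OF open_uhp y(1) that] ode_derivs(1)[OF open_uhp y(2) that] by (intro DERIV_add DERIV_cmult)
  have i2: "- 1 / \<i> = \<i>"
    by simp
  have e: "a * deriv y1 \<i> + b * deriv y2 \<i> = y1 \<i> + deriv y1 \<i> / \<i>" "c * deriv y1 \<i> + d * deriv y2 \<i> = y2 \<i> + deriv y2 \<i> / \<i>"
    using has_field_derivative_eq_on_open[OF open_uhp ii_in_uhp _ D[OF y(1) ii_in_uhp] L[OF ii_in_uhp], of a b]
      has_field_derivative_eq_on_open[OF open_uhp ii_in_uhp _ D[OF y(2) ii_in_uhp] L[OF ii_in_uhp], of c d]
      ab cd unfolding i2 by auto
  have e': "a * y1 \<i> + b * y2 \<i> = \<i> * y1 \<i>" "c * y1 \<i> + d * y2 \<i> = \<i> * y2 \<i>"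
    using bspec[OF ab ii_in_uhp] bspec[OF cd ii_in_uhp] unfolding i2 by simp_all
  have "(a * d - b * c) * w = (a * deriv y1 \<i> + b * deriv y2 \<i>) * (c * y1 \<i> + d * y2 \<i>) -
      (a * y1 \<i> + b * y2 \<i>) * (c * deriv y1 \<i> + d * deriv y2 \<i>)"
    unfolding W[OF ii_in_uhp, symmetric] wronskian_def by (simp add: algebra_simps)
  also have "\<dots> = w"
    unfolding e e' W[OF ii_in_uhp, symmetric] wronskian_def by (simp add: algebra_simps)
  finally have det: "a * d - b * c = 1"
    using w by simp
  have "Upair (real n / (2 * real m)) (- 1 / z) = (- \<i> * a) * Upair (real n / (2 * real m)) z + (- \<i> * b) * Upair (- (real n / (2 * real m))) z \<and>
     Upair (- (real n / (2 * real m))) (- 1 / z) = (- \<i> * c) * Upair (real n / (2 * real m)) z + (- \<i> * d) * Upair (- (real n / (2 * real m))) z"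
    if z: "z \<in> upper_half_plane" for z
  proof -
    have e: "eta2 (- 1 / z) * y (- 1 / z) = (- \<i> * eta2 z) * (z * y (- 1 / z))" for y
      unfolding eta2_inversion[OF z] by (simp add: mult_ac)
    have U: "Upair (real n / (2 * real m)) = (\<lambda>z. eta2 z * y1 z)" "Upair (- (real n / (2 * real m))) = (\<lambda>z. eta2 z * y2 z)"
      by (simp_all add: fun_eq_iff Upair_def y1_def y2_def)
    show ?thesis
      unfolding U e bspec[OF ab z] bspec[OF cd z] by (simp add: algebra_simps)
  qed
  moreover have "(- \<i> * a) * (- \<i> * d) - (- \<i> * b) * (- \<i> * c) = - (a * d - b * c)"
    by (simp add: algebra_simps)
  then have "norm ((- \<i> * a) * (- \<i> * d) - (- \<i> * b) * (- \<i> * c)) = 1"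
    unfolding det by simp
  ultimately show ?thesis
    by blast
qed

lemma modular_pair_frobenius:
  "modular_pair m n (1 / 12 - real n / (2 * real m)) (Upair (real n / (2 * real m))) (Upair (- (real n / (2 * real m))))
     (ppart m (real n / (2 * real m))) (ppart m (- (real n / (2 * real m))))"
proof
  have m_pos: "m > 0"
    using m by simp
  show "2 \<le> m" "m \<le> 5" "n > 0"
    using m n by auto
  show "ppart m (real n / (2 * real m)) holomorphic_on ball 0 1" "ppart m (- (real n / (2 * real m))) holomorphic_on ball 0 1"
    "ppart m (real n / (2 * real m)) 0 = 1" "ppart m (- (real n / (2 * real m))) 0 = 1"
    by (intro holomorphic_ppart ppart_0 m_pos)+
  show "1 / 12 - real n / (2 * real m) = 1 / 12 - real n / (2 * real m)" ..
  show "\<exists>a b. norm a = 1 \<and> norm b = 1 \<and> (\<forall>z\<in>upper_half_plane. Upair (real n / (2 * real m)) (z + of_int k) = a * Upair (real n / (2 * real m)) z \<and>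
      Upair (- (real n / (2 * real m))) (z + of_int k) = b * Upair (- (real n / (2 * real m))) z)" for k
    by (rule exI[of _ "qexp (of_real (real_of_int k * (1 / 12 + real n / (2 * real m))))"],
        rule exI[of _ "qexp (of_real (real_of_int k * (1 / 12 + - (real n / (2 * real m)))))"])
      (simp only: Upair_translation norm_qexp Im_complex_of_real, simp)
  show "\<exists>a b c d. norm (a * d - b * c) = 1 \<and> (\<forall>z\<in>upper_half_plane.
     Upair (real n / (2 * real m)) (- 1 / z) = a * Upair (real n / (2 * real m)) z + b * Upair (- (real n / (2 * real m))) z \<and>
     Upair (- (real n / (2 * real m))) (- 1 / z) = c * Upair (real n / (2 * real m)) z + d * Upair (- (real n / (2 * real m))) z)"
    by (rule Upair_inversion)
  fix z assume z: "z \<in> upper_half_plane"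
  \<comment> \<open>1/12 + n/(2m) = \<kappa> + n/m: the two exponents differ by an integral power of
    e(z/m).\<close>
  have "of_real (1 / 12 + real n / (2 * real m)) * z = of_real (1 / 12 - real n / (2 * real m)) * z + of_nat n * (z / of_nat m)"
    using m_pos by (simp add: field_simps)
  then have "qexp (of_real (1 / 12 + real n / (2 * real m)) * z) = qexp (of_real (1 / 12 - real n / (2 * real m)) * z) * qexp (z / of_nat m) ^ n"
    by (simp only: qexp_add qexp_of_nat_mult)
  then show "Upair (real n / (2 * real m)) z = qexp (of_real (1 / 12 - real n / (2 * real m)) * z) *
      (qexp (z / of_nat m) ^ n * ppart m (real n / (2 * real m)) (qexp (z / of_nat m)))"
    unfolding Upair_eq[OF m_pos] by (simp only: mult.assoc)
  show "Upair (- (real n / (2 * real m))) z = qexp (of_real (1 / 12 - real n / (2 * real m)) * z) *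
      ppart m (- (real n / (2 * real m))) (qexp (z / of_nat m))"
    unfolding Upair_eq[OF m_pos] by (simp only: diff_conv_add_uminus)
  define y1 y2 where "y1 = frob_solution (of_real (real n / (2 * real m)))"
    and "y2 = frob_solution (of_real (- (real n / (2 * real m))))"
  note y = ode_frob_pair[folded y1_def y2_def]
  have e: "(eta2 has_field_derivative deriv eta2 z) (at z)"
    using DERIV_eta2[OF z] DERIV_imp_deriv by metis
  have U: "Upair (real n / (2 * real m)) = (\<lambda>z. eta2 z * y1 z)" "Upair (- (real n / (2 * real m))) = (\<lambda>z. eta2 z * y2 z)"
    by (simp_all add: fun_eq_iff Upair_def y1_def y2_def)
  have d: "deriv (Upair (real n / (2 * real m))) z = deriv eta2 z * y1 z + deriv y1 z * eta2 z"
    "deriv (Upair (- (real n / (2 * real m)))) z = deriv eta2 z * y2 z + deriv y2 z * eta2 z"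
    unfolding U by (rule DERIV_imp_deriv, rule DERIV_mult[OF e ode_derivs(1)[OF open_uhp y(1) z]],
        rule DERIV_imp_deriv, rule DERIV_mult[OF e ode_derivs(1)[OF open_uhp y(2) z]])
  have "wronskian (Upair (real n / (2 * real m))) (Upair (- (real n / (2 * real m)))) z = eta2 z ^ 2 * wronskian y1 y2 z"
    unfolding wronskian_def d unfolding U by (simp add: power2_eq_square algebra_simps)
  moreover have "wronskian y1 y2 z \<noteq> 0"
    using wronskian_frob_pair[OF z] m_pos n by (simp add: y1_def y2_def)
  ultimately show "wronskian (Upair (real n / (2 * real m))) (Upair (- (real n / (2 * real m)))) z \<noteq> 0"
    by simp
qed

lemma schwarz_solution_pair:
  assumes "schwarz_solution (2 * of_real pi ^ 2 * (of_nat n / of_nat m) ^ 2) h"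
  shows "\<exists>a b c d. a * d - b * c \<noteq> 0 \<and> (\<forall>z\<in>upper_half_plane. h z =
    modular_pair.lin (Upair (real n / (2 * real m))) (Upair (- (real n / (2 * real m)))) a b z /
    modular_pair.lin (Upair (real n / (2 * real m))) (Upair (- (real n / (2 * real m)))) c d z)"
proof -
  interpret modular_pair m n "1 / 12 - real n / (2 * real m)" "Upair (real n / (2 * real m))" "Upair (- (real n / (2 * real m)))"
     "ppart m (real n / (2 * real m))" "ppart m (- (real n / (2 * real m)))"
    by (rule modular_pair_frobenius)
  \<comment> \<open>Half of the constant of the Schwarz equation is 4\<pi>^2 s^2 with s = n/(2m),
    the constant of the Frobenius solutions.\<close>
  have "2 * of_real pi ^ 2 * (of_nat n / of_nat m) ^ 2 / 2 = 4 * of_real pi ^ 2 * complex_of_real (real n / (2 * real m)) ^ 2"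
    by (simp add: power2_eq_square field_simps)
  note y = ode_frob_pair[folded this]
  have "4 * of_real pi * \<i> * of_real (real n / (2 * real m)) \<noteq> 0"
    using m n by simp
  from schwarz_solution_quotient[OF assms y this wronskian_frob_pair]
  obtain a b c d where det: "a * d - b * c \<noteq> 0" and h: "\<forall>z\<in>upper_half_plane. h z =
     (a * frob_solution (of_real (real n / (2 * real m))) z + b * frob_solution (of_real (- (real n / (2 * real m)))) z) /
     (c * frob_solution (of_real (real n / (2 * real m))) z + d * frob_solution (of_real (- (real n / (2 * real m)))) z)"
    by blast
  have "lin x y z = eta2 z * (x * frob_solution (of_real (real n / (2 * real m))) z + y * frob_solution (of_real (- (real n / (2 * real m)))) z)" for x y z
    by (simp only: lin_def Upair_def) (simp add: algebra_simps)
  then have "\<forall>z\<in>upper_half_plane. h z = lin a b z / lin c d z"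
    using h by simp
  then show ?thesis
    using det by blast
qed

end

section \<open>The degree of the rational function\<close>

text \<open>Pairwise non-proportional factors exclude common roots, including one at infinity: if
  some \<open>a i\<close> is 0, then every \<open>a' j\<close> is nonzero, so at least one of the
  two degrees is exactly d.\<close>

lemma linear_products_rational:
  fixes a b a' b' :: "nat \<Rightarrow> complex"
  assumes c: "c \<noteq> 0" "c' \<noteq> 0"
    and ab: "\<And>i. i < d \<Longrightarrow> (a i, b i) \<noteq> (0, 0)" "\<And>i. i < d \<Longrightarrow> (a' i, b' i) \<noteq> (0, 0)"
    and indep: "\<And>i j. i < d \<Longrightarrow> j < d \<Longrightarrow> a i * b' j \<noteq> a' j * b i"
  shows "rational_function_of_degree d (\<lambda>x. (c * (\<Prod>i<d. a i * x + b i)) / (c' * (\<Prod>i<d. a' i * x + b' i)))"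
proof -
  define P Q where "P = smult c (\<Prod>i<d. [:b i, a i:])" and "Q = smult c' (\<Prod>i<d. [:b' i, a' i:])"
  have poly: "poly P x = c * (\<Prod>i<d. a i * x + b i)" "poly Q x = c' * (\<Prod>i<d. a' i * x + b' i)" for x
    by (simp_all add: P_def Q_def poly_prod add.commute mult.commute)
  have deg: "degree (\<Prod>i<d. [:b i, a i:]) = (\<Sum>i<d. degree [:b i, a i:])"
    if "\<And>i. i < d \<Longrightarrow> (a i, b i) \<noteq> (0, 0)" for a b :: "nat \<Rightarrow> complex"
    using that by (intro degree_prod_eq_sum_degree) auto
  have le: "degree (\<Prod>i<d. [:b i, a i:]) \<le> d" if "\<And>i. i < d \<Longrightarrow> (a i, b i) \<noteq> (0, 0)" for a b :: "nat \<Rightarrow> complex"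
  proof -
    have "(\<Sum>i<d. degree [:b i, a i:]) \<le> (\<Sum>i<d. 1)"
      by (intro sum_mono) simp
    then show ?thesis
      using deg[of a b, OF that] by (simp only: sum_constant card_lessThan of_nat_id mult_1_right)
  qed
  have eq: "degree (\<Prod>i<d. [:b i, a i:]) = d" if "\<And>i. i < d \<Longrightarrow> a i \<noteq> 0" for a b :: "nat \<Rightarrow> complex"
    using deg[of a b] that by simp
  have dP: "degree P = degree (\<Prod>i<d. [:b i, a i:])" and dQ: "degree Q = degree (\<Prod>i<d. [:b' i, a' i:])"
    using c by (simp_all add: P_def Q_def)
  have "max (degree P) (degree Q) = d"
  proof (cases "\<forall>i<d. a i \<noteq> 0")
    case True
    then show ?thesis
      using eq[of a b] le[OF ab(2)] by (simp add: dP dQ)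
  next
    case False
    then have "\<forall>j<d. a' j \<noteq> 0"
      using indep by force
    then show ?thesis
      using eq[of a' b'] le[OF ab(1)] by (simp add: dP dQ)
  qed
  moreover have "Q \<noteq> 0"
    using c(2) ab(2) by (auto simp: Q_def)
  moreover have "coprime P Q"
  proof (rule coprimeI, rule ccontr)
    fix r assume r: "r dvd P" "r dvd Q" "\<not> is_unit r"
    then have "degree r \<noteq> 0"
      using \<open>Q \<noteq> 0\<close> is_unit_iff_degree[of r] by auto
    then have "\<not> constant (poly r)"
      by (simp add: constant_degree)
    then obtain x where "poly r x = 0"
      using fundamental_theorem_of_algebra by blast
    then have "poly P x = 0" "poly Q x = 0"
      using r(1,2) by (auto elim!: dvdE)
    then obtain i j where ij: "i < d" "j < d" "a i * x + b i = 0" "a' j * x + b' j = 0"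
      using c by (auto simp: poly)
    have "a i * b' j - a' j * b i = a i * (a' j * x + b' j) - a' j * (a i * x + b i)"
      by (simp add: algebra_simps)
    then show False
      using ij indep by simp
  qed
  ultimately show ?thesis
    unfolding rational_function_of_degree_def using poly by (intro exI[of _ P] exI[of _ Q]) auto
qed

lemma proportional_zero:
  fixes a b :: complex
  assumes "(a, b) \<noteq> (0, 0)" "a * b' = a' * b" "a * x + b * y = 0"
  shows "a' * x + b' * y = 0"
proof -
  have "a * (a' * x + b' * y) = a' * (a * x + b * y) + (a * b' - a' * b) * y"
    "b * (a' * x + b' * y) = b' * (a * x + b * y) - (a * b' - a' * b) * x"
    by (simp_all add: algebra_simps)
  then show ?thesis
    using assms by auto
qed

context modular_pair
begin

lemma lin_no_common_zero:
  assumes det: "a * d - b * c \<noteq> 0" and z: "z \<in> upper_half_plane"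
  shows "lin a b z \<noteq> 0 \<or> lin c d z \<noteq> 0"
  using lin_wronskian_nonzero[OF det z] by auto

lemma lin_cusp_expansion:
  assumes A: "A \<in> SL2Z" "rho A \<alpha> \<beta> \<gamma> \<delta>" and G: "G holomorphic_on ball 0 1"
    "\<forall>z\<in>upper_half_plane. lin a b (lin_frac A z) = qexp (of_real \<kappa> * z) * G (qexp (z / of_nat m))"
  shows "G 0 = a * \<beta> + b * \<delta>"
proof -
  have "G 0 = (a * \<alpha> + b * \<gamma>) * p1 0 + (a * \<beta> + b * \<delta>) * p2 0"
  proof (rule cusp_expansion_unique[OF m_pos G(1)])
    show "(\<lambda>q. (a * \<alpha> + b * \<gamma>) * p1 q + (a * \<beta> + b * \<delta>) * p2 q) holomorphic_on ball 0 1"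
      by (intro holomorphic_intros p1_hol p2_hol)
    fix z assume z: "z \<in> upper_half_plane"
    show "G (qexp (z / of_nat m)) = (a * \<alpha> + b * \<gamma>) * p1 (qexp (z / of_nat m)) + (a * \<beta> + b * \<delta>) * p2 (qexp (z / of_nat m))"
      using G(2) z lin_rho[OF A(2) z, of a b] lin_expansion[OF z] by simp
  qed simp
  then show ?thesis
    by (simp add: p1_0 p2_0)
qed

lemma lin_no_common_cusp:
  assumes det: "a * d - b * c \<noteq> 0" and A: "A \<in> SL2Z"
    and G: "G holomorphic_on ball 0 1"
      "\<forall>z\<in>upper_half_plane. lin a b (lin_frac A z) = qexp (of_real \<kappa> * z) * G (qexp (z / of_nat m))"
    and G': "G' holomorphic_on ball 0 1"
      "\<forall>z\<in>upper_half_plane. lin c d (lin_frac A z) = qexp (of_real \<kappa> * z) * G' (qexp (z / of_nat m))"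
  shows "G 0 \<noteq> 0 \<or> G' 0 \<noteq> 0"
proof (rule ccontr)
  assume contra: "\<not> ?thesis"
  obtain \<alpha> \<beta> \<gamma> \<delta> where r: "rho A \<alpha> \<beta> \<gamma> \<delta>"
    using rho_exists[OF A] .
  have z: "a * \<beta> + b * \<delta> = 0" "c * \<beta> + d * \<delta> = 0"
    using contra lin_cusp_expansion[OF A r G] lin_cusp_expansion[OF A r G'] by auto
  have "(a * d - b * c) * \<beta> = d * (a * \<beta> + b * \<delta>) - b * (c * \<beta> + d * \<delta>)"
    "(a * d - b * c) * \<delta> = a * (c * \<beta> + d * \<delta>) - c * (a * \<beta> + b * \<delta>)"
    by (simp_all add: algebra_simps)
  then have "\<beta> = 0" "\<delta> = 0"
    using z det by auto
  then show False
    using rho_det[OF r] by simp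
qed

end

context modular_pair1
begin

lemma product_cusp_expansion:
  assumes A: "A \<in> SL2Z" "rho A \<alpha> \<beta> \<gamma> \<delta>" and z: "z \<in> upper_half_plane"
  shows "c * (\<Prod>i<d. lin (a i) (b i) (lin_frac A z)) = qexp (of_real (real d * \<kappa>) * z) *
    (c * (\<Prod>i<d. (a i * \<alpha> + b i * \<gamma>) * p1 (qexp (z / of_nat m)) + (a i * \<beta> + b i * \<delta>) * p2 (qexp (z / of_nat m))))"
proof -
  have "of_real (real d * \<kappa>) * z = of_nat d * (of_real \<kappa> * z)"
    by (simp add: mult_ac)
  then have "qexp (of_real (real d * \<kappa>) * z) = qexp (of_real \<kappa> * z) ^ d"
    by (simp only: qexp_of_nat_mult)
  then show ?thesis
    by (simp add: lin_rho[OF A(2) z] lin_expansion[OF z] prod.distrib)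
qed

text \<open>If a factor of f were proportional to one of g, both functions would vanish wherever
  that factor does. Every linear form vanishes at some point or cusp, as \<kappa> is negative, and
  common zeros of both kinds are excluded.\<close>

lemma factors_independent:
  assumes ab: "\<And>i. i < d \<Longrightarrow> (a i, b i) \<noteq> (0, 0)"
    and f: "\<And>z. z \<in> upper_half_plane \<Longrightarrow> f z = c * (\<Prod>i<d. lin (a i) (b i) z)"
    and g: "\<And>z. z \<in> upper_half_plane \<Longrightarrow> g z = c' * (\<Prod>i<d. lin (a' i) (b' i) z)"
    and interior: "\<And>z. z \<in> upper_half_plane \<Longrightarrow> f z \<noteq> 0 \<or> g z \<noteq> 0"
    and cusp: "\<And>A F G. A \<in> SL2Z \<Longrightarrow> F holomorphic_on ball 0 1 \<Longrightarrow> G holomorphic_on ball 0 1 \<Longrightarrow>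
      \<forall>z\<in>upper_half_plane. f (lin_frac A z) = qexp (of_real (real d * \<kappa>) * z) * F (qexp (z / of_nat m)) \<Longrightarrow>
      \<forall>z\<in>upper_half_plane. g (lin_frac A z) = qexp (of_real (real d * \<kappa>) * z) * G (qexp (z / of_nat m)) \<Longrightarrow>
      F 0 \<noteq> 0 \<or> G 0 \<noteq> 0"
    and ij: "i < d" "j < d"
  shows "a i * b' j \<noteq> a' j * b i"
proof
  assume eq: "a i * b' j = a' j * b i"
  show False
  proof (cases "\<exists>z\<in>upper_half_plane. lin (a i) (b i) z = 0")
    case True
    then obtain z where z: "z \<in> upper_half_plane" "lin (a i) (b i) z = 0"
      by blast
    then have "lin (a' j) (b' j) z = 0"
      using proportional_zero[OF ab[OF ij(1)] eq] by (simp add: lin_def)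
    then have "(\<Prod>i<d. lin (a i) (b i) z) = 0" "(\<Prod>i<d. lin (a' i) (b' i) z) = 0"
      using z(2) ij by auto
    then show False
      using interior[OF z(1)] f[OF z(1)] g[OF z(1)] by simp
  next
    case False
    then obtain A G where A: "A \<in> SL2Z" and G: "G holomorphic_on ball 0 1" "G 0 = 0"
      "\<forall>z\<in>upper_half_plane. lin (a i) (b i) (lin_frac A z) = qexp (of_real \<kappa> * z) * G (qexp (z / of_nat m))"
      using mform_has_zero[OF m_pos mform_lin kappa_neg] by blast
    obtain \<alpha> \<beta> \<gamma> \<delta> where r: "rho A \<alpha> \<beta> \<gamma> \<delta>"
      using rho_exists[OF A] .
    have zi: "a i * \<beta> + b i * \<delta> = 0"
      using lin_cusp_expansion[OF A r G(1,3)] G(2) by simp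
    then have zj: "a' j * \<beta> + b' j * \<delta> = 0"
      by (rule proportional_zero[OF ab[OF ij(1)] eq])
    define F1 where "F1 q = c * (\<Prod>i<d. (a i * \<alpha> + b i * \<gamma>) * p1 q + (a i * \<beta> + b i * \<delta>) * p2 q)" for q
    define F2 where "F2 q = c' * (\<Prod>i<d. (a' i * \<alpha> + b' i * \<gamma>) * p1 q + (a' i * \<beta> + b' i * \<delta>) * p2 q)" for q
    have "F1 0 \<noteq> 0 \<or> F2 0 \<noteq> 0"
    proof (rule cusp[OF A])
      show "F1 holomorphic_on ball 0 1" "F2 holomorphic_on ball 0 1"
        unfolding F1_def[abs_def] F2_def[abs_def] by (intro holomorphic_intros p1_hol p2_hol)+
      show "\<forall>z\<in>upper_half_plane. f (lin_frac A z) = qexp (of_real (real d * \<kappa>) * z) * F1 (qexp (z / of_nat m))"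
        using f A product_cusp_expansion[OF A r] by (simp add: F1_def)
      show "\<forall>z\<in>upper_half_plane. g (lin_frac A z) = qexp (of_real (real d * \<kappa>) * z) * F2 (qexp (z / of_nat m))"
        using g A product_cusp_expansion[OF A r] by (simp add: F2_def)
    qed
    moreover have "(\<Prod>i<d. (a i * \<alpha> + b i * \<gamma>) * p1 0 + (a i * \<beta> + b i * \<delta>) * p2 0) = 0"
      by (rule prod_zero) (use ij zi p1_0 in auto)
    moreover have "(\<Prod>i<d. (a' i * \<alpha> + b' i * \<gamma>) * p1 0 + (a' i * \<beta> + b' i * \<delta>) * p2 0) = 0"
      by (rule prod_zero) (use ij zj p1_0 in auto)
    ultimately show False
      unfolding F1_def F2_def by (metis mult_zero_right)
  qed
qed

text \<open>The zeros of \<open>U2\<close> are the poles of t. There t has the dummy value 0, so the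
  relation between h and t is claimed only off this discrete set.\<close>

lemma eventually_U2_nonzero: "\<forall>\<^sub>\<approx>z\<in>upper_half_plane. U2 z \<noteq> 0"
  unfolding eventually_cosparse_open_eq[OF open_uhp]
proof
  fix z assume z: "z \<in> upper_half_plane"
  have "U2 z \<noteq> 0 \<or> deriv U2 z \<noteq> 0"
    using wronskian_nonzero[OF z] by (auto simp: wronskian_def)
  then show "\<forall>\<^sub>F w in at z. U2 w \<noteq> 0"
    using eventually_nonzero_simple_zero[OF open_uhp z U2_hol] by blast
qed

lemma product_of_t:
  assumes "U2 z \<noteq> 0"
  shows "(\<Prod>i<d. lin (a i) (b i) z) = U2 z ^ d * (\<Prod>i<d. a i * t z + b i)"
proof -
  have "lin (a i) (b i) z = U2 z * (a i * t z + b i)" for i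
    using assms by (simp add: lin_def t_def distrib_left)
  then show ?thesis
    by (simp add: prod.distrib)
qed

lemma rational_function_of_t:
  assumes mf: "mform m (real d * \<kappa>) f" "mform m (real d * \<kappa>) g"
    and nz: "\<exists>z\<in>upper_half_plane. f z \<noteq> 0" "\<exists>z\<in>upper_half_plane. g z \<noteq> 0"
    and interior: "\<And>z. z \<in> upper_half_plane \<Longrightarrow> f z \<noteq> 0 \<or> g z \<noteq> 0"
    and cusp: "\<And>A F G. A \<in> SL2Z \<Longrightarrow> F holomorphic_on ball 0 1 \<Longrightarrow> G holomorphic_on ball 0 1 \<Longrightarrow>
      \<forall>z\<in>upper_half_plane. f (lin_frac A z) = qexp (of_real (real d * \<kappa>) * z) * F (qexp (z / of_nat m)) \<Longrightarrow>
      \<forall>z\<in>upper_half_plane. g (lin_frac A z) = qexp (of_real (real d * \<kappa>) * z) * G (qexp (z / of_nat m)) \<Longrightarrow>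
      F 0 \<noteq> 0 \<or> G 0 \<noteq> 0"
    and h: "\<And>z. z \<in> upper_half_plane \<Longrightarrow> h z = f z / g z"
  shows "\<exists>R. rational_function_of_degree d R \<and> (\<forall>\<^sub>\<approx>z\<in>upper_half_plane. h z = R (t z))"
proof -
  obtain c a b where f: "c \<noteq> 0" "\<forall>i<d. (a i, b i) \<noteq> (0, 0)"
    "\<forall>z\<in>upper_half_plane. f z = c * (\<Prod>i<d. lin (a i) (b i) z)"
    using mform_factorization[OF mf(1) nz(1)] by blast
  obtain c' a' b' where g: "c' \<noteq> 0" "\<forall>i<d. (a' i, b' i) \<noteq> (0, 0)"
    "\<forall>z\<in>upper_half_plane. g z = c' * (\<Prod>i<d. lin (a' i) (b' i) z)"
    using mform_factorization[OF mf(2) nz(2)] by blast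
  define R where "R x = (c * (\<Prod>i<d. a i * x + b i)) / (c' * (\<Prod>i<d. a' i * x + b' i))" for x
  have f2: "(a i, b i) \<noteq> (0, 0)" if "i < d" for i
    using f(2) that by blast
  have f3: "f z = c * (\<Prod>i<d. lin (a i) (b i) z)" if "z \<in> upper_half_plane" for z
    using f(3) that by blast
  have g2: "(a' i, b' i) \<noteq> (0, 0)" if "i < d" for i
    using g(2) that by blast
  have g3: "g z = c' * (\<Prod>i<d. lin (a' i) (b' i) z)" if "z \<in> upper_half_plane" for z
    using g(3) that by blast
  have "rational_function_of_degree d R"
    unfolding R_def[abs_def]
  proof (rule linear_products_rational[OF f(1) g(1) f2 g2])
    fix i j assume ij: "i < d" "j < d"
    show "a i * b' j \<noteq> a' j * b i"
    proof (rule factors_independent[OF f2 f3 g3 interior _ ij])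
      fix A F G
      assume "A \<in> SL2Z" "F holomorphic_on ball 0 1" "G holomorphic_on ball 0 1"
        "\<forall>z\<in>upper_half_plane. f (lin_frac A z) = qexp (of_real (real d * \<kappa>) * z) * F (qexp (z / of_nat m))"
        "\<forall>z\<in>upper_half_plane. g (lin_frac A z) = qexp (of_real (real d * \<kappa>) * z) * G (qexp (z / of_nat m))"
      then show "F 0 \<noteq> 0 \<or> G 0 \<noteq> 0"
        by (rule cusp[of A F G])
    qed
  qed
  moreover have "\<forall>\<^sub>\<approx>z\<in>upper_half_plane. z \<in> upper_half_plane"
    by (rule eventually_in_cosparse) auto
  with eventually_U2_nonzero have "\<forall>\<^sub>\<approx>z\<in>upper_half_plane. h z = R (t z)"
  proof eventually_elim
    case (elim z)
    then show ?case
      using h[of z] f3[of z] g3[of z] product_of_t[of z] by (simp add: R_def)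
  qed
  ultimately show ?thesis
    by blast
qed

end

text \<open>For m = 2 the divisor 4 divides 6n - 2 because n is odd. For m = 3, 4, 5 the quotient is
  2n - 1, 3n - 2 and 6n - 5.\<close>

lemma degree_exists:
  assumes "2 \<le> m" "m \<le> 5" "0 < n" "gcd m n = (1 :: nat)"
  shows "\<exists>d :: nat. 6 * int n - int m = int d * (6 - int m)"
proof -
  consider "m = 2" | "m = 3" | "m = 4" | "m = 5"
    using assms by linarith
  then show ?thesis
  proof cases
    case 1
    then have "odd n"
      using assms(4) by (metis coprime_iff_gcd_eq_1 coprime_left_2_iff_odd)
    then obtain k where "n = 2 * k + 1"
      by (rule oddE)
    then show ?thesis
      using 1 by (intro exI[of _ "3 * k + 1"]) simp
  next
    case 2
    then show ?thesis
      using assms by (intro exI[of _ "2 * n - 1"]) (simp add: of_nat_diff)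
  next
    case 3
    then show ?thesis
      using assms by (intro exI[of _ "3 * n - 2"]) (simp add: of_nat_diff)
  next
    case 4
    then show ?thesis
      using assms by (intro exI[of _ "6 * n - 5"]) (simp add: of_nat_diff)
  qed
qed

theorem theorem7p2:
  fixes m n :: nat
  assumes "2 \<le> m" and "m \<le> 5" and "0 < n" and "gcd m n = 1"
  shows "(\<forall>h. schwarz_solution (2 * of_real pi ^ 2 * (of_nat n / of_nat m) ^ 2) h
              \<longrightarrow> modular_function m h) \<and>
         (\<exists>d :: nat.
            (6 * int n - int m) * int (num_inequivalent_cusps m) = 12 * int d \<and>
            (\<forall>h. schwarz_solution (2 * of_real pi ^ 2 * (of_nat n / of_nat m) ^ 2) h
              \<longrightarrow> (\<exists>t R. hauptmodul m t \<and> rational_function_of_degree d R \<and>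
                         (\<forall>\<^sub>\<approx>\<tau>\<in>upper_half_plane. h \<tau> = R (t \<tau>)))))"
proof -
  \<comment> \<open>Two pairs side by side: \<open>N\<close> belongs to the given n and provides the
    numerator and denominator of h, \<open>T\<close> belongs to n = 1 and provides the Hauptmodul
    and the linear factors.\<close>
  interpret N: modular_pair m n "1 / 12 - real n / (2 * real m)" "Upair (real n / (2 * real m))"
    "Upair (- (real n / (2 * real m)))" "ppart m (real n / (2 * real m))" "ppart m (- (real n / (2 * real m)))"
    by (rule modular_pair_frobenius[OF assms])
  interpret T: modular_pair m 1 "1 / 12 - real 1 / (2 * real m)" "Upair (real 1 / (2 * real m))"
    "Upair (- (real 1 / (2 * real m)))" "ppart m (real 1 / (2 * real m))" "ppart m (- (real 1 / (2 * real m)))"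
    by (rule modular_pair_frobenius) (use assms in auto)
  interpret T: modular_pair1 m 1 "1 / 12 - real 1 / (2 * real m)" "Upair (real 1 / (2 * real m))"
    "Upair (- (real 1 / (2 * real m)))" "ppart m (real 1 / (2 * real m))" "ppart m (- (real 1 / (2 * real m)))"
    by unfold_locales simp
  obtain d :: nat where d: "6 * int n - int m = int d * (6 - int m)"
    using degree_exists[OF assms] by blast
  have "real_of_int (6 * int n - int m) = real_of_int (int d * (6 - int m))"
    by (simp only: d)
  then have "6 * real n - real m = real d * (6 - real m)"
    by simp
  \<comment> \<open>The exponent \<kappa> of \<open>N\<close> is d times that of \<open>T\<close>,
    so a linear form of \<open>N\<close> splits into d linear forms of \<open>T\<close>.\<close>
  then have weight: "1 / 12 - real n / (2 * real m) = real d * (1 / 12 - real 1 / (2 * real m))"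
    using assms(1) by (simp add: field_simps)
  have "int (card (cusp_vectors m) * (6 - m)) = 12"
    using card_cusp_vectors[OF assms(1,2)] by simp
  then have "int (num_inequivalent_cusps m) * (6 - int m) = 12"
    using assms(2) num_inequivalent_cusps_eq[OF assms(1,2)] by (simp add: of_nat_diff)
  then have "(6 * int n - int m) * int (num_inequivalent_cusps m) = 12 * int d"
    unfolding d by (simp add: mult.commute mult.left_commute)
  moreover have "modular_function m h \<and> (\<exists>t R. hauptmodul m t \<and> rational_function_of_degree d R \<and>
      (\<forall>\<^sub>\<approx>\<tau>\<in>upper_half_plane. h \<tau> = R (t \<tau>)))"
    if sol: "schwarz_solution (2 * of_real pi ^ 2 * (of_nat n / of_nat m) ^ 2) h" for h
  proof -
    obtain a b c e where det: "a * e - b * c \<noteq> 0" and h: "\<forall>z\<in>upper_half_plane. h z = N.lin a b z / N.lin c e z"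
      using schwarz_solution_pair[OF assms sol] by blast
    have h': "h z = N.lin a b z / N.lin c e z" if "z \<in> upper_half_plane" for z
      using h that by blast
    have "\<exists>R. rational_function_of_degree d R \<and> (\<forall>\<^sub>\<approx>z\<in>upper_half_plane. h z = R (T.t z))"
    proof (rule T.rational_function_of_t[OF N.mform_lin[unfolded weight] N.mform_lin[unfolded weight] _ _ _ _ h'])
      show "\<exists>z\<in>upper_half_plane. N.lin a b z \<noteq> 0" "\<exists>z\<in>upper_half_plane. N.lin c e z \<noteq> 0"
        using N.lin_eq_0_iff[of a b] N.lin_eq_0_iff[of c e] det by auto
      show "N.lin a b z \<noteq> 0 \<or> N.lin c e z \<noteq> 0" if "z \<in> upper_half_plane" for z
        by (rule N.lin_no_common_zero[OF det that])
      show "F 0 \<noteq> 0 \<or> G 0 \<noteq> 0" if "A \<in> SL2Z" "F holomorphic_on ball 0 1" "G holomorphic_on ball 0 1"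
        "\<forall>z\<in>upper_half_plane. N.lin a b (lin_frac A z) = qexp (of_real (real d * (1 / 12 - real 1 / (2 * real m))) * z) * F (qexp (z / of_nat m))"
        "\<forall>z\<in>upper_half_plane. N.lin c e (lin_frac A z) = qexp (of_real (real d * (1 / 12 - real 1 / (2 * real m))) * z) * G (qexp (z / of_nat m))"
        for A F G
        by (rule N.lin_no_common_cusp[OF det that(1,2) that(4)[folded weight] that(3) that(5)[folded weight]])
    qed
    then show ?thesis
      using N.modular_function_quotient[OF det h'] T.hauptmodul_t by blast
  qed
  ultimately show ?thesis
    by blast
qed

end
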